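(* Let $\sigma\in\{1,-1\}$, let $q\in\langle\cdot\rangle^{-2}H^s(\mathbb{C})$ for some $s\in\,]1,2]$, and let $\epsilon\in\,]0,1]$. With $h=1/|k|$ and the notation of the context, for all $k\in\mathbb{C}$ with $h$ small enough the system $$\begin{cases}h\overline\partial\phi_1=\widehat\tau_{-\omega}\frac{hq}{2}\phi_2,\\ h\partial\phi_2=\sigma\widehat\tau_\omega\frac{h\overline q}{2}\phi_1\end{cases}$$ has a unique solution $(\phi_1,\phi_2)$ of the form $\phi_1=1+\phi_1^1$, $\phi_2=\phi_2^1$ with $\phi_1^1,\phi_2^1\in\langle\cdot\rangle^\epsilon L^2$. It satisfies, in $\langle\cdot\rangle^\epsilon L^2$, $$\phi_1^1=(1-AB)^{-1}A\sigma F\widehat\tau_\omega\frac{h\overline q}{2}=A\sigma F\widehat\tau_\omega\frac{h\overline q}{2}+\mathcal{O}\left(h^{s-1}\|AF\widehat\tau_\omega h\overline q\|_{\langle\cdot\rangle^\epsilon L^2}\right),$$ $$\phi_2^1=(1-BA)^{-1}\sigma F\widehat\tau_\omega\frac{h\overline q}{2}=\sigma F\widehat\tau_\omega\frac{h\overline q}{2}+\mathcal{O}\left(h^{s-1}\|F\widehat\tau_\omega h\overline q\|_{\langle\cdot\rangle^\epsilon L^2}\right),$$ $$\phi_1^1=A\sigma F\widehat\tau_\omega\frac{h\overline q}{2}+\mathcal{O}(h^{2(s-1)})=\mathcal{O}(h^{s-1}).$$ For two different values of $\epsilon\in\,]0,1]$ one gets the same solutions when $h$ is small enough.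
   Context: Notation: $z=x+iy\in\mathbb{C}\simeq\mathbb{R}^2$, $\partial=\frac12(\partial_x-i\partial_y)$, $\overline\partial=\frac12(\partial_x+i\partial_y)$ (in the sense of distributions), $\langle z\rangle=(1+|z|^2)^{1/2}$. For $\theta\in\mathbb{R}$, $\langle\cdot\rangle^\theta L^2=\{\langle z\rangle^\theta u:\ u\in L^2(\mathbb{C})\}$ with norm $\|v\|_{\langle\cdot\rangle^\theta L^2}=\|\langle\cdot\rangle^{-\theta}v\|_{L^2}$. $q\in\langle\cdot\rangle^{-2}H^s(\mathbb{C})$ means that $\langle z\rangle^2q$ belongs to the Sobolev space $H^s(\mathbb{C})=H^s(\mathbb{R}^2)$. For $k\in\mathbb{C}\setminus\{0\}$ put $h=1/|k|$ and $\omega=2i\overline{k}/|k|$, so that $|\omega|=2$ and $kz-\overline{kz}=\frac{i}{h}\mathrm{Re}(z\overline\omega)$. Define $\widehat\tau_{\pm\omega}u(z)=e^{\pm\frac ih\mathrm{Re}(z\overline\omega)}u(z)$; expressions like $\widehat\tau_\omega h\overline q$ without further argument denote the function $e^{\frac ih\mathrm{Re}(z\overline\omega)}h\overline{q(z)}$. For $v\in\langle\cdot\rangle^{-1}L^2$, let $u=Ev$ and $\widetilde u=Fv$ be the unique solutions in $\langle\cdot\rangle L^2$ of $h\overline\partial u=v$ and $h\partial\widetilde u=v$ respectively; explicitly $Ev(z)=\frac{1}{\pi h}\int\frac{v(w)}{z-w}L(dw)$, $Fv(z)=\frac1{\pi h}\int\frac{v(w)}{\overline z-\overline w}L(dw)$.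 For every $\epsilon\in\,]0,1]$, $E$ and $F$ are bounded from $\langle\cdot\rangle^{\epsilon-2}L^2$ to $\langle\cdot\rangle^{\epsilon}L^2$. Set $A=E\,\widehat\tau_{-\omega}\frac{hq}{2}$ and $B=\sigma F\,\widehat\tau_{\omega}\frac{h\overline q}{2}$ as operators on $\langle\cdot\rangle^\epsilon L^2$, where $q,\overline q$ act as multiplication operators. $\mathcal{O}(\cdot)$ for functions refers to the norm of $\langle\cdot\rangle^\epsilon L^2$; all bounds are uniform in $k$ (i.e. depend only on $q,s,\epsilon$). "$h$ small enough" means $0<h\le h_0$ with $h_0>0$ depending only on $q,s$ and the value(s) of $\epsilon$. *)

theory Defs
  imports "HOL-Analysis.Analysis"
begin

text \<open>Elements of Lebesgue spaces on the plane are represented by Borel functions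
  \<^typ>\<open>complex \<Rightarrow> complex\<close>; two representatives are identified when they agree
  almost everywhere with respect to \<^term>\<open>lborel\<close>.\<close>

definition ae_eq :: "(complex \<Rightarrow> complex) \<Rightarrow> (complex \<Rightarrow> complex) \<Rightarrow> bool" where
  "ae_eq u v \<longleftrightarrow> (AE z in lborel. u z = v z)"

definition japanese :: "complex \<Rightarrow> real" where
  "japanese z = sqrt (1 + (cmod z)\<^sup>2)"

definition L2 :: "(complex \<Rightarrow> complex) set" where
  "L2 = {u \<in> borel_measurable lborel. integrable lborel (\<lambda>z. (cmod (u z))\<^sup>2)}"

definition wL2 :: "real \<Rightarrow> (complex \<Rightarrow> complex) set" where
  "wL2 \<theta> = {\<lambda>z. of_real (japanese z powr \<theta>) * u z | u. u \<in> L2}"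

text \<open>Only meaningful on \<^term>\<open>wL2 \<theta>\<close>: outside it the Bochner integral is 0 by convention.\<close>

definition wnorm :: "real \<Rightarrow> (complex \<Rightarrow> complex) \<Rightarrow> real" where
  "wnorm \<theta> v = sqrt (LINT z|lborel. (cmod (of_real (japanese z powr (- \<theta>)) * v z))\<^sup>2)"

definition fourier :: "(complex \<Rightarrow> complex) \<Rightarrow> complex \<Rightarrow> complex" where
  "fourier u \<xi> = (LINT z|lborel. exp (- \<i> * of_real (z \<bullet> \<xi>)) * u z)"

text \<open>The Fourier--Plancherel transform of an L2 function: the L2 limit of the
  Fourier integrals of its truncations to large balls.\<close>

definition has_plancherel :: "(complex \<Rightarrow> complex) \<Rightarrow> (complex \<Rightarrow> complex) \<Rightarrow> bool" where
  "has_plancherel u g \<longleftrightarrow> u \<in> L2 \<and> g \<in> L2 \<and>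
     ((\<lambda>R. \<integral>\<^sup>+ \<xi>. ennreal ((cmod (fourier (\<lambda>z. indicator (ball 0 R) z * u z) \<xi> - g \<xi>))\<^sup>2) \<partial>lborel)
        \<longlongrightarrow> 0) at_top"

text \<open>The Sobolev space of order \<open>s \<ge> 0\<close> (for negative \<open>s\<close> it would contain
  distributions that are not functions).\<close>

definition sobolev :: "real \<Rightarrow> (complex \<Rightarrow> complex) set" where
  "sobolev s = {u. \<exists>g. has_plancherel u g \<and> (\<lambda>\<xi>. of_real (japanese \<xi> powr s) * g \<xi>) \<in> L2}"

primrec C_k :: "nat \<Rightarrow> (complex \<Rightarrow> complex) \<Rightarrow> bool" where
  "C_k 0 f \<longleftrightarrow> continuous_on UNIV f"
| "C_k (Suc n) f \<longleftrightarrow> (\<exists>fx fy. C_k n fx \<and> C_k n fy \<and>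
     (\<forall>z. (f has_derivative (\<lambda>w. of_real (Re w) * fx z + of_real (Im w) * fy z)) (at z)))"

definition test_fun :: "(complex \<Rightarrow> complex) \<Rightarrow> bool" where
  "test_fun \<psi> \<longleftrightarrow> (\<forall>n. C_k n \<psi>) \<and> compact (closure {z. \<psi> z \<noteq> 0})"

definition dz :: "(complex \<Rightarrow> complex) \<Rightarrow> complex \<Rightarrow> complex" where
  "dz f z = (frechet_derivative f (at z) 1 - \<i> * frechet_derivative f (at z) \<i>) / 2"

definition dzbar :: "(complex \<Rightarrow> complex) \<Rightarrow> complex \<Rightarrow> complex" where
  "dzbar f z = (frechet_derivative f (at z) 1 + \<i> * frechet_derivative f (at z) \<i>) / 2"

text \<open>Locally integrable functions and their derivatives as distributions, i.e. as
  functionals of a test function \<open>\<psi>\<close>.\<close>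

definition dist_of :: "(complex \<Rightarrow> complex) \<Rightarrow> (complex \<Rightarrow> complex) \<Rightarrow> complex" where
  "dist_of u \<psi> = (LINT z|lborel. u z * \<psi> z)"

definition dist_dz :: "(complex \<Rightarrow> complex) \<Rightarrow> (complex \<Rightarrow> complex) \<Rightarrow> complex" where
  "dist_dz u \<psi> = - dist_of u (dz \<psi>)"

definition dist_dzbar :: "(complex \<Rightarrow> complex) \<Rightarrow> (complex \<Rightarrow> complex) \<Rightarrow> complex" where
  "dist_dzbar u \<psi> = - dist_of u (dzbar \<psi>)"

definition hpar :: "complex \<Rightarrow> real" where
  "hpar k = 1 / cmod k"

definition omega :: "complex \<Rightarrow> complex" where
  "omega k = 2 * \<i> * cnj k / of_real (cmod k)"

definition tau :: "real \<Rightarrow> complex \<Rightarrow> (complex \<Rightarrow> complex) \<Rightarrow> complex \<Rightarrow> complex" where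
  "tau h \<omega> u z = exp (\<i> / of_real h * of_real (Re (z * cnj \<omega>))) * u z"

definition opE :: "real \<Rightarrow> (complex \<Rightarrow> complex) \<Rightarrow> complex \<Rightarrow> complex" where
  "opE h v z = of_real (1 / (pi * h)) * (LINT w|lborel. v w / (z - w))"

definition opF :: "real \<Rightarrow> (complex \<Rightarrow> complex) \<Rightarrow> complex \<Rightarrow> complex" where
  "opF h v z = of_real (1 / (pi * h)) * (LINT w|lborel. v w / (cnj z - cnj w))"

definition opA :: "(complex \<Rightarrow> complex) \<Rightarrow> complex \<Rightarrow> (complex \<Rightarrow> complex) \<Rightarrow> complex \<Rightarrow> complex" where
  "opA q k u = opE (hpar k) (tau (hpar k) (- omega k) (\<lambda>w. of_real (hpar k) * q w / 2 * u w))"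

definition opB :: "complex \<Rightarrow> (complex \<Rightarrow> complex) \<Rightarrow> complex \<Rightarrow> (complex \<Rightarrow> complex) \<Rightarrow> complex \<Rightarrow> complex" where
  "opB \<sigma> q k u =
     (\<lambda>z. \<sigma> * opF (hpar k) (tau (hpar k) (omega k) (\<lambda>w. of_real (hpar k) * cnj (q w) / 2 * u w)) z)"

definition F_tau_hq :: "(complex \<Rightarrow> complex) \<Rightarrow> complex \<Rightarrow> complex \<Rightarrow> complex" where
  "F_tau_hq q k = opF (hpar k) (tau (hpar k) (omega k) (\<lambda>w. of_real (hpar k) * cnj (q w)))"

definition sigma_F_tau_hq2 :: "complex \<Rightarrow> (complex \<Rightarrow> complex) \<Rightarrow> complex \<Rightarrow> complex \<Rightarrow> complex" where
  "sigma_F_tau_hq2 \<sigma> q k =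
     (\<lambda>z. \<sigma> * opF (hpar k) (tau (hpar k) (omega k) (\<lambda>w. of_real (hpar k) * cnj (q w) / 2)) z)"

text \<open>Invertibility of a map of \<^term>\<open>wL2 \<theta>\<close> modulo almost everywhere equality, with
  bounded inverse: \<open>T\<close> is well defined and injective on equivalence classes (the two
  directions of the equivalence), surjective, and bounded from below.\<close>

definition invertible_wL2 :: "real \<Rightarrow> ((complex \<Rightarrow> complex) \<Rightarrow> complex \<Rightarrow> complex) \<Rightarrow> bool" where
  "invertible_wL2 \<theta> T \<longleftrightarrow>
     (\<forall>u\<in>wL2 \<theta>. T u \<in> wL2 \<theta>) \<and>
     (\<forall>u\<in>wL2 \<theta>. \<forall>v\<in>wL2 \<theta>. ae_eq u v \<longleftrightarrow> ae_eq (T u) (T v)) \<and>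
     (\<forall>v\<in>wL2 \<theta>. \<exists>u\<in>wL2 \<theta>. ae_eq (T u) v) \<and>
     (\<exists>C. \<forall>u\<in>wL2 \<theta>. wnorm \<theta> u \<le> C * wnorm \<theta> (T u))"

text \<open>A representative of the inverse image; unique up to \<^const>\<open>ae_eq\<close> when
  \<^term>\<open>invertible_wL2 \<theta> T\<close> and \<^term>\<open>v \<in> wL2 \<theta>\<close>.\<close>

definition inverse_wL2 :: "real \<Rightarrow> ((complex \<Rightarrow> complex) \<Rightarrow> complex \<Rightarrow> complex)
    \<Rightarrow> (complex \<Rightarrow> complex) \<Rightarrow> complex \<Rightarrow> complex" where
  "inverse_wL2 \<theta> T v = (SOME u. u \<in> wL2 \<theta> \<and> ae_eq (T u) v)"

definition one_minus :: "((complex \<Rightarrow> complex) \<Rightarrow> complex \<Rightarrow> complex)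
    \<Rightarrow> (complex \<Rightarrow> complex) \<Rightarrow> complex \<Rightarrow> complex" where
  "one_minus S u = (\<lambda>z. u z - S u z)"

definition dbar_system :: "complex \<Rightarrow> (complex \<Rightarrow> complex) \<Rightarrow> complex
    \<Rightarrow> (complex \<Rightarrow> complex) \<Rightarrow> (complex \<Rightarrow> complex) \<Rightarrow> bool" where
  "dbar_system \<sigma> q k \<phi>1 \<phi>2 \<longleftrightarrow> (\<forall>\<psi>. test_fun \<psi> \<longrightarrow>
     of_real (hpar k) * dist_dzbar \<phi>1 \<psi>
       = dist_of (tau (hpar k) (- omega k) (\<lambda>z. of_real (hpar k) * q z / 2 * \<phi>2 z)) \<psi> \<and>
     of_real (hpar k) * dist_dz \<phi>2 \<psi>
       = dist_of (\<lambda>z. \<sigma> * tau (hpar k) (omega k) (\<lambda>w. of_real (hpar k) * cnj (q w) / 2 * \<phi>1 w) z) \<psi>)"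

text \<open>Here \<open>u1\<close>, \<open>u2\<close> stand for the corrections in
  \<open>\<phi>1 = 1 + u1\<close>, \<open>\<phi>2 = u2\<close>.\<close>

definition cgo_solution :: "real \<Rightarrow> complex \<Rightarrow> (complex \<Rightarrow> complex) \<Rightarrow> complex
    \<Rightarrow> (complex \<Rightarrow> complex) \<Rightarrow> (complex \<Rightarrow> complex) \<Rightarrow> bool" where
  "cgo_solution \<epsilon> \<sigma> q k u1 u2 \<longleftrightarrow>
     u1 \<in> wL2 \<epsilon> \<and> u2 \<in> wL2 \<epsilon> \<and> dbar_system \<sigma> q k (\<lambda>z. 1 + u1 z) u2"

definition unique_cgo_solution :: "real \<Rightarrow> complex \<Rightarrow> (complex \<Rightarrow> complex) \<Rightarrow> complex
    \<Rightarrow> (complex \<Rightarrow> complex) \<Rightarrow> (complex \<Rightarrow> complex) \<Rightarrow> bool" where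
  "unique_cgo_solution \<epsilon> \<sigma> q k u1 u2 \<longleftrightarrow>
     cgo_solution \<epsilon> \<sigma> q k u1 u2 \<and>
     (\<forall>v1 v2. cgo_solution \<epsilon> \<sigma> q k v1 v2 \<longrightarrow> ae_eq v1 u1 \<and> ae_eq v2 u2)"

definition bounded_wL2 :: "real \<Rightarrow> (complex \<Rightarrow> complex) \<Rightarrow> real \<Rightarrow> bool" where
  "bounded_wL2 \<epsilon> v b \<longleftrightarrow> v \<in> wL2 \<epsilon> \<and> wnorm \<epsilon> v \<le> b"

end

theory Submission
  imports Defs "HOL-Probability.Characteristic_Functions"
begin

text \<open>
  The operator \<open>AB\<close> has the integral kernel \<open>q(x)\<close> times
  \<open>M(z,x) = \<integral> e\<^sub>-\<^sub>\<eta>(y) q(y) / ((z - y) (cnj y - cnj x)) dy\<close>, up to constants, where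
  \<open>e\<^sub>\<zeta>(y) = exp (i Re (y cnj \<zeta>))\<close> and \<open>|\<eta>| = 2/h\<close>.  Since \<open>\<langle>y\<rangle>\<^sup>2 q\<close> is the inverse Fourier
  transform of a function \<open>G\<close> with \<open>\<langle>\<xi>\<rangle>\<^sup>s G \<in> L\<^sup>2\<close>, \<open>M\<close> is a superposition with density \<open>G(\<xi>)\<close>
  of the explicit kernels
  \<open>K\<^sub>\<zeta>(z,x) = \<integral> e\<^sub>\<zeta>(y) \<langle>y\<rangle>\<^sup>-\<^sup>2 / ((z - y) (cnj y - cnj x)) dy\<close> at the frequencies \<open>\<zeta> = \<xi> - \<eta>\<close>.
  These satisfy the pointwise bound \<open>|K\<^sub>\<zeta>(z,x)| \<le> C min (1, 1/|\<zeta>|) / |z - x|\<close>: with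
  \<open>D = |y - x|\<^sup>2 + |y - z|\<^sup>2\<close> the kernel splits into a part singular only at \<open>y = z\<close> and one singular
  only at \<open>y = x\<close>, and the Cauchy--Pompeiu formula allows one integration by parts in each.
  Splitting the superposition at \<open>|\<xi>| = 1/h\<close> and using that \<open>s > 1\<close> makes
  \<open>\<langle>\<xi>\<rangle>\<^sup>-\<^sup>s\<close> square integrable gives \<open>|M(z,x)| \<le> C h powr (s - 1) / |z - x|\<close>.
  Schur's test with weight \<open>\<langle>\<cdot>\<rangle>\<^sup>-\<^sup>1\<close> bounds \<open>AB\<close>, and likewise its conjugate \<open>BA\<close>, on
  \<open>\<langle>\<cdot>\<rangle>\<^sup>\<epsilon> L\<^sup>2\<close> by \<open>O(h powr (s - 1))\<close>, and everything follows from Neumann series.  The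
  differential system is equivalent to the integral equations because a function in \<open>\<langle>\<cdot>\<rangle> L\<^sup>2\<close>
  whose distributional \<open>dbar\<close>-derivative vanishes is zero.
\<close>

section \<open>Integrals over the complex plane\<close>

text \<open>The operator norms of A and B do not depend on h, because multiplication by a unimodular
  phase is an isometry. Smallness appears only in the products, where the phase meets q inside the
  composed kernel. This is why the decisive estimate is made pointwise on that kernel. The rate
  comes from a gap of scales. The phase has frequency 2/h, twice the splitting radius 1/h, so for
  |\<xi>| \<le> 1/h the shifted frequency \<xi> - \<eta> has size at least 1/h and never resonates.
  One integration by parts then gains h, which is at most h powr (s - 1) because s \<le> 2 and h
  \<le> 1. Two obstacles shape the rest. The constant 1 is not in \<langle>.\<rangle>^\<epsilon> L^2
  for \<epsilon> \<le> 1, so A and B are studied on a larger class \<open>adm\<close> that contains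
  it. Cauchy integrals may diverge on null sets, so A and B are additive only almost everywhere, and
  the Neumann series is set up for maps that are linear in this weaker sense.\<close>

lemma lborel_complex:
  "(lborel :: complex measure) = distr (lborel \<Otimes>\<^sub>M lborel) borel (\<lambda>(x, y). Complex x y)"
proof (rule lborel_eqI)
  have [measurable]: "(\<lambda>(x, y). Complex x y) \<in> borel_measurable (lborel \<Otimes>\<^sub>M lborel)"
    unfolding Complex_eq by measurable
  fix l u :: complex assume le: "\<And>b. b \<in> Basis \<Longrightarrow> l \<bullet> b \<le> u \<bullet> b"
  have eq: "(\<lambda>(x, y). Complex x y) -` box l u = {Re l<..<Re u} \<times> {Im l<..<Im u}"
    by (auto simp: box_def Basis_complex_def)
  have "emeasure (distr (lborel \<Otimes>\<^sub>M lborel) borel (\<lambda>(x, y). Complex x y)) (box l u)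
      = emeasure (lborel \<Otimes>\<^sub>M lborel) ({Re l<..<Re u} \<times> {Im l<..<Im u})"
    by (subst emeasure_distr) (auto simp: eq space_pair_measure)
  also have "\<dots> = ennreal ((Re u - Re l) * (Im u - Im l))"
    using le[of 1] le[of \<i>]
    by (subst lborel.emeasure_pair_measure_Times) (auto simp: Basis_complex_def ennreal_mult)
  also have "\<dots> = (\<Prod>b\<in>Basis. (u - l) \<bullet> b)"
    by (simp add: Basis_complex_def inner_diff_left)
  finally show "emeasure (distr (lborel \<Otimes>\<^sub>M lborel) borel (\<lambda>(x, y). Complex x y)) (box l u)
      = (\<Prod>b\<in>Basis. (u - l) \<bullet> b)" .
qed simp

lemma measurable_Complex [measurable]:
  assumes [measurable]: "f \<in> borel_measurable M" "g \<in> borel_measurable M"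
  shows "(\<lambda>x. Complex (f x) (g x)) \<in> borel_measurable M"
  unfolding Complex_eq by measurable

lemma measurable_cnj [measurable (raw)]:
  assumes "f \<in> borel_measurable M"
  shows "(\<lambda>x. cnj (f x)) \<in> borel_measurable M"
  by (rule borel_measurable_continuous_on[OF _ assms]) (intro continuous_intros)

lemma nn_integral_complex:
  assumes [measurable]: "f \<in> borel_measurable (borel :: complex measure)"
  shows "(\<integral>\<^sup>+z. f z \<partial>lborel) = (\<integral>\<^sup>+x. \<integral>\<^sup>+y. f (Complex x y) \<partial>lborel \<partial>lborel)"
  by (subst lborel_complex) (simp add: nn_integral_distr case_prod_unfold lborel.nn_integral_fst[symmetric])

lemma integrable_complex_prod:
  fixes f :: "complex \<Rightarrow> complex"
  assumes f: "integrable lborel f"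
  shows "integrable (lborel \<Otimes>\<^sub>M lborel) (\<lambda>(x, y). f (Complex x y))"
proof -
  have [measurable]: "f \<in> borel_measurable borel"
    using borel_measurable_integrable[OF f] by simp
  have "integrable (distr (lborel \<Otimes>\<^sub>M lborel) borel (\<lambda>(x, y). Complex x y)) f"
    using f lborel_complex by simp
  then show ?thesis
    by (subst (asm) integrable_distr_eq) (auto simp: case_prod_unfold)
qed

lemma integral_complex_prod:
  fixes f :: "complex \<Rightarrow> complex"
  assumes [measurable]: "f \<in> borel_measurable borel"
  shows "(LINT z|lborel. f z) = (LINT z|(lborel \<Otimes>\<^sub>M lborel). f (Complex (fst z) (snd z)))"
  by (subst lborel_complex, subst integral_distr) (auto simp: case_prod_unfold)

lemma nn_integral_complex_affine:
  fixes f :: "complex \<Rightarrow> ennreal"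
  assumes [measurable]: "f \<in> borel_measurable borel" and c: "c \<noteq> 0"
  shows "(\<integral>\<^sup>+z. f z \<partial>lborel) = ennreal (c\<^sup>2) * (\<integral>\<^sup>+z. f (t + c *\<^sub>R z) \<partial>lborel)"
  by (subst lborel_affine[OF c, of t])
     (simp add: nn_integral_density nn_integral_distr nn_integral_cmult ennreal_power)

lemma nn_integral_complex_reflect:
  fixes f :: "complex \<Rightarrow> ennreal"
  assumes [measurable]: "f \<in> borel_measurable borel"
  shows "(\<integral>\<^sup>+z. f (a - z) \<partial>lborel) = (\<integral>\<^sup>+z. f z \<partial>lborel)"
  by (subst (2) nn_integral_complex_affine[where c="-1" and t=a]) auto

lemma integrable_complex_affine:
  fixes f :: "complex \<Rightarrow> complex"
  assumes f: "integrable lborel f" and c: "c \<noteq> (0::real)"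
  shows "integrable lborel (\<lambda>z. f (t + c *\<^sub>R z))"
proof -
  have [measurable]: "f \<in> borel_measurable borel"
    using borel_measurable_integrable[OF f] by simp
  have "(\<integral>\<^sup>+z. norm (f z) \<partial>lborel) < \<infinity>"
    using f by (simp add: integrable_iff_bounded)
  then have "(\<integral>\<^sup>+z. norm (f (t + c *\<^sub>R z)) \<partial>lborel) < \<infinity>"
    using c by (subst (asm) nn_integral_complex_affine[where c=c and t=t])
       (auto simp: ennreal_mult_less_top)
  then show ?thesis by (simp add: integrable_iff_bounded)
qed

lemma integral_complex_affine:
  fixes f :: "complex \<Rightarrow> complex"
  assumes [measurable]: "f \<in> borel_measurable borel" and c: "c \<noteq> (0::real)"
  shows "(LINT z|lborel. f z) = of_real (c\<^sup>2) * (LINT z|lborel. f (t + c *\<^sub>R z))"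
  apply (subst lborel_affine[OF c, of t])
  apply (subst integral_density)
  by (auto simp: integral_distr scaleR_conv_of_real)

section \<open>Elementary inequalities for the weight \<open>japanese\<close>\<close>

lemma japanese_ge_1: "1 \<le> japanese z"
  and cmod_le_japanese: "cmod z \<le> japanese z"
  and japanese_squared: "(japanese z)\<^sup>2 = 1 + (cmod z)\<^sup>2"
  and japanese_pos [simp]: "0 < japanese z"
  and japanese_nz [simp]: "japanese z \<noteq> 0"
proof -
  show *: "1 \<le> japanese z" "cmod z \<le> japanese z"
    by (auto simp: japanese_def real_le_rsqrt)
  show "(japanese z)\<^sup>2 = 1 + (cmod z)\<^sup>2"
    by (simp add: japanese_def add_nonneg_nonneg)
  show "0 < japanese z" "japanese z \<noteq> 0" using * by linarith+
qed

lemma japanese_nonneg [simp]: "0 \<le> japanese z"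
  by (simp add: less_imp_le)

lemma japanese_triangle: "japanese (z + w) \<le> japanese z + cmod w"
proof (rule power2_le_imp_le)
  have "(cmod (z + w))\<^sup>2 \<le> (cmod z + cmod w)\<^sup>2"
    by (intro power_mono norm_triangle_ineq) auto
  moreover have "cmod z * cmod w \<le> japanese z * cmod w"
    by (intro mult_right_mono cmod_le_japanese) auto
  ultimately show "(japanese (z + w))\<^sup>2 \<le> (japanese z + cmod w)\<^sup>2"
    using japanese_squared[of z] japanese_squared[of "z + w"]
    by (simp add: power2_sum)
qed (simp add: add_nonneg_nonneg less_imp_le)

lemma japanese_le_add: "japanese z \<le> 1 + cmod z"
  using japanese_triangle[of 0 z] by (simp add: japanese_def)

lemma measurable_japanese [measurable]: "japanese \<in> borel_measurable borel"
  unfolding japanese_def[abs_def] by measurable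

section \<open>Monotonicity of powers, and convergence of the model integrals in the plane\<close>

lemma powr_neg_mono:
  fixes a b c :: real
  assumes "0 < a" "a \<le> b" "0 \<le> c"
  shows "b powr (- c) \<le> a powr (- c)"
  using assms by (intro powr_mono2') auto

lemma power2_powr:
  fixes a r :: real
  assumes "0 < a"
  shows "(a\<^sup>2) powr r = a powr (2 * r)"
  using assms by (simp add: powr_powr[symmetric])

text \<open>Reduces convergence on the line to a majorant on a half-line with known integral. It
  serves both decay at infinity and an integrable singularity at 0.\<close>

lemma nn_integral_real_even_bound:
  fixes f g :: "real \<Rightarrow> real"
  assumes [measurable]: "g \<in> borel_measurable borel"
    and g: "\<And>x. 0 \<le> x \<Longrightarrow> 0 \<le> g x" "(g has_integral I) {0..}"
    and f: "\<And>x. f x \<le> g \<bar>x\<bar>"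
  shows "(\<integral>\<^sup>+x. ennreal (f x) \<partial>lborel) < \<infinity>"
proof -
  let ?G = "\<lambda>x. ennreal (g x) * indicator {0..} x"
  have I: "(\<integral>\<^sup>+x. ?G x \<partial>lborel) = ennreal I"
    by (rule nn_integral_has_integral_lebesgue') (use g in auto)
  have I': "(\<integral>\<^sup>+x. ?G (- x) \<partial>lborel) = ennreal I"
    using nn_integral_real_affine[where f="?G" and c="-1" and t=0] I by simp
  have "(\<integral>\<^sup>+x. ennreal (f x) \<partial>lborel) \<le> (\<integral>\<^sup>+x. ?G x + ?G (- x) \<partial>lborel)"
  proof (intro nn_integral_mono)
    fix x
    show "ennreal (f x) \<le> ?G x + ?G (- x)"
      using f[of x] g(1)[of "\<bar>x\<bar>"]
      by (cases "0 \<le> x") (auto simp: indicator_def intro: order_trans[OF ennreal_leI])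
  qed
  also have "\<dots> = ennreal I + ennreal I"
    by (subst nn_integral_add) (auto simp: I I')
  also have "\<dots> < \<infinity>" by simp
  finally show ?thesis .
qed

lemma nn_integral_real_decay:
  assumes b: "1 < b"
  shows "(\<integral>\<^sup>+x. ennreal ((1 + x\<^sup>2) powr (- b / 2)) \<partial>lborel) < \<infinity>"
proof (rule nn_integral_real_even_bound)
  let ?g = "\<lambda>x::real. if x \<in> {0..1} then 1 else x powr (- b)"
  have 1: "((\<lambda>x::real. 1::real) has_integral 1) {0..1}"
    using has_integral_const_real[of "1::real" 0 1] by simp
  have 2: "((\<lambda>x::real. x powr (- b)) has_integral -(1 powr (-b + 1)) / (-b + 1)) {1..}"
    using b by (intro has_integral_powr_to_inf) auto
  have g1: "(?g has_integral 1) {0..1}"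
    by (rule has_integral_eq[OF _ 1]) auto
  have g2: "(?g has_integral -(1 powr (-b + 1)) / (-b + 1)) {1..}"
    by (rule has_integral_eq[OF _ 2]) auto
  have "{0..1} \<union> {1..} = {0::real..}" "{0..1} \<inter> {1..} = {1::real}" by auto
  then show "(?g has_integral (1 + -(1 powr (-b + 1)) / (-b + 1))) {0..}"
    using has_integral_Un[OF g1 g2] by simp
  show "?g \<in> borel_measurable borel" by measurable
  fix x :: real
  show "0 \<le> x \<Longrightarrow> 0 \<le> ?g x" by auto
  show "(1 + x\<^sup>2) powr (- b / 2) \<le> ?g \<bar>x\<bar>"
  proof (cases "\<bar>x\<bar> \<le> 1")
    case True
    have "(1 + x\<^sup>2) powr (- (b / 2)) \<le> 1 powr (- (b / 2))"
      using b by (intro powr_neg_mono) auto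
    with True show ?thesis by simp
  next
    case False
    have "(1 + x\<^sup>2) powr (- (b / 2)) \<le> (\<bar>x\<bar>\<^sup>2) powr (- (b / 2))"
      using b False by (intro powr_neg_mono) auto
    also have "\<dots> = \<bar>x\<bar> powr (- b)"
      using False by (subst power2_powr) auto
    finally show ?thesis using False by simp
  qed
qed

text \<open>A majorant that is a product in the real coordinates turns a planar integral into the
  square of a one-dimensional one by Tonelli; polar coordinates are avoided throughout.\<close>

lemma nn_integral_complex_prod_bound:
  fixes a :: "real \<Rightarrow> real"
  assumes [measurable]: "a \<in> borel_measurable borel" and a: "\<And>x. 0 \<le> a x"
    and fin: "(\<integral>\<^sup>+x. ennreal (a x) \<partial>lborel) < \<infinity>"
    and f: "AE z in lborel. f z \<le> a (Re z) * a (Im z)"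
  shows "(\<integral>\<^sup>+z. ennreal (f z) \<partial>lborel) < \<infinity>"
proof -
  have "(\<integral>\<^sup>+z. ennreal (f z) \<partial>lborel) \<le> (\<integral>\<^sup>+z. ennreal (a (Re z)) * ennreal (a (Im z)) \<partial>lborel)"
    using f by (intro nn_integral_mono_AE) (auto simp: a ennreal_mult[symmetric] intro!: ennreal_leI)
  also have "\<dots> = (\<integral>\<^sup>+x. ennreal (a x) \<partial>lborel) * (\<integral>\<^sup>+x. ennreal (a x) \<partial>lborel)"
    by (subst nn_integral_complex) (auto simp: nn_integral_cmult nn_integral_multc)
  also have "\<dots> < \<infinity>" using fin by (simp add: ennreal_mult_less_top)
  finally show ?thesis .
qed

text \<open>Since (1 + x^2)(1 + y^2) \<le> (1 + |z|^2)^2, the weight can be shared evenly between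
  the two coordinates. Each factor then decays with exponent c/2 > 1.\<close>

lemma nn_integral_japanese:
  assumes c: "2 < c"
  shows "(\<integral>\<^sup>+z. ennreal (japanese z powr (- c)) \<partial>lborel) < \<infinity>"
proof (rule nn_integral_complex_prod_bound)
  show "(\<integral>\<^sup>+x. ennreal ((1 + x\<^sup>2) powr (- (c / 2) / 2)) \<partial>lborel) < \<infinity>"
    by (rule nn_integral_real_decay) (use c in auto)
  show "AE z in lborel. japanese z powr (- c)
      \<le> (1 + (Re z)\<^sup>2) powr (- (c / 2) / 2) * (1 + (Im z)\<^sup>2) powr (- (c / 2) / 2)"
  proof (intro AE_I2)
    fix z
    have "(1 + (Re z)\<^sup>2) * (1 + (Im z)\<^sup>2) \<le> (1 + (cmod z)\<^sup>2)\<^sup>2"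
      using zero_le_mult_iff[of "(Re z)\<^sup>2" "(Im z)\<^sup>2"]
        zero_le_power2[of "(Re z)\<^sup>2"] zero_le_power2[of "(Im z)\<^sup>2"] zero_le_power2[of "Re z"] zero_le_power2[of "Im z"]
      unfolding cmod_power2 power2_sum distrib_left distrib_right by (simp add: algebra_simps)
    then have "((1 + (cmod z)\<^sup>2)\<^sup>2) powr (- (c / 4)) \<le> ((1 + (Re z)\<^sup>2) * (1 + (Im z)\<^sup>2)) powr (- (c / 4))"
      using c by (intro powr_neg_mono) (auto intro!: mult_pos_pos add_pos_nonneg)
    moreover have "((1 + (cmod z)\<^sup>2)\<^sup>2) powr (- (c / 4)) = japanese z powr (- c)"
      unfolding japanese_squared[symmetric]
      by (simp only: power2_powr zero_less_power japanese_pos) simp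
    ultimately show "japanese z powr (- c)
      \<le> (1 + (Re z)\<^sup>2) powr (- (c / 2) / 2) * (1 + (Im z)\<^sup>2) powr (- (c / 2) / 2)"
      by (simp add: powr_mult)
  qed
qed auto

text \<open>The product majorant used next for 1/|z| fails on the axes, where
  \<open>0 powr (- 1 / 2)\<close> is \<open>0\<close>, so the axes have to be discarded.\<close>

lemma AE_complex_Re_Im_nz: "AE z in lborel. Re z \<noteq> 0 \<and> Im z \<noteq> 0"
proof (rule AE_I')
  let ?N = "{z::complex. Re z = 0} \<union> {z. Im z = 0}"
  have "{z::complex. Re z = 0} = {z. z \<bullet> 1 = 0}" "{z::complex. Im z = 0} = {z. z \<bullet> \<i> = 0}"
    by (auto simp: inner_complex_def)
  then have "?N \<in> null_sets lebesgue"
    using negligible_standard_hyperplane[of "1::complex" 0] negligible_standard_hyperplane[of "\<i>" 0]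
    by (auto simp: negligible_iff_null_sets Basis_complex_def intro!: null_sets.Un)
  moreover have "?N \<in> sets lborel" by measurable
  ultimately show "?N \<in> null_sets lborel"
    by (metis null_sets_completion_iff)
qed auto

text \<open>From |Re z| |Im z| \<le> |z|^2 one gets 1/|z| \<le> |Re z|^(-1/2) |Im z|^(-1/2), and
  both factors are integrable at 0.\<close>

lemma nn_integral_inverse_cmod_disc:
  "(\<integral>\<^sup>+z. ennreal (indicator (ball 0 1) z / cmod z) \<partial>lborel) < \<infinity>"
proof (rule nn_integral_complex_prod_bound)
  let ?a = "\<lambda>x::real. if \<bar>x\<bar> \<le> 1 then \<bar>x\<bar> powr (- 1 / 2) else 0"
  let ?g = "\<lambda>x::real. if x \<in> {0..1} then x powr (- 1 / 2) else 0"
  show "(\<integral>\<^sup>+x. ennreal (?a x) \<partial>lborel) < \<infinity>"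
  proof (rule nn_integral_real_even_bound)
    have "((\<lambda>x::real. x powr (- 1 / 2)) has_integral (1 powr (- 1 / 2 + 1) / (- 1 / 2 + 1))) {0..1}"
      by (rule has_integral_powr_from_0) auto
    then show "(?g has_integral (1 powr (- 1 / 2 + 1) / (- 1 / 2 + 1))) {0..}"
      by (subst has_integral_restrict) auto
  qed auto
  show "AE z in lborel. indicator (ball 0 1) z / cmod z \<le> ?a (Re z) * ?a (Im z)"
    using AE_complex_Re_Im_nz
  proof eventually_elim
    case (elim z)
    show ?case
    proof (cases "cmod z < 1")
      case True
      have "2 * (\<bar>Re z\<bar> * \<bar>Im z\<bar>) \<le> (cmod z)\<^sup>2"
        using sum_squares_bound[of "\<bar>Re z\<bar>" "\<bar>Im z\<bar>"] by (simp add: cmod_power2 mult.assoc)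
      then have "\<bar>Re z\<bar> * \<bar>Im z\<bar> \<le> (cmod z)\<^sup>2"
        using mult_nonneg_nonneg[of "\<bar>Re z\<bar>" "\<bar>Im z\<bar>"] by linarith
      moreover have "0 < \<bar>Re z\<bar> * \<bar>Im z\<bar>" using elim by simp
      ultimately have "((cmod z)\<^sup>2) powr (- (1 / 2)) \<le> (\<bar>Re z\<bar> * \<bar>Im z\<bar>) powr (- (1 / 2))"
        by (intro powr_neg_mono) auto
      moreover have "((cmod z)\<^sup>2) powr (- (1 / 2)) = 1 / cmod z"
        using elim by (subst powr_minus, subst powr_half_sqrt) (auto simp: divide_inverse)
      ultimately have "1 / cmod z \<le> \<bar>Re z\<bar> powr (- (1 / 2)) * \<bar>Im z\<bar> powr (- (1 / 2))"
        by (simp add: powr_mult)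
      moreover have "\<bar>Re z\<bar> \<le> 1" "\<bar>Im z\<bar> \<le> 1"
        using True abs_Re_le_cmod[of z] abs_Im_le_cmod[of z] by linarith+
      ultimately show ?thesis using True by simp
    qed auto
  qed
qed auto

section \<open>Schur's test for the Cauchy kernel\<close>

text \<open>The smaller of X and Y can absorb both exponents. This separates products of weights at
  two points into single weights, each of which integrates to a constant independent of the other
  point.\<close>

lemma powr_neg_mix:
  fixes X Y a b :: real
  assumes "0 < X" "0 < Y" "0 \<le> a" "0 \<le> b"
  shows "X powr (- a) * Y powr (- b) \<le> X powr (- (a + b)) + Y powr (- (a + b))"
proof (cases "X \<le> Y")
  case True
  then have "X powr (- a) * Y powr (- b) \<le> X powr (- a) * X powr (- b)"
    using assms by (intro mult_left_mono powr_neg_mono) auto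
  also have "\<dots> = X powr (- (a + b))" by (simp add: powr_add[symmetric])
  finally show ?thesis by (smt (verit) powr_ge_zero)
next
  case False
  then have "X powr (- a) * Y powr (- b) \<le> Y powr (- a) * Y powr (- b)"
    using assms by (intro mult_right_mono powr_neg_mono) auto
  also have "\<dots> = Y powr (- (a + b))" by (simp add: powr_add[symmetric])
  finally show ?thesis by (smt (verit) powr_ge_zero)
qed

lemma inverse_cmod_le_japanese:
  assumes "1 \<le> cmod x"
  shows "1 / cmod x \<le> 2 * japanese x powr (- 1)"
proof -
  have "japanese x \<le> 2 * cmod x" using japanese_le_add[of x] assms by linarith
  then have "2 / (2 * cmod x) \<le> 2 / japanese x"
    using assms by (intro divide_left_mono) (auto intro!: mult_pos_pos)
  then show ?thesis by (simp add: powr_neg_one abs_of_pos)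
qed

text \<open>Here \<open>x\<close> plays the role of z - y. Near the diagonal the singularity is
  integrable and the weight at most 1; elsewhere 1/|x| is comparable to a weight, and mixing gives
  the exponent 1 + b.\<close>

lemma potential_kernel_le:
  assumes b: "0 \<le> b"
  shows "japanese y powr (- b) / cmod x \<le> indicator (ball 0 1) x / cmod x
    + 2 * (japanese x powr (- (1 + b)) + japanese y powr (- (1 + b)))"
proof (cases "cmod x < 1")
  case True
  have "japanese y powr (- b) \<le> 1"
    using powr_neg_mono[of 1 "japanese y" b] japanese_ge_1[of y] b by simp
  then have "japanese y powr (- b) / cmod x \<le> 1 / cmod x" by (intro divide_right_mono) auto
  moreover have "indicator (ball 0 1) x / cmod x = 1 / cmod x" using True by simp
  ultimately show ?thesis by (smt (verit) powr_ge_zero)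
next
  case False
  have "japanese y powr (- b) / cmod x = (1 / cmod x) * japanese y powr (- b)" by simp
  also have "\<dots> \<le> (2 * japanese x powr (- 1)) * japanese y powr (- b)"
    using False by (intro mult_right_mono inverse_cmod_le_japanese) auto
  also have "\<dots> \<le> 2 * (japanese x powr (- (1 + b)) + japanese y powr (- (1 + b)))"
    using powr_neg_mix[of "japanese x" "japanese y" 1 b] b by simp
  finally show ?thesis using False by simp
qed

text \<open>Here \<open>x\<close> plays the role of z - y, so \<open>x + y\<close> is z. Multiplying
  by the inverse of the expected row decay reduces the row bound to a uniform one. The total degree
  (1 - \<epsilon>) + (\<epsilon> - 3) - 1 = -3 is integrable in the plane for every
  \<epsilon>.\<close>

lemma schur_kernel_le:
  assumes e: "0 < \<epsilon>" "\<epsilon> \<le> 1"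
  shows "japanese (x + y) powr (1 - \<epsilon>) * (japanese y powr (\<epsilon> - 3) / cmod x)
    \<le> 2 * (indicator (ball 0 1) x / cmod x) + 8 * (japanese x powr (- 3) + japanese y powr (- 3))"
proof -
  define X Y where "X = japanese x" and "Y = japanese y"
  have X: "1 \<le> X" and Y: "1 \<le> Y" by (simp_all add: X_def Y_def japanese_ge_1)
  have Z: "japanese (x + y) \<le> Y + cmod x"
    using japanese_triangle[of y x] by (simp add: Y_def add.commute)
  have p2: "2 powr (1 - \<epsilon>) \<le> (2::real)"
    using powr_mono[of "1 - \<epsilon>" 1 "2::real"] e by simp
  show ?thesis
  proof (cases "cmod x < 1")
    case True
    have "japanese (x + y) powr (1 - \<epsilon>) \<le> (2 * Y) powr (1 - \<epsilon>)"
      using Z True Y e by (intro powr_mono2) (auto simp: less_imp_le)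
    also have "\<dots> \<le> 2 * Y powr (1 - \<epsilon>)"
      using p2 Y by (simp add: powr_mult mult_right_mono)
    finally have "japanese (x + y) powr (1 - \<epsilon>) * Y powr (\<epsilon> - 3) \<le> 2 * Y powr (1 - \<epsilon>) * Y powr (\<epsilon> - 3)"
      by (intro mult_right_mono) auto
    also have "\<dots> = 2 * Y powr (- 2)" by (simp add: powr_add[symmetric])
    also have "\<dots> \<le> 2" using powr_neg_mono[of 1 Y 2] Y by simp
    finally have "japanese (x + y) powr (1 - \<epsilon>) * Y powr (\<epsilon> - 3) / cmod x \<le> 2 / cmod x"
      by (intro divide_right_mono) auto
    moreover have "2 * (indicator (ball 0 1) x / cmod x) = 2 / cmod x" using True by simp
    ultimately show ?thesis unfolding X_def[symmetric] Y_def[symmetric]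
      by (smt (verit) powr_ge_zero times_divide_eq_right)
  next
    case False
    have "japanese (x + y) \<le> X + Y" using Z cmod_le_japanese[of x] by (simp add: X_def)
    then have "japanese (x + y) powr (1 - \<epsilon>) \<le> (2 * max X Y) powr (1 - \<epsilon>)"
      using e by (intro powr_mono2) (auto simp: less_imp_le)
    also have "\<dots> \<le> 2 * (max X Y) powr (1 - \<epsilon>)"
      using p2 X by (simp add: powr_mult mult_right_mono)
    also have "\<dots> \<le> 2 * (X powr (1 - \<epsilon>) + Y powr (1 - \<epsilon>))"
      by (simp add: max_def)
    finally have "japanese (x + y) powr (1 - \<epsilon>) * (Y powr (\<epsilon> - 3) / cmod x)
       \<le> (2 * (X powr (1 - \<epsilon>) + Y powr (1 - \<epsilon>))) * (Y powr (\<epsilon> - 3) / cmod x)"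
      by (intro mult_right_mono) auto
    also have "\<dots> = (2 * (X powr (1 - \<epsilon>) + Y powr (1 - \<epsilon>)) * Y powr (\<epsilon> - 3)) * (1 / cmod x)"
      by simp
    also have "\<dots> \<le> (2 * (X powr (1 - \<epsilon>) + Y powr (1 - \<epsilon>)) * Y powr (\<epsilon> - 3)) * (2 * X powr (- 1))"
      using inverse_cmod_le_japanese[of x] False by (intro mult_left_mono) (auto simp: X_def)
    also have "\<dots> = 4 * (X powr (1 - \<epsilon>) * X powr (- 1) * Y powr (\<epsilon> - 3) + X powr (- 1) * (Y powr (1 - \<epsilon>) * Y powr (\<epsilon> - 3)))"
      by (simp add: algebra_simps)
    also have "\<dots> = 4 * (X powr (- \<epsilon>) * Y powr (- (3 - \<epsilon>)) + X powr (- 1) * Y powr (- 2))"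
    proof -
      have "X powr (1 - \<epsilon>) * X powr (- 1) = X powr (- \<epsilon>)"
        by (subst powr_add[symmetric]) simp
      moreover have "Y powr (1 - \<epsilon>) * Y powr (\<epsilon> - 3) = Y powr (- 2)"
        by (subst powr_add[symmetric]) simp
      ultimately show ?thesis by (simp only: minus_diff_eq)
    qed
    also have "\<dots> \<le> 8 * (X powr (- 3) + Y powr (- 3))"
      using powr_neg_mix[of X Y \<epsilon> "3 - \<epsilon>"] powr_neg_mix[of X Y 1 2] X Y e by simp
    finally show ?thesis using False by (simp add: X_def Y_def)
  qed
qed

text \<open>The reflection y \<mapsto> z - y removes z from every term, which is what makes
  \<open>C\<close> uniform in z.\<close>

lemma nn_integral_kernel_majorant:
  assumes b: "2 < b" and "0 \<le> c" "0 \<le> d"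
  shows "\<exists>C\<ge>0. \<forall>z. (\<integral>\<^sup>+y. ennreal (c * (indicator (ball 0 1) (z - y) / cmod (z - y))
     + d * (japanese (z - y) powr (- b) + japanese y powr (- b))) \<partial>lborel) \<le> ennreal C"
proof -
  let ?i = "\<lambda>x. ennreal (indicator (ball 0 1) x / cmod x)"
  let ?j = "\<lambda>x. ennreal (japanese x powr (- b))"
  obtain I where I: "(\<integral>\<^sup>+x. ?i x \<partial>lborel) = ennreal I" "0 \<le> I"
    using nn_integral_inverse_cmod_disc by (cases "\<integral>\<^sup>+x. ?i x \<partial>lborel") auto
  obtain J where J: "(\<integral>\<^sup>+x. ?j x \<partial>lborel) = ennreal J" "0 \<le> J"
    using nn_integral_japanese[OF b] by (cases "\<integral>\<^sup>+x. ?j x \<partial>lborel") auto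
  have "(\<integral>\<^sup>+y. ennreal (c * (indicator (ball 0 1) (z - y) / cmod (z - y))
     + d * (japanese (z - y) powr (- b) + japanese y powr (- b))) \<partial>lborel) \<le> ennreal (c * I + d * (J + J))" for z
  proof -
    have [measurable]: "cmod \<in> borel_measurable borel"
      by (intro borel_measurable_continuous_onI continuous_intros)
    have [measurable]: "ball (0::complex) 1 \<in> sets borel" by simp
    have i[measurable]: "?i \<in> borel_measurable borel" by measurable
    have *: "ennreal (c * a + d * (u + v)) = ennreal c * ennreal a + ennreal d * (ennreal u + ennreal v)"
      if "0 \<le> a" "0 \<le> u" "0 \<le> v" for a u v
      using assms that by (simp add: ennreal_mult)
    have "(\<integral>\<^sup>+y. ennreal (c * (indicator (ball 0 1) (z - y) / cmod (z - y))
     + d * (japanese (z - y) powr (- b) + japanese y powr (- b))) \<partial>lborel)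
      = (\<integral>\<^sup>+y. ennreal c * ?i (z - y) + ennreal d * (?j (z - y) + ?j y) \<partial>lborel)"
      by (intro nn_integral_cong *) auto
    also have "\<dots> = ennreal c * (\<integral>\<^sup>+y. ?i (z - y) \<partial>lborel)
        + ennreal d * ((\<integral>\<^sup>+y. ?j (z - y) \<partial>lborel) + (\<integral>\<^sup>+y. ?j y \<partial>lborel))"
    proof -
      have [measurable]: "(\<lambda>y. ?i (z - y)) \<in> borel_measurable borel"
        by (rule measurable_compose[of "\<lambda>y. z - y" _ borel ?i]) measurable
      show ?thesis
        by (subst nn_integral_add, measurable, subst (1 2) nn_integral_cmult, measurable,
            subst nn_integral_add, measurable)
    qed
    also have "\<dots> = ennreal (c * I + d * (J + J))"
    proof -
      have e1: "(\<integral>\<^sup>+y. ?i (z - y) \<partial>lborel) = ennreal I"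
        using nn_integral_complex_reflect[OF i, of z] I by simp
      have e2: "(\<integral>\<^sup>+y. ?j (z - y) \<partial>lborel) = ennreal J"
        using nn_integral_complex_reflect[of ?j z] J by simp
      show ?thesis unfolding e1 e2 J(1) by (rule *[OF I(2) J(2) J(2), symmetric])
    qed
    finally show ?thesis by simp
  qed
  moreover have "0 \<le> c * I + d * (J + J)" using assms I J by auto
  ultimately show ?thesis by blast
qed

lemma potential_bound:
  assumes b: "1 < b"
  shows "\<exists>C\<ge>0. \<forall>z. (\<integral>\<^sup>+y. ennreal (japanese y powr (- b) / cmod (z - y)) \<partial>lborel) \<le> ennreal C"
proof -
  obtain C where C: "0 \<le> C" "\<And>z. (\<integral>\<^sup>+y. ennreal (1 * (indicator (ball 0 1) (z - y) / cmod (z - y))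
     + 2 * (japanese (z - y) powr (- (1 + b)) + japanese y powr (- (1 + b)))) \<partial>lborel) \<le> ennreal C"
    using nn_integral_kernel_majorant[of "1 + b" 1 2] b by auto
  have "(\<integral>\<^sup>+y. ennreal (japanese y powr (- b) / cmod (z - y)) \<partial>lborel) \<le> ennreal C" for z
    using potential_kernel_le[of b _ "z - _"] b
    by (intro order_trans[OF nn_integral_mono C(2)] ennreal_leI) auto
  with C(1) show ?thesis by blast
qed

text \<open>This is the row condition of Schur's test for the kernel
  \<langle>z\<rangle>^(-\<epsilon>) \<langle>y\<rangle>^(\<epsilon> - 2) / |z - y| with test weight
  \<langle>.\<rangle>^(-1), with the factor \<langle>z\<rangle>^(-\<epsilon>) moved to the other
  side.\<close>

lemma schur_row_bound:
  assumes e: "0 < \<epsilon>" "\<epsilon> \<le> 1"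
  shows "\<exists>C\<ge>0. \<forall>z. (\<integral>\<^sup>+y. ennreal (japanese y powr (\<epsilon> - 3) / cmod (z - y)) \<partial>lborel)
     \<le> ennreal (C * japanese z powr (\<epsilon> - 1))"
proof -
  obtain C where C: "0 \<le> C" "\<And>z. (\<integral>\<^sup>+y. ennreal (2 * (indicator (ball 0 1) (z - y) / cmod (z - y))
     + 8 * (japanese (z - y) powr (- 3) + japanese y powr (- 3))) \<partial>lborel) \<le> ennreal C"
    using nn_integral_kernel_majorant[of 3 2 8] by auto
  have "(\<integral>\<^sup>+y. ennreal (japanese y powr (\<epsilon> - 3) / cmod (z - y)) \<partial>lborel)
     \<le> ennreal (C * japanese z powr (\<epsilon> - 1))" for z
  proof -
    let ?J = "japanese z powr (\<epsilon> - 1)"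
    have "(\<integral>\<^sup>+y. ennreal (japanese y powr (\<epsilon> - 3) / cmod (z - y)) \<partial>lborel)
       = (\<integral>\<^sup>+y. ennreal ?J * ennreal (japanese z powr (1 - \<epsilon>) * (japanese y powr (\<epsilon> - 3) / cmod (z - y))) \<partial>lborel)"
      by (intro nn_integral_cong)
        (simp add: ennreal_mult[symmetric] powr_add[symmetric] flip: mult.assoc times_divide_eq_right)
    also have "\<dots> = ennreal ?J * (\<integral>\<^sup>+y. ennreal (japanese z powr (1 - \<epsilon>) * (japanese y powr (\<epsilon> - 3) / cmod (z - y))) \<partial>lborel)"
      by (rule nn_integral_cmult) measurable
    also have "\<dots> \<le> ennreal ?J * ennreal C"
    proof (intro mult_left_mono order_trans[OF nn_integral_mono C(2)] ennreal_leI)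
      show "japanese z powr (1 - \<epsilon>) * (japanese y powr (\<epsilon> - 3) / cmod (z - y))
        \<le> 2 * (indicator (ball 0 1) (z - y) / cmod (z - y)) + 8 * (japanese (z - y) powr - 3 + japanese y powr - 3)" for y
        using schur_kernel_le[OF e, of "z - y" y] by simp
    qed auto
    also have "\<dots> = ennreal (C * ?J)" using C(1) by (simp add: ennreal_mult mult.commute)
    finally show ?thesis .
  qed
  with C(1) show ?thesis by blast
qed

section \<open>The Riesz potential of order one and its weighted bound\<close>

definition pot :: "(complex \<Rightarrow> ennreal) \<Rightarrow> complex \<Rightarrow> ennreal" where
  "pot v z = (\<integral>\<^sup>+w. v w * ennreal (1 / cmod (z - w)) \<partial>lborel)"

text \<open>\<open>wnn\<close> is a squared norm. Like \<open>pot\<close> it takes values in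
  \<open>ennreal\<close>, so that Tonelli applies before any integrability is known and membership
  in a weighted space becomes finiteness.\<close>

definition wnn :: "real \<Rightarrow> (complex \<Rightarrow> ennreal) \<Rightarrow> ennreal" where
  "wnn \<theta> v = (\<integral>\<^sup>+z. (v z)\<^sup>2 * ennreal (japanese z powr (- 2 * \<theta>)) \<partial>lborel)"

lemma measurable_pot [measurable]:
  assumes [measurable]: "v \<in> borel_measurable borel"
  shows "pot v \<in> borel_measurable borel"
  unfolding pot_def[abs_def] by measurable

text \<open>Cauchy--Schwarz with the splitting \<langle>w\<rangle>^((\<epsilon> - 3)/2) against its
  inverse brings in the row bound. Its decay joined to the outer weight leaves
  \<langle>z\<rangle>^(-(1 + \<epsilon>)), and the column integral is then bounded because 1 +
  \<epsilon> > 1.\<close>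

lemma schur_bound:
  assumes e: "0 < \<epsilon>" "\<epsilon> \<le> 1"
  shows "\<exists>C\<ge>0. \<forall>v\<in>borel_measurable borel. wnn \<epsilon> (pot v) \<le> ennreal C * wnn (\<epsilon> - 2) v"
proof -
  obtain C where C: "0 \<le> C" "\<And>z. (\<integral>\<^sup>+y. ennreal (japanese y powr (\<epsilon> - 3) / cmod (z - y)) \<partial>lborel)
     \<le> ennreal (C * japanese z powr (\<epsilon> - 1))"
    using schur_row_bound[OF e] by auto
  obtain C' where C': "0 \<le> C'" "\<And>z. (\<integral>\<^sup>+y. ennreal (japanese y powr (- (1 + \<epsilon>)) / cmod (z - y)) \<partial>lborel) \<le> ennreal C'"
    using potential_bound[of "1 + \<epsilon>"] e by auto
  have "wnn \<epsilon> (pot v) \<le> ennreal (C * C') * wnn (\<epsilon> - 2) v" if [measurable]: "v \<in> borel_measurable borel" for v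
  proof -
    define K where "K z w = ennreal (1 / cmod (z - w))" for z w
    have K[measurable]: "(\<lambda>(z, w). K z w) \<in> borel_measurable (lborel \<Otimes>\<^sub>M lborel)"
      unfolding K_def by measurable
    have K1[measurable]: "K z \<in> borel_measurable borel" "(\<lambda>z. K z w) \<in> borel_measurable borel" for z w
      unfolding K_def by measurable
    let ?g = "\<lambda>w. (v w)\<^sup>2 * ennreal (japanese w powr (3 - \<epsilon>))"
    have cs: "(pot v z)\<^sup>2 \<le> ennreal (C * japanese z powr (\<epsilon> - 1)) * (\<integral>\<^sup>+w. ?g w * K z w \<partial>lborel)" for z
    proof -
      let ?a = "\<lambda>w. ennreal (sqrt (japanese w powr (\<epsilon> - 3) / cmod (z - w)))"
      let ?b = "\<lambda>w. v w * ennreal (sqrt (japanese w powr (3 - \<epsilon>) / cmod (z - w)))"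
      have ab: "v w * ennreal (1 / cmod (z - w)) = ?a w * ?b w" for w
      proof -
        have "sqrt (japanese w powr (\<epsilon> - 3) / cmod (z - w)) * sqrt (japanese w powr (3 - \<epsilon>) / cmod (z - w))
          = sqrt ((japanese w powr (\<epsilon> - 3) * japanese w powr (3 - \<epsilon>)) / (cmod (z - w))\<^sup>2)"
          by (simp add: real_sqrt_mult[symmetric] power2_eq_square)
        also have "\<dots> = 1 / cmod (z - w)"
          by (simp add: powr_add[symmetric] real_sqrt_divide)
        finally show ?thesis
          by (simp add: ennreal_mult[symmetric] mult.left_commute)
      qed
      have "(pot v z)\<^sup>2 = (\<integral>\<^sup>+w. ?a w * ?b w \<partial>lborel)\<^sup>2"
        unfolding pot_def ab ..
      also have "\<dots> \<le> (\<integral>\<^sup>+w. (?a w)\<^sup>2 \<partial>lborel) * (\<integral>\<^sup>+w. (?b w)\<^sup>2 \<partial>lborel)"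
        by (rule Cauchy_Schwarz_nn_integral) measurable
      also have "(\<integral>\<^sup>+w. (?a w)\<^sup>2 \<partial>lborel) = (\<integral>\<^sup>+w. ennreal (japanese w powr (\<epsilon> - 3) / cmod (z - w)) \<partial>lborel)"
        by (intro nn_integral_cong) (simp add: ennreal_power)
      also have "(\<integral>\<^sup>+w. (?b w)\<^sup>2 \<partial>lborel) = (\<integral>\<^sup>+w. ?g w * K z w \<partial>lborel)"
        by (intro nn_integral_cong) (simp add: ennreal_power power_mult_distrib K_def ennreal_mult[symmetric] mult.assoc)
      finally show ?thesis
        by (rule order_trans) (intro mult_right_mono C(2), simp)
    qed
    have "wnn \<epsilon> (pot v) \<le> (\<integral>\<^sup>+z. (ennreal (C * japanese z powr (\<epsilon> - 1)) * (\<integral>\<^sup>+w. ?g w * K z w \<partial>lborel)) * ennreal (japanese z powr (- 2 * \<epsilon>)) \<partial>lborel)"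
      unfolding wnn_def by (intro nn_integral_mono mult_right_mono cs) auto
    also have "\<dots> = (\<integral>\<^sup>+z. \<integral>\<^sup>+w. ennreal C * ?g w * (K z w * ennreal (japanese z powr (- (1 + \<epsilon>)))) \<partial>lborel \<partial>lborel)"
    proof (intro nn_integral_cong)
      fix z
      have "ennreal (C * japanese z powr (\<epsilon> - 1)) * ennreal (japanese z powr (- 2 * \<epsilon>))
        = ennreal C * ennreal (japanese z powr (- (1 + \<epsilon>)))"
      proof -
        have pw: "japanese z powr (\<epsilon> - 1) * japanese z powr (- 2 * \<epsilon>) = japanese z powr (- (1 + \<epsilon>))"
          by (subst powr_add[symmetric]) (rule arg_cong[where f="\<lambda>t. japanese z powr t"], simp)
        have "ennreal (C * japanese z powr (\<epsilon> - 1)) * ennreal (japanese z powr (- 2 * \<epsilon>))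
          = ennreal (C * (japanese z powr (\<epsilon> - 1) * japanese z powr (- 2 * \<epsilon>)))"
          using C(1) by (simp only: ennreal_mult[symmetric] mult.assoc mult_nonneg_nonneg powr_ge_zero)
        then show ?thesis unfolding pw using C(1) by (simp add: ennreal_mult)
      qed
      note eq = this
      let ?j = "ennreal (japanese z powr (- (1 + \<epsilon>)))"
      have "(\<integral>\<^sup>+w. ennreal C * ?g w * (K z w * ?j) \<partial>lborel) = (\<integral>\<^sup>+w. (ennreal C * ?j) * (?g w * K z w) \<partial>lborel)"
        by (intro nn_integral_cong) (simp only: mult_ac)
      also have "\<dots> = (ennreal C * ?j) * (\<integral>\<^sup>+w. ?g w * K z w \<partial>lborel)"
        by (rule nn_integral_cmult) measurable
      finally show "(ennreal (C * japanese z powr (\<epsilon> - 1)) * (\<integral>\<^sup>+w. ?g w * K z w \<partial>lborel)) * ennreal (japanese z powr (- 2 * \<epsilon>))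
        = (\<integral>\<^sup>+w. ennreal C * ?g w * (K z w * ?j) \<partial>lborel)"
        unfolding eq[symmetric] by (simp only: mult_ac)
    qed
    also have "\<dots> = (\<integral>\<^sup>+w. \<integral>\<^sup>+z. ennreal C * ?g w * (K z w * ennreal (japanese z powr (- (1 + \<epsilon>)))) \<partial>lborel \<partial>lborel)"
      by (rule lborel_pair.Fubini') measurable
    also have "\<dots> \<le> (\<integral>\<^sup>+w. ennreal C * ?g w * ennreal C' \<partial>lborel)"
    proof (intro nn_integral_mono)
      fix w
      have "(\<integral>\<^sup>+z. K z w * ennreal (japanese z powr (- (1 + \<epsilon>))) \<partial>lborel) \<le> ennreal C'"
        using C'(2)[of w] by (simp add: K_def ennreal_mult[symmetric] norm_minus_commute)
      then show "(\<integral>\<^sup>+z. ennreal C * ?g w * (K z w * ennreal (japanese z powr (- (1 + \<epsilon>)))) \<partial>lborel) \<le> ennreal C * ?g w * ennreal C'"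
        by (subst nn_integral_cmult) (auto intro: mult_left_mono)
    qed
    also have "\<dots> \<le> (\<integral>\<^sup>+w. ennreal (C * C') * ((v w)\<^sup>2 * ennreal (japanese w powr (- 2 * (\<epsilon> - 2)))) \<partial>lborel)"
    proof (intro nn_integral_mono)
      fix w
      \<comment> \<open>The comparison 3 - \<epsilon> \<le> 4 - 2\<epsilon> is exactly the condition
        \<epsilon> \<le> 1.\<close>
      have "japanese w powr (3 - \<epsilon>) \<le> japanese w powr (- 2 * (\<epsilon> - 2))"
        using e japanese_ge_1[of w] by (intro powr_mono) auto
      then have "?g w \<le> (v w)\<^sup>2 * ennreal (japanese w powr (- 2 * (\<epsilon> - 2)))"
        by (intro mult_left_mono ennreal_leI) auto
      then have "ennreal (C * C') * ?g w \<le> ennreal (C * C') * ((v w)\<^sup>2 * ennreal (japanese w powr (- 2 * (\<epsilon> - 2))))"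
        by (rule mult_left_mono) auto
      then show "ennreal C * ?g w * ennreal C' \<le> ennreal (C * C') * ((v w)\<^sup>2 * ennreal (japanese w powr (- 2 * (\<epsilon> - 2))))"
        using C(1) C'(1) by (simp add: ennreal_mult mult_ac)
    qed
    also have "\<dots> = ennreal (C * C') * wnn (\<epsilon> - 2) v"
      unfolding wnn_def by (rule nn_integral_cmult) measurable
    finally show ?thesis .
  qed
  then show ?thesis using C(1) C'(1) by (intro exI[of _ "C * C'"]) auto
qed

text \<open>The kernel is homogeneous of degree -3 in (z - y, r) and the measure has degree 2, so
  scaling by r leaves 1/r. It measures the error of an integrand that changes on the scale r = |z -
  x| near a singularity.\<close>

lemma scaled_kernel_bound:
  "\<exists>C\<ge>0. \<forall>z r. 0 < r \<longrightarrow> (\<integral>\<^sup>+y. ennreal (1 / (((cmod (z - y))\<^sup>2 + r\<^sup>2) * cmod (z - y))) \<partial>lborel) \<le> ennreal (C / r)"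
proof -
  obtain C where C: "0 \<le> C" "\<And>z. (\<integral>\<^sup>+y. ennreal (japanese y powr (- 2) / cmod (z - y)) \<partial>lborel) \<le> ennreal C"
    using potential_bound[of 2] by auto
  have "(\<integral>\<^sup>+y. ennreal (1 / (((cmod (z - y))\<^sup>2 + r\<^sup>2) * cmod (z - y))) \<partial>lborel) \<le> ennreal (C / r)" if r: "0 < r" for z r
  proof -
    let ?f = "\<lambda>y. ennreal (1 / (((cmod y)\<^sup>2 + r\<^sup>2) * cmod y))"
    have "(\<integral>\<^sup>+y. ?f (z - y) \<partial>lborel) = (\<integral>\<^sup>+y. ?f y \<partial>lborel)"
      by (rule nn_integral_complex_reflect) measurable
    also have "\<dots> = ennreal (r\<^sup>2) * (\<integral>\<^sup>+y. ?f (0 + r *\<^sub>R y) \<partial>lborel)"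
      using r by (intro nn_integral_complex_affine) auto
    also have "\<dots> = (\<integral>\<^sup>+y. ennreal (r\<^sup>2) * ?f (0 + r *\<^sub>R y) \<partial>lborel)"
      by (rule nn_integral_cmult[symmetric]) measurable
    also have "\<dots> = (\<integral>\<^sup>+y. ennreal (1 / r) * ennreal (japanese y powr (- 2) / cmod (0 - y)) \<partial>lborel)"
    proof (intro nn_integral_cong)
      fix y
      have nz: "1 + cmod y * cmod y \<noteq> 0"
        by (smt (verit) mult_nonneg_nonneg norm_ge_zero)
      have "r\<^sup>2 * (1 / (((cmod (r *\<^sub>R y))\<^sup>2 + r\<^sup>2) * cmod (r *\<^sub>R y))) = 1 / r * (1 / (japanese y)\<^sup>2 / cmod y)"
        using r nz unfolding japanese_squared by (simp add: power_mult_distrib divide_simps power2_eq_square) (simp add: algebra_simps)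
      moreover have "japanese y powr (- 2) = 1 / (japanese y)\<^sup>2"
        by (simp add: powr_minus divide_inverse)
      ultimately show "ennreal (r\<^sup>2) * ?f (0 + r *\<^sub>R y) = ennreal (1 / r) * ennreal (japanese y powr (- 2) / cmod (0 - y))"
        using r by (simp add: ennreal_mult[symmetric])
    qed
    also have "\<dots> = ennreal (1 / r) * (\<integral>\<^sup>+y. ennreal (japanese y powr (- 2) / cmod (0 - y)) \<partial>lborel)"
      by (rule nn_integral_cmult) measurable
    also have "\<dots> \<le> ennreal (1 / r) * ennreal C" by (intro mult_left_mono C(2)) auto
    also have "\<dots> = ennreal (C / r)" using r C(1) by (simp add: ennreal_mult[symmetric])
    finally show ?thesis .
  qed
  with C(1) show ?thesis by blast
qed

section \<open>The Cauchy--Pompeiu formula\<close>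

lemma nn_integral_FTC_UNIV:
  fixes f F :: "real \<Rightarrow> real"
  assumes [measurable]: "f \<in> borel_measurable borel"
    and F: "\<And>x. (F has_real_derivative f x) (at x)" and f: "\<And>x. 0 \<le> f x"
    and A: "(F \<longlongrightarrow> A) at_bot" and B: "(F \<longlongrightarrow> B) at_top"
  shows "(\<integral>\<^sup>+x. ennreal (f x) \<partial>lborel) = ennreal (B - A)"
proof -
  have mono: "F x \<le> F y" if "x \<le> y" for x y
    using that F f by (intro DERIV_nonneg_imp_nondecreasing[of x y F]) auto
  have AF: "A \<le> F 0"
    using A by (rule tendsto_upperbound) (auto simp: eventually_at_bot_linorder intro!: exI[of _ 0] mono)
  have FB: "F 0 \<le> B"
    using B by (rule tendsto_lowerbound) (auto simp: eventually_at_top_linorder intro!: exI[of _ 0] mono)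
  have 1: "(\<integral>\<^sup>+x. ennreal (f x) * indicator {0..} x \<partial>lborel) = ennreal (B - F 0)"
    by (rule nn_integral_FTC_atLeast) (auto simp: F f B)
  have "(\<integral>\<^sup>+x. ennreal (f (- x)) * indicator {0..} x \<partial>lborel) = ennreal (- A - - F (- 0))"
  proof (rule nn_integral_FTC_atLeast)
    show "((\<lambda>x. - F (- x)) has_real_derivative f (- x)) (at x)" for x
      by (rule derivative_eq_intros DERIV_chain2[OF F] refl | simp)+
    have "((\<lambda>x. F (- x)) \<longlongrightarrow> A) at_top"
      using A by (simp add: filterlim_at_bot_mirror)
    then show "((\<lambda>x. - F (- x)) \<longlongrightarrow> - A) at_top" by (rule tendsto_minus)
  qed (auto simp: f)
  then have "(\<integral>\<^sup>+x. ennreal (f (- x)) * indicator {0..} x \<partial>lborel) = ennreal (F 0 - A)" by simp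
  moreover have "(\<integral>\<^sup>+x. ennreal (f (- x)) * indicator {0..} x \<partial>lborel)
      = (\<integral>\<^sup>+x. ennreal (f x) * indicator {..0} x \<partial>lborel)"
    by (subst (2) nn_integral_real_affine[where c="-1" and t=0])
      (auto intro!: nn_integral_cong simp: indicator_def)
  ultimately have 2: "(\<integral>\<^sup>+x. ennreal (f x) * indicator {..0} x \<partial>lborel) = ennreal (F 0 - A)"
    by simp
  have "(\<integral>\<^sup>+x. ennreal (f x) \<partial>lborel)
      = (\<integral>\<^sup>+x. ennreal (f x) * indicator {0..} x + ennreal (f x) * indicator {..0} x \<partial>lborel)"
    using AE_lborel_singleton[of "0::real"]
    by (intro nn_integral_cong_AE) (auto simp: indicator_def)
  also have "\<dots> = ennreal (B - F 0) + ennreal (F 0 - A)"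
    by (subst nn_integral_add) (auto simp: 1 2)
  also have "\<dots> = ennreal (B - A)" using AF FB by (subst ennreal_plus[symmetric]) auto
  finally show ?thesis .
qed

text \<open>The exact value matters: it is the mass of the approximate identities t / (|y|^2 + t)^2
  and hence the origin of the factor pi in the Cauchy--Pompeiu formula.\<close>

lemma nn_integral_japanese_4:
  "(\<integral>\<^sup>+z. ennreal (1 / (1 + (cmod z)\<^sup>2)\<^sup>2) \<partial>lborel) = ennreal pi"
proof -
  have inner: "(\<integral>\<^sup>+y. ennreal (1 / (1 + (cmod (Complex x y))\<^sup>2)\<^sup>2) \<partial>lborel)
      = ennreal (pi / 2 * (1 / sqrt (1 + x\<^sup>2) ^ 3))" for x
  proof -
    define a where "a = sqrt (1 + x\<^sup>2)"
    have a: "0 < a" and a2: "a\<^sup>2 = 1 + x\<^sup>2"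
      by (auto simp: a_def add_pos_nonneg)
    \<comment> \<open>A primitive of 1 / (a^2 + y^2)^2; only the arctangent part survives at
      \<plusminus>\<infinity>, with limits \<plusminus>pi / (4 a^3).\<close>
    let ?F = "\<lambda>y. y / (2 * a\<^sup>2 * (a\<^sup>2 + y\<^sup>2)) + arctan (y / a) / (2 * a ^ 3)"
    have ne: "a\<^sup>2 + y\<^sup>2 \<noteq> 0" for y using a by (simp add: add_pos_nonneg less_imp_neq[symmetric])
    have "(\<integral>\<^sup>+y. ennreal (1 / (a\<^sup>2 + y\<^sup>2)\<^sup>2) \<partial>lborel) = ennreal (pi / (4 * a ^ 3) - (- pi / (4 * a ^ 3)))"
    proof (rule nn_integral_FTC_UNIV)
      fix y
      have 1: "((\<lambda>y. y / (2 * a\<^sup>2 * (a\<^sup>2 + y\<^sup>2))) has_real_derivative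
          (2 * a\<^sup>2 * (a\<^sup>2 + y\<^sup>2) - y * (2 * a\<^sup>2 * (2 * y))) / (2 * a\<^sup>2 * (a\<^sup>2 + y\<^sup>2))\<^sup>2) (at y)"
        using a ne[of y] by (auto intro!: derivative_eq_intros simp: power2_eq_square)
      have 2: "((\<lambda>y. arctan (y / a) / (2 * a ^ 3)) has_real_derivative
          (1 / (1 + (y / a)\<^sup>2) * (1 / a)) / (2 * a ^ 3)) (at y)"
      proof -
        have "((\<lambda>y. y / a) has_real_derivative 1 / a) (at y)" by (rule DERIV_cdivide[OF DERIV_ident])
        from DERIV_cdivide[OF DERIV_chain2[OF DERIV_arctan this], of "2 * a ^ 3"] show ?thesis
          by (simp add: inverse_eq_divide)
      qed
      have 3: "(1 / (1 + (y / a)\<^sup>2) * (1 / a)) / (2 * a ^ 3) = 1 / (2 * a\<^sup>2 * (a\<^sup>2 + y\<^sup>2))"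
      proof -
        have "1 + (y / a)\<^sup>2 = (a\<^sup>2 + y\<^sup>2) / a\<^sup>2" using a by (simp add: field_simps)
        then show ?thesis using a ne[of y] by (simp add: divide_simps power2_eq_square power3_eq_cube)
      qed
      have 4: "(2 * a\<^sup>2 * (a\<^sup>2 + y\<^sup>2) - y * (2 * a\<^sup>2 * (2 * y))) / (2 * a\<^sup>2 * (a\<^sup>2 + y\<^sup>2))\<^sup>2
        = ((a\<^sup>2 + y\<^sup>2) - 2 * y\<^sup>2) / (2 * a\<^sup>2 * (a\<^sup>2 + y\<^sup>2)\<^sup>2)"
        using a ne[of y] by (simp add: divide_simps power2_eq_square) (simp add: algebra_simps)
      have 5: "((a\<^sup>2 + y\<^sup>2) - 2 * y\<^sup>2) / (2 * a\<^sup>2 * (a\<^sup>2 + y\<^sup>2)\<^sup>2) + 1 / (2 * a\<^sup>2 * (a\<^sup>2 + y\<^sup>2))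
         = 1 / (a\<^sup>2 + y\<^sup>2)\<^sup>2"
        using a ne[of y] by (simp add: divide_simps power2_eq_square)
      show "(?F has_real_derivative 1 / (a\<^sup>2 + y\<^sup>2)\<^sup>2) (at y)"
        using DERIV_add[OF 1 2] unfolding 3 4 5 .
    next
      show "(?F \<longlongrightarrow> pi / (4 * a ^ 3)) at_top" using a by (real_asymp simp: field_simps)
      show "(?F \<longlongrightarrow> - pi / (4 * a ^ 3)) at_bot" using a by (real_asymp simp: field_simps)
    qed auto
    moreover have "1 + (cmod (Complex x y))\<^sup>2 = a\<^sup>2 + y\<^sup>2" for y
      unfolding cmod_power2 a2 by simp
    moreover have "pi / (4 * a ^ 3) - (- pi / (4 * a ^ 3)) = pi / 2 * (1 / a ^ 3)"
      using a by (simp add: field_simps)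
    ultimately show ?thesis by (simp only: a_def)
  qed
  have "(\<integral>\<^sup>+z. ennreal (1 / (1 + (cmod z)\<^sup>2)\<^sup>2) \<partial>lborel)
     = (\<integral>\<^sup>+x. ennreal (pi / 2 * (1 / sqrt (1 + x\<^sup>2) ^ 3)) \<partial>lborel)"
    by (subst nn_integral_complex) (auto simp: inner)
  also have "\<dots> = ennreal (pi / 2 - - (pi / 2))"
  proof (rule nn_integral_FTC_UNIV)
    fix x :: real
    define s where "s = sqrt (1 + x\<^sup>2)"
    have s: "0 < s" "s\<^sup>2 = 1 + x\<^sup>2" by (auto simp: s_def add_pos_nonneg)
    have p: "0 < 1 + x\<^sup>2" by (simp add: add_pos_nonneg)
    have "((\<lambda>x. 1 + x\<^sup>2) has_real_derivative 2 * x) (at x)"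
      by (auto intro!: derivative_eq_intros)
    from DERIV_chain2[OF DERIV_real_sqrt[OF p] this]
    have d: "((\<lambda>x. sqrt (1 + x\<^sup>2)) has_real_derivative x / s) (at x)"
      by (simp add: s_def inverse_eq_divide)
    have "((\<lambda>x. pi / 2 * (x / sqrt (1 + x\<^sup>2))) has_real_derivative
        pi / 2 * ((1 * s - x * (x / s)) / (s * s))) (at x)"
      using s by (intro DERIV_cmult DERIV_divide[OF DERIV_ident d, folded s_def]) auto
    moreover have "(1 * s - x * (x / s)) / (s * s) = 1 / s ^ 3"
    proof -
      have "s * s - x * x = 1" using s by (simp add: power2_eq_square)
      then show ?thesis using s(1) by (simp add: field_simps power3_eq_cube)
    qed
    ultimately show "((\<lambda>x. pi / 2 * (x / sqrt (1 + x\<^sup>2))) has_real_derivative pi / 2 * (1 / sqrt (1 + x\<^sup>2) ^ 3)) (at x)"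
      unfolding s_def by (simp only:)
  next
    show "((\<lambda>x. pi / 2 * (x / sqrt (1 + x\<^sup>2))) \<longlongrightarrow> pi / 2) at_top" by real_asymp
    show "((\<lambda>x. pi / 2 * (x / sqrt (1 + x\<^sup>2))) \<longlongrightarrow> - (pi / 2)) at_bot" by real_asymp
  qed (auto intro!: mult_nonneg_nonneg)
  finally show ?thesis by simp
qed

section \<open>Real partial derivatives and the vanishing of their integrals\<close>

definition has_partials :: "(complex \<Rightarrow> complex) \<Rightarrow> (complex \<Rightarrow> complex) \<Rightarrow> (complex \<Rightarrow> complex) \<Rightarrow> bool" where
  "has_partials f fx fy \<longleftrightarrow>
     (\<forall>z. (f has_derivative (\<lambda>w. of_real (Re w) * fx z + of_real (Im w) * fy z)) (at z))"

lemma has_partials_dzbar: "has_partials f fx fy \<Longrightarrow> dzbar f z = (fx z + \<i> * fy z) / 2"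
  and has_partials_dz: "has_partials f fx fy \<Longrightarrow> dz f z = (fx z - \<i> * fy z) / 2"
proof -
  assume "has_partials f fx fy"
  then have "frechet_derivative f (at z) = (\<lambda>w. of_real (Re w) * fx z + of_real (Im w) * fy z)"
    by (auto simp: has_partials_def intro: frechet_derivative_at[symmetric])
  then show "dzbar f z = (fx z + \<i> * fy z) / 2" "dz f z = (fx z - \<i> * fy z) / 2"
    by (simp_all add: dzbar_def dz_def)
qed

lemma has_partials_continuous: "has_partials f fx fy \<Longrightarrow> continuous_on UNIV f"
  unfolding has_partials_def
  by (meson continuous_at_imp_continuous_on has_derivative_continuous)

lemma has_partials_mult:
  assumes "has_partials f fx fy" "has_partials g gx gy"
  shows "has_partials (\<lambda>z. f z * g z) (\<lambda>z. fx z * g z + f z * gx z) (\<lambda>z. fy z * g z + f z * gy z)"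
  unfolding has_partials_def
proof
  fix z
  have "((\<lambda>z. f z * g z) has_derivative (\<lambda>w. f z * (of_real (Re w) * gx z + of_real (Im w) * gy z)
      + (of_real (Re w) * fx z + of_real (Im w) * fy z) * g z)) (at z)"
    using assms unfolding has_partials_def by (intro has_derivative_mult) auto
  then show "((\<lambda>z. f z * g z) has_derivative (\<lambda>w. of_real (Re w) * (fx z * g z + f z * gx z)
      + of_real (Im w) * (fy z * g z + f z * gy z))) (at z)"
    by (simp add: algebra_simps)
qed

lemma integral_line_derivative:
  fixes g g' :: "real \<Rightarrow> complex"
  assumes g: "\<And>x. (g has_vector_derivative g' x) (at x)" and cont: "continuous_on UNIV g'"
    and int: "integrable lborel g'" and decay: "\<And>x. cmod (g x) \<le> C / (1 + \<bar>x\<bar>)"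
  shows "(LINT x|lborel. g' x) = 0"
proof -
  have lim1: "((\<lambda>x. C / (1 + \<bar>x\<bar>)) \<longlongrightarrow> 0) at_top" "((\<lambda>x. C / (1 + \<bar>x\<bar>)) \<longlongrightarrow> 0) at_bot"
    by real_asymp+
  have "(g \<longlongrightarrow> 0) at_top" "(g \<longlongrightarrow> 0) at_bot"
    using lim1 by (auto intro!: Lim_null_comparison[where g="\<lambda>x. C / (1 + \<bar>x\<bar>)"] decay always_eventually)
  then have "(LBINT x=-\<infinity>..\<infinity>. g' x) = 0 - 0"
    using g cont int by (intro interval_integral_FTC_integrable[where F=g])
      (auto simp: ereal_tendsto_simps set_integrable_def continuous_on_eq_continuous_at)
  then show ?thesis
    by (simp add: interval_lebesgue_integral_def set_lebesgue_integral_def)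
qed

text \<open>Fubini is applied with the direction of differentiation innermost. On almost every line
  the partial is integrable, and its integral is the difference of the limits of \<open>f\<close> at
  the two ends, which are 0 by the decay.\<close>

lemma integral_partials_zero:
  assumes pd: "has_partials f fx fy" and cont: "continuous_on UNIV fx" "continuous_on UNIV fy"
    and int: "integrable lborel fx" "integrable lborel fy"
    and decay: "\<And>z. cmod (f z) \<le> C / japanese z" and C: "0 \<le> C"
  shows "(LINT z|lborel. fx z) = 0" "(LINT z|lborel. fy z) = 0"
proof -
  have [measurable]: "fx \<in> borel_measurable borel" "fy \<in> borel_measurable borel"
    using cont by (auto intro: borel_measurable_continuous_onI)
  have dec: "cmod (f (Complex x y)) \<le> (2 * C) / (1 + \<bar>x\<bar>)" "cmod (f (Complex x y)) \<le> (2 * C) / (1 + \<bar>y\<bar>)" for x y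
  proof -
    have "C / japanese z \<le> (2 * C) / (1 + t)" if "0 \<le> t" "t \<le> cmod z" for z t
    proof -
      have "1 + t \<le> 2 * japanese z"
        using that cmod_le_japanese[of z] japanese_ge_1[of z] by linarith
      then have "C * (1 + t) \<le> C * (2 * japanese z)" using C by (rule mult_left_mono)
      then show ?thesis using that by (simp add: divide_simps mult_ac)
    qed
    from this[of "\<bar>x\<bar>" "Complex x y"] this[of "\<bar>y\<bar>" "Complex x y"] decay[of "Complex x y"]
    show "cmod (f (Complex x y)) \<le> (2 * C) / (1 + \<bar>x\<bar>)" "cmod (f (Complex x y)) \<le> (2 * C) / (1 + \<bar>y\<bar>)"
      using abs_Re_le_cmod[of "Complex x y"] abs_Im_le_cmod[of "Complex x y"] by auto
  qed
  have derx: "((\<lambda>x. f (Complex x y)) has_vector_derivative fx (Complex x y)) (at x)" for x y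
  proof -
    have "((\<lambda>x. Complex x y) has_derivative (\<lambda>h. of_real h)) (at x)"
      unfolding Complex_eq by (auto intro!: derivative_eq_intros)
    from has_derivative_compose[OF this, of f "\<lambda>w. of_real (Re w) * fx (Complex x y) + of_real (Im w) * fy (Complex x y)"]
    show ?thesis using pd
      by (simp add: has_partials_def has_vector_derivative_def scaleR_conv_of_real)
  qed
  have dery: "((\<lambda>y. f (Complex x y)) has_vector_derivative fy (Complex x y)) (at y)" for x y
  proof -
    have "((\<lambda>y. Complex x y) has_derivative (\<lambda>h. \<i> * of_real h)) (at y)"
      unfolding Complex_eq by (auto intro!: derivative_eq_intros)
    from has_derivative_compose[OF this, of f "\<lambda>w. of_real (Re w) * fx (Complex x y) + of_real (Im w) * fy (Complex x y)"]
    show ?thesis using pd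
      by (simp add: has_partials_def has_vector_derivative_def scaleR_conv_of_real)
  qed
  have cC: "continuous_on UNIV (\<lambda>x. Complex x y)" "continuous_on UNIV (\<lambda>y. Complex x y)" for x y
    unfolding Complex_eq by (intro continuous_intros)+
  have contx: "continuous_on UNIV (\<lambda>x. fx (Complex x y))" for y
    by (rule continuous_on_compose2[OF cont(1) cC(1)]) auto
  have conty: "continuous_on UNIV (\<lambda>y. fy (Complex x y))" for x
    by (rule continuous_on_compose2[OF cont(2) cC(2)]) auto
  note ix = integrable_complex_prod[OF int(1)] and iy = integrable_complex_prod[OF int(2)]
  have "(LINT z|lborel. fx z) = (LINT y|lborel. LINT x|lborel. fx (Complex x y))"
    using lborel_pair.integral_snd[OF ix] by (simp add: integral_complex_prod case_prod_unfold)
  also have "\<dots> = (LINT y|(lborel :: real measure). 0)"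
    using lborel_pair.AE_integrable_snd[OF ix]
    by (intro integral_cong_AE)
       (auto elim!: eventually_mono intro!: integral_line_derivative[OF derx contx _ dec(1)])
  finally show "(LINT z|lborel. fx z) = 0" by simp
  have "(LINT z|lborel. fy z) = (LINT x|lborel. LINT y|lborel. fy (Complex x y))"
    using lborel_pair.integral_fst[OF iy] by (simp add: integral_complex_prod case_prod_unfold)
  also have "\<dots> = (LINT x|(lborel :: real measure). 0)"
    using lborel_pair.AE_integrable_fst[OF iy]
    by (intro integral_cong_AE)
       (auto elim!: eventually_mono intro!: integral_line_derivative[OF dery conty _ dec(2)])
  finally show "(LINT z|lborel. fy z) = 0" by simp
qed

lemma integrable_japanese_bound:
  fixes f :: "complex \<Rightarrow> complex"
  assumes [measurable]: "f \<in> borel_measurable borel" and b: "2 < b"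
    and f: "\<And>y. cmod (f y) \<le> C * japanese y powr (- b)"
  shows "integrable lborel f"
proof (rule Bochner_Integration.integrable_bound)
  show "integrable lborel (\<lambda>y. C * japanese y powr (- b))"
    using nn_integral_japanese[OF b]
    by (intro integrable_mult_right integrableI_bounded) auto
  show "AE y in lborel. cmod (f y) \<le> norm (C * japanese y powr (- b))"
    using f by (auto intro: order_trans[OF _ abs_ge_self])
qed auto

lemma integrable_potential_bound:
  fixes f :: "complex \<Rightarrow> complex"
  assumes [measurable]: "f \<in> borel_measurable borel" and b: "1 < b"
    and f: "\<And>y. cmod (f y) \<le> C * (japanese y powr (- b) / cmod (z - y))"
  shows "integrable lborel f"
proof (rule Bochner_Integration.integrable_bound)
  obtain B where B: "(\<integral>\<^sup>+y. ennreal (japanese y powr (- b) / cmod (z - y)) \<partial>lborel) \<le> ennreal B"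
    using potential_bound[OF b] by auto
  then have "(\<integral>\<^sup>+y. ennreal (japanese y powr (- b) / cmod (z - y)) \<partial>lborel) < \<infinity>"
    using le_less_trans[OF _ ennreal_less_top] by simp
  then show "integrable lborel (\<lambda>y. C * (japanese y powr (- b) / cmod (z - y)))"
    by (intro integrable_mult_right integrableI_bounded) auto
  show "AE y in lborel. cmod (f y) \<le> norm (C * (japanese y powr (- b) / cmod (z - y)))"
    unfolding real_norm_def by (intro AE_I2 order_trans[OF f abs_ge_self])
qed auto

text \<open>For t = 0 this is 1/(z - y). Adding \<open>t\<close> to the denominator makes the kernel
  smooth in y, so integration by parts needs no excised disc and no boundary integral.\<close>

definition reg_kernel :: "real \<Rightarrow> complex \<Rightarrow> complex \<Rightarrow> complex" where
  "reg_kernel t z y = cnj (z - y) / of_real ((cmod (z - y))\<^sup>2 + t)"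

lemma has_partials_reg_kernel:
  fixes t :: real and z :: complex
  assumes t: "0 < t"
  defines "D \<equiv> \<lambda>y. complex_of_real ((cmod (z - y))\<^sup>2 + t)"
  shows "has_partials (reg_kernel t z)
    (\<lambda>y. - 1 / D y + 2 * of_real (Re (z - y)) * cnj (z - y) / (D y)\<^sup>2)
    (\<lambda>y. \<i> / D y + 2 * of_real (Im (z - y)) * cnj (z - y) / (D y)\<^sup>2)"
  unfolding has_partials_def
proof
  fix y
  have D: "D y = (z - y) * cnj (z - y) + of_real t" for y
    by (simp only: D_def of_real_add complex_norm_square)
  have nz: "D y \<noteq> 0"
    unfolding D_def of_real_eq_0_iff using t by (simp add: add_nonneg_pos less_imp_neq[symmetric])
  have 1: "((\<lambda>y. cnj (z - y)) has_derivative (\<lambda>w. - cnj w)) (at y)"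
    by (auto intro!: derivative_eq_intros bounded_linear.has_derivative[OF bounded_linear_cnj])
  have 2: "(D has_derivative (\<lambda>w. (z - y) * - cnj w + - w * cnj (z - y))) (at y)"
    unfolding D[abs_def] by (auto intro!: derivative_eq_intros bounded_linear.has_derivative[OF bounded_linear_cnj])
  have 3: "(reg_kernel t z has_derivative
      (\<lambda>w. - cnj (z - y) * (inverse (D y) * ((z - y) * - cnj w + - w * cnj (z - y)) * inverse (D y)) + - cnj w / D y)) (at y)"
    using has_derivative_divide[OF 1 2 nz] by (simp add: reg_kernel_def[abs_def] D_def)
  have eq: "- cnj (z - y) * (inverse (D y) * ((z - y) * - cnj w + - w * cnj (z - y)) * inverse (D y)) + - cnj w / D y
    = of_real (Re w) * (- 1 / D y + 2 * of_real (Re (z - y)) * cnj (z - y) / (D y)\<^sup>2)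
    + of_real (Im w) * (\<i> / D y + 2 * of_real (Im (z - y)) * cnj (z - y) / (D y)\<^sup>2)" for w
  proof -
    have a: "(z - y) * - cnj w + - w * cnj (z - y)
       = - 2 * (of_real (Re w) * of_real (Re (z - y)) + of_real (Im w) * of_real (Im (z - y)))"
      by (auto simp: complex_eq_iff algebra_simps)
    have b: "- cnj w = - of_real (Re w) + \<i> * of_real (Im w)"
      by (auto simp: complex_eq_iff)
    have alg: "- c * (inverse d * (- 2 * (r * p + m * q)) * inverse d) + (- r + \<i> * m) / d
       = r * (- 1 / d + 2 * p * c / d\<^sup>2) + m * (\<i> / d + 2 * q * c / d\<^sup>2)"
      if "d \<noteq> 0" for c d r m p q :: complex
      using that by (simp add: divide_simps power2_eq_square) (simp add: algebra_simps)
    show ?thesis by (subst a, subst b, rule alg[OF nz])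
  qed
  show "(reg_kernel t z has_derivative
      (\<lambda>w. of_real (Re w) * (- 1 / D y + 2 * of_real (Re (z - y)) * cnj (z - y) / (D y)\<^sup>2)
        + of_real (Im w) * (\<i> / D y + 2 * of_real (Im (z - y)) * cnj (z - y) / (D y)\<^sup>2))) (at y)"
    using 3 unfolding eq .
qed

text \<open>The substitution y = z + sqrt(t) y' turns the kernels into a single integrable one of
  mass pi and moves the parameter into the argument of \<open>f\<close>, where continuity and
  boundedness allow dominated convergence.\<close>

lemma integral_scaled_kernel:
  fixes f :: "complex \<Rightarrow> complex"
  assumes cont: "continuous_on UNIV f" and bd: "\<And>y. cmod (f y) \<le> C"
    and t: "\<And>n. 0 < t n" "t \<longlonglongrightarrow> 0"
  shows "(\<lambda>n. LINT y|lborel. f y * of_real (t n / ((cmod (z - y))\<^sup>2 + t n)\<^sup>2)) \<longlonglongrightarrow> of_real pi * f z"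
proof -
  have [measurable]: "f \<in> borel_measurable borel"
    using cont by (rule borel_measurable_continuous_onI)
  let ?k = "\<lambda>y::complex. 1 / (1 + (cmod y)\<^sup>2)\<^sup>2"
  have k: "integrable lborel ?k"
    by (rule integrableI_bounded) (simp_all add: nn_integral_japanese_4)
  have kpi: "(LINT y|lborel. ?k y) = pi"
    by (rule integral_eq_nn_integral[THEN trans]) (simp_all add: nn_integral_japanese_4)
  have eq: "(LINT y|lborel. f y * of_real (t n / ((cmod (z - y))\<^sup>2 + t n)\<^sup>2))
      = (LINT y|lborel. f (z + sqrt (t n) *\<^sub>R y) * of_real (?k y))" for n
  proof -
    have "(LINT y|lborel. f y * of_real (t n / ((cmod (z - y))\<^sup>2 + t n)\<^sup>2))
      = of_real ((sqrt (t n))\<^sup>2) * (LINT y|lborel. f (z + sqrt (t n) *\<^sub>R y)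
          * of_real (t n / ((cmod (z - (z + sqrt (t n) *\<^sub>R y)))\<^sup>2 + t n)\<^sup>2))"
      using t(1)[of n] by (intro integral_complex_affine) auto
    also have "\<dots> = (LINT y|lborel. of_real ((sqrt (t n))\<^sup>2) * (f (z + sqrt (t n) *\<^sub>R y)
          * of_real (t n / ((cmod (z - (z + sqrt (t n) *\<^sub>R y)))\<^sup>2 + t n)\<^sup>2)))"
      by (rule integral_mult_right_zero[symmetric])
    also have "\<dots> = (LINT y|lborel. f (z + sqrt (t n) *\<^sub>R y) * of_real (?k y))"
    proof (intro Bochner_Integration.integral_cong refl)
      fix y :: complex
      have "(cmod (z - (z + sqrt (t n) *\<^sub>R y)))\<^sup>2 + t n = t n * (1 + (cmod y)\<^sup>2)"
        using t(1)[of n] by (simp add: power_mult_distrib algebra_simps)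
      then have "(sqrt (t n))\<^sup>2 * (t n / ((cmod (z - (z + sqrt (t n) *\<^sub>R y)))\<^sup>2 + t n)\<^sup>2) = ?k y"
        using t(1)[of n] by (simp add: power_mult_distrib power2_eq_square[of "t n"])
      then show "of_real ((sqrt (t n))\<^sup>2) * (f (z + sqrt (t n) *\<^sub>R y)
          * of_real (t n / ((cmod (z - (z + sqrt (t n) *\<^sub>R y)))\<^sup>2 + t n)\<^sup>2)) = f (z + sqrt (t n) *\<^sub>R y) * of_real (?k y)"
        unfolding mult.left_commute[of "of_real _" "f _"] of_real_mult[symmetric] by simp
    qed
    finally show ?thesis .
  qed
  have "(\<lambda>n. LINT y|lborel. f (z + sqrt (t n) *\<^sub>R y) * of_real (?k y)) \<longlonglongrightarrow> (LINT y|lborel. f z * of_real (?k y))"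
  proof (rule integral_dominated_convergence)
    show "integrable lborel (\<lambda>y. C * ?k y)" by (rule integrable_mult_right[OF k])
    show "AE y in lborel. (\<lambda>n. f (z + sqrt (t n) *\<^sub>R y) * of_real (?k y)) \<longlonglongrightarrow> f z * of_real (?k y)"
    proof (intro AE_I2 tendsto_mult tendsto_const)
      fix y
      have "(\<lambda>n. sqrt (t n)) \<longlonglongrightarrow> sqrt 0" using t(2) by (intro tendsto_intros)
      then have "(\<lambda>n. z + sqrt (t n) *\<^sub>R y) \<longlonglongrightarrow> z + sqrt 0 *\<^sub>R y"
        by (intro tendsto_add tendsto_scaleR tendsto_const)
      then have "(\<lambda>n. f (z + sqrt (t n) *\<^sub>R y)) \<longlonglongrightarrow> f (z + sqrt 0 *\<^sub>R y)"
        by (rule continuous_on_tendsto_compose[OF cont]) auto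
      then show "(\<lambda>n. f (z + sqrt (t n) *\<^sub>R y)) \<longlonglongrightarrow> f z" by simp
    qed
    show "AE y in lborel. cmod (f (z + sqrt (t n) *\<^sub>R y) * of_real (?k y)) \<le> C * ?k y" for n
      unfolding norm_mult norm_of_real
      by (intro AE_I2 mult_mono bd) (auto intro: order_trans[OF norm_ge_zero bd])
  qed auto
  also have "(LINT y|lborel. f z * of_real (?k y)) = of_real pi * f z"
    using kpi by (simp del: of_real_divide)
  finally show ?thesis unfolding eq .
qed

text \<open>A Peetre-type comparison between weights centred at 0 and at z. The constant blows up as
  t \<rightarrow> 0, which is harmless because it only serves integrability for fixed t.\<close>

lemma japanese_le_regularized:
  assumes t: "0 < t"
  shows "(japanese y)\<^sup>2 \<le> (2 * (japanese z)\<^sup>2 / t + 2) * ((cmod (z - y))\<^sup>2 + t)"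
proof -
  define u where "u = (cmod (z - y))\<^sup>2"
  have u: "0 \<le> u" by (simp add: u_def)
  have "japanese y \<le> japanese z + cmod (z - y)"
    using japanese_triangle[of z "y - z"] by (simp add: norm_minus_commute)
  then have "(japanese y)\<^sup>2 \<le> (japanese z + cmod (z - y))\<^sup>2"
    by (intro power_mono) auto
  also have "\<dots> \<le> 2 * (japanese z)\<^sup>2 + 2 * u"
    using sum_squares_bound[of "japanese z" "cmod (z - y)"] by (simp add: power2_sum u_def)
  also have "\<dots> \<le> (2 * (japanese z)\<^sup>2 / t + 2) * (u + t)"
  proof -
    have "(2 * (japanese z)\<^sup>2 / t + 2) * (u + t)
       = 2 * (japanese z)\<^sup>2 + 2 * u + (2 * t + 2 * (japanese z)\<^sup>2 / t * u)"
      using t by (simp add: field_simps)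
    moreover have "0 \<le> 2 * t + 2 * (japanese z)\<^sup>2 / t * u"
      using t u by (intro add_nonneg_nonneg mult_nonneg_nonneg divide_nonneg_pos) auto
    ultimately show ?thesis by linarith
  qed
  finally show ?thesis by (simp add: u_def)
qed

lemma inverse_regularized_le:
  assumes t: "0 < t"
  shows "1 / ((cmod (z - y))\<^sup>2 + t) \<le> (2 * (japanese z)\<^sup>2 / t + 2) / (japanese y)\<^sup>2"
proof -
  have "0 < (cmod (z - y))\<^sup>2 + t" using t by (simp add: add_nonneg_pos)
  then show ?thesis
    using japanese_le_regularized[OF t, of y z] by (simp add: divide_simps mult.commute)
qed

lemma norm_reg_kernel_le:
  assumes t: "0 < t"
  shows "cmod (reg_kernel t z y) \<le> sqrt (2 * (japanese z)\<^sup>2 / t + 2) / japanese y"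
proof -
  define D where "D = (cmod (z - y))\<^sup>2 + t"
  have D0: "0 < D" using t by (simp add: D_def add_nonneg_pos)
  have "cmod (z - y) \<le> sqrt D" using t by (intro real_le_rsqrt) (simp add: D_def)
  then have "cmod (reg_kernel t z y) \<le> sqrt D / D"
    using D0 unfolding reg_kernel_def D_def[symmetric]
    by (simp add: norm_divide divide_right_mono del: complex_cnj_diff)
  also have "\<dots> = sqrt (1 / D)" using D0 by (simp add: real_sqrt_divide real_div_sqrt divide_simps)
  also have "\<dots> \<le> sqrt ((2 * (japanese z)\<^sup>2 / t + 2) / (japanese y)\<^sup>2)"
    unfolding D_def by (intro real_sqrt_le_mono inverse_regularized_le t)
  finally show ?thesis by (simp add: real_sqrt_divide)
qed

text \<open>With D = |u|^2 + t and u = z - y, differentiating numerator and denominator leaves -(D -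
  |u|^2)/D^2 = -t/D^2, a multiple of an approximate delta.\<close>

lemma reg_kernel_dbar:
  assumes t: "0 < t"
  shows "(- 1 / of_real ((cmod u)\<^sup>2 + t) + 2 * of_real (Re u) * cnj u / (of_real ((cmod u)\<^sup>2 + t))\<^sup>2
     + \<i> * (\<i> / of_real ((cmod u)\<^sup>2 + t) + 2 * of_real (Im u) * cnj u / (of_real ((cmod u)\<^sup>2 + t))\<^sup>2)) / 2
    = - complex_of_real (t / ((cmod u)\<^sup>2 + t)\<^sup>2)"
proof -
  define d where "d = complex_of_real ((cmod u)\<^sup>2 + t)"
  have d0: "d \<noteq> 0"
    unfolding d_def of_real_eq_0_iff using t by (simp add: add_nonneg_pos less_imp_neq[symmetric])
  have alg: "(- 1 / d + 2 * r * c / d\<^sup>2 + \<i> * (\<i> / d + 2 * m * c / d\<^sup>2)) / 2 = - ((d - (r + \<i> * m) * c) / d\<^sup>2)" for r m c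
    using d0 by (simp add: divide_simps power2_eq_square) (simp add: algebra_simps)
  have "(of_real (Re u) + \<i> * of_real (Im u)) * cnj u = complex_of_real ((cmod u)\<^sup>2)"
    unfolding complex_eq[symmetric] complex_norm_square ..
  then have "d - (of_real (Re u) + \<i> * of_real (Im u)) * cnj u = of_real t" by (simp add: d_def)
  then show ?thesis unfolding d_def[symmetric] alg by (simp add: d_def)
qed

text \<open>The integral of dbar(f k) vanishes for the regularised kernel k, so dbar f paired with k
  equals f paired with an approximate identity of mass pi. As t \<rightarrow> 0 the first pairing is
  dominated by |dbar f| / |z - y| and the second tends to pi f(z).\<close>

theorem cauchy_pompeiu:
  assumes pd: "has_partials f fx fy"
    and cont: "continuous_on UNIV fx" "continuous_on UNIV fy"
    and C: "0 \<le> C" and bd: "\<And>y. cmod (f y) \<le> C / japanese y"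
    and bdx: "\<And>y. cmod (fx y) \<le> C / (japanese y)\<^sup>2" and bdy: "\<And>y. cmod (fy y) \<le> C / (japanese y)\<^sup>2"
  shows "integrable lborel (\<lambda>y. (fx y + \<i> * fy y) / 2 / (z - y))"
    and "(LINT y|lborel. (fx y + \<i> * fy y) / 2 / (z - y)) = of_real pi * f z"
proof -
  have contf: "continuous_on UNIV f" by (rule has_partials_continuous[OF pd])
  have [measurable]: "f \<in> borel_measurable borel" "fx \<in> borel_measurable borel" "fy \<in> borel_measurable borel"
    using cont contf by (auto intro: borel_measurable_continuous_onI)
  define db where "db y = (fx y + \<i> * fy y) / 2" for y
  have [measurable]: "db \<in> borel_measurable borel" unfolding db_def[abs_def] by measurable
  have db: "cmod (db y) \<le> C / (japanese y)\<^sup>2" for y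
  proof -
    have "cmod (fx y + \<i> * fy y) \<le> C / (japanese y)\<^sup>2 + C / (japanese y)\<^sup>2"
      using norm_triangle_ineq[of "fx y" "\<i> * fy y"] bdx[of y] bdy[of y] by (simp add: norm_mult)
    then show ?thesis by (simp add: db_def norm_divide mult.commute)
  qed
  have jp: "japanese y powr (- 2) = 1 / (japanese y)\<^sup>2" for y
    by (simp add: powr_minus_divide)
  have int: "integrable lborel (\<lambda>y. db y / (z - y))"
  proof (rule integrable_potential_bound)
    show "cmod (db y / (z - y)) \<le> C * (japanese y powr (- 2) / cmod (z - y))" for y
      using divide_right_mono[OF db, of "cmod (z - y)" y] by (simp add: norm_divide jp)
  qed auto
  then show "integrable lborel (\<lambda>y. (fx y + \<i> * fy y) / 2 / (z - y))" by (simp add: db_def)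
  define T :: "nat \<Rightarrow> real" where "T n = 1 / (real n + 1)" for n
  have T: "0 < T n" for n by (simp add: T_def add_nonneg_pos)
  have Tlim: "T \<longlonglongrightarrow> 0" unfolding T_def by real_asymp
  have main: "(LINT y|lborel. db y * reg_kernel (T n) z y)
     = (LINT y|lborel. f y * of_real (T n / ((cmod (z - y))\<^sup>2 + T n)\<^sup>2))" for n
  proof -
    define t where "t = T n"
    have t: "0 < t" by (simp add: t_def T)
    define D where "D y = (cmod (z - y))\<^sup>2 + t" for y
    define kx where "kx y = - 1 / of_real (D y) + 2 * of_real (Re (z - y)) * cnj (z - y) / (of_real (D y))\<^sup>2" for y
    define ky where "ky y = \<i> / of_real (D y) + 2 * of_real (Im (z - y)) * cnj (z - y) / (of_real (D y))\<^sup>2" for y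
    have D0: "0 < D y" for y using t by (simp add: D_def add_nonneg_pos)
    have pk: "has_partials (reg_kernel t z) kx ky"
      using has_partials_reg_kernel[OF t, of z] unfolding kx_def[abs_def] ky_def[abs_def] D_def .
    define G where "G = 2 * (japanese z)\<^sup>2 / t + 2"
    have G: "0 < G" using t by (simp add: G_def add_nonneg_pos)
    have DG: "1 / D y \<le> G / (japanese y)\<^sup>2" for y
      unfolding D_def G_def by (rule inverse_regularized_le[OF t])
    have kb: "cmod (reg_kernel t z y) \<le> sqrt G / japanese y" for y
      unfolding G_def by (rule norm_reg_kernel_le[OF t])
    have kxy: "cmod (kx y) \<le> 3 * G / (japanese y)\<^sup>2" "cmod (ky y) \<le> 3 * G / (japanese y)\<^sup>2" for y
    proof -
      have *: "cmod (a / of_real (D y) + 2 * of_real r * cnj (z - y) / (of_real (D y))\<^sup>2) \<le> 3 * G / (japanese y)\<^sup>2"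
        if "cmod a = 1" "\<bar>r\<bar> \<le> cmod (z - y)" for a r
      proof -
        have "\<bar>r\<bar> * cmod (z - y) \<le> D y"
          using mult_right_mono[OF that(2), of "cmod (z - y)"] t by (simp add: D_def power2_eq_square)
        then have "2 * \<bar>r\<bar> * cmod (z - y) / (D y)\<^sup>2 \<le> 2 * D y / (D y)\<^sup>2"
          by (intro divide_right_mono) auto
        moreover have "2 * D y / (D y)\<^sup>2 = 2 * (1 / D y)" using D0[of y] by (simp add: power2_eq_square)
        moreover have "cmod (a / of_real (D y) + 2 * of_real r * cnj (z - y) / (of_real (D y))\<^sup>2)
           \<le> 1 / D y + 2 * \<bar>r\<bar> * cmod (z - y) / (D y)\<^sup>2"
          using norm_triangle_ineq[of "a / of_real (D y)" "2 * of_real r * cnj (z - y) / (of_real (D y))\<^sup>2"] that(1) D0[of y]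
          by (simp add: norm_divide norm_mult norm_power del: complex_cnj_diff)
        ultimately show ?thesis using DG[of y] by simp
      qed
      show "cmod (kx y) \<le> 3 * G / (japanese y)\<^sup>2" "cmod (ky y) \<le> 3 * G / (japanese y)\<^sup>2"
        unfolding kx_def ky_def by (intro *; simp add: abs_Re_le_cmod abs_Im_le_cmod del: minus_complex.sel)+
    qed
    have ck: "continuous_on UNIV (reg_kernel t z)" by (rule has_partials_continuous[OF pk])
    have ckx: "continuous_on UNIV kx" "continuous_on UNIV ky"
      using D0 unfolding kx_def[abs_def] ky_def[abs_def] D_def
      by (auto intro!: continuous_intros simp del: of_real_add simp: less_imp_neq[symmetric])
    have [measurable]: "reg_kernel t z \<in> borel_measurable borel" "kx \<in> borel_measurable borel" "ky \<in> borel_measurable borel"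
      using ck ckx by (auto intro: borel_measurable_continuous_onI)
    define px where "px y = fx y * reg_kernel t z y + f y * kx y" for y
    define py where "py y = fy y * reg_kernel t z y + f y * ky y" for y
    have pp: "has_partials (\<lambda>y. f y * reg_kernel t z y) px py"
      using has_partials_mult[OF pd pk] unfolding px_def[abs_def] py_def[abs_def] .
    have jp3: "japanese y powr (- 3) = 1 / (japanese y) ^ 3" for y
      by (simp add: powr_minus_divide)
    \<comment> \<open>One power of decay from the kernel and two from the derivative of
      \<open>f\<close>, or the other way round, give exponent 3, above the integrability threshold
      2.\<close>
    have bnd: "cmod (a * reg_kernel t z y + f y * b) \<le> (C * sqrt G + C * (3 * G)) * japanese y powr (- 3)"
      if "cmod a \<le> C / (japanese y)\<^sup>2" "cmod b \<le> 3 * G / (japanese y)\<^sup>2" for a b y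
    proof -
      have "cmod (a * reg_kernel t z y + f y * b) \<le> cmod a * cmod (reg_kernel t z y) + cmod (f y) * cmod b"
        by (metis norm_mult norm_triangle_ineq)
      also have "\<dots> \<le> (C / (japanese y)\<^sup>2) * (sqrt G / japanese y) + (C / japanese y) * (3 * G / (japanese y)\<^sup>2)"
        using that kb[of y] bd[of y] C G by (intro add_mono mult_mono) auto
      also have "\<dots> = (C * sqrt G + C * (3 * G)) * japanese y powr (- 3)"
        unfolding jp3 by (simp add: divide_simps power2_eq_square power3_eq_cube)
      finally show ?thesis .
    qed
    have [measurable]: "px \<in> borel_measurable borel" "py \<in> borel_measurable borel"
      unfolding px_def[abs_def] py_def[abs_def] by measurable
    have ip: "integrable lborel px" "integrable lborel py"
      using bnd[OF bdx kxy(1)] bnd[OF bdy kxy(2)]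
      by (auto intro!: integrable_japanese_bound[where b=3] simp: px_def py_def)
    have cp: "continuous_on UNIV px" "continuous_on UNIV py"
      unfolding px_def[abs_def] py_def[abs_def] by (intro continuous_intros cont contf ck ckx)+
    have dec: "cmod (f y * reg_kernel t z y) \<le> (C * sqrt G) / japanese y" for y
    proof -
      have "cmod (f y * reg_kernel t z y) \<le> (C / japanese y) * (sqrt G / japanese y)"
        unfolding norm_mult using bd[of y] kb[of y] C by (intro mult_mono) auto
      also have "\<dots> \<le> (C / 1) * (sqrt G / japanese y)"
        using C G japanese_ge_1[of y] by (intro mult_right_mono divide_left_mono) auto
      finally show ?thesis by simp
    qed
    note zero = integral_partials_zero[OF pp cp ip dec]
    have CG: "0 \<le> C * sqrt G" using C G by simp
    have "(LINT y|lborel. (px y + \<i> * py y) / 2) = 0"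
      using zero[OF CG] ip by simp
    moreover have "(px y + \<i> * py y) / 2 = db y * reg_kernel t z y - f y * of_real (t / (D y)\<^sup>2)" for y
    proof -
      have "(px y + \<i> * py y) / 2 = db y * reg_kernel t z y + f y * ((kx y + \<i> * ky y) / 2)"
        by (simp add: px_def py_def db_def field_simps)
      also have "(kx y + \<i> * ky y) / 2 = - of_real (t / (D y)\<^sup>2)"
        unfolding kx_def ky_def D_def by (rule reg_kernel_dbar[OF t])
      finally show ?thesis by simp
    qed
    ultimately have z0: "(LINT y|lborel. db y * reg_kernel t z y - f y * of_real (t / (D y)\<^sup>2)) = 0" by simp
    have i1: "integrable lborel (\<lambda>y. db y * reg_kernel t z y)"
    proof (rule integrable_japanese_bound)
      show "cmod (db y * reg_kernel t z y) \<le> (C * sqrt G) * japanese y powr (- 3)" for y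
      proof -
        have "cmod (db y * reg_kernel t z y) \<le> (C / (japanese y)\<^sup>2) * (sqrt G / japanese y)"
          unfolding norm_mult using db[of y] kb[of y] C by (intro mult_mono) auto
        then show ?thesis unfolding jp3 by (simp add: power2_eq_square power3_eq_cube)
      qed
    qed auto
    have i2: "integrable lborel (\<lambda>y. f y * of_real (t / (D y)\<^sup>2))"
    proof (rule integrable_japanese_bound)
      show "(\<lambda>y. f y * of_real (t / (D y)\<^sup>2)) \<in> borel_measurable borel" unfolding D_def by measurable
      show "cmod (f y * of_real (t / (D y)\<^sup>2)) \<le> (C * G) * japanese y powr (- 3)" for y
      proof -
        have "t / (D y)\<^sup>2 \<le> D y / (D y)\<^sup>2" by (intro divide_right_mono) (auto simp: D_def)
        also have "\<dots> = 1 / D y" using D0[of y] by (simp add: power2_eq_square)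
        also have "\<dots> \<le> G / (japanese y)\<^sup>2" by (rule DG)
        finally have "cmod (f y * of_real (t / (D y)\<^sup>2)) \<le> (C / japanese y) * (G / (japanese y)\<^sup>2)"
          using t bd[of y] C unfolding norm_mult norm_of_real by (intro mult_mono) auto
        then show ?thesis unfolding jp3 by (simp add: power2_eq_square power3_eq_cube)
      qed
    qed auto
    show ?thesis using z0 i1 i2 unfolding D_def t_def by simp
  qed
  have "(\<lambda>n. LINT y|lborel. db y * reg_kernel (T n) z y) \<longlonglongrightarrow> (LINT y|lborel. db y / (z - y))"
  proof (rule integral_dominated_convergence)
    show "(\<lambda>y. db y * reg_kernel (T n) z y) \<in> borel_measurable lborel" for n
    proof -
      have [measurable]: "reg_kernel (T n) z \<in> borel_measurable borel"
        by (rule borel_measurable_continuous_onI has_partials_continuous has_partials_reg_kernel T)+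
      show ?thesis by measurable
    qed
    show "integrable lborel (\<lambda>y. cmod (db y / (z - y)))" using int by (rule integrable_norm)
    show "AE y in lborel. (\<lambda>n. db y * reg_kernel (T n) z y) \<longlonglongrightarrow> db y / (z - y)"
    proof (intro AE_I2)
      fix y
      show "(\<lambda>n. db y * reg_kernel (T n) z y) \<longlonglongrightarrow> db y / (z - y)"
      proof (cases "y = z")
        case False
        then have nz: "(cmod (z - y))\<^sup>2 \<noteq> 0" by simp
        have "(\<lambda>n. db y * (cnj (z - y) / of_real ((cmod (z - y))\<^sup>2 + T n)))
          \<longlonglongrightarrow> db y * (cnj (z - y) / of_real ((cmod (z - y))\<^sup>2 + 0))"
          using nz by (intro tendsto_intros Tlim) auto
        also have "db y * (cnj (z - y) / of_real ((cmod (z - y))\<^sup>2 + 0)) = db y / (z - y)"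
          using False unfolding add_0_right complex_norm_square by (simp del: complex_cnj_diff)
        finally show ?thesis unfolding reg_kernel_def .
      qed (simp add: reg_kernel_def)
    qed
    show "AE y in lborel. cmod (db y * reg_kernel (T n) z y) \<le> cmod (db y / (z - y))" for n
    proof (intro AE_I2)
      fix y
      \<comment> \<open>At y = z both sides are 0 by the convention on division by zero.\<close>
      have "cmod (reg_kernel (T n) z y) \<le> 1 / cmod (z - y)"
      proof (cases "y = z")
        case False
        have "cmod (reg_kernel (T n) z y) = cmod (z - y) / ((cmod (z - y))\<^sup>2 + T n)"
          unfolding reg_kernel_def using T[of n] by (simp add: norm_divide abs_of_nonneg del: complex_cnj_diff of_real_add)
        also have "\<dots> \<le> cmod (z - y) / (cmod (z - y))\<^sup>2"
          using False T[of n] by (intro divide_left_mono) (auto intro!: mult_pos_pos add_nonneg_pos)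
        finally show ?thesis using False by (simp add: power2_eq_square)
      qed (simp add: reg_kernel_def)
      then show "cmod (db y * reg_kernel (T n) z y) \<le> cmod (db y / (z - y))"
        using mult_left_mono[OF _ norm_ge_zero[of "db y"], of "cmod (reg_kernel (T n) z y)" "1 / cmod (z - y)"]
        by (simp add: norm_mult norm_divide)
    qed
  qed auto
  moreover have "(\<lambda>n. LINT y|lborel. db y * reg_kernel (T n) z y) \<longlonglongrightarrow> of_real pi * f z"
    unfolding main
  proof (rule integral_scaled_kernel[OF contf _ T Tlim])
    show "cmod (f y) \<le> C" for y
      using bd[of y] C japanese_ge_1[of y] divide_left_mono[of 1 "japanese y" C] by simp
  qed
  ultimately show "(LINT y|lborel. (fx y + \<i> * fy y) / 2 / (z - y)) = of_real pi * f z"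
    using LIMSEQ_unique unfolding db_def by blast
qed

section \<open>Oscillatory kernels\<close>

text \<open>The exponent is the real inner product of y and \<zeta>, so this is the character of
  frequency \<zeta>. It serves at once for the phases of the operators and for the Fourier
  transform.\<close>

definition ephase :: "complex \<Rightarrow> complex \<Rightarrow> complex" where
  "ephase \<zeta> y = exp (\<i> * of_real (Re (y * cnj \<zeta>)))"

lemma norm_ephase [simp]: "cmod (ephase \<zeta> y) = 1"
  by (simp add: ephase_def)

lemma cnj_ephase: "cnj (ephase \<zeta> y) = ephase (- \<zeta>) y"
  by (simp add: ephase_def exp_cnj algebra_simps)

lemma ephase_add: "ephase (\<zeta> + \<eta>) y = ephase \<zeta> y * ephase \<eta> y"
  by (simp add: ephase_def exp_add[symmetric] algebra_simps)

lemma continuous_ephase: "continuous_on UNIV (\<lambda>x. ephase (fst x) (snd x))"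
  unfolding ephase_def by (intro continuous_intros)

lemma measurable_ephase [measurable (raw)]:
  assumes "f \<in> borel_measurable M" "g \<in> borel_measurable M"
  shows "(\<lambda>x. ephase (f x) (g x)) \<in> borel_measurable M"
  using borel_measurable_continuous_Pair[OF assms continuous_ephase] by simp

lemma has_partials_ephase:
  "has_partials (ephase \<zeta>) (\<lambda>y. \<i> * of_real (Re \<zeta>) * ephase \<zeta> y) (\<lambda>y. \<i> * of_real (Im \<zeta>) * ephase \<zeta> y)"
  unfolding has_partials_def
proof
  fix z
  have 1: "((\<lambda>y. \<i> * complex_of_real (Re (y * cnj \<zeta>))) has_derivative (\<lambda>w. \<i> * of_real (Re (w * cnj \<zeta>)))) (at z)"
    by (auto intro!: derivative_eq_intros)
  have 2: "(exp has_derivative (*) (exp x)) (at x)" for x :: complex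
    using DERIV_exp[of x] by (simp add: has_field_derivative_def)
  show "(ephase \<zeta> has_derivative (\<lambda>w. of_real (Re w) * (\<i> * of_real (Re \<zeta>) * ephase \<zeta> z)
      + of_real (Im w) * (\<i> * of_real (Im \<zeta>) * ephase \<zeta> z))) (at z)"
    using has_derivative_compose[OF 1 2] unfolding ephase_def[abs_def]
    by (simp add: algebra_simps)
qed

text \<open>The smooth factor \<langle>y\<rangle>^(-2) split off from q. It is complex-valued so
  that it can be multiplied with the other factors of the kernel and differentiated with
  them.\<close>

definition jweight :: "complex \<Rightarrow> complex" where
  "jweight y = 1 / of_real ((japanese y)\<^sup>2)"

lemma norm_jweight: "cmod (jweight y) = japanese y powr (- 2)" "cmod (jweight y) = 1 / (japanese y)\<^sup>2"
  by (simp_all add: jweight_def norm_divide norm_power powr_minus_divide)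

lemma has_partials_jweight:
  "has_partials jweight (\<lambda>y. - 2 * of_real (Re y) * (jweight y)\<^sup>2) (\<lambda>y. - 2 * of_real (Im y) * (jweight y)\<^sup>2)"
  unfolding has_partials_def
proof
  fix y
  have D: "complex_of_real ((japanese y)\<^sup>2) = 1 + y * cnj y" for y
    unfolding japanese_squared of_real_add complex_norm_square by simp
  have nz: "1 + y * cnj y \<noteq> 0"
    unfolding D[symmetric] of_real_eq_0_iff by simp
  have "((\<lambda>y. 1 + y * cnj y) has_derivative (\<lambda>w. y * cnj w + w * cnj y)) (at y)"
    by (auto intro!: derivative_eq_intros bounded_linear.has_derivative[OF bounded_linear_cnj])
  from has_derivative_divide[OF has_derivative_const[of 1] this nz]
  have 1: "(jweight has_derivative
      (\<lambda>w. - 1 * (inverse (1 + y * cnj y) * (y * cnj w + w * cnj y) * inverse (1 + y * cnj y)) + 0 / (1 + y * cnj y))) (at y)"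
    unfolding jweight_def[abs_def] D .
  have "y * cnj w + w * cnj y = 2 * (of_real (Re w) * of_real (Re y) + of_real (Im w) * of_real (Im y))" for w
    by (auto simp: complex_eq_iff algebra_simps)
  then have "- 1 * (inverse (1 + y * cnj y) * (y * cnj w + w * cnj y) * inverse (1 + y * cnj y)) + 0 / (1 + y * cnj y)
    = of_real (Re w) * (- 2 * of_real (Re y) * (jweight y)\<^sup>2) + of_real (Im w) * (- 2 * of_real (Im y) * (jweight y)\<^sup>2)" for w
    unfolding jweight_def D using nz by (simp add: divide_simps power2_eq_square)
  with 1 show "(jweight has_derivative
      (\<lambda>w. of_real (Re w) * (- 2 * of_real (Re y) * (jweight y)\<^sup>2) + of_real (Im w) * (- 2 * of_real (Im y) * (jweight y)\<^sup>2))) (at y)"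
    by simp
qed

section \<open>The symmetric splitting of the double Cauchy kernel\<close>

definition sqd :: "complex \<Rightarrow> complex \<Rightarrow> complex \<Rightarrow> real" where
  "sqd x z y = (cmod (y - x))\<^sup>2 + (cmod (y - z))\<^sup>2"

lemma sqd_pos:
  assumes "x \<noteq> z"
  shows "0 < sqd x z y"
proof (cases "y = x")
  case True
  then show ?thesis using assms by (simp add: sqd_def)
next
  case False
  then show ?thesis by (simp add: sqd_def add_pos_nonneg)
qed

lemma sqd_bounds:
  shows "(cmod (z - x))\<^sup>2 \<le> 2 * sqd x z y" "(cmod (y - x))\<^sup>2 \<le> sqd x z y" "(cmod (y - z))\<^sup>2 \<le> sqd x z y"
proof -
  have "cmod (z - x) \<le> cmod (y - x) + cmod (y - z)"
    using norm_triangle_ineq[of "z - y" "y - x"] by (simp add: norm_minus_commute)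
  then have "(cmod (z - x))\<^sup>2 \<le> (cmod (y - x) + cmod (y - z))\<^sup>2"
    by (intro power_mono) auto
  also have "\<dots> \<le> 2 * sqd x z y"
    using sum_squares_bound[of "cmod (y - x)" "cmod (y - z)"] by (simp add: power2_sum sqd_def)
  finally show "(cmod (z - x))\<^sup>2 \<le> 2 * sqd x z y" .
qed (auto simp: sqd_def)

text \<open>Chosen so that \<open>1 / ((z - y) (cnj y - cnj x))\<close> is
  \<open>acoef x z y / (z - y)\<close> plus the conjugate of \<open>acoef z x y / (x - y)\<close>.\<close>

definition acoef :: "complex \<Rightarrow> complex \<Rightarrow> complex \<Rightarrow> complex" where
  "acoef x z y = (y - x) / of_real (sqd x z y)"

lemma has_partials_acoef:
  assumes xz: "x \<noteq> z"
  shows "has_partials (acoef x z)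
     (\<lambda>y. 1 / of_real (sqd x z y) - (y - x) * of_real (2 * Re ((y - x) + (y - z))) / (of_real (sqd x z y))\<^sup>2)
     (\<lambda>y. \<i> / of_real (sqd x z y) - (y - x) * of_real (2 * Im ((y - x) + (y - z))) / (of_real (sqd x z y))\<^sup>2)"
  unfolding has_partials_def
proof
  fix y
  have D: "complex_of_real (sqd x z y) = (y - x) * cnj (y - x) + (y - z) * cnj (y - z)" for y
    unfolding sqd_def of_real_add complex_norm_square ..
  have nz: "complex_of_real (sqd x z y) \<noteq> 0"
    using sqd_pos[OF xz, of y] by simp
  have 1: "((\<lambda>y. complex_of_real (sqd x z y)) has_derivative
     (\<lambda>w. (y - x) * cnj w + w * cnj (y - x) + ((y - z) * cnj w + w * cnj (y - z)))) (at y)"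
    unfolding D by (auto intro!: derivative_eq_intros bounded_linear.has_derivative[OF bounded_linear_cnj])
  have 2: "((\<lambda>y. y - x) has_derivative (\<lambda>w. w)) (at y)"
    by (auto intro!: derivative_eq_intros)
  note 3 = has_derivative_divide[OF 2 1 nz]
  have lin: "(y - x) * cnj w + w * cnj (y - x) + ((y - z) * cnj w + w * cnj (y - z))
     = of_real (Re w) * of_real (2 * Re ((y - x) + (y - z))) + of_real (Im w) * of_real (2 * Im ((y - x) + (y - z)))" for w
    by (auto simp: complex_eq_iff algebra_simps)
  have alg: "- u * (inverse d * (r * p + m * q) * inverse d) + (r + m * \<i>) / d
     = r * (1 / d - u * p / d\<^sup>2) + m * (\<i> / d - u * q / d\<^sup>2)" if "d \<noteq> 0" for u d r m p q :: complex
    using that by (simp add: divide_simps power2_eq_square) (simp add: algebra_simps)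
  have w: "w = of_real (Re w) + of_real (Im w) * \<i>" for w by (auto simp: complex_eq_iff)
  have eq: "- (y - x) * (inverse (of_real (sqd x z y)) * ((y - x) * cnj w + w * cnj (y - x) + ((y - z) * cnj w + w * cnj (y - z))) * inverse (of_real (sqd x z y))) + w / of_real (sqd x z y)
    = of_real (Re w) * (1 / of_real (sqd x z y) - (y - x) * of_real (2 * Re ((y - x) + (y - z))) / (of_real (sqd x z y))\<^sup>2)
    + of_real (Im w) * (\<i> / of_real (sqd x z y) - (y - x) * of_real (2 * Im ((y - x) + (y - z))) / (of_real (sqd x z y))\<^sup>2)" for w
    unfolding lin by (subst (3) w) (rule alg[OF nz])
  show "(acoef x z has_derivative (\<lambda>w.
      of_real (Re w) * (1 / of_real (sqd x z y) - (y - x) * of_real (2 * Re ((y - x) + (y - z))) / (of_real (sqd x z y))\<^sup>2)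
    + of_real (Im w) * (\<i> / of_real (sqd x z y) - (y - x) * of_real (2 * Im ((y - x) + (y - z))) / (of_real (sqd x z y))\<^sup>2))) (at y)"
    using 3 unfolding eq acoef_def[abs_def] .
qed

lemma norm_acoef_le:
  assumes xz: "x \<noteq> z"
  shows "cmod (acoef x z y) \<le> 2 / cmod (z - x)"
proof -
  let ?D = "sqd x z y"
  have r: "0 < cmod (z - x)" using xz by simp
  have D: "0 < ?D" by (rule sqd_pos[OF xz])
  have "cmod (y - x) * cmod (z - x) \<le> 2 * ?D"
    using sqd_bounds(1)[of z x y] sqd_bounds(2)[of y x z] sum_squares_bound[of "cmod (y - x)" "cmod (z - x)"] D
    unfolding mult.assoc by linarith
  then have "cmod (y - x) / ?D \<le> 2 / cmod (z - x)"
    using r D by (simp add: divide_simps mult.commute)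
  then show ?thesis using D by (simp add: acoef_def norm_divide)
qed

text \<open>Covers both partials: \<open>a\<close> is 1 or \<i>, and \<open>r\<close> is the real or
  imaginary part of (y - x) + (y - z). The bound 5/D arises as 1/D + 4/D, and D \<ge> |z - x|^2 / 2
  gives the constant 10.\<close>

lemma norm_acoef_partials_le:
  assumes xz: "x \<noteq> z" and a: "cmod a = 1" and r: "\<bar>r\<bar> \<le> cmod ((y - x) + (y - z))"
  shows "cmod (a / of_real (sqd x z y) - (y - x) * of_real (2 * r) / (of_real (sqd x z y))\<^sup>2) \<le> 10 / (cmod (z - x))\<^sup>2"
proof -
  let ?D = "sqd x z y"
  have z: "0 < cmod (z - x)" using xz by simp
  have D: "0 < ?D" by (rule sqd_pos[OF xz])
  have "cmod (y - x) * \<bar>r\<bar> \<le> cmod (y - x) * (cmod (y - x) + cmod (y - z))"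
    using r norm_triangle_ineq[of "y - x" "y - z"] by (intro mult_left_mono) auto
  also have "\<dots> \<le> 2 * ?D"
    using sqd_bounds(2)[of y x z] sum_squares_bound[of "cmod (y - x)" "cmod (y - z)"]
      zero_le_power2[of "cmod (y - x)"] zero_le_power2[of "cmod (y - z)"]
    unfolding distrib_left power2_eq_square[symmetric] sqd_def mult.assoc by linarith
  finally have 1: "cmod (y - x) * \<bar>r\<bar> \<le> 2 * ?D" .
  have "cmod (a / of_real ?D - (y - x) * of_real (2 * r) / (of_real ?D)\<^sup>2)
     \<le> 1 / ?D + cmod (y - x) * (2 * \<bar>r\<bar>) / ?D\<^sup>2"
    using norm_triangle_ineq4[of "a / of_real ?D" "(y - x) * of_real (2 * r) / (of_real ?D)\<^sup>2"] a D
    by (simp add: norm_divide norm_mult norm_power)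
  also have "cmod (y - x) * (2 * \<bar>r\<bar>) / ?D\<^sup>2 \<le> 4 * ?D / ?D\<^sup>2"
    using 1 by (intro divide_right_mono) (auto simp: mult_ac)
  also have "4 * ?D / ?D\<^sup>2 = 4 / ?D" using D by (simp add: power2_eq_square)
  also have "1 / ?D + 4 / ?D = 5 / ?D" by (simp add: add_divide_distrib[symmetric])
  also have "5 / ?D \<le> 10 / (cmod (z - x))\<^sup>2"
    using sqd_bounds(1)[of z x y] z D by (simp add: divide_simps mult.commute)
  finally show ?thesis by simp
qed

text \<open>The part of the double kernel that is singular only at y = z; the other part is a
  conjugate of the same expression with x and z exchanged.\<close>

definition Jint :: "complex \<Rightarrow> complex \<Rightarrow> complex \<Rightarrow> complex" where
  "Jint \<zeta> z x = (LINT y|lborel. ephase \<zeta> y * jweight y * acoef x z y / (z - y))"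

lemma measurable_acoef: "x \<noteq> z \<Longrightarrow> acoef x z \<in> borel_measurable borel"
  by (rule borel_measurable_continuous_onI has_partials_continuous has_partials_acoef)+

lemma measurable_jweight [measurable]: "jweight \<in> borel_measurable borel"
  by (rule borel_measurable_continuous_onI has_partials_continuous has_partials_jweight)+

lemma Jint_integrable:
  assumes xz: "x \<noteq> z"
  shows "integrable lborel (\<lambda>y. ephase \<zeta> y * jweight y * acoef x z y / (z - y))"
proof (rule integrable_potential_bound[where b=2 and C="2 / cmod (z - x)"])
  have [measurable]: "acoef x z \<in> borel_measurable borel" using xz by (rule measurable_acoef)
  show "(\<lambda>y. ephase \<zeta> y * jweight y * acoef x z y / (z - y)) \<in> borel_measurable borel" by measurable
  fix y
  have "cmod (ephase \<zeta> y * jweight y * acoef x z y / (z - y)) = cmod (acoef x z y) * (japanese y powr (- 2) / cmod (z - y))"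
    by (simp add: norm_mult norm_divide norm_jweight(1))
  also have "\<dots> \<le> (2 / cmod (z - x)) * (japanese y powr (- 2) / cmod (z - y))"
    by (intro mult_right_mono norm_acoef_le xz) auto
  finally show "cmod (ephase \<zeta> y * jweight y * acoef x z y / (z - y)) \<le> (2 / cmod (z - x)) * (japanese y powr (- 2) / cmod (z - y))" .
qed simp

lemma norm_integral_le_nn:
  fixes f :: "complex \<Rightarrow> complex"
  shows "ennreal (cmod (LINT y|lborel. f y)) \<le> (\<integral>\<^sup>+y. ennreal (cmod (f y)) \<partial>lborel)"
  by (cases "integrable lborel f") (auto simp: integral_norm_bound_ennreal not_integrable_integral_eq)

lemma norm_integral_le_nn_integral:
  fixes f :: "complex \<Rightarrow> complex"
  assumes "(\<integral>\<^sup>+y. ennreal (cmod (f y)) \<partial>lborel) \<le> ennreal C" "0 \<le> C"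
  shows "cmod (LINT y|lborel. f y) \<le> C"
  using order_trans[OF norm_integral_le_nn assms(1)] assms(2) by (simp add: ennreal_le_iff)

lemma Jint_bound:
  "\<exists>C\<ge>0. \<forall>\<zeta> x z. x \<noteq> z \<longrightarrow> cmod (Jint \<zeta> z x) \<le> C / cmod (z - x)"
proof -
  obtain C where C: "0 \<le> C" "\<And>z. (\<integral>\<^sup>+y. ennreal (japanese y powr (- 2) / cmod (z - y)) \<partial>lborel) \<le> ennreal C"
    using potential_bound[of 2] by auto
  have "cmod (Jint \<zeta> z x) \<le> 2 * C / cmod (z - x)" if xz: "x \<noteq> z" for \<zeta> x z
    unfolding Jint_def
  proof (rule norm_integral_le_nn_integral)
    have "(\<integral>\<^sup>+y. ennreal (cmod (ephase \<zeta> y * jweight y * acoef x z y / (z - y))) \<partial>lborel)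
      \<le> (\<integral>\<^sup>+y. ennreal (2 / cmod (z - x)) * ennreal (japanese y powr (- 2) / cmod (z - y)) \<partial>lborel)"
    proof (intro nn_integral_mono)
      fix y
      have "cmod (ephase \<zeta> y * jweight y * acoef x z y / (z - y)) = cmod (acoef x z y) * (japanese y powr (- 2) / cmod (z - y))"
        by (simp add: norm_mult norm_divide norm_jweight(1))
      also have "\<dots> \<le> (2 / cmod (z - x)) * (japanese y powr (- 2) / cmod (z - y))"
        by (intro mult_right_mono norm_acoef_le xz) auto
      finally show "ennreal (cmod (ephase \<zeta> y * jweight y * acoef x z y / (z - y)))
         \<le> ennreal (2 / cmod (z - x)) * ennreal (japanese y powr (- 2) / cmod (z - y))"
        by (subst ennreal_mult[symmetric]) (auto intro: ennreal_leI)
    qed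
    also have "\<dots> = ennreal (2 / cmod (z - x)) * (\<integral>\<^sup>+y. ennreal (japanese y powr (- 2) / cmod (z - y)) \<partial>lborel)"
      by (rule nn_integral_cmult) measurable
    also have "\<dots> \<le> ennreal (2 / cmod (z - x)) * ennreal C"
      by (intro mult_left_mono C(2)) auto
    also have "\<dots> = ennreal (2 * C / cmod (z - x))"
      using C(1) by (simp add: ennreal_mult[symmetric])
    finally show "(\<integral>\<^sup>+y. ennreal (cmod (ephase \<zeta> y * jweight y * acoef x z y / (z - y))) \<partial>lborel) \<le> ennreal (2 * C / cmod (z - x))" .
  qed (use C in auto)
  with C(1) show ?thesis by (intro exI[of _ "2 * C"]) auto
qed

text \<open>Since y - x is holomorphic only the denominator contributes, and dbar of |y - x|^2 + |y
  - z|^2 is (y - x) + (y - z).\<close>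

lemma acoef_dbar:
  assumes xz: "x \<noteq> z"
  shows "(1 / of_real (sqd x z y) - (y - x) * of_real (2 * Re ((y - x) + (y - z))) / (of_real (sqd x z y))\<^sup>2
    + \<i> * (\<i> / of_real (sqd x z y) - (y - x) * of_real (2 * Im ((y - x) + (y - z))) / (of_real (sqd x z y))\<^sup>2)) / 2
    = - (y - x) * ((y - x) + (y - z)) / (of_real (sqd x z y))\<^sup>2"
proof -
  have alg: "(1 / d - u * (2 * r) / d\<^sup>2 + \<i> * (\<i> / d - u * (2 * m) / d\<^sup>2)) / 2 = - u * (r + \<i> * m) / d\<^sup>2"
    if "d \<noteq> 0" for d u r m :: complex
    using that by (simp add: divide_simps power2_eq_square) (simp add: algebra_simps)
  have nz: "complex_of_real (sqd x z y) \<noteq> 0"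
    using sqd_pos[OF xz, of y] by simp
  show ?thesis
    using alg[OF nz, of "y - x" "of_real (Re ((y - x) + (y - z)))" "of_real (Im ((y - x) + (y - z)))"]
    unfolding complex_eq[symmetric] by simp
qed

text \<open>Integration by parts: \<open>ephase \<zeta>\<close> is, up to the factor \<open>\<i> \<zeta> / 2\<close>, its own
  \<open>dbar\<close>-derivative, while the factor \<open>y - x\<close> in \<^const>\<open>acoef\<close> is holomorphic, so that
  differentiating \<^const>\<open>acoef\<close> costs only \<open>1 / sqd x z y\<close>.\<close>

lemma Jint_by_parts:
  assumes xz: "x \<noteq> z"
  shows "\<i> * \<zeta> / 2 * Jint \<zeta> z x = of_real pi * (ephase \<zeta> z * jweight z * acoef x z z)
    - (LINT y|lborel. ephase \<zeta> y * (- y * (jweight y)\<^sup>2 * acoef x z y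
         + jweight y * (- (y - x) * ((y - x) + (y - z)) / (of_real (sqd x z y))\<^sup>2)) / (z - y))"
proof -
  have r: "0 < cmod (z - x)" using xz by simp
  define ax where "ax y = 1 / of_real (sqd x z y) - (y - x) * of_real (2 * Re ((y - x) + (y - z))) / (of_real (sqd x z y))\<^sup>2" for y
  define ay where "ay y = \<i> / of_real (sqd x z y) - (y - x) * of_real (2 * Im ((y - x) + (y - z))) / (of_real (sqd x z y))\<^sup>2" for y
  define px where "px y = - 2 * of_real (Re y) * (jweight y)\<^sup>2" for y
  define py where "py y = - 2 * of_real (Im y) * (jweight y)\<^sup>2" for y
  define ex where "ex y = \<i> * of_real (Re \<zeta>) * ephase \<zeta> y" for y
  define ey where "ey y = \<i> * of_real (Im \<zeta>) * ephase \<zeta> y" for y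
  have a: "has_partials (acoef x z) ax ay"
    unfolding ax_def[abs_def] ay_def[abs_def] by (rule has_partials_acoef[OF xz])
  have p: "has_partials jweight px py"
    unfolding px_def[abs_def] py_def[abs_def] by (rule has_partials_jweight)
  have e: "has_partials (ephase \<zeta>) ex ey"
    unfolding ex_def[abs_def] ey_def[abs_def] by (rule has_partials_ephase)
  note pd = has_partials_mult[OF has_partials_mult[OF e p] a]
  note ca = has_partials_continuous[OF a] and cp = has_partials_continuous[OF p] and ce = has_partials_continuous[OF e]
  have nz: "complex_of_real (sqd x z y) \<noteq> 0" for y
    using sqd_pos[OF xz, of y] by simp
  have cax: "continuous_on UNIV ax" "continuous_on UNIV ay"
    using sqd_pos[OF xz] unfolding ax_def[abs_def] ay_def[abs_def] sqd_def
    by (auto intro!: continuous_intros simp del: of_real_add simp: less_imp_neq[symmetric])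
  have cpx: "continuous_on UNIV px" "continuous_on UNIV py"
    unfolding px_def[abs_def] py_def[abs_def] by (intro continuous_intros cp)+
  have cex: "continuous_on UNIV ex" "continuous_on UNIV ey"
    unfolding ex_def[abs_def] ey_def[abs_def] by (intro continuous_intros ce)+
  have bp: "cmod (px y) \<le> 2 / (japanese y)\<^sup>2" "cmod (py y) \<le> 2 / (japanese y)\<^sup>2" for y
  proof -
    have "2 * t * (1 / (japanese y)\<^sup>2)\<^sup>2 \<le> 2 / (japanese y)\<^sup>2" if "t \<le> cmod y" for t
    proof -
      have "t \<le> (japanese y)\<^sup>2"
        using that cmod_le_japanese[of y] japanese_ge_1[of y] self_le_power[of "japanese y" 2] by linarith
      then have "2 * t / ((japanese y)\<^sup>2 * (japanese y)\<^sup>2) \<le> 2 * (japanese y)\<^sup>2 / ((japanese y)\<^sup>2 * (japanese y)\<^sup>2)"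
        by (intro divide_right_mono) auto
      then show ?thesis by (simp add: power2_eq_square)
    qed
    then show "cmod (px y) \<le> 2 / (japanese y)\<^sup>2" "cmod (py y) \<le> 2 / (japanese y)\<^sup>2"
      using abs_Re_le_cmod[of y] abs_Im_le_cmod[of y]
      by (simp_all add: px_def py_def norm_mult norm_power norm_jweight(2))
  qed
  have bax: "cmod (ax y) \<le> 10 / (cmod (z - x))\<^sup>2" "cmod (ay y) \<le> 10 / (cmod (z - x))\<^sup>2" for y
    unfolding ax_def ay_def
    by (rule norm_acoef_partials_le[OF xz _ abs_Re_le_cmod] norm_acoef_partials_le[OF xz _ abs_Im_le_cmod]; simp)+
  \<comment> \<open>The three Leibniz terms contribute |\<zeta>| (phase), 2 (weight) and 10/|z -
    x|^2 (coefficient). Only finiteness is used here, so the dependence on \<zeta> and z - x does no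
    harm.\<close>
  define C where "C = (cmod \<zeta> + 2) * (2 / cmod (z - x)) + 10 / (cmod (z - x))\<^sup>2"
  have C0: "2 / cmod (z - x) \<le> C" "0 \<le> C"
  proof -
    have "1 * (2 / cmod (z - x)) \<le> (cmod \<zeta> + 2) * (2 / cmod (z - x))"
      by (intro mult_right_mono) auto
    moreover have "0 \<le> 10 / (cmod (z - x))\<^sup>2" "0 \<le> 2 / cmod (z - x)" by auto
    ultimately show "2 / cmod (z - x) \<le> C" "0 \<le> C" unfolding C_def by linarith+
  qed
  have bnd: "cmod ((e' * jweight y + ephase \<zeta> y * p') * acoef x z y + ephase \<zeta> y * jweight y * a') \<le> C / (japanese y)\<^sup>2"
    if "cmod e' \<le> cmod \<zeta>" "cmod p' \<le> 2 / (japanese y)\<^sup>2" "cmod a' \<le> 10 / (cmod (z - x))\<^sup>2" for e' p' a' y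
  proof -
    have "cmod ((e' * jweight y + ephase \<zeta> y * p') * acoef x z y + ephase \<zeta> y * jweight y * a')
      \<le> (cmod e' * cmod (jweight y) + cmod p') * cmod (acoef x z y) + cmod (jweight y) * cmod a'"
    proof -
      have "cmod (e' * jweight y + ephase \<zeta> y * p') \<le> cmod e' * cmod (jweight y) + cmod p'"
        using norm_triangle_ineq[of "e' * jweight y" "ephase \<zeta> y * p'"] by (simp add: norm_mult)
      then have "cmod ((e' * jweight y + ephase \<zeta> y * p') * acoef x z y) \<le> (cmod e' * cmod (jweight y) + cmod p') * cmod (acoef x z y)"
        unfolding norm_mult[of "e' * jweight y + ephase \<zeta> y * p'"] by (rule mult_right_mono) simp
      then show ?thesis
        using norm_triangle_ineq[of "(e' * jweight y + ephase \<zeta> y * p') * acoef x z y" "ephase \<zeta> y * jweight y * a'"]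
        by (simp add: norm_mult)
    qed
    also have "\<dots> \<le> (cmod \<zeta> * (1 / (japanese y)\<^sup>2) + 2 / (japanese y)\<^sup>2) * (2 / cmod (z - x)) + (1 / (japanese y)\<^sup>2) * (10 / (cmod (z - x))\<^sup>2)"
      using that norm_acoef_le[OF xz, of y] unfolding norm_jweight(2)
      by (intro add_mono mult_mono add_nonneg_nonneg mult_nonneg_nonneg) auto
    also have "\<dots> = C / (japanese y)\<^sup>2"
      by (simp add: C_def add_divide_distrib algebra_simps)
    finally show ?thesis .
  qed
  have ble: "cmod (ex y) \<le> cmod \<zeta>" "cmod (ey y) \<le> cmod \<zeta>" for y
    by (simp_all add: ex_def ey_def norm_mult abs_Re_le_cmod abs_Im_le_cmod)
  have b0: "cmod (ephase \<zeta> y * jweight y * acoef x z y) \<le> C / japanese y" for y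
  proof -
    have "cmod (ephase \<zeta> y * jweight y * acoef x z y) \<le> (1 / (japanese y)\<^sup>2) * C"
      using norm_acoef_le[OF xz, of y] C0 by (simp add: norm_mult norm_jweight(2) divide_right_mono)
    also have "\<dots> \<le> (1 / japanese y) * C"
      using C0 japanese_ge_1[of y] self_le_power[of "japanese y" 2]
      by (intro mult_right_mono divide_left_mono) auto
    finally show ?thesis by simp
  qed
  have cpom: "integrable lborel (\<lambda>y. (((ex y * jweight y + ephase \<zeta> y * px y) * acoef x z y + ephase \<zeta> y * jweight y * ax y)
       + \<i> * ((ey y * jweight y + ephase \<zeta> y * py y) * acoef x z y + ephase \<zeta> y * jweight y * ay y)) / 2 / (z - y))"
    "(LINT y|lborel. (((ex y * jweight y + ephase \<zeta> y * px y) * acoef x z y + ephase \<zeta> y * jweight y * ax y)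
       + \<i> * ((ey y * jweight y + ephase \<zeta> y * py y) * acoef x z y + ephase \<zeta> y * jweight y * ay y)) / 2 / (z - y))
     = of_real pi * (ephase \<zeta> z * jweight z * acoef x z z)"
    by (rule cauchy_pompeiu[OF pd _ _ C0(2) b0 bnd[OF ble(1) bp(1) bax(1)] bnd[OF ble(2) bp(2) bax(2)]];
        intro continuous_intros ca cp ce cax cpx cex)+
  define R where "R y = ephase \<zeta> y * (- y * (jweight y)\<^sup>2 * acoef x z y
         + jweight y * (- (y - x) * ((y - x) + (y - z)) / (of_real (sqd x z y))\<^sup>2)) / (z - y)" for y
  have eq: "(((ex y * jweight y + ephase \<zeta> y * px y) * acoef x z y + ephase \<zeta> y * jweight y * ax y)
       + \<i> * ((ey y * jweight y + ephase \<zeta> y * py y) * acoef x z y + ephase \<zeta> y * jweight y * ay y)) / 2 / (z - y)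
     = \<i> * \<zeta> / 2 * (ephase \<zeta> y * jweight y * acoef x z y / (z - y)) + R y" for y
  proof -
    have 1: "(ex y + \<i> * ey y) / 2 = \<i> * \<zeta> / 2 * ephase \<zeta> y"
    proof -
      have "(ex y + \<i> * ey y) / 2 = \<i> * (of_real (Re \<zeta>) + \<i> * of_real (Im \<zeta>)) / 2 * ephase \<zeta> y"
        by (simp add: ex_def ey_def algebra_simps)
      then show ?thesis unfolding complex_eq[symmetric] .
    qed
    have 2: "(px y + \<i> * py y) / 2 = - y * (jweight y)\<^sup>2"
    proof -
      have "(px y + \<i> * py y) / 2 = - (of_real (Re y) + \<i> * of_real (Im y)) * (jweight y)\<^sup>2"
        by (simp add: px_def py_def field_simps)
      then show ?thesis unfolding complex_eq[symmetric] .
    qed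
    have 3: "(ax y + \<i> * ay y) / 2 = - (y - x) * ((y - x) + (y - z)) / (of_real (sqd x z y))\<^sup>2"
      unfolding ax_def ay_def by (rule acoef_dbar[OF xz])
    have alg: "(((e1 * p + e * p1) * a + e * p * a1) + \<i> * ((e2 * p + e * p2) * a + e * p * a2)) / 2
      = ((e1 + \<i> * e2) / 2) * p * a + e * (((p1 + \<i> * p2) / 2) * a + p * ((a1 + \<i> * a2) / 2))"
      for e1 e2 p1 p2 a1 a2 e p a :: complex
      by (simp add: field_simps)
    show ?thesis unfolding alg 1 2 3 R_def by (simp add: add_divide_distrib mult.assoc)
  qed
  have iJ: "integrable lborel (\<lambda>y. \<i> * \<zeta> / 2 * (ephase \<zeta> y * jweight y * acoef x z y / (z - y)))"
    by (intro integrable_mult_right Jint_integrable[OF xz])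
  have iR: "integrable lborel R"
    using Bochner_Integration.integrable_diff[OF cpom(1)[unfolded eq] iJ] by simp
  have "(LINT y|lborel. \<i> * \<zeta> / 2 * (ephase \<zeta> y * jweight y * acoef x z y / (z - y)) + R y)
     = \<i> * \<zeta> / 2 * Jint \<zeta> z x + (LINT y|lborel. R y)"
    unfolding Jint_def integral_mult_right_zero[symmetric] by (rule Bochner_Integration.integral_add[OF iJ iR])
  with cpom(2)[unfolded eq] show ?thesis unfolding R_def by (simp add: algebra_simps)
qed

text \<open>After integration by parts the boundary value and the remaining integral are both O(1/|z
  - x|) uniformly in \<zeta>, so division by \<zeta>/2 gives the decay. The derivative of the weight
  is handled by \<open>potential_bound\<close>, that of the coefficient by
  \<open>scaled_kernel_bound\<close>.\<close>

lemma Jint_decay: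
  "\<exists>C\<ge>0. \<forall>\<zeta> x z. x \<noteq> z \<longrightarrow> \<zeta> \<noteq> 0 \<longrightarrow> cmod (Jint \<zeta> z x) \<le> C / (cmod \<zeta> * cmod (z - x))"
proof -
  obtain C1 where C1: "0 \<le> C1" "\<And>z. (\<integral>\<^sup>+y. ennreal (japanese y powr (- 2) / cmod (z - y)) \<partial>lborel) \<le> ennreal C1"
    using potential_bound[of 2] by auto
  obtain C2 where C2: "0 \<le> C2" "\<And>z r. 0 < r \<Longrightarrow> (\<integral>\<^sup>+y. ennreal (1 / (((cmod (z - y))\<^sup>2 + r\<^sup>2) * cmod (z - y))) \<partial>lborel) \<le> ennreal (C2 / r)"
    using scaled_kernel_bound by auto
  define C where "C = 2 * (pi + (2 * C1 + 6 * C2))"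
  have "cmod (Jint \<zeta> z x) \<le> C / (cmod \<zeta> * cmod (z - x))" if xz: "x \<noteq> z" and \<zeta>: "\<zeta> \<noteq> 0" for \<zeta> x z
  proof -
    define r where "r = cmod (z - x)"
    have r: "0 < r" using xz by (simp add: r_def)
    define S where "S y = ephase \<zeta> y * (- y * (jweight y)\<^sup>2 * acoef x z y
         + jweight y * (- (y - x) * ((y - x) + (y - z)) / (of_real (sqd x z y))\<^sup>2)) / (z - y)" for y
    have S: "cmod (S y) \<le> (2 / r) * (japanese y powr (- 2) / cmod (z - y)) + 6 * (1 / (((cmod (z - y))\<^sup>2 + r\<^sup>2) * cmod (z - y)))" for y
    proof -
      let ?D = "sqd x z y"
      have D: "0 < ?D" by (rule sqd_pos[OF xz])
      have p1: "cmod (jweight y) \<le> 1"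
        unfolding norm_jweight(2) using one_le_power[OF japanese_ge_1[of y], of 2] by simp
      have p2: "cmod y * cmod (jweight y) \<le> 1"
      proof -
        have "cmod y \<le> (japanese y)\<^sup>2"
          using cmod_le_japanese[of y] japanese_ge_1[of y] self_le_power[of "japanese y" 2] by linarith
        then show ?thesis unfolding norm_jweight(2) by (simp add: divide_le_eq)
      qed
      have a: "cmod (- y * (jweight y)\<^sup>2 * acoef x z y) \<le> japanese y powr (- 2) * (2 / r)"
      proof -
        have "cmod (- y * (jweight y)\<^sup>2 * acoef x z y) = (cmod y * cmod (jweight y)) * (cmod (jweight y) * cmod (acoef x z y))"
          by (simp add: norm_mult norm_power power2_eq_square)
        also have "\<dots> \<le> 1 * (cmod (jweight y) * (2 / r))"
          using norm_acoef_le[OF xz, of y] unfolding r_def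
          by (intro mult_mono p2 mult_left_mono) auto
        finally show ?thesis by (simp add: norm_jweight(1))
      qed
      have q: "cmod ((y - x) * ((y - x) + (y - z))) \<le> 2 * ?D"
      proof -
        have "cmod ((y - x) * ((y - x) + (y - z))) \<le> cmod (y - x) * (cmod (y - x) + cmod (y - z))"
          unfolding norm_mult by (intro mult_left_mono norm_triangle_ineq) auto
        also have "\<dots> \<le> 2 * ?D"
          using sqd_bounds(2)[of y x z] sum_squares_bound[of "cmod (y - x)" "cmod (y - z)"]
            zero_le_power2[of "cmod (y - x)"] zero_le_power2[of "cmod (y - z)"]
          unfolding distrib_left power2_eq_square[symmetric] sqd_def mult.assoc by linarith
        finally show ?thesis .
      qed
      have "cmod (- (y - x) * ((y - x) + (y - z)) / (of_real ?D)\<^sup>2) = cmod ((y - x) * ((y - x) + (y - z))) / ?D\<^sup>2"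
        unfolding norm_divide norm_power norm_of_real power2_abs mult_minus_left norm_minus_cancel ..
      also have "\<dots> \<le> 2 * ?D / ?D\<^sup>2"
        using q by (intro divide_right_mono) auto
      also have "\<dots> = 2 / ?D" using D by (simp add: power2_eq_square)
      also have "\<dots> \<le> 6 / ((cmod (z - y))\<^sup>2 + r\<^sup>2)"
      proof -
        \<comment> \<open>D dominates both |z - y|^2 and r^2 / 2. Keeping the sum of the two is
          essential: 1/r^2 alone would not be integrable against 1/|z - y|, and 1/|z - y|^2 alone
          would be too singular.\<close>
        have "(cmod (z - y))\<^sup>2 + r\<^sup>2 \<le> 3 * ?D"
          using sqd_bounds(1)[of z x y] sqd_bounds(3)[of y z x] by (simp add: r_def norm_minus_commute)
        moreover have "0 < (cmod (z - y))\<^sup>2 + r\<^sup>2" using r by (simp add: add_nonneg_pos)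
        ultimately show ?thesis using D by (simp add: divide_simps)
      qed
      finally have b1: "cmod (- (y - x) * ((y - x) + (y - z)) / (of_real ?D)\<^sup>2) \<le> 6 / ((cmod (z - y))\<^sup>2 + r\<^sup>2)" .
      have b: "cmod (jweight y * (- (y - x) * ((y - x) + (y - z)) / (of_real ?D)\<^sup>2)) \<le> 6 / ((cmod (z - y))\<^sup>2 + r\<^sup>2)"
        unfolding norm_mult[of "jweight y"] using mult_mono[OF p1 b1] by simp
      have "cmod (S y) \<le> (japanese y powr (- 2) * (2 / r) + 6 / ((cmod (z - y))\<^sup>2 + r\<^sup>2)) / cmod (z - y)"
        unfolding S_def norm_divide[of _ "z - y"] norm_mult[of "ephase \<zeta> y"] norm_ephase mult_1
        by (intro divide_right_mono order_trans[OF norm_triangle_ineq] add_mono a b) auto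
      also have "\<dots> = (2 / r) * (japanese y powr (- 2) / cmod (z - y)) + 6 * (1 / (((cmod (z - y))\<^sup>2 + r\<^sup>2) * cmod (z - y)))"
        by (simp add: add_divide_distrib)
      finally show ?thesis .
    qed
    have IS: "cmod (LINT y|lborel. S y) \<le> (2 * C1 + 6 * C2) / r"
    proof (rule norm_integral_le_nn_integral)
      have "(\<integral>\<^sup>+y. ennreal (cmod (S y)) \<partial>lborel)
        \<le> (\<integral>\<^sup>+y. ennreal (2 / r) * ennreal (japanese y powr (- 2) / cmod (z - y))
             + ennreal 6 * ennreal (1 / (((cmod (z - y))\<^sup>2 + r\<^sup>2) * cmod (z - y))) \<partial>lborel)"
      proof (intro nn_integral_mono)
        fix y
        have "ennreal (cmod (S y)) \<le> ennreal ((2 / r) * (japanese y powr (- 2) / cmod (z - y)) + 6 * (1 / (((cmod (z - y))\<^sup>2 + r\<^sup>2) * cmod (z - y))))"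
          by (rule ennreal_leI[OF S])
        also have "\<dots> = ennreal ((2 / r) * (japanese y powr (- 2) / cmod (z - y))) + ennreal (6 * (1 / (((cmod (z - y))\<^sup>2 + r\<^sup>2) * cmod (z - y))))"
          using r by (intro ennreal_plus) (auto intro!: mult_nonneg_nonneg divide_nonneg_nonneg add_nonneg_nonneg)
        also have "\<dots> = ennreal (2 / r) * ennreal (japanese y powr (- 2) / cmod (z - y))
             + ennreal 6 * ennreal (1 / (((cmod (z - y))\<^sup>2 + r\<^sup>2) * cmod (z - y)))"
          using r by (subst (1 2) ennreal_mult) (auto intro!: mult_nonneg_nonneg divide_nonneg_nonneg add_nonneg_nonneg)
        finally show "ennreal (cmod (S y)) \<le> ennreal (2 / r) * ennreal (japanese y powr (- 2) / cmod (z - y))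
             + ennreal 6 * ennreal (1 / (((cmod (z - y))\<^sup>2 + r\<^sup>2) * cmod (z - y)))" .
      qed
      also have "\<dots> = ennreal (2 / r) * (\<integral>\<^sup>+y. ennreal (japanese y powr (- 2) / cmod (z - y)) \<partial>lborel)
             + ennreal 6 * (\<integral>\<^sup>+y. ennreal (1 / (((cmod (z - y))\<^sup>2 + r\<^sup>2) * cmod (z - y))) \<partial>lborel)"
        by (subst nn_integral_add, measurable, subst (1 2) nn_integral_cmult, measurable)
      also have "\<dots> \<le> ennreal (2 / r) * ennreal C1 + ennreal 6 * ennreal (C2 / r)"
        by (intro add_mono mult_left_mono C1(2) C2(2) r) auto
      also have "\<dots> = ennreal ((2 / r) * C1 + 6 * (C2 / r))"
        using r C1(1) C2(1) by (subst (1 2) ennreal_mult[symmetric], simp_all add: ennreal_plus[symmetric] del: ennreal_plus)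
      also have "(2 / r) * C1 + 6 * (C2 / r) = (2 * C1 + 6 * C2) / r" by (simp add: add_divide_distrib)
      finally show "(\<integral>\<^sup>+y. ennreal (cmod (S y)) \<partial>lborel) \<le> ennreal ((2 * C1 + 6 * C2) / r)" .
    qed (use r C1(1) C2(1) in auto)
    have bd: "cmod (of_real pi * (ephase \<zeta> z * jweight z * acoef x z z)) \<le> pi / r"
    proof -
      have p1: "cmod (jweight z) \<le> 1"
        unfolding norm_jweight(2) using one_le_power[OF japanese_ge_1[of z], of 2] by simp
      have "cmod (acoef x z z) = r / r\<^sup>2"
        unfolding acoef_def sqd_def by (simp add: norm_divide norm_power r_def)
      also have "\<dots> = 1 / r" using r by (simp add: power2_eq_square)
      finally have "cmod (jweight z) * cmod (acoef x z z) \<le> 1 * (1 / r)"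
        using p1 r by (intro mult_mono) auto
      then have "pi * (cmod (jweight z) * cmod (acoef x z z)) \<le> pi * (1 / r)"
        by (intro mult_left_mono) auto
      then show ?thesis by (simp add: norm_mult)
    qed
    have "cmod \<zeta> / 2 * cmod (Jint \<zeta> z x) = cmod (\<i> * \<zeta> / 2 * Jint \<zeta> z x)"
      by (simp add: norm_mult norm_divide)
    also have "\<dots> \<le> pi / r + (2 * C1 + 6 * C2) / r"
      unfolding Jint_by_parts[OF xz] S_def[symmetric]
      by (rule order_trans[OF norm_triangle_ineq4]) (intro add_mono bd IS)
    finally have "cmod \<zeta> / 2 * cmod (Jint \<zeta> z x) \<le> (pi + (2 * C1 + 6 * C2)) / r"
      by (simp add: add_divide_distrib)
    then show ?thesis
      using r \<zeta> unfolding C_def r_def[symmetric] by (simp add: field_simps)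
  qed
  moreover have "0 \<le> C" unfolding C_def using C1(1) C2(1) by simp
  ultimately show ?thesis by blast
qed

section \<open>The full oscillatory kernels and their superposition over frequencies\<close>

definition Kint :: "complex \<Rightarrow> complex \<Rightarrow> complex \<Rightarrow> complex" where
  "Kint \<zeta> z x = (LINT y|lborel. ephase \<zeta> y * jweight y / ((z - y) * (cnj y - cnj x)))"

lemma sqd_commute: "sqd x z y = sqd z x y"
  by (simp add: sqd_def)

text \<open>Writing 1 as D/D and distributing the two summands of D cancels one singular factor in
  each term. Conjugation exchanges x and z and flips the frequency, so one family of integrals
  covers both terms.\<close>

lemma Kint_eq_Jint:
  assumes xz: "x \<noteq> z"
  shows "Kint \<zeta> z x = Jint \<zeta> z x + cnj (Jint (- \<zeta>) x z)"
proof -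
  have [measurable]: "acoef x z \<in> borel_measurable borel" "acoef z x \<in> borel_measurable borel"
    using xz by (auto intro: measurable_acoef)
  note i1 = Jint_integrable[OF xz, of \<zeta>] and i2 = Jint_integrable[of z x "- \<zeta>"]
  have i2b: "integrable lborel (\<lambda>y. cnj (ephase (- \<zeta>) y * jweight y * acoef z x y / (x - y)))"
    using i2 xz by (subst integrable_cnj) auto
  have "Jint \<zeta> z x + cnj (Jint (- \<zeta>) x z) = (LINT y|lborel. ephase \<zeta> y * jweight y * acoef x z y / (z - y)
      + cnj (ephase (- \<zeta>) y * jweight y * acoef z x y / (x - y)))"
    unfolding Jint_def Bochner_Integration.integral_add[OF i1 i2b] Bochner_Integration.integral_cnj ..
  also have "\<dots> = Kint \<zeta> z x"
    unfolding Kint_def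
  proof (rule integral_cong_AE)
    show "AE y in lborel. ephase \<zeta> y * jweight y * acoef x z y / (z - y)
      + cnj (ephase (- \<zeta>) y * jweight y * acoef z x y / (x - y))
      = ephase \<zeta> y * jweight y / ((z - y) * (cnj y - cnj x))"
      using AE_lborel_singleton[of x] AE_lborel_singleton[of z]
    proof eventually_elim
      case (elim y)
      define D where "D = complex_of_real (sqd x z y)"
      have D: "D = (y - x) * cnj (y - x) + (y - z) * cnj (y - z)"
        unfolding D_def sqd_def of_real_add complex_norm_square ..
      have D0: "D \<noteq> 0" using sqd_pos[OF xz, of y] by (simp add: D_def)
      have cj: "cnj (jweight y) = jweight y" by (simp add: jweight_def)
      have nz: "z - y \<noteq> 0" "cnj (y - x) \<noteq> 0" using elim by auto
      have alg: "e * p * (u / d) / (- v) + e * p * (w / d) / (- s) = e * p / ((- v) * s)"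
        if "d = u * s + v * w" "d \<noteq> 0" "v \<noteq> 0" "s \<noteq> 0" for e p d u v w s :: complex
        using that(2-4) unfolding that(1) by (simp add: divide_simps) (simp add: algebra_simps)
      have "cnj (ephase (- \<zeta>) y * jweight y * acoef z x y / (x - y))
        = ephase \<zeta> y * jweight y * (cnj (y - z) / D) / (- cnj (y - x))"
        by (simp add: acoef_def cj cnj_ephase D_def sqd_commute[of z])
      moreover have "ephase \<zeta> y * jweight y * acoef x z y / (z - y)
        = ephase \<zeta> y * jweight y * ((y - x) / D) / (- (y - z))"
        by (simp add: acoef_def D_def)
      moreover have "(z - y) * (cnj y - cnj x) = (- (y - z)) * cnj (y - x)" by simp
      ultimately show ?case
        using alg[OF D D0] nz by simp
    qed
  qed measurable
  finally show ?thesis ..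
qed

lemma Kint_bound:
  "\<exists>C\<ge>0. (\<forall>\<zeta> x z. x \<noteq> z \<longrightarrow> cmod (Kint \<zeta> z x) \<le> C / cmod (z - x))
     \<and> (\<forall>\<zeta> x z. x \<noteq> z \<longrightarrow> \<zeta> \<noteq> 0 \<longrightarrow> cmod (Kint \<zeta> z x) \<le> C / (cmod \<zeta> * cmod (z - x)))"
proof -
  obtain C1 where C1: "0 \<le> C1" "\<And>\<zeta> x z. x \<noteq> z \<Longrightarrow> cmod (Jint \<zeta> z x) \<le> C1 / cmod (z - x)"
    using Jint_bound by blast
  obtain C2 where C2: "0 \<le> C2" "\<And>\<zeta> x z. x \<noteq> z \<Longrightarrow> \<zeta> \<noteq> 0 \<Longrightarrow> cmod (Jint \<zeta> z x) \<le> C2 / (cmod \<zeta> * cmod (z - x))"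
    using Jint_decay by blast
  have tri: "cmod (Kint \<zeta> z x) \<le> cmod (Jint \<zeta> z x) + cmod (Jint (- \<zeta>) x z)" if "x \<noteq> z" for \<zeta> x z
    unfolding Kint_eq_Jint[OF that] using norm_triangle_ineq[of "Jint \<zeta> z x" "cnj (Jint (- \<zeta>) x z)"] by simp
  have "cmod (Kint \<zeta> z x) \<le> (2 * C1 + 2 * C2) / cmod (z - x)" if "x \<noteq> z" for \<zeta> x z
  proof -
    have "cmod (Kint \<zeta> z x) \<le> (2 * C1) / cmod (z - x)"
      using tri[OF that, of \<zeta>] C1(2)[OF that, of \<zeta>] C1(2)[of z x "- \<zeta>"] that by (simp add: norm_minus_commute)
    also have "\<dots> \<le> (2 * C1 + 2 * C2) / cmod (z - x)"
      using C2(1) by (intro divide_right_mono) auto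
    finally show ?thesis .
  qed
  moreover have "cmod (Kint \<zeta> z x) \<le> (2 * C1 + 2 * C2) / (cmod \<zeta> * cmod (z - x))" if "x \<noteq> z" "\<zeta> \<noteq> 0" for \<zeta> x z
  proof -
    have "cmod (Kint \<zeta> z x) \<le> (2 * C2) / (cmod \<zeta> * cmod (z - x))"
      using tri[OF that(1), of \<zeta>] C2(2)[OF that] C2(2)[of z x "- \<zeta>"] that by (simp add: norm_minus_commute)
    also have "\<dots> \<le> (2 * C1 + 2 * C2) / (cmod \<zeta> * cmod (z - x))"
      using C1(1) by (intro divide_right_mono) auto
    finally show ?thesis .
  qed
  ultimately show ?thesis using C1(1) C2(1) by (intro exI[of _ "2 * C1 + 2 * C2"]) auto
qed

text \<open>With a = |z - y| and b = |x - y|, the triangle inequality |z - x| \<le> a + b gives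
  1/(ab) \<le> (1/a + 1/b) / |z - x|, so the two singularities can be treated one at a time.\<close>

lemma integrable_double_kernel:
  assumes xz: "x \<noteq> z"
  shows "integrable lborel (\<lambda>y. jweight y / ((z - y) * (cnj y - cnj x)))"
proof -
  have r: "0 < cmod (z - x)" using xz by simp
  have i: "integrable lborel (\<lambda>y. jweight y / (a - y))" for a
    by (rule integrable_potential_bound[where b=2 and C=1 and z=a])
      (auto simp: norm_divide norm_jweight(1))
  show ?thesis
  proof (rule Bochner_Integration.integrable_bound)
    show "integrable lborel (\<lambda>y. (1 / cmod (z - x)) * (cmod (jweight y / (x - y)) + cmod (jweight y / (z - y))))"
      by (intro integrable_mult_right Bochner_Integration.integrable_add integrable_norm i)
    show "AE y in lborel. cmod (jweight y / ((z - y) * (cnj y - cnj x)))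
      \<le> norm ((1 / cmod (z - x)) * (cmod (jweight y / (x - y)) + cmod (jweight y / (z - y))))"
      using AE_lborel_singleton[of x] AE_lborel_singleton[of z]
    proof eventually_elim
      case (elim y)
      define a b j where "a = cmod (z - y)" and "b = cmod (x - y)" and "j = cmod (jweight y)"
      have ab: "0 < a" "0 < b" "0 \<le> j" using elim by (auto simp: a_def b_def j_def)
      have "cmod (z - x) \<le> a + b"
        using norm_triangle_ineq[of "z - y" "y - x"] by (simp add: a_def b_def norm_minus_commute)
      then have "cmod (z - x) / (a * b) \<le> (a + b) / (a * b)"
        using ab by (intro divide_right_mono) auto
      also have "\<dots> = 1 / b + 1 / a" using ab by (simp add: field_simps)
      finally have "1 / (a * b) \<le> (1 / cmod (z - x)) * (1 / b + 1 / a)"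
        using r by (simp add: field_simps)
      then have "j * (1 / (a * b)) \<le> j * ((1 / cmod (z - x)) * (1 / b + 1 / a))"
        using ab(3) by (rule mult_left_mono)
      also have "\<dots> = (1 / cmod (z - x)) * (j / b + j / a)" by (simp add: distrib_left)
      also have "\<dots> = norm ((1 / cmod (z - x)) * (j / b + j / a))"
        using ab r by (simp add: abs_of_nonneg)
      finally have *: "j / (a * b) \<le> norm ((1 / cmod (z - x)) * (j / b + j / a))" by simp
      have "cmod (cnj y - cnj x) = b"
        unfolding complex_cnj_diff[symmetric] complex_mod_cnj b_def by (rule norm_minus_commute)
      then show ?case using * by (simp add: norm_divide norm_mult a_def b_def j_def)
    qed
  qed measurable
qed

text \<open>The product of the integrable density and the integrable double kernel justifies Fubini;
  the two phases merge into the frequency \<xi> - \<eta>.\<close>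

lemma Kint_superposition:
  assumes G: "integrable lborel G" and xz: "x \<noteq> z"
  shows "(LINT y|lborel. ephase (- \<eta>) y * (jweight y * (LINT \<xi>|lborel. G \<xi> * ephase \<xi> y)) / ((z - y) * (cnj y - cnj x)))
    = (LINT \<xi>|lborel. G \<xi> * Kint (\<xi> - \<eta>) z x)"
proof -
  have [measurable]: "G \<in> borel_measurable borel"
    using borel_measurable_integrable[OF G] by simp
  let ?w = "\<lambda>y. jweight y / ((z - y) * (cnj y - cnj x))"
  let ?f = "\<lambda>\<xi> y. G \<xi> * (ephase (\<xi> - \<eta>) y * jweight y / ((z - y) * (cnj y - cnj x)))"
  have int: "integrable (lborel \<Otimes>\<^sub>M lborel) (case_prod ?f)"
  proof (rule integrableI_bounded)
    show "case_prod ?f \<in> borel_measurable (lborel \<Otimes>\<^sub>M lborel)" by measurable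
    have "(\<integral>\<^sup>+p. ennreal (cmod (case_prod ?f p)) \<partial>(lborel \<Otimes>\<^sub>M lborel))
      = (\<integral>\<^sup>+\<xi>. \<integral>\<^sup>+y. ennreal (cmod (?f \<xi> y)) \<partial>lborel \<partial>lborel)"
      by (subst lborel.nn_integral_fst[symmetric]) auto
    also have "\<dots> = (\<integral>\<^sup>+\<xi>. \<integral>\<^sup>+y. ennreal (cmod (G \<xi>)) * ennreal (cmod (?w y)) \<partial>lborel \<partial>lborel)"
      by (intro nn_integral_cong) (simp add: norm_mult norm_divide ennreal_mult[symmetric])
    also have "\<dots> = (\<integral>\<^sup>+\<xi>. ennreal (cmod (G \<xi>)) \<partial>lborel) * (\<integral>\<^sup>+y. ennreal (cmod (?w y)) \<partial>lborel)"
    proof -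
      have [measurable]: "?w \<in> borel_measurable borel" by measurable
      show ?thesis by (subst nn_integral_cmult, measurable, subst nn_integral_multc, measurable)
    qed
    also have "\<dots> < \<infinity>"
      using G integrable_double_kernel[OF xz] by (simp add: integrable_iff_bounded ennreal_mult_less_top)
    finally show "(\<integral>\<^sup>+p. ennreal (cmod (case_prod ?f p)) \<partial>(lborel \<Otimes>\<^sub>M lborel)) < \<infinity>" .
  qed
  have "(LINT y|lborel. ephase (- \<eta>) y * (jweight y * (LINT \<xi>|lborel. G \<xi> * ephase \<xi> y)) / ((z - y) * (cnj y - cnj x)))
      = (LINT y|lborel. LINT \<xi>|lborel. ?f \<xi> y)"
  proof (rule Bochner_Integration.integral_cong[OF refl])
    fix y
    have "ephase (- \<eta>) y * (jweight y * (LINT \<xi>|lborel. G \<xi> * ephase \<xi> y)) / ((z - y) * (cnj y - cnj x))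
      = (ephase (- \<eta>) y * ?w y) * (LINT \<xi>|lborel. G \<xi> * ephase \<xi> y)" by simp
    also have "\<dots> = (LINT \<xi>|lborel. (ephase (- \<eta>) y * ?w y) * (G \<xi> * ephase \<xi> y))"
      by (rule integral_mult_right_zero[symmetric])
    also have "\<dots> = (LINT \<xi>|lborel. ?f \<xi> y)"
      by (rule Bochner_Integration.integral_cong[OF refl])
        (simp add: ephase_add[of _ "- \<eta>", simplified] mult_ac)
    finally show "ephase (- \<eta>) y * (jweight y * (LINT \<xi>|lborel. G \<xi> * ephase \<xi> y)) / ((z - y) * (cnj y - cnj x))
      = (LINT \<xi>|lborel. ?f \<xi> y)" .
  qed
  also have "\<dots> = (LINT \<xi>|lborel. LINT y|lborel. ?f \<xi> y)"
    by (rule lborel_pair.Fubini_integral[OF int])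
  also have "\<dots> = (LINT \<xi>|lborel. G \<xi> * Kint (\<xi> - \<eta>) z x)"
    unfolding Kint_def integral_mult_right_zero ..
  finally show ?thesis .
qed

text \<open>For |\<xi>| \<le> R the condition |\<eta>| \<ge> 2R keeps |\<xi> - \<eta>| \<ge> R, and
  the decay of the kernel gives 1/R. For larger \<xi> resonance is possible and only the uniform
  bound is available, so the mass of \<open>G\<close> there must be small.\<close>

lemma superposition_bound:
  "\<exists>C\<ge>0. \<forall>G \<eta> z x R. integrable lborel G \<longrightarrow> x \<noteq> z \<longrightarrow> 0 < R \<longrightarrow> 2 * R \<le> cmod \<eta> \<longrightarrow>
     cmod (LINT y|lborel. ephase (- \<eta>) y * (jweight y * (LINT \<xi>|lborel. G \<xi> * ephase \<xi> y)) / ((z - y) * (cnj y - cnj x)))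
     \<le> C / cmod (z - x) * (1 / R * (LINT \<xi>|lborel. cmod (G \<xi>)) + (LINT \<xi>|lborel. indicator {\<xi>. R < cmod \<xi>} \<xi> * cmod (G \<xi>)))"
proof -
  obtain C where C: "0 \<le> C" "\<And>\<zeta> x z. x \<noteq> z \<Longrightarrow> cmod (Kint \<zeta> z x) \<le> C / cmod (z - x)"
     "\<And>\<zeta> x z. x \<noteq> z \<Longrightarrow> \<zeta> \<noteq> 0 \<Longrightarrow> cmod (Kint \<zeta> z x) \<le> C / (cmod \<zeta> * cmod (z - x))"
    using Kint_bound by blast
  have "cmod (LINT y|lborel. ephase (- \<eta>) y * (jweight y * (LINT \<xi>|lborel. G \<xi> * ephase \<xi> y)) / ((z - y) * (cnj y - cnj x)))
     \<le> C / cmod (z - x) * (1 / R * (LINT \<xi>|lborel. cmod (G \<xi>)) + (LINT \<xi>|lborel. indicator {\<xi>. R < cmod \<xi>} \<xi> * cmod (G \<xi>)))"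
    if G: "integrable lborel G" and xz: "x \<noteq> z" and R: "0 < R" and \<eta>: "2 * R \<le> cmod \<eta>" for G \<eta> z x R
  proof -
    have [measurable]: "G \<in> borel_measurable borel"
      using borel_measurable_integrable[OF G] by simp
    have r: "0 < cmod (z - x)" using xz by simp
    let ?g = "\<lambda>\<xi>. C / cmod (z - x) * (1 / R * cmod (G \<xi>) + indicator {\<xi>. R < cmod \<xi>} \<xi> * cmod (G \<xi>))"
    have i1: "integrable lborel (\<lambda>\<xi>. 1 / R * cmod (G \<xi>))" using G by (intro integrable_mult_right integrable_norm)
    have i2: "integrable lborel (\<lambda>\<xi>. indicator {\<xi>. R < cmod \<xi>} \<xi> * cmod (G \<xi>))"
      by (rule Bochner_Integration.integrable_bound[OF integrable_norm[OF G]]) (auto simp: indicator_def)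
    have i: "integrable lborel ?g" by (intro integrable_mult_right Bochner_Integration.integrable_add i1 i2)
    have le: "cmod (G \<xi> * Kint (\<xi> - \<eta>) z x) \<le> ?g \<xi>" for \<xi>
    proof (cases "R < cmod \<xi>")
      case True
      have "cmod (G \<xi>) * cmod (Kint (\<xi> - \<eta>) z x) \<le> cmod (G \<xi>) * (C / cmod (z - x))"
        by (intro mult_left_mono C(2) xz) auto
      also have "\<dots> = C / cmod (z - x) * (0 + cmod (G \<xi>))" by simp
      also have "\<dots> \<le> C / cmod (z - x) * (1 / R * cmod (G \<xi>) + cmod (G \<xi>))"
        using C(1) R by (intro mult_left_mono add_right_mono) auto
      finally show ?thesis using True by (simp add: norm_mult)
    next
      case False
      have "cmod \<eta> \<le> cmod \<xi> + cmod (\<xi> - \<eta>)"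
        using norm_triangle_ineq[of \<xi> "\<eta> - \<xi>"] by (simp add: norm_minus_commute)
      then have Rle: "R \<le> cmod (\<xi> - \<eta>)" using False \<eta> by linarith
      then have "\<xi> - \<eta> \<noteq> 0" using R by auto
      then have "cmod (Kint (\<xi> - \<eta>) z x) \<le> C / (cmod (\<xi> - \<eta>) * cmod (z - x))" by (rule C(3)[OF xz])
      also have "\<dots> \<le> C / (R * cmod (z - x))"
        using Rle R r C(1) by (intro divide_left_mono mult_right_mono mult_pos_pos) auto
      finally have "cmod (G \<xi>) * cmod (Kint (\<xi> - \<eta>) z x) \<le> cmod (G \<xi>) * (C / (R * cmod (z - x)))"
        by (intro mult_left_mono) auto
      also have "\<dots> = C / cmod (z - x) * (1 / R * cmod (G \<xi>))" by (simp add: mult.commute)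
      finally show ?thesis using False by (simp add: norm_mult)
    qed
    have "cmod (LINT \<xi>|lborel. G \<xi> * Kint (\<xi> - \<eta>) z x) \<le> (LINT \<xi>|lborel. ?g \<xi>)"
    proof (cases "integrable lborel (\<lambda>\<xi>. G \<xi> * Kint (\<xi> - \<eta>) z x)")
      case True
      then show ?thesis using le by (intro Bochner_Integration.integral_norm_bound_integral i) auto
    next
      \<comment> \<open>A non-integrable function has integral 0 by convention, so the bound reduces
        to the right-hand side being nonnegative.\<close>
      case False
      have "0 \<le> (LINT \<xi>|lborel. ?g \<xi>)"
        using le norm_ge_zero order_trans by (intro Bochner_Integration.integral_nonneg) blast
      then show ?thesis using False by (simp add: not_integrable_integral_eq)
    qed
    also have "\<dots> = C / cmod (z - x) * (1 / R * (LINT \<xi>|lborel. cmod (G \<xi>)) + (LINT \<xi>|lborel. indicator {\<xi>. R < cmod \<xi>} \<xi> * cmod (G \<xi>)))"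
      unfolding integral_mult_right_zero Bochner_Integration.integral_add[OF i1 i2] ..
    finally show ?thesis unfolding Kint_superposition[OF G xz] .
  qed
  with C(1) show ?thesis by (intro exI[of _ C]) auto
qed

section \<open>High-frequency tails of Sobolev densities and the rate in h\<close>

lemma tail_japanese_bound:
  assumes s: "1 < s"
  shows "\<exists>C\<ge>0. \<forall>R>0. (\<integral>\<^sup>+\<xi>. ennreal (indicator {\<xi>. R < cmod \<xi>} \<xi> * japanese \<xi> powr (- (2 * s))) \<partial>lborel)
     \<le> ennreal (C * R powr (2 - 2 * s))"
proof -
  obtain J where J: "(\<integral>\<^sup>+x. ennreal (japanese x powr (- (2 * s))) \<partial>lborel) = ennreal J" "0 \<le> J"
    using nn_integral_japanese[of "2 * s"] s by (cases "\<integral>\<^sup>+x. ennreal (japanese x powr (- (2 * s))) \<partial>lborel") auto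
  have "(\<integral>\<^sup>+\<xi>. ennreal (indicator {\<xi>. R < cmod \<xi>} \<xi> * japanese \<xi> powr (- (2 * s))) \<partial>lborel)
     \<le> ennreal ((2 powr (2 * s) * J) * R powr (2 - 2 * s))" if R: "0 < R" for R
  proof -
    let ?f = "\<lambda>\<xi>. ennreal (indicator {\<xi>. R < cmod \<xi>} \<xi> * japanese \<xi> powr (- (2 * s)))"
    have [measurable]: "?f \<in> borel_measurable borel" by measurable
    have "(\<integral>\<^sup>+\<xi>. ?f \<xi> \<partial>lborel) = ennreal (R\<^sup>2) * (\<integral>\<^sup>+\<xi>. ?f (0 + R *\<^sub>R \<xi>) \<partial>lborel)"
      using R by (intro nn_integral_complex_affine) auto
    also have "\<dots> \<le> ennreal (R\<^sup>2) * (\<integral>\<^sup>+\<xi>. ennreal (R powr (- (2 * s)) * 2 powr (2 * s)) * ennreal (japanese \<xi> powr (- (2 * s))) \<partial>lborel)"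
    proof (intro mult_left_mono nn_integral_mono)
      fix v :: complex
      have "indicator {\<xi>. R < cmod \<xi>} (R *\<^sub>R v) * japanese (R *\<^sub>R v) powr (- (2 * s))
        \<le> R powr (- (2 * s)) * 2 powr (2 * s) * japanese v powr (- (2 * s))"
      proof (cases "R < cmod (R *\<^sub>R v)")
        case True
        then have v: "1 < cmod v" using R by simp
        \<comment> \<open>After scaling by R the tail becomes |v| > 1, where \<langle>v\<rangle>
          \<le> 2|v|. The weight at Rv is then at least R/2 times the weight at v; with the Jacobian
          R^2 this produces R powr (2 - 2 * s).\<close>
        have "R * (japanese v / 2) \<le> R * cmod v"
          using japanese_le_add[of v] v R by (intro mult_left_mono) auto
        also have "\<dots> \<le> japanese (R *\<^sub>R v)"
          using cmod_le_japanese[of "R *\<^sub>R v"] R by simp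
        finally have "japanese (R *\<^sub>R v) powr (- (2 * s)) \<le> (R * (japanese v / 2)) powr (- (2 * s))"
          using R s by (intro powr_neg_mono) (auto intro!: mult_pos_pos)
        also have "\<dots> = R powr (- (2 * s)) * (japanese v powr (- (2 * s)) / 2 powr (- (2 * s)))"
          using R by (simp add: powr_mult powr_divide)
        also have "\<dots> = R powr (- (2 * s)) * 2 powr (2 * s) * japanese v powr (- (2 * s))"
          by (simp add: powr_minus[of 2] divide_inverse)
        finally show ?thesis using True by simp
      qed auto
      then show "?f (0 + R *\<^sub>R v) \<le> ennreal (R powr (- (2 * s)) * 2 powr (2 * s)) * ennreal (japanese v powr (- (2 * s)))"
        by (subst ennreal_mult[symmetric]) (auto intro: ennreal_leI)
    qed auto
    also have "\<dots> = ennreal (R\<^sup>2) * (ennreal (R powr (- (2 * s)) * 2 powr (2 * s)) * ennreal J)"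
      by (subst nn_integral_cmult) (auto simp: J)
    also have "\<dots> = ennreal (R\<^sup>2 * (R powr (- (2 * s)) * 2 powr (2 * s) * J))"
      using J(2) by (simp only: ennreal_mult[symmetric] mult_nonneg_nonneg powr_ge_zero zero_le_power2)
    also have "R\<^sup>2 * (R powr (- (2 * s)) * 2 powr (2 * s) * J) = (2 powr (2 * s) * J) * R powr (2 - 2 * s)"
    proof -
      have "R powr (2 - 2 * s) = R powr 2 * R powr (- (2 * s))"
        by (subst powr_add[symmetric]) simp
      then show ?thesis using R by simp
    qed
    finally show ?thesis .
  qed
  then show ?thesis using J by (intro exI[of _ "2 powr (2 * s) * J"]) auto
qed

text \<open>Cauchy--Schwarz pairs \<langle>\<xi>\<rangle>^(-s) with \<langle>\<xi>\<rangle>^s G. The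
  first factor is square integrable in the plane exactly when s > 1, and the square root of its tail
  integral is the rate.\<close>

lemma sobolev_weight_tail:
  assumes s: "1 < s" and G[measurable]: "G \<in> borel_measurable borel"
    and L2: "(\<lambda>\<xi>. of_real (japanese \<xi> powr s) * G \<xi>) \<in> L2"
  shows "integrable lborel G"
    and "\<exists>C\<ge>0. \<forall>R>0. (LINT \<xi>|lborel. indicator {\<xi>. R < cmod \<xi>} \<xi> * cmod (G \<xi>)) \<le> C * R powr (1 - s)"
proof -
  let ?H = "\<lambda>\<xi>. ennreal (japanese \<xi> powr s * cmod (G \<xi>))"
  have "integrable lborel (\<lambda>\<xi>. (japanese \<xi> powr s * cmod (G \<xi>))\<^sup>2)"
    using L2 by (simp add: L2_def norm_mult)
  then have "(\<integral>\<^sup>+\<xi>. (?H \<xi>)\<^sup>2 \<partial>lborel) < \<infinity>"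
    by (simp add: integrable_iff_bounded ennreal_power)
  then obtain N where N: "(\<integral>\<^sup>+\<xi>. (?H \<xi>)\<^sup>2 \<partial>lborel) = ennreal N" "0 \<le> N"
    by (cases "\<integral>\<^sup>+\<xi>. (?H \<xi>)\<^sup>2 \<partial>lborel") auto
  \<comment> \<open>Serves both claims: \<open>a\<close> is the constant 1 for integrability and the
    indicator of the tail for the rate. In both cases its square is itself.\<close>
  have cs: "(\<integral>\<^sup>+\<xi>. ennreal (a \<xi> * cmod (G \<xi>)) \<partial>lborel)\<^sup>2
     \<le> (\<integral>\<^sup>+\<xi>. ennreal (a \<xi> * japanese \<xi> powr (- (2 * s))) \<partial>lborel) * ennreal N"
    if [measurable]: "a \<in> borel_measurable borel" and a: "\<And>\<xi>. a \<xi> = 0 \<or> a \<xi> = (1::real)" for a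
  proof -
    have a0: "0 \<le> a \<xi>" for \<xi> using a[of \<xi>] by auto
    have "(\<integral>\<^sup>+\<xi>. ennreal (a \<xi> * cmod (G \<xi>)) \<partial>lborel) = (\<integral>\<^sup>+\<xi>. ennreal (a \<xi> * japanese \<xi> powr (- s)) * ?H \<xi> \<partial>lborel)"
    proof (rule nn_integral_cong)
      fix \<xi>
      have "a \<xi> * japanese \<xi> powr (- s) * (japanese \<xi> powr s * cmod (G \<xi>)) = a \<xi> * (japanese \<xi> powr (- s) * japanese \<xi> powr s) * cmod (G \<xi>)"
        by simp
      also have "japanese \<xi> powr (- s) * japanese \<xi> powr s = 1" by (simp add: powr_add[symmetric])
      finally show "ennreal (a \<xi> * cmod (G \<xi>)) = ennreal (a \<xi> * japanese \<xi> powr (- s)) * ?H \<xi>"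
        using a0[of \<xi>] by (simp add: ennreal_mult[symmetric])
    qed
    also have "(\<dots>)\<^sup>2 \<le> (\<integral>\<^sup>+\<xi>. (ennreal (a \<xi> * japanese \<xi> powr (- s)))\<^sup>2 \<partial>lborel) * (\<integral>\<^sup>+\<xi>. (?H \<xi>)\<^sup>2 \<partial>lborel)"
      by (rule Cauchy_Schwarz_nn_integral) measurable
    also have "(\<integral>\<^sup>+\<xi>. (ennreal (a \<xi> * japanese \<xi> powr (- s)))\<^sup>2 \<partial>lborel) = (\<integral>\<^sup>+\<xi>. ennreal (a \<xi> * japanese \<xi> powr (- (2 * s))) \<partial>lborel)"
    proof (rule nn_integral_cong)
      fix \<xi>
      have "(japanese \<xi> powr (- s))\<^sup>2 = japanese \<xi> powr (- (2 * s))"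
        by (simp add: power2_eq_square powr_add[symmetric])
      moreover have "(a \<xi>)\<^sup>2 = a \<xi>" using a[of \<xi>] by auto
      ultimately show "(ennreal (a \<xi> * japanese \<xi> powr (- s)))\<^sup>2 = ennreal (a \<xi> * japanese \<xi> powr (- (2 * s)))"
        using a0[of \<xi>] by (simp add: ennreal_power power_mult_distrib)
    qed
    finally show ?thesis unfolding N(1) .
  qed
  have "(\<integral>\<^sup>+\<xi>. ennreal (1 * cmod (G \<xi>)) \<partial>lborel)\<^sup>2
     \<le> (\<integral>\<^sup>+\<xi>. ennreal (1 * japanese \<xi> powr (- (2 * s))) \<partial>lborel) * ennreal N"
    by (rule cs) auto
  also have "\<dots> < \<infinity>"
    using nn_integral_japanese[of "2 * s"] s by (simp add: ennreal_mult_less_top)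
  finally have fin: "(\<integral>\<^sup>+\<xi>. ennreal (cmod (G \<xi>)) \<partial>lborel) < \<infinity>"
    by (simp add: power2_eq_square ennreal_mult_less_top less_top[symmetric] ennreal_mult_eq_top_iff)
  show int: "integrable lborel G" using fin by (simp add: integrable_iff_bounded)
  obtain C where C: "0 \<le> C" "\<And>R. 0 < R \<Longrightarrow> (\<integral>\<^sup>+\<xi>. ennreal (indicator {\<xi>. R < cmod \<xi>} \<xi> * japanese \<xi> powr (- (2 * s))) \<partial>lborel)
     \<le> ennreal (C * R powr (2 - 2 * s))"
    using tail_japanese_bound[OF s] by blast
  have "(LINT \<xi>|lborel. indicator {\<xi>. R < cmod \<xi>} \<xi> * cmod (G \<xi>)) \<le> sqrt (C * N) * R powr (1 - s)" if R: "0 < R" for R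
  proof -
    define L where "L = (LINT \<xi>|lborel. indicator {\<xi>. R < cmod \<xi>} \<xi> * cmod (G \<xi>))"
    have L0: "0 \<le> L" unfolding L_def by (intro Bochner_Integration.integral_nonneg) auto
    have i2: "integrable lborel (\<lambda>\<xi>. indicator {\<xi>. R < cmod \<xi>} \<xi> * cmod (G \<xi>))"
      by (rule Bochner_Integration.integrable_bound[OF integrable_norm[OF int]]) (auto simp: indicator_def)
    have "(\<integral>\<^sup>+\<xi>. ennreal (indicator {\<xi>. R < cmod \<xi>} \<xi> * cmod (G \<xi>)) \<partial>lborel) = ennreal L"
      unfolding L_def using i2 by (intro nn_integral_eq_integral) auto
    then have "ennreal (L\<^sup>2) = (\<integral>\<^sup>+\<xi>. ennreal (indicator {\<xi>. R < cmod \<xi>} \<xi> * cmod (G \<xi>)) \<partial>lborel)\<^sup>2"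
      using L0 by (simp add: ennreal_power)
    also have "\<dots> \<le> (\<integral>\<^sup>+\<xi>. ennreal (indicator {\<xi>. R < cmod \<xi>} \<xi> * japanese \<xi> powr (- (2 * s))) \<partial>lborel) * ennreal N"
      by (rule cs) (auto simp: indicator_def)
    also have "\<dots> \<le> ennreal (C * R powr (2 - 2 * s)) * ennreal N"
      by (intro mult_right_mono C(2) R) auto
    also have "\<dots> = ennreal (C * R powr (2 - 2 * s) * N)"
      using C(1) N(2) by (simp add: ennreal_mult)
    also have "C * R powr (2 - 2 * s) * N = (sqrt (C * N) * R powr (1 - s))\<^sup>2"
    proof -
      have "R powr (2 - 2 * s) = (R powr (1 - s))\<^sup>2"
        by (simp add: power2_eq_square powr_add[symmetric])
      then show ?thesis using C(1) N(2) by (simp add: power_mult_distrib)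
    qed
    finally have "L\<^sup>2 \<le> (sqrt (C * N) * R powr (1 - s))\<^sup>2" by (simp add: ennreal_le_iff)
    then show ?thesis unfolding L_def[symmetric]
      by (rule power2_le_imp_le) (use C(1) N(2) in auto)
  qed
  then show "\<exists>C\<ge>0. \<forall>R>0. (LINT \<xi>|lborel. indicator {\<xi>. R < cmod \<xi>} \<xi> * cmod (G \<xi>)) \<le> C * R powr (1 - s)"
    using C(1) N(2) by (intro exI[of _ "sqrt (C * N)"]) auto
qed

lemma oscillatory_kernel_bound:
  assumes s: "1 < s" "s \<le> 2" and G[measurable]: "G \<in> borel_measurable borel"
    and L2: "(\<lambda>\<xi>. of_real (japanese \<xi> powr s) * G \<xi>) \<in> L2"
  shows "\<exists>C\<ge>0. \<forall>h \<eta> z x. 0 < h \<longrightarrow> h \<le> 1 \<longrightarrow> cmod \<eta> = 2 / h \<longrightarrow> x \<noteq> z \<longrightarrow>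
     cmod (LINT y|lborel. ephase (- \<eta>) y * (jweight y * (LINT \<xi>|lborel. G \<xi> * ephase \<xi> y)) / ((z - y) * (cnj y - cnj x)))
     \<le> C * h powr (s - 1) / cmod (z - x)"
proof -
  note int = sobolev_weight_tail(1)[OF s(1) G L2]
  obtain T where T: "0 \<le> T" "\<And>R. 0 < R \<Longrightarrow> (LINT \<xi>|lborel. indicator {\<xi>. R < cmod \<xi>} \<xi> * cmod (G \<xi>)) \<le> T * R powr (1 - s)"
    using sobolev_weight_tail(2)[OF s(1) G L2] by blast
  obtain C where C: "0 \<le> C" "\<And>G \<eta> z x R. integrable lborel G \<Longrightarrow> x \<noteq> z \<Longrightarrow> 0 < R \<Longrightarrow> 2 * R \<le> cmod \<eta> \<Longrightarrow>
     cmod (LINT y|lborel. ephase (- \<eta>) y * (jweight y * (LINT \<xi>|lborel. G \<xi> * ephase \<xi> y)) / ((z - y) * (cnj y - cnj x)))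
     \<le> C / cmod (z - x) * (1 / R * (LINT \<xi>|lborel. cmod (G \<xi>)) + (LINT \<xi>|lborel. indicator {\<xi>. R < cmod \<xi>} \<xi> * cmod (G \<xi>)))"
    using superposition_bound by blast
  define I where "I = (LINT \<xi>|lborel. cmod (G \<xi>))"
  have I: "0 \<le> I" unfolding I_def by (intro Bochner_Integration.integral_nonneg) auto
  have "cmod (LINT y|lborel. ephase (- \<eta>) y * (jweight y * (LINT \<xi>|lborel. G \<xi> * ephase \<xi> y)) / ((z - y) * (cnj y - cnj x)))
     \<le> (C * (I + T)) * h powr (s - 1) / cmod (z - x)"
    if h: "0 < h" "h \<le> 1" and \<eta>: "cmod \<eta> = 2 / h" and xz: "x \<noteq> z" for h \<eta> z x
  proof -
    \<comment> \<open>With R = 1/h the low frequencies contribute a factor h, absorbed into the rate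
      because s - 1 \<le> 1 and h \<le> 1.\<close>
    have "h powr 1 \<le> h powr (s - 1)" using h s by (intro powr_mono') auto
    then have hs: "h \<le> h powr (s - 1)" using h by simp
    have "(1 / h) powr (1 - s) = h powr (s - 1)"
      using h by (simp add: powr_divide powr_minus_divide[of h "s - 1", simplified])
    then have t: "(LINT \<xi>|lborel. indicator {\<xi>. 1 / h < cmod \<xi>} \<xi> * cmod (G \<xi>)) \<le> T * h powr (s - 1)"
      using T(2)[of "1 / h"] h by simp
    have "cmod (LINT y|lborel. ephase (- \<eta>) y * (jweight y * (LINT \<xi>|lborel. G \<xi> * ephase \<xi> y)) / ((z - y) * (cnj y - cnj x)))
      \<le> C / cmod (z - x) * (1 / (1 / h) * I + (LINT \<xi>|lborel. indicator {\<xi>. 1 / h < cmod \<xi>} \<xi> * cmod (G \<xi>)))"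
      unfolding I_def by (rule C(2)[OF int xz]) (use h \<eta> in auto)
    also have "\<dots> \<le> C / cmod (z - x) * (h powr (s - 1) * I + T * h powr (s - 1))"
      using hs I C(1) by (intro mult_left_mono add_mono t mult_right_mono) auto
    also have "\<dots> = (C * (I + T)) * h powr (s - 1) / cmod (z - x)" by (simp add: field_simps)
    finally show ?thesis .
  qed
  then show ?thesis using C(1) I T(1) by (intro exI[of _ "C * (I + T)"]) auto
qed

section \<open>Approximate identities and Fourier inversion\<close>

text \<open>Boxes form an intersection-stable generator, so vanishing on boxes extends to all Borel
  sets by Dynkin induction. The function is first cut to a fixed box, which makes complements and
  countable unions legitimate; then boxes exhaust the plane.\<close>

lemma AE_zero_from_boxes:
  fixes f :: "complex \<Rightarrow> complex"
  assumes [measurable]: "f \<in> borel_measurable borel"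
    and loc: "\<And>l r. integrable lborel (\<lambda>z. indicator (box l r) z * f z)"
    and zero: "\<And>l r. (LINT z|lborel. indicator (box l r) z * f z) = 0"
  shows "AE z in lborel. f z = 0"
proof -
  let ?E = "range (\<lambda>(a, b). box a b :: complex set)"
  have stable: "Int_stable ?E" by (auto simp: Int_stable_def box_Int_box)
  have closed: "?E \<subseteq> Pow UNIV" by simp
  have bx: "AE z in lborel. indicator (box l r) z * f z = 0" for l r
  proof (rule sigma_finite_measure.density_zero[OF sigma_finite_lborel loc])
    fix A :: "complex set" assume A: "A \<in> sets lborel"
    have eq: "(LINT z:B|lborel. indicator (box l r) z * f z) = (LINT z|lborel. indicator B z * (indicator (box l r) z * f z))" for B :: "complex set"
      unfolding set_lebesgue_integral_def by (intro Bochner_Integration.integral_cong) (auto simp: indicator_def)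
    have "A \<in> sigma_sets UNIV ?E"
      using A borel_eq_box by (metis sets_lborel sets_measure_of subset_UNIV top_greatest Pow_UNIV)
    then show "(LINT z:A|lborel. indicator (box l r) z * f z) = 0"
    proof (induction rule: sigma_sets_induct_disjoint[OF stable closed, consumes 1, case_names basic empty compl union])
      case (basic A)
      then obtain a b where "A = box a b" by auto
      then obtain c d where cd: "A \<inter> box l r = box c d"
        using box_Int_box by blast
      have "(LINT z:A|lborel. indicator (box l r) z * f z) = (LINT z|lborel. indicator (box c d) z * f z)"
        unfolding set_lebesgue_integral_def cd[symmetric]
        by (intro Bochner_Integration.integral_cong) (auto simp: indicator_def)
      then show ?case using zero by simp
    next
      case (compl A)
      have [measurable]: "A \<in> sets borel"
        using compl(1) borel_eq_box by (metis sets_measure_of subset_UNIV top_greatest Pow_UNIV)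
      have "(LINT z:UNIV - A|lborel. indicator (box l r) z * f z)
         = (LINT z|lborel. indicator (box l r) z * f z - indicator A z *\<^sub>R (indicator (box l r) z * f z))"
        unfolding set_lebesgue_integral_def
        by (intro Bochner_Integration.integral_cong) (auto simp: indicator_def)
      also have "\<dots> = (LINT z|lborel. indicator (box l r) z * f z) - (LINT z:A|lborel. indicator (box l r) z * f z)"
        unfolding set_lebesgue_integral_def
        by (intro Bochner_Integration.integral_diff loc integrable_mult_indicator) auto
      finally show ?case using compl(2) zero by simp
    next
      case (union A)
      have [measurable]: "A i \<in> sets borel" for i
        using union(2) borel_eq_box by (metis range_subsetD sets_measure_of subset_UNIV top_greatest Pow_UNIV)
      have "(LINT z:(\<Union>i. A i)|lborel. indicator (box l r) z * f z) = (\<Sum>i. LINT z:A i|lborel. indicator (box l r) z * f z)"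
        using union(1) by (intro lebesgue_integral_countable_add)
          (auto simp: disjoint_family_on_def set_integrable_def loc intro!: integrable_mult_indicator)
      then show ?case using union(3) by simp
    qed (simp add: set_lebesgue_integral_def)
  qed
  have "AE z in lborel. \<forall>n::nat. indicator (box (- (real n *\<^sub>R One)) (real n *\<^sub>R One)) z * f z = 0"
    unfolding AE_all_countable using bx by blast
  then show ?thesis
  proof eventually_elim
    case (elim z)
    obtain n :: nat where "z \<in> box (- (real n *\<^sub>R One)) (real n *\<^sub>R One)"
      using UN_box_eq_UNIV[where 'a=complex] by blast
    then show ?case using elim[rule_format, of n] by simp
  qed
qed

text \<open>Fubini moves the averaging from the rough function \<open>u\<close> to the indicator of
  the box. The averaged indicators converge off the boundary of the box, a null set, and are
  dominated by a multiple of \<langle>z\<rangle>^(-4), which \<open>int\<close> makes integrable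
  against \<open>u\<close>.\<close>

lemma box_average_limit:
  fixes u :: "complex \<Rightarrow> complex" and k :: "complex \<Rightarrow> real"
  assumes u[measurable]: "u \<in> borel_measurable borel"
    and int: "integrable lborel (\<lambda>z. cmod (u z) * japanese z powr (- 4))"
    and k[measurable]: "k \<in> borel_measurable borel" and k0: "\<And>x. 0 \<le> k x"
    and kC: "\<And>x. k x \<le> C * japanese x powr (- 4)" and k1: "(\<integral>\<^sup>+x. ennreal (k x) \<partial>lborel) = 1"
    and t: "\<And>n. 0 < t n" "\<And>n. t n \<le> 1" "t \<longlonglongrightarrow> 0"
  shows "(\<lambda>n. LINT a|lborel. indicator (box l r) a * (LINT z|lborel. u z * of_real (k ((1 / t n) *\<^sub>R (a - z)) / (t n)\<^sup>2)))
    \<longlonglongrightarrow> (LINT z|lborel. indicator (box l r) z * u z)"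
proof -
  let ?Q = "box l r"
  define K where "K n x = k ((1 / t n) *\<^sub>R x) / (t n)\<^sup>2" for n x
  have K[measurable]: "K n \<in> borel_measurable borel" for n unfolding K_def by measurable
  have K0: "0 \<le> K n x" for n x using k0 by (simp add: K_def)
  define W where "W n z = (LINT a|lborel. complex_of_real (indicator ?Q a * K n (a - z)))" for n z
  have W[measurable]: "W n \<in> borel_measurable borel" for n unfolding W_def by measurable
  have Waff: "W n z = (LINT x|lborel. complex_of_real (indicator ?Q (z + t n *\<^sub>R x) * k x))" for n z
  proof -
    have "W n z = of_real ((t n)\<^sup>2) * (LINT x|lborel. complex_of_real (indicator ?Q (z + t n *\<^sub>R x) * K n ((z + t n *\<^sub>R x) - z)))"
      unfolding W_def using t(1)[of n] by (intro integral_complex_affine) auto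
    also have "\<dots> = (LINT x|lborel. of_real ((t n)\<^sup>2) * complex_of_real (indicator ?Q (z + t n *\<^sub>R x) * K n ((z + t n *\<^sub>R x) - z)))"
      by (rule integral_mult_right_zero[symmetric])
    also have "\<dots> = (LINT x|lborel. complex_of_real (indicator ?Q (z + t n *\<^sub>R x) * k x))"
      using t(1)[of n] unfolding of_real_mult[symmetric]
      by (intro Bochner_Integration.integral_cong) (auto simp: K_def)
    finally show ?thesis .
  qed
  have nnaff: "(\<integral>\<^sup>+a. ennreal (indicator ?Q a * K n (a - z)) \<partial>lborel) \<le> 1" for n z
  proof -
    have "(\<integral>\<^sup>+a. ennreal (indicator ?Q a * K n (a - z)) \<partial>lborel)
      = ennreal ((t n)\<^sup>2) * (\<integral>\<^sup>+x. ennreal (indicator ?Q (z + t n *\<^sub>R x) * K n ((z + t n *\<^sub>R x) - z)) \<partial>lborel)"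
      using t(1)[of n] by (intro nn_integral_complex_affine) auto
    also have "\<dots> = (\<integral>\<^sup>+x. ennreal ((t n)\<^sup>2) * ennreal (indicator ?Q (z + t n *\<^sub>R x) * K n ((z + t n *\<^sub>R x) - z)) \<partial>lborel)"
      by (rule nn_integral_cmult[symmetric]) measurable
    also have "\<dots> \<le> (\<integral>\<^sup>+x. ennreal (k x) \<partial>lborel)"
      using t(1)[of n] k0 by (intro nn_integral_mono) (auto simp: ennreal_mult[symmetric] K_def indicator_def)
    finally show ?thesis by (simp add: k1)
  qed
  obtain \<rho>' where "?Q \<subseteq> ball 0 \<rho>'" using bounded_subset_ballD[OF bounded_box, of l r 0] by auto
  then obtain \<rho> where \<rho>: "1 \<le> \<rho>" "?Q \<subseteq> ball 0 \<rho>"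
    by (intro that[of "max 1 \<rho>'"]) (auto simp: subset_iff)
  obtain V where V: "emeasure lborel ?Q = ennreal V" "0 \<le> V"
    by (metis emeasure_lborel_box_finite ennreal_cases infinity_ennreal_def less_irrefl)
  have C0: "0 \<le> C"
    using order_trans[OF k0 kC, of 0] by (simp add: japanese_def)
  \<comment> \<open>The first summand handles |z| \<le> 2\<rho>, where the average is at most 1. The
    second handles larger z: there \<langle>z\<rangle> \<le> 4|a - z| for a in the box, 256 is 4^4,
    and V is the area of the box.\<close>
  define C' where "C' = (1 + 2 * \<rho>) ^ 4 + 256 * C * V"
  have C'0: "0 \<le> C'" using \<rho> C0 V by (simp add: C'_def)
  have jp4: "japanese x powr (- 4) = 1 / (japanese x) ^ 4" for x
    by (simp add: powr_minus_divide)
  have nnW: "(\<integral>\<^sup>+a. ennreal (indicator ?Q a * K n (a - z)) \<partial>lborel) \<le> ennreal (C' * japanese z powr (- 4))" for n z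
  proof (cases "cmod z \<le> 2 * \<rho>")
    case True
    have "(japanese z) ^ 4 \<le> (1 + 2 * \<rho>) ^ 4"
      using True japanese_le_add[of z] by (intro power_mono) auto
    also have "\<dots> \<le> C'" using C0 V by (simp add: C'_def)
    finally have "1 \<le> C' * japanese z powr (- 4)"
      using japanese_pos[of z] unfolding jp4 by (simp add: le_divide_eq)
    then have "1 \<le> ennreal (C' * japanese z powr (- 4))"
      by (subst ennreal_1[symmetric]) (rule ennreal_leI)
    with nnaff[of n z] show ?thesis by (rule order_trans)
  next
    case False
    have ker: "indicator ?Q a * K n (a - z) \<le> (256 * C * japanese z powr (- 4)) * indicator ?Q a" for a
    proof (cases "a \<in> ?Q")
      case True
      define y where "y = cmod (a - z)"
      have z2: "2 \<le> cmod z" using False \<rho> by simp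
      have "cmod a < \<rho>" using True \<rho> by auto
      then have "cmod z \<le> 2 * y"
        using False norm_triangle_ineq2[of z a] by (simp add: y_def norm_minus_commute)
      moreover have "japanese z \<le> 2 * cmod z" using japanese_le_add[of z] z2 by linarith
      ultimately have jy: "japanese z \<le> 4 * y" by linarith
      then have y0: "0 < y" using japanese_pos[of z] by linarith
      have "y / t n \<le> japanese ((1 / t n) *\<^sub>R (a - z))"
        using cmod_le_japanese[of "(1 / t n) *\<^sub>R (a - z)"] t(1)[of n] by (simp add: y_def)
      then have "(y / t n) ^ 4 \<le> japanese ((1 / t n) *\<^sub>R (a - z)) ^ 4"
        using y0 t(1)[of n] by (intro power_mono) auto
      then have "1 / japanese ((1 / t n) *\<^sub>R (a - z)) ^ 4 \<le> 1 / (y / t n) ^ 4"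
        using y0 t(1)[of n] by (intro divide_left_mono) auto
      then have "K n (a - z) \<le> C * (1 / (y / t n) ^ 4) / (t n)\<^sup>2"
        using kC[of "(1 / t n) *\<^sub>R (a - z)"] C0 unfolding jp4 K_def
        by (intro divide_right_mono order_trans[OF kC[unfolded jp4]] mult_left_mono) auto
      also have "\<dots> = C * (t n)\<^sup>2 / y ^ 4"
        using t(1)[of n] y0 by (simp add: field_simps power2_eq_square power4_eq_xxxx)
      also have "\<dots> \<le> C * 1 / y ^ 4"
        using C0 t(1,2)[of n] y0 by (intro divide_right_mono mult_left_mono) (auto simp: power_le_one)
      also have "\<dots> \<le> C * (256 / japanese z ^ 4)"
      proof -
        have "japanese z ^ 4 \<le> (4 * y) ^ 4" using jy by (intro power_mono) auto
        then have "1 / y ^ 4 \<le> 256 / japanese z ^ 4" using y0 by (simp add: divide_simps)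
        then have "C * (1 / y ^ 4) \<le> C * (256 / japanese z ^ 4)" using C0 by (rule mult_left_mono)
        then show ?thesis by simp
      qed
      finally show ?thesis using True unfolding jp4 by (simp add: mult_ac)
    qed auto
    have "(\<integral>\<^sup>+a. ennreal (indicator ?Q a * K n (a - z)) \<partial>lborel)
       \<le> (\<integral>\<^sup>+a. ennreal (256 * C * japanese z powr (- 4)) * indicator ?Q a \<partial>lborel)"
    proof (intro nn_integral_mono)
      fix a
      show "ennreal (indicator ?Q a * K n (a - z)) \<le> ennreal (256 * C * japanese z powr (- 4)) * indicator ?Q a"
        using ennreal_leI[OF ker[of a]] by (cases "a \<in> ?Q") auto
    qed
    also have "\<dots> = ennreal (256 * C * japanese z powr (- 4)) * ennreal V"
      by (simp add: nn_integral_cmult_indicator V(1))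
    also have "\<dots> = ennreal (256 * C * V * japanese z powr (- 4))"
      using C0 V(2) by (simp add: ennreal_mult[symmetric] mult_ac)
    also have "\<dots> \<le> ennreal (C' * japanese z powr (- 4))"
      using \<rho> by (intro ennreal_leI mult_right_mono) (auto simp: C'_def)
    finally show ?thesis .
  qed
  have Wb: "cmod (W n z) \<le> C' * japanese z powr (- 4)" for n z
    unfolding W_def
    by (rule norm_integral_le_nn_integral)
      (use nnW[of n z] C'0 K0 in \<open>auto simp: abs_mult abs_of_nonneg simp del: of_real_mult\<close>)
  have fub: "(LINT a|lborel. indicator ?Q a * (LINT z|lborel. u z * of_real (K n (a - z)))) = (LINT z|lborel. u z * W n z)" for n
  proof -
    let ?f = "\<lambda>z a. u z * of_real (indicator ?Q a * K n (a - z))"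
    have "integrable (lborel \<Otimes>\<^sub>M lborel) (case_prod ?f)"
    proof (rule integrableI_bounded)
      show "case_prod ?f \<in> borel_measurable (lborel \<Otimes>\<^sub>M lborel)" by measurable
      have "(\<integral>\<^sup>+p. ennreal (cmod (case_prod ?f p)) \<partial>(lborel \<Otimes>\<^sub>M lborel))
        = (\<integral>\<^sup>+z. \<integral>\<^sup>+a. ennreal (cmod (?f z a)) \<partial>lborel \<partial>lborel)"
        by (subst lborel.nn_integral_fst[symmetric]) auto
      also have "\<dots> = (\<integral>\<^sup>+z. ennreal (cmod (u z)) * (\<integral>\<^sup>+a. ennreal (indicator ?Q a * K n (a - z)) \<partial>lborel) \<partial>lborel)"
      proof (rule nn_integral_cong)
        fix z
        have "(\<integral>\<^sup>+a. ennreal (cmod (?f z a)) \<partial>lborel) = (\<integral>\<^sup>+a. ennreal (cmod (u z)) * ennreal (indicator ?Q a * K n (a - z)) \<partial>lborel)"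
          using K0 by (intro nn_integral_cong) (simp add: norm_mult ennreal_mult[symmetric] abs_mult abs_of_nonneg del: of_real_mult)
        then show "(\<integral>\<^sup>+a. ennreal (cmod (?f z a)) \<partial>lborel) = ennreal (cmod (u z)) * (\<integral>\<^sup>+a. ennreal (indicator ?Q a * K n (a - z)) \<partial>lborel)"
          by (simp add: nn_integral_cmult)
      qed
      also have "\<dots> \<le> (\<integral>\<^sup>+z. ennreal C' * ennreal (cmod (u z) * japanese z powr (- 4)) \<partial>lborel)"
      proof (rule nn_integral_mono)
        fix z
        have "ennreal (cmod (u z)) * (\<integral>\<^sup>+a. ennreal (indicator ?Q a * K n (a - z)) \<partial>lborel) \<le> ennreal (cmod (u z)) * ennreal (C' * japanese z powr (- 4))"
          by (intro mult_left_mono nnW) auto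
        also have "\<dots> = ennreal C' * ennreal (cmod (u z) * japanese z powr (- 4))"
          using C'0 by (simp add: ennreal_mult[symmetric] mult_ac)
        finally show "ennreal (cmod (u z)) * (\<integral>\<^sup>+a. ennreal (indicator ?Q a * K n (a - z)) \<partial>lborel) \<le> ennreal C' * ennreal (cmod (u z) * japanese z powr (- 4))" .
      qed
      also have "\<dots> = ennreal C' * (\<integral>\<^sup>+z. ennreal (cmod (u z) * japanese z powr (- 4)) \<partial>lborel)"
        by (rule nn_integral_cmult) measurable
      also have "\<dots> < \<infinity>"
        using int by (simp add: integrable_iff_bounded ennreal_mult_less_top)
      finally show "(\<integral>\<^sup>+p. ennreal (cmod (case_prod ?f p)) \<partial>(lborel \<Otimes>\<^sub>M lborel)) < \<infinity>" .
    qed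
    then have "(LINT a|lborel. LINT z|lborel. ?f z a) = (LINT z|lborel. LINT a|lborel. ?f z a)"
      by (rule lborel_pair.Fubini_integral)
    moreover have "(LINT z|lborel. LINT a|lborel. ?f z a) = (LINT z|lborel. u z * W n z)"
      unfolding W_def integral_mult_right_zero ..
    moreover have "(LINT z|lborel. ?f z a) = indicator ?Q a * (LINT z|lborel. u z * of_real (K n (a - z)))" for a
      unfolding integral_mult_right_zero[symmetric]
      by (intro Bochner_Integration.integral_cong) (auto simp: indicator_def)
    ultimately show ?thesis by simp
  qed
  \<comment> \<open>Boundary points are excluded because the averaged indicator there mixes values
    from both sides; at all other points the indicator is locally constant.\<close>
  have Wlim: "(\<lambda>n. W n z) \<longlonglongrightarrow> indicator ?Q z" if z: "z \<notin> cbox l r - ?Q" for z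
  proof -
    have lim: "(\<lambda>n. z + t n *\<^sub>R x) \<longlonglongrightarrow> z" for x
      using tendsto_add[OF tendsto_const tendsto_scaleR[OF t(3) tendsto_const], of z x] by simp
    have ev: "\<forall>\<^sub>F n in sequentially. indicator ?Q (z + t n *\<^sub>R x) = (indicator ?Q z :: real)" for x
    proof (cases "z \<in> ?Q")
      case True
      then have "\<forall>\<^sub>F n in sequentially. z + t n *\<^sub>R x \<in> ?Q"
        by (rule topological_tendstoD[OF lim open_box])
      then show ?thesis by eventually_elim (use True in auto)
    next
      case False
      then have "z \<in> - cbox l r" using z by auto
      then have "\<forall>\<^sub>F n in sequentially. z + t n *\<^sub>R x \<in> - cbox l r"
        by (intro topological_tendstoD[OF lim]) auto
      then show ?thesis
        by eventually_elim (use False box_subset_cbox[of l r] in \<open>auto simp: indicator_def\<close>)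
    qed
    have "(\<lambda>n. W n z) \<longlonglongrightarrow> (LINT x|lborel. complex_of_real (indicator ?Q z * k x))"
      unfolding Waff
    proof (rule integral_dominated_convergence)
      show "integrable lborel k" by (rule integrableI_bounded) (auto simp: k0 k1 abs_of_nonneg)
      show "AE x in lborel. (\<lambda>n. complex_of_real (indicator ?Q (z + t n *\<^sub>R x) * k x)) \<longlonglongrightarrow> complex_of_real (indicator ?Q z * k x)"
      proof (intro AE_I2)
        fix x
        show "(\<lambda>n. complex_of_real (indicator ?Q (z + t n *\<^sub>R x) * k x)) \<longlonglongrightarrow> complex_of_real (indicator ?Q z * k x)"
          by (rule tendsto_eventually, rule eventually_mono[OF ev[of x]]) simp
      qed
      show "AE x in lborel. cmod (complex_of_real (indicator ?Q (z + t n *\<^sub>R x) * k x)) \<le> k x" for n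
        by (intro AE_I2) (auto simp: indicator_def k0)
    qed measurable
    also have "(LINT x|lborel. complex_of_real (indicator ?Q z * k x)) = of_real (indicator ?Q z * (LINT x|lborel. k x))"
      by simp
    also have "(LINT x|lborel. k x) = 1"
      by (subst integral_eq_nn_integral) (auto simp: k0 k1)
    finally show ?thesis by (cases "z \<in> ?Q") simp_all
  qed
  have "(\<lambda>n. LINT z|lborel. u z * W n z) \<longlonglongrightarrow> (LINT z|lborel. u z * indicator ?Q z)"
  proof (rule integral_dominated_convergence)
    show "integrable lborel (\<lambda>z. C' * (cmod (u z) * japanese z powr (- 4)))" by (rule integrable_mult_right[OF int])
    show "AE z in lborel. (\<lambda>n. u z * W n z) \<longlonglongrightarrow> u z * indicator ?Q z"
      using AE_not_in[OF null_sets_cbox_Diff_box[of l r]]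
      by eventually_elim (intro tendsto_mult tendsto_const Wlim)
    show "AE z in lborel. cmod (u z * W n z) \<le> C' * (cmod (u z) * japanese z powr (- 4))" for n
    proof (intro AE_I2)
      fix z
      show "cmod (u z * W n z) \<le> C' * (cmod (u z) * japanese z powr (- 4))"
        using mult_left_mono[OF Wb[of n z] norm_ge_zero[of "u z"]] by (simp add: norm_mult mult_ac)
    qed
  qed measurable
  then show ?thesis unfolding fub[symmetric] K_def by (simp add: mult.commute)
qed

text \<open>Integrated over any box, the averages tend to the integral of \<open>u\<close> by
  \<open>box_average_limit\<close> and to that of \<open>v\<close> by bounded convergence. This
  replaces a Lebesgue differentiation argument and serves both Fourier inversion and the Liouville
  theorem.\<close>

lemma AE_eq_limit_of_averages:
  fixes u v :: "complex \<Rightarrow> complex" and k :: "complex \<Rightarrow> real"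
  assumes u[measurable]: "u \<in> borel_measurable borel"
    and int: "integrable lborel (\<lambda>z. cmod (u z) * japanese z powr (- 4))"
    and k[measurable]: "k \<in> borel_measurable borel" and k0: "\<And>x. 0 \<le> k x"
    and kC: "\<And>x. k x \<le> C * japanese x powr (- 4)" and k1: "(\<integral>\<^sup>+x. ennreal (k x) \<partial>lborel) = 1"
    and t: "\<And>n. 0 < t n" "\<And>n. t n \<le> 1" "t \<longlonglongrightarrow> 0"
    and lim: "\<And>a. (\<lambda>n. LINT z|lborel. u z * of_real (k ((1 / t n) *\<^sub>R (a - z)) / (t n)\<^sup>2)) \<longlonglongrightarrow> v a"
    and bd: "\<And>n a. cmod (LINT z|lborel. u z * of_real (k ((1 / t n) *\<^sub>R (a - z)) / (t n)\<^sup>2)) \<le> B"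
  shows "AE z in lborel. u z = v z"
proof -
  define V where "V n a = (LINT z|lborel. u z * of_real (k ((1 / t n) *\<^sub>R (a - z)) / (t n)\<^sup>2))" for n a
  have [measurable]: "V n \<in> borel_measurable borel" for n unfolding V_def by measurable
  have v[measurable]: "v \<in> borel_measurable borel"
    by (rule borel_measurable_LIMSEQ_metric[of V]) (use lim in \<open>auto simp: V_def\<close>)
  have Bv: "cmod (v a) \<le> B" for a
    using tendsto_norm[OF lim[of a]] bd by (intro LIMSEQ_le_const2) auto
  have ib: "integrable lborel (\<lambda>z. indicator (box l r) z * B)" for l r :: complex
    by (intro integrable_mult_left integrable_real_indicator) (use emeasure_lborel_box_finite[of l r] in auto)
  have iv: "integrable lborel (\<lambda>z. indicator (box l r) z * v z)" for l r
    by (rule Bochner_Integration.integrable_bound[OF ib[of l r]])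
      (auto simp: indicator_def intro: order_trans[OF Bv abs_ge_self])
  have iu: "integrable lborel (\<lambda>z. indicator (box l r) z * u z)" for l r
  proof -
    obtain \<rho> where \<rho>: "box l r \<subseteq> ball 0 \<rho>" using bounded_subset_ballD[OF bounded_box, of l r 0] by auto
    show ?thesis
    proof (rule Bochner_Integration.integrable_bound)
      show "integrable lborel (\<lambda>z. (1 + \<bar>\<rho>\<bar>) ^ 4 * (cmod (u z) * japanese z powr (- 4)))"
        by (rule integrable_mult_right[OF int])
      show "AE z in lborel. cmod (indicator (box l r) z * u z) \<le> norm ((1 + \<bar>\<rho>\<bar>) ^ 4 * (cmod (u z) * japanese z powr (- 4)))"
      proof (intro AE_I2)
        fix z
        show "cmod (indicator (box l r) z * u z) \<le> norm ((1 + \<bar>\<rho>\<bar>) ^ 4 * (cmod (u z) * japanese z powr (- 4)))"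
        proof (cases "z \<in> box l r")
          case True
          then have "cmod z < \<rho>" using \<rho> by auto
          then have "japanese z ^ 4 \<le> (1 + \<bar>\<rho>\<bar>) ^ 4"
            using japanese_le_add[of z] by (intro power_mono) auto
          then have "1 \<le> (1 + \<bar>\<rho>\<bar>) ^ 4 * (1 / japanese z ^ 4)"
            using japanese_pos[of z] by (simp add: le_divide_eq)
          then have "cmod (u z) * 1 \<le> cmod (u z) * ((1 + \<bar>\<rho>\<bar>) ^ 4 * (1 / japanese z ^ 4))"
            by (intro mult_left_mono) auto
          moreover have "japanese z powr (- 4) = 1 / (japanese z) ^ 4" by (simp add: powr_minus_divide)
          ultimately show ?thesis using True by (simp add: abs_mult mult_ac)
        qed auto
      qed
    qed measurable
  qed
  have eq: "(LINT z|lborel. indicator (box l r) z * u z) = (LINT z|lborel. indicator (box l r) z * v z)" for l r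
  proof (rule LIMSEQ_unique)
    show "(\<lambda>n. LINT a|lborel. indicator (box l r) a * V n a) \<longlonglongrightarrow> (LINT z|lborel. indicator (box l r) z * u z)"
      unfolding V_def by (rule box_average_limit[OF u int k k0 kC k1 t])
    show "(\<lambda>n. LINT a|lborel. indicator (box l r) a * V n a) \<longlonglongrightarrow> (LINT z|lborel. indicator (box l r) z * v z)"
    proof (rule integral_dominated_convergence)
      show "integrable lborel (\<lambda>z. indicator (box l r) z * B)" by (rule ib)
      show "AE a in lborel. (\<lambda>n. indicator (box l r) a * V n a) \<longlonglongrightarrow> indicator (box l r) a * v a"
        unfolding V_def by (intro AE_I2 tendsto_mult tendsto_const lim)
      show "AE a in lborel. cmod (indicator (box l r) a * V n a) \<le> indicator (box l r) a * B" for n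
        using bd[of n] by (intro AE_I2) (auto simp: V_def indicator_def)
    qed measurable
  qed
  have "AE z in lborel. u z - v z = 0"
  proof (rule AE_zero_from_boxes)
    show "integrable lborel (\<lambda>z. indicator (box l r) z * (u z - v z))" for l r
      using Bochner_Integration.integrable_diff[OF iu[of l r] iv[of l r]] by (simp add: right_diff_distrib)
    show "(LINT z|lborel. indicator (box l r) z * (u z - v z)) = 0" for l r
      using Bochner_Integration.integral_diff[OF iu[of l r] iv[of l r]] eq[of l r] by (simp add: right_diff_distrib)
  qed measurable
  then show ?thesis by simp
qed

section \<open>Gaussians, their Fourier transforms and the multiplication formula\<close>

definition gauss :: "complex \<Rightarrow> real" where
  "gauss x = std_normal_density (Re x) * std_normal_density (Im x)"

lemma measurable_gauss [measurable]: "gauss \<in> borel_measurable borel"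
  unfolding gauss_def[abs_def] by measurable

lemma gauss_eq: "gauss x = exp (- (cmod x)\<^sup>2 / 2) / (2 * pi)"
proof -
  have "gauss x = (1 / (sqrt (2 * pi) * sqrt (2 * pi))) * (exp (- (Re x)\<^sup>2 / 2) * exp (- (Im x)\<^sup>2 / 2))"
    by (simp add: gauss_def std_normal_density_def)
  also have "sqrt (2 * pi) * sqrt (2 * pi) = 2 * pi" by simp
  also have "exp (- (Re x)\<^sup>2 / 2) * exp (- (Im x)\<^sup>2 / 2) = exp (- (cmod x)\<^sup>2 / 2)"
    unfolding exp_add[symmetric] cmod_power2 by (simp add: add_divide_distrib)
  finally show ?thesis by simp
qed

lemma gauss_nonneg: "0 \<le> gauss x"
  by (simp add: gauss_eq)

lemma gauss_le: "2 * pi * gauss x \<le> 1"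
  by (simp add: gauss_eq)

lemma gauss_le_1: "gauss x \<le> 1"
  using gauss_le[of x] gauss_nonneg[of x] mult_right_mono[of 1 "2 * pi" "gauss x"] pi_gt3 by simp

lemma gauss_japanese: "gauss x \<le> 16 * japanese x powr (- 4)"
proof -
  define s where "s = (cmod x)\<^sup>2"
  have s: "0 \<le> s" by (simp add: s_def)
  have "(1 + s) / 4 \<le> 1 + s / 4" using s by simp
  also have "\<dots> \<le> exp (s / 4)" by (rule exp_ge_add_one_self)
  finally have "(1 + s) / 4 \<le> exp (s / 4)" .
  then have "((1 + s) / 4)\<^sup>2 \<le> (exp (s / 4))\<^sup>2" using s by (intro power_mono) auto
  also have "(exp (s / 4))\<^sup>2 = exp (s / 2)" by (simp add: power2_eq_square exp_add[symmetric])
  finally have "(1 + s)\<^sup>2 \<le> 16 * exp (s / 2)" by (simp add: power_divide)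
  then have "exp (- s / 2) \<le> 16 / (1 + s)\<^sup>2"
    using s by (simp add: exp_minus divide_simps)
  moreover have "exp (- s / 2) / (2 * pi) \<le> exp (- s / 2) / 1"
    using pi_gt3 by (intro divide_left_mono) auto
  ultimately have "gauss x \<le> 16 / (1 + s)\<^sup>2" by (simp add: gauss_eq s_def)
  also have "16 / (1 + s)\<^sup>2 = 16 * (1 / (japanese x) ^ 4)"
    unfolding s_def japanese_squared[symmetric] by (simp add: power_mult[symmetric])
  also have "1 / (japanese x) ^ 4 = japanese x powr (- 4)" by (simp add: powr_minus_divide)
  finally show ?thesis .
qed

lemma nn_integral_std_normal: "(\<integral>\<^sup>+x. ennreal (std_normal_density x) \<partial>lborel) = 1"
  by (subst nn_integral_eq_integral) auto

lemma nn_integral_gauss: "(\<integral>\<^sup>+x. ennreal (gauss x) \<partial>lborel) = 1"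
  by (subst nn_integral_complex)
     (auto simp: gauss_def ennreal_mult nn_integral_cmult nn_integral_std_normal)

lemma integrable_gauss: "integrable lborel gauss"
  by (rule integrableI_bounded) (auto simp: nn_integral_gauss gauss_nonneg abs_of_nonneg)

text \<open>The left side is the characteristic function of the standard normal law.\<close>

lemma std_normal_fourier:
  "(LINT x|lborel. of_real (std_normal_density x) * iexp (t * x)) = complex_of_real (exp (- t\<^sup>2 / 2))"
proof -
  have "char std_normal_distribution t = complex_of_real (exp (- t\<^sup>2 / 2))"
    by (simp add: char_std_normal_distribution)
  then show ?thesis
    unfolding char_def by (subst (asm) integral_density) (auto simp: scaleR_conv_of_real)
qed

lemma gauss_fourier: "(LINT \<eta>|lborel. ephase \<eta> y * of_real (gauss \<eta>)) = complex_of_real (2 * pi * gauss y)"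
proof -
  let ?f = "\<lambda>\<eta>. ephase \<eta> y * of_real (gauss \<eta>)"
  have i: "integrable lborel ?f"
    by (rule Bochner_Integration.integrable_bound[OF integrable_gauss]) (auto simp: norm_mult)
  have eq: "?f (Complex a b) = (of_real (std_normal_density a) * iexp (Re y * a)) * (of_real (std_normal_density b) * iexp (Im y * b))" for a b
  proof -
    have "ephase (Complex a b) y = iexp (Re y * a) * iexp (Im y * b)"
      unfolding ephase_def exp_add[symmetric] by (simp add: algebra_simps)
    then show ?thesis by (simp add: gauss_def mult_ac)
  qed
  have "(LINT \<eta>|lborel. ?f \<eta>) = (LINT a|lborel. LINT b|lborel. ?f (Complex a b))"
    using lborel_pair.integral_fst[OF integrable_complex_prod[OF i]] by (simp add: integral_complex_prod case_prod_unfold)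
  also have "\<dots> = of_real (exp (- (Re y)\<^sup>2 / 2)) * of_real (exp (- (Im y)\<^sup>2 / 2))"
    unfolding eq integral_mult_right_zero integral_mult_left_zero std_normal_fourier ..
  also have "\<dots> = of_real (exp (- (cmod y)\<^sup>2 / 2))"
    unfolding of_real_mult[symmetric] exp_add[symmetric] cmod_power2 by (simp add: add_divide_distrib)
  also have "exp (- (cmod y)\<^sup>2 / 2) = 2 * pi * gauss y" by (simp add: gauss_eq)
  finally show ?thesis .
qed

lemma integrable_gauss_scaled:
  assumes t: "0 < t"
  shows "integrable lborel (\<lambda>\<xi>. gauss (t *\<^sub>R \<xi>))" "integrable lborel (\<lambda>z. gauss ((1 / t) *\<^sub>R (a - z)) / t\<^sup>2)"
proof -
  have *: "integrable lborel (\<lambda>z. gauss (b + c *\<^sub>R z))" if "c \<noteq> 0" for b :: complex and c :: real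
  proof -
    have "integrable lborel (\<lambda>z. complex_of_real (gauss (b + c *\<^sub>R z)))"
      using integrable_complex_affine[of "\<lambda>z. complex_of_real (gauss z)" c b] integrable_gauss that by simp
    then show ?thesis by (simp add: complex_of_real_integrable_eq)
  qed
  show "integrable lborel (\<lambda>\<xi>. gauss (t *\<^sub>R \<xi>))" using *[of t 0] t by simp
  have "(1 / t) *\<^sub>R (a - z) = (1 / t) *\<^sub>R a + (- (1 / t)) *\<^sub>R z" for z
    by (simp add: scaleR_diff_right)
  then show "integrable lborel (\<lambda>z. gauss ((1 / t) *\<^sub>R (a - z)) / t\<^sup>2)"
    using *[of "- (1 / t)" "(1 / t) *\<^sub>R a"] t by simp
qed

text \<open>The multiplier \<open>2 * pi * gauss (t *\<^sub>R \<xi>)\<close> is exp(-t^2 |\<xi>|^2 /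
  2), which tends to 1 as t \<rightarrow> 0. One factor 2 pi comes from this normalisation and one
  from the transform of the Gaussian; together they give the constant of the inversion
  formula.\<close>

lemma gauss_scaled_fourier:
  assumes t: "0 < t"
  shows "(LINT \<xi>|lborel. ephase (- \<xi>) z * (ephase \<xi> a * of_real (2 * pi * gauss (t *\<^sub>R \<xi>))))
    = complex_of_real ((2 * pi)\<^sup>2 * (gauss ((1 / t) *\<^sub>R (a - z)) / t\<^sup>2))"
proof -
  have "(LINT \<xi>|lborel. ephase (- \<xi>) z * (ephase \<xi> a * of_real (2 * pi * gauss (t *\<^sub>R \<xi>))))
     = of_real ((1 / t)\<^sup>2) * (LINT \<xi>|lborel. ephase (- (0 + (1 / t) *\<^sub>R \<xi>)) z * (ephase (0 + (1 / t) *\<^sub>R \<xi>) a * of_real (2 * pi * gauss (t *\<^sub>R (0 + (1 / t) *\<^sub>R \<xi>)))))"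
    using t by (intro integral_complex_affine) auto
  also have "(LINT \<xi>|lborel. ephase (- (0 + (1 / t) *\<^sub>R \<xi>)) z * (ephase (0 + (1 / t) *\<^sub>R \<xi>) a * of_real (2 * pi * gauss (t *\<^sub>R (0 + (1 / t) *\<^sub>R \<xi>)))))
     = (LINT \<xi>|lborel. of_real (2 * pi) * (ephase \<xi> ((1 / t) *\<^sub>R (a - z)) * of_real (gauss \<xi>)))"
  proof (rule Bochner_Integration.integral_cong[OF refl])
    fix \<xi>
    have "ephase (- (0 + (1 / t) *\<^sub>R \<xi>)) z * ephase (0 + (1 / t) *\<^sub>R \<xi>) a = ephase \<xi> ((1 / t) *\<^sub>R (a - z))"
      unfolding ephase_def exp_add[symmetric] using t by (simp add: field_simps)
    then show "ephase (- (0 + (1 / t) *\<^sub>R \<xi>)) z * (ephase (0 + (1 / t) *\<^sub>R \<xi>) a * of_real (2 * pi * gauss (t *\<^sub>R (0 + (1 / t) *\<^sub>R \<xi>))))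
      = of_real (2 * pi) * (ephase \<xi> ((1 / t) *\<^sub>R (a - z)) * of_real (gauss \<xi>))"
      using t by (simp add: mult.assoc[symmetric])
  qed
  also have "\<dots> = of_real (2 * pi) * of_real (2 * pi * gauss ((1 / t) *\<^sub>R (a - z)))"
    unfolding integral_mult_right_zero gauss_fourier ..
  also have "of_real ((1 / t)\<^sup>2) * (of_real (2 * pi) * of_real (2 * pi * gauss ((1 / t) *\<^sub>R (a - z))))
     = complex_of_real ((2 * pi)\<^sup>2 * (gauss ((1 / t) *\<^sub>R (a - z)) / t\<^sup>2))"
    unfolding of_real_mult[symmetric] by (rule arg_cong[where f=of_real]) (simp add: power2_eq_square)
  finally show ?thesis .
qed

lemma fourier_duality:
  assumes u: "integrable lborel u" and p: "integrable lborel p"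
  shows "(LINT \<xi>|lborel. fourier u \<xi> * p \<xi>) = (LINT z|lborel. u z * (LINT \<xi>|lborel. ephase (- \<xi>) z * p \<xi>))"
proof -
  have [measurable]: "u \<in> borel_measurable borel" "p \<in> borel_measurable borel"
    using borel_measurable_integrable[OF u] borel_measurable_integrable[OF p] by simp_all
  let ?f = "\<lambda>z \<xi>. u z * (ephase (- \<xi>) z * p \<xi>)"
  have "integrable (lborel \<Otimes>\<^sub>M lborel) (case_prod ?f)"
  proof (rule integrableI_bounded)
    show "case_prod ?f \<in> borel_measurable (lborel \<Otimes>\<^sub>M lborel)" by measurable
    have "(\<integral>\<^sup>+q. ennreal (cmod (case_prod ?f q)) \<partial>(lborel \<Otimes>\<^sub>M lborel))
        = (\<integral>\<^sup>+z. \<integral>\<^sup>+\<xi>. ennreal (cmod (u z)) * ennreal (cmod (p \<xi>)) \<partial>lborel \<partial>lborel)"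
      by (subst lborel.nn_integral_fst[symmetric]) (auto simp: norm_mult ennreal_mult)
    also have "\<dots> = (\<integral>\<^sup>+z. ennreal (cmod (u z)) \<partial>lborel) * (\<integral>\<^sup>+\<xi>. ennreal (cmod (p \<xi>)) \<partial>lborel)"
      by (subst nn_integral_cmult, measurable, subst nn_integral_multc, measurable)
    also have "\<dots> < \<infinity>"
      using u p by (simp add: integrable_iff_bounded ennreal_mult_less_top)
    finally show "(\<integral>\<^sup>+q. ennreal (cmod (case_prod ?f q)) \<partial>(lborel \<Otimes>\<^sub>M lborel)) < \<infinity>" .
  qed
  then have "(LINT \<xi>|lborel. LINT z|lborel. ?f z \<xi>) = (LINT z|lborel. LINT \<xi>|lborel. ?f z \<xi>)"
    by (rule lborel_pair.Fubini_integral)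
  moreover have "(LINT z|lborel. ?f z \<xi>) = fourier u \<xi> * p \<xi>" for \<xi>
  proof -
    have "ephase (- \<xi>) z = exp (- \<i> * of_real (z \<bullet> \<xi>))" for z
      by (simp add: ephase_def inner_complex_def algebra_simps)
    then show ?thesis
      unfolding fourier_def integral_mult_left_zero[symmetric]
      by (intro Bochner_Integration.integral_cong) (auto simp: mult_ac)
  qed
  ultimately show ?thesis by simp
qed

section \<open>Plancherel pairing and inversion for an integrable transform\<close>

lemma L2_nn_integral: "u \<in> L2 \<longleftrightarrow> u \<in> borel_measurable borel \<and> (\<integral>\<^sup>+z. (ennreal (cmod (u z)))\<^sup>2 \<partial>lborel) < \<infinity>"
  by (auto simp: L2_def integrable_iff_bounded ennreal_power)

lemma integrable_L2_mult:
  assumes f: "f \<in> L2" and g: "g \<in> L2"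
  shows "integrable lborel (\<lambda>z. f z * g z)"
proof (rule Bochner_Integration.integrable_bound)
  have [measurable]: "f \<in> borel_measurable borel" "g \<in> borel_measurable borel"
    using f g by (auto simp: L2_def)
  show "integrable lborel (\<lambda>z. (cmod (f z))\<^sup>2 + (cmod (g z))\<^sup>2)"
    using f g by (intro Bochner_Integration.integrable_add) (auto simp: L2_def)
  have "a * b \<le> a\<^sup>2 + b\<^sup>2" for a b :: real
    using sum_squares_bound[of a b] zero_le_power2[of a] zero_le_power2[of b] by linarith
  then show "AE z in lborel. cmod (f z * g z) \<le> norm ((cmod (f z))\<^sup>2 + (cmod (g z))\<^sup>2)"
    by (simp add: norm_mult)
  show "(\<lambda>z. f z * g z) \<in> borel_measurable lborel" by measurable
qed

lemma integrable_L2_ball: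
  assumes u: "u \<in> L2"
  shows "integrable lborel (\<lambda>z. indicator (ball 0 R) z * u z)"
proof (rule integrable_L2_mult[OF _ u])
  have "(\<lambda>z::complex. indicator (ball 0 R) z :: real) = (\<lambda>z. (cmod (indicator (ball 0 R) z))\<^sup>2)"
    by (auto simp: indicator_def fun_eq_iff)
  moreover have "integrable lborel (\<lambda>z::complex. indicator (ball 0 R) z :: real)"
    using emeasure_lborel_ball_finite[of 0 R] by (intro integrable_real_indicator) auto
  ultimately show "(indicator (ball 0 R) :: complex \<Rightarrow> complex) \<in> L2"
    by (simp add: L2_def borel_measurable_indicator)
qed

lemma measurable_fourier:
  assumes [measurable]: "u \<in> borel_measurable borel"
  shows "fourier u \<in> borel_measurable borel"
  unfolding fourier_def[abs_def] by measurable

text \<open>Each truncation of \<open>u\<close> is integrable, so \<open>fourier_duality\<close>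
  applies to it. Its transform tends to \<open>g\<close> in L^2, and pairing with \<open>p\<close>
  in L^2 is continuous by Cauchy--Schwarz.\<close>

lemma plancherel_pairing:
  assumes pl: "has_plancherel u g" and p: "p \<in> L2" "integrable lborel p"
  shows "(\<lambda>n. LINT z|lborel. indicator (ball 0 (real n)) z * u z * (LINT \<xi>|lborel. ephase (- \<xi>) z * p \<xi>))
     \<longlonglongrightarrow> (LINT \<xi>|lborel. g \<xi> * p \<xi>)"
proof -
  have u: "u \<in> L2" and g: "g \<in> L2"
    and lim: "((\<lambda>R. \<integral>\<^sup>+ \<xi>. ennreal ((cmod (fourier (\<lambda>z. indicator (ball 0 R) z * u z) \<xi> - g \<xi>))\<^sup>2) \<partial>lborel) \<longlongrightarrow> 0) at_top"
    using pl by (auto simp: has_plancherel_def)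
  have [measurable]: "u \<in> borel_measurable borel" "g \<in> borel_measurable borel" "p \<in> borel_measurable borel"
    using u g p by (auto simp: L2_def)
  define U where "U n = fourier (\<lambda>z. indicator (ball 0 (real n)) z * u z)" for n :: nat
  have [measurable]: "U n \<in> borel_measurable borel" for n
    unfolding U_def by (rule measurable_fourier) (intro borel_measurable_times borel_measurable_indicator; simp)
  define N where "N n = (\<integral>\<^sup>+ \<xi>. ennreal ((cmod (U n \<xi> - g \<xi>))\<^sup>2) \<partial>lborel)" for n
  have Nlim: "N \<longlonglongrightarrow> 0"
    unfolding N_def U_def by (rule filterlim_compose[OF lim filterlim_real_sequentially])
  obtain P where P: "(\<integral>\<^sup>+ \<xi>. (ennreal (cmod (p \<xi>)))\<^sup>2 \<partial>lborel) = ennreal P" "0 \<le> P"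
    using p(1) unfolding L2_nn_integral by (cases "\<integral>\<^sup>+ \<xi>. (ennreal (cmod (p \<xi>)))\<^sup>2 \<partial>lborel") auto
  have ig: "integrable lborel (\<lambda>\<xi>. g \<xi> * p \<xi>)" by (rule integrable_L2_mult[OF g p(1)])
  have iU: "integrable lborel (\<lambda>\<xi>. U n \<xi> * p \<xi>)" for n
  proof (rule Bochner_Integration.integrable_bound)
    let ?un = "\<lambda>z. indicator (ball 0 (real n)) z * u z"
    define B where "B = (LINT z|lborel. cmod (?un z))"
    have B: "cmod (U n \<xi>) \<le> B" for \<xi>
    proof -
      have "cmod (U n \<xi>) \<le> (LINT z|lborel. cmod (exp (- \<i> * of_real (z \<bullet> \<xi>)) * ?un z))"
        unfolding U_def fourier_def by (rule integral_norm_bound)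
      also have "\<dots> = B" unfolding B_def by (simp add: norm_mult)
      finally show ?thesis .
    qed
    show "integrable lborel (\<lambda>\<xi>. B * cmod (p \<xi>))" using p(2) by (intro integrable_mult_right integrable_norm)
    show "AE \<xi> in lborel. cmod (U n \<xi> * p \<xi>) \<le> norm (B * cmod (p \<xi>))"
    proof (intro AE_I2)
      fix \<xi>
      show "cmod (U n \<xi> * p \<xi>) \<le> norm (B * cmod (p \<xi>))"
        using mult_right_mono[OF order_trans[OF B[of \<xi>] abs_ge_self] norm_ge_zero[of "p \<xi>"]] by (simp add: norm_mult abs_mult)
    qed
  qed measurable
  define d where "d n = (LINT \<xi>|lborel. U n \<xi> * p \<xi>) - (LINT \<xi>|lborel. g \<xi> * p \<xi>)" for n
  have dle: "ennreal ((cmod (d n))\<^sup>2) \<le> N n * ennreal P" for n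
  proof -
    have "d n = (LINT \<xi>|lborel. (U n \<xi> - g \<xi>) * p \<xi>)"
      unfolding d_def using Bochner_Integration.integral_diff[OF iU[of n] ig] by (simp add: left_diff_distrib)
    moreover have "integrable lborel (\<lambda>\<xi>. (U n \<xi> - g \<xi>) * p \<xi>)"
      using Bochner_Integration.integrable_diff[OF iU[of n] ig] by (simp add: left_diff_distrib)
    ultimately have "ennreal (cmod (d n)) \<le> (\<integral>\<^sup>+\<xi>. ennreal (cmod ((U n \<xi> - g \<xi>) * p \<xi>)) \<partial>lborel)"
      using integral_norm_bound_ennreal by metis
    also have "\<dots> = (\<integral>\<^sup>+\<xi>. ennreal (cmod (U n \<xi> - g \<xi>)) * ennreal (cmod (p \<xi>)) \<partial>lborel)"
      by (simp add: norm_mult ennreal_mult)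
    finally have "(ennreal (cmod (d n)))\<^sup>2 \<le> (\<integral>\<^sup>+\<xi>. ennreal (cmod (U n \<xi> - g \<xi>)) * ennreal (cmod (p \<xi>)) \<partial>lborel)\<^sup>2"
      by (intro power_mono) auto
    also have "\<dots> \<le> (\<integral>\<^sup>+\<xi>. (ennreal (cmod (U n \<xi> - g \<xi>)))\<^sup>2 \<partial>lborel) * (\<integral>\<^sup>+\<xi>. (ennreal (cmod (p \<xi>)))\<^sup>2 \<partial>lborel)"
      by (rule Cauchy_Schwarz_nn_integral) measurable
    finally show ?thesis unfolding P(1) by (simp add: N_def ennreal_power)
  qed
  have "(\<lambda>n. ennreal ((cmod (d n))\<^sup>2)) \<longlonglongrightarrow> ennreal 0"
  proof (rule tendsto_sandwich[where f="\<lambda>_. 0"])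
    have "(\<lambda>n. ennreal P * N n) \<longlonglongrightarrow> ennreal P * 0"
      by (rule ennreal_tendsto_cmult[OF _ Nlim]) simp
    then show "(\<lambda>n. N n * ennreal P) \<longlonglongrightarrow> ennreal 0" by (simp add: mult.commute)
  qed (use dle in auto)
  then have "(\<lambda>n. (cmod (d n))\<^sup>2) \<longlonglongrightarrow> 0"
    by (subst (asm) tendsto_ennreal_iff) auto
  then have "(\<lambda>n. sqrt ((cmod (d n))\<^sup>2)) \<longlonglongrightarrow> sqrt 0" by (rule tendsto_real_sqrt)
  then have "d \<longlonglongrightarrow> 0" by (simp add: tendsto_norm_zero_iff)
  then have "(\<lambda>n. LINT \<xi>|lborel. U n \<xi> * p \<xi>) \<longlonglongrightarrow> (LINT \<xi>|lborel. g \<xi> * p \<xi>)"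
    unfolding d_def by (rule LIM_zero_cancel)
  then show ?thesis
    unfolding U_def fourier_duality[OF integrable_L2_ball[OF u] p(2)] .
qed

text \<open>Pairing with a plane wave damped by a Gaussian turns the Plancherel relation into an
  average of \<open>u\<close> at width t. As t \<rightarrow> 0 the damping disappears, with |g| as
  dominating function, and the averages identify \<open>u\<close> almost everywhere.\<close>

theorem fourier_inversion:
  assumes pl: "has_plancherel u g" and g1: "integrable lborel g"
  shows "AE z in lborel. u z = (LINT \<xi>|lborel. g \<xi> / of_real ((2 * pi)\<^sup>2) * ephase \<xi> z)"
proof -
  have u: "u \<in> L2" using pl by (simp add: has_plancherel_def)
  have [measurable]: "u \<in> borel_measurable borel" "g \<in> borel_measurable borel"
    using u borel_measurable_integrable[OF g1] by (auto simp: L2_def)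
  have [measurable]: "ball (0::complex) r \<in> sets borel" for r by simp
  define t :: "nat \<Rightarrow> real" where "t n = 1 / (real n + 1)" for n
  have t: "0 < t n" "t n \<le> 1" for n by (auto simp: t_def add_nonneg_pos)
  have tlim: "t \<longlonglongrightarrow> 0" unfolding t_def by real_asymp
  define c where "c = complex_of_real ((2 * pi)\<^sup>2)"
  have c: "c \<noteq> 0" by (simp add: c_def)
  have rep: "(LINT z|lborel. u z * of_real (gauss ((1 / t n) *\<^sub>R (a - z)) / (t n)\<^sup>2))
     = (LINT \<xi>|lborel. g \<xi> / c * (ephase \<xi> a * of_real (2 * pi * gauss (t n *\<^sub>R \<xi>))))" for n a
  proof -
    let ?p = "\<lambda>\<xi>. ephase \<xi> a * complex_of_real (2 * pi * gauss (t n *\<^sub>R \<xi>))"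
    let ?k = "\<lambda>z. complex_of_real (gauss ((1 / t n) *\<^sub>R (a - z)) / (t n)\<^sup>2)"
    have pm[measurable]: "?p \<in> borel_measurable borel" by measurable
    have pn: "cmod (?p \<xi>) = 2 * pi * gauss (t n *\<^sub>R \<xi>)" for \<xi>
      using gauss_nonneg by (simp add: norm_mult abs_mult abs_of_nonneg del: of_real_mult)
    have ip: "integrable lborel ?p"
      by (rule Bochner_Integration.integrable_bound[OF integrable_mult_right[OF integrable_gauss_scaled(1)[OF t(1)[of n]], of "2 * pi"]])
         (auto simp: pn simp del: of_real_mult intro: order_trans[OF _ abs_ge_self])
    have p2: "?p \<in> L2"
      unfolding L2_def
    proof (intro CollectI conjI)
      show "integrable lborel (\<lambda>\<xi>. (cmod (?p \<xi>))\<^sup>2)"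
      proof (rule Bochner_Integration.integrable_bound[OF integrable_norm[OF ip]])
        show "AE \<xi> in lborel. norm ((cmod (?p \<xi>))\<^sup>2) \<le> norm (cmod (?p \<xi>))"
        proof (intro AE_I2)
          fix \<xi>
          have "(cmod (?p \<xi>)) ^ 2 \<le> (cmod (?p \<xi>)) ^ 1"
            unfolding pn using gauss_le gauss_nonneg by (intro power_decreasing) auto
          then show "norm ((cmod (?p \<xi>))\<^sup>2) \<le> norm (cmod (?p \<xi>))" by simp
        qed
      qed measurable
    qed measurable
    have k2: "?k \<in> L2"
      unfolding L2_def
    proof (intro CollectI conjI)
      show "integrable lborel (\<lambda>z. (cmod (?k z))\<^sup>2)"
      proof (rule Bochner_Integration.integrable_bound)
        show "integrable lborel (\<lambda>z. 1 / (t n)\<^sup>2 * (gauss ((1 / t n) *\<^sub>R (a - z)) / (t n)\<^sup>2))"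
          by (intro integrable_mult_right integrable_gauss_scaled(2) t)
        show "AE z in lborel. norm ((cmod (?k z))\<^sup>2) \<le> norm (1 / (t n)\<^sup>2 * (gauss ((1 / t n) *\<^sub>R (a - z)) / (t n)\<^sup>2))"
        proof (intro AE_I2)
          fix z
          define G where "G = gauss ((1 / t n) *\<^sub>R (a - z)) / (t n)\<^sup>2"
          have G: "0 \<le> G" "G \<le> 1 / (t n)\<^sup>2"
            using gauss_nonneg gauss_le_1 by (auto simp: G_def intro: divide_right_mono)
          have "G\<^sup>2 \<le> 1 / (t n)\<^sup>2 * G"
            using mult_right_mono[OF G(2,1)] by (simp add: power2_eq_square)
          from order_trans[OF this abs_ge_self]
          show "norm ((cmod (?k z))\<^sup>2) \<le> norm (1 / (t n)\<^sup>2 * (gauss ((1 / t n) *\<^sub>R (a - z)) / (t n)\<^sup>2))"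
            unfolding G_def[symmetric] norm_of_real power2_abs real_norm_def abs_of_nonneg[OF zero_le_power2] .
        qed
      qed measurable
    qed measurable
    have iuk: "integrable lborel (\<lambda>z. u z * ?k z)" by (rule integrable_L2_mult[OF u k2])
    have F: "(LINT \<xi>|lborel. ephase (- \<xi>) z * ?p \<xi>) = c * ?k z" for z
      unfolding gauss_scaled_fourier[OF t(1)] c_def by simp
    have "(\<lambda>n'. LINT z|lborel. indicator (ball 0 (real n')) z * u z * (c * ?k z)) \<longlonglongrightarrow> (LINT \<xi>|lborel. g \<xi> * ?p \<xi>)"
      using plancherel_pairing[OF pl p2 ip] unfolding F .
    moreover have "(\<lambda>n'. LINT z|lborel. indicator (ball 0 (real n')) z * u z * (c * ?k z)) \<longlonglongrightarrow> (LINT z|lborel. c * (u z * ?k z))"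
    proof (rule integral_dominated_convergence)
      show "integrable lborel (\<lambda>z. cmod (c * (u z * ?k z)))" by (intro integrable_norm integrable_mult_right iuk)
      show "AE z in lborel. (\<lambda>n'. indicator (ball 0 (real n')) z * u z * (c * ?k z)) \<longlonglongrightarrow> c * (u z * ?k z)"
      proof (intro AE_I2 tendsto_eventually)
        fix z :: complex
        obtain N where "cmod z < real N" using reals_Archimedean2 by blast
        then have "\<forall>m\<ge>N. indicator (ball 0 (real m)) z * u z * (c * ?k z) = c * (u z * ?k z)"
          by (auto simp: indicator_def)
        then show "\<forall>\<^sub>F m in sequentially. indicator (ball 0 (real m)) z * u z * (c * ?k z) = c * (u z * ?k z)"
          unfolding eventually_sequentially by blast
      qed
      show "AE z in lborel. cmod (indicator (ball 0 (real m)) z * u z * (c * ?k z)) \<le> cmod (c * (u z * ?k z))" for m :: nat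
        by (intro AE_I2) (auto simp: indicator_def norm_mult norm_divide mult_ac)
    qed measurable
    ultimately have "c * (LINT z|lborel. u z * ?k z) = (LINT \<xi>|lborel. g \<xi> * ?p \<xi>)"
      unfolding integral_mult_right_zero by (rule LIMSEQ_unique[rotated])
    then have "(LINT z|lborel. u z * ?k z) = (LINT \<xi>|lborel. g \<xi> * ?p \<xi>) / c"
      using c by (simp add: field_simps)
    also have "\<dots> = (LINT \<xi>|lborel. g \<xi> * ?p \<xi> / c)" by (rule integral_divide_zero[symmetric])
    finally show ?thesis by simp
  qed
  have bound: "cmod (g \<xi> / c * (ephase \<xi> a * of_real (2 * pi * gauss (t n *\<^sub>R \<xi>)))) \<le> cmod (g \<xi> / c)" for \<xi> a n
  proof -
    have "cmod (ephase \<xi> a * complex_of_real (2 * pi * gauss (t n *\<^sub>R \<xi>))) \<le> 1"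
      using gauss_le[of "t n *\<^sub>R \<xi>"] gauss_nonneg[of "t n *\<^sub>R \<xi>"]
      unfolding norm_mult norm_ephase norm_of_real by (simp add: abs_of_nonneg)
    from mult_left_mono[OF this norm_ge_zero[of "g \<xi> / c"]] show ?thesis
      by (simp only: norm_mult mult_1_right)
  qed
  have igc: "integrable lborel (\<lambda>\<xi>. g \<xi> / c)" using g1 by (rule integrable_divide_zero)
  show ?thesis
    unfolding c_def[symmetric]
  proof (rule AE_eq_limit_of_averages[where k=gauss and t=t and C=16])
    show "integrable lborel (\<lambda>z. cmod (u z) * japanese z powr (- 4))"
    proof -
      have "(\<lambda>z. complex_of_real (japanese z powr (- 4))) \<in> L2"
      proof -
        have "(\<integral>\<^sup>+z. (ennreal (cmod (complex_of_real (japanese z powr (- 4)))))\<^sup>2 \<partial>lborel) = (\<integral>\<^sup>+z. ennreal (japanese z powr (- 8)) \<partial>lborel)"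
          by (intro nn_integral_cong) (simp add: power2_eq_square ennreal_mult[symmetric] powr_add[symmetric])
        then show ?thesis unfolding L2_nn_integral using nn_integral_japanese[of 8] by simp
      qed
      from integrable_norm[OF integrable_L2_mult[OF u this]] show ?thesis by (simp add: norm_mult)
    qed
    show "(\<lambda>n. LINT z|lborel. u z * of_real (gauss ((1 / t n) *\<^sub>R (a - z)) / (t n)\<^sup>2)) \<longlonglongrightarrow> (LINT \<xi>|lborel. g \<xi> / c * ephase \<xi> a)" for a
      unfolding rep
    proof (rule integral_dominated_convergence)
      show "integrable lborel (\<lambda>\<xi>. cmod (g \<xi> / c))" by (rule integrable_norm[OF igc])
      show "AE \<xi> in lborel. (\<lambda>n. g \<xi> / c * (ephase \<xi> a * of_real (2 * pi * gauss (t n *\<^sub>R \<xi>)))) \<longlonglongrightarrow> g \<xi> / c * ephase \<xi> a"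
      proof (intro AE_I2)
        fix \<xi>
        have "(\<lambda>n. exp (- (cmod (t n *\<^sub>R \<xi>))\<^sup>2 / 2)) \<longlonglongrightarrow> exp (- (cmod (0 *\<^sub>R \<xi>))\<^sup>2 / 2)"
          by (intro tendsto_exp tendsto_divide tendsto_minus tendsto_power tendsto_norm tendsto_scaleR tlim tendsto_const) simp
        then have "(\<lambda>n. 2 * pi * gauss (t n *\<^sub>R \<xi>)) \<longlonglongrightarrow> 1" by (simp add: gauss_eq)
        then have "(\<lambda>n. g \<xi> / c * (ephase \<xi> a * of_real (2 * pi * gauss (t n *\<^sub>R \<xi>)))) \<longlonglongrightarrow> g \<xi> / c * (ephase \<xi> a * of_real 1)"
          by (intro tendsto_mult tendsto_const tendsto_of_real)
        then show "(\<lambda>n. g \<xi> / c * (ephase \<xi> a * of_real (2 * pi * gauss (t n *\<^sub>R \<xi>)))) \<longlonglongrightarrow> g \<xi> / c * ephase \<xi> a" by simp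
      qed
      show "AE \<xi> in lborel. cmod (g \<xi> / c * (ephase \<xi> a * of_real (2 * pi * gauss (t n *\<^sub>R \<xi>)))) \<le> cmod (g \<xi> / c)" for n
        by (intro AE_I2 bound)
    qed measurable
    show "cmod (LINT z|lborel. u z * of_real (gauss ((1 / t n) *\<^sub>R (a - z)) / (t n)\<^sup>2)) \<le> (LINT \<xi>|lborel. cmod (g \<xi> / c))" for n a
      unfolding rep
    proof (rule Bochner_Integration.integral_norm_bound_integral)
      show "integrable lborel (\<lambda>\<xi>. cmod (g \<xi> / c))" by (rule integrable_norm[OF igc])
      show "integrable lborel (\<lambda>\<xi>. g \<xi> / c * (ephase \<xi> a * of_real (2 * pi * gauss (t n *\<^sub>R \<xi>))))"
        by (rule Bochner_Integration.integrable_bound[OF integrable_norm[OF igc]]) (use bound in auto)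
    qed (rule bound)
  qed (auto simp: gauss_nonneg gauss_japanese nn_integral_gauss t tlim)
qed

section \<open>Test functions and distributional derivatives\<close>

lemma C_k_Suc_iff: "C_k (Suc n) f \<longleftrightarrow> (\<exists>fx fy. C_k n fx \<and> C_k n fy \<and> has_partials f fx fy)"
  by (simp add: has_partials_def)

declare C_k.simps(2) [simp del]

lemma C_k_SucI: "has_partials f fx fy \<Longrightarrow> C_k n fx \<Longrightarrow> C_k n fy \<Longrightarrow> C_k (Suc n) f"
  unfolding C_k_Suc_iff by blast

lemma C_k_SucD: "C_k (Suc n) f \<Longrightarrow> C_k n f"
proof (induction n arbitrary: f)
  case 0
  then show ?case by (auto simp: C_k_Suc_iff intro: has_partials_continuous)
next
  case (Suc n)
  then show ?case unfolding C_k_Suc_iff[of "Suc n"] C_k_Suc_iff[of n] by blast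
qed

lemma C_k_const: "C_k n (\<lambda>_. c)"
proof (induction n arbitrary: c)
  case (Suc n)
  have "has_partials (\<lambda>_. c) (\<lambda>_. 0) (\<lambda>_. 0)"
    unfolding has_partials_def by (auto intro!: derivative_eq_intros)
  then show ?case by (rule C_k_SucI[OF _ Suc Suc])
qed simp

lemma C_k_ident: "C_k n (\<lambda>z. z)"
proof (cases n)
  case (Suc m)
  have "has_partials (\<lambda>z. z) (\<lambda>_. 1) (\<lambda>_. \<i>)"
    unfolding has_partials_def
  proof
    fix z :: complex
    have "(\<lambda>w. complex_of_real (Re w) * 1 + complex_of_real (Im w) * \<i>) = (\<lambda>w. w)"
      by (auto simp: complex_eq_iff fun_eq_iff)
    then show "((\<lambda>z. z) has_derivative (\<lambda>w. complex_of_real (Re w) * 1 + complex_of_real (Im w) * \<i>)) (at z)"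
      by (simp add: has_derivative_ident)
  qed
  then show ?thesis unfolding Suc by (rule C_k_SucI[OF _ C_k_const C_k_const])
qed (simp; intro continuous_intros; simp)

lemma has_partials_cnj:
  assumes "has_partials f fx fy"
  shows "has_partials (\<lambda>z. cnj (f z)) (\<lambda>z. cnj (fx z)) (\<lambda>z. cnj (fy z))"
  unfolding has_partials_def
proof
  fix z
  have "((\<lambda>z. cnj (f z)) has_derivative (\<lambda>w. cnj (of_real (Re w) * fx z + of_real (Im w) * fy z))) (at z)"
    using assms unfolding has_partials_def
    by (intro bounded_linear.has_derivative[OF bounded_linear_cnj]) auto
  then show "((\<lambda>z. cnj (f z)) has_derivative (\<lambda>w. of_real (Re w) * cnj (fx z) + of_real (Im w) * cnj (fy z))) (at z)"
    by simp
qed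

lemma C_k_cnj: "C_k n f \<Longrightarrow> C_k n (\<lambda>z. cnj (f z))"
proof (induction n arbitrary: f)
  case (Suc n)
  obtain fx fy where f: "C_k n fx" "C_k n fy" "has_partials f fx fy"
    using Suc.prems unfolding C_k_Suc_iff by blast
  show ?case by (rule C_k_SucI[OF has_partials_cnj[OF f(3)]]; intro Suc.IH f)
qed (simp; intro continuous_intros; simp)

lemma has_partials_add:
  assumes "has_partials f fx fy" "has_partials g gx gy"
  shows "has_partials (\<lambda>z. f z + g z) (\<lambda>z. fx z + gx z) (\<lambda>z. fy z + gy z)"
  unfolding has_partials_def
proof
  fix z
  have "((\<lambda>z. f z + g z) has_derivative (\<lambda>w. (of_real (Re w) * fx z + of_real (Im w) * fy z)
      + (of_real (Re w) * gx z + of_real (Im w) * gy z))) (at z)"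
    using assms unfolding has_partials_def by (intro has_derivative_add) auto
  then show "((\<lambda>z. f z + g z) has_derivative (\<lambda>w. of_real (Re w) * (fx z + gx z) + of_real (Im w) * (fy z + gy z))) (at z)"
    by (simp add: algebra_simps)
qed

lemma C_k_add: "C_k n f \<Longrightarrow> C_k n g \<Longrightarrow> C_k n (\<lambda>z. f z + g z)"
proof (induction n arbitrary: f g)
  case (Suc n)
  obtain fx fy gx gy where f: "C_k n fx" "C_k n fy" "has_partials f fx fy"
    and g: "C_k n gx" "C_k n gy" "has_partials g gx gy"
    using Suc.prems unfolding C_k_Suc_iff by blast
  show ?case by (rule C_k_SucI[OF has_partials_add[OF f(3) g(3)]]; intro Suc.IH f g)
qed (simp; intro continuous_intros; simp)

lemma C_k_mult: "C_k n f \<Longrightarrow> C_k n g \<Longrightarrow> C_k n (\<lambda>z. f z * g z)"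
proof (induction n arbitrary: f g)
  case (Suc n)
  obtain fx fy gx gy where f: "C_k n fx" "C_k n fy" "has_partials f fx fy"
    and g: "C_k n gx" "C_k n gy" "has_partials g gx gy"
    using Suc.prems unfolding C_k_Suc_iff by blast
  note fg = C_k_SucD[OF Suc.prems(1)] C_k_SucD[OF Suc.prems(2)]
  show ?case
    by (rule C_k_SucI[OF has_partials_mult[OF f(3) g(3)]]; intro C_k_add Suc.IH f g fg)
qed (simp; intro continuous_intros; simp)

lemma C_k_minus: "C_k n f \<Longrightarrow> C_k n (\<lambda>z. - f z)"
  using C_k_mult[OF C_k_const[of n "- 1"]] by simp

lemma C_k_inverse: "C_k n f \<Longrightarrow> (\<And>z. f z \<noteq> 0) \<Longrightarrow> C_k n (\<lambda>z. inverse (f z))"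
proof (induction n arbitrary: f)
  case (Suc n)
  obtain fx fy where f: "C_k n fx" "C_k n fy" "has_partials f fx fy"
    using Suc.prems unfolding C_k_Suc_iff by blast
  have i: "C_k n (\<lambda>z. inverse (f z))" by (rule Suc.IH[OF C_k_SucD[OF Suc.prems(1)] Suc.prems(2)])
  have "has_partials (\<lambda>z. inverse (f z)) (\<lambda>z. - (fx z * (inverse (f z) * inverse (f z)))) (\<lambda>z. - (fy z * (inverse (f z) * inverse (f z))))"
    unfolding has_partials_def
  proof
    fix z
    have f': "(f has_derivative (\<lambda>w. of_real (Re w) * fx z + of_real (Im w) * fy z)) (at z)"
      using f(3) unfolding has_partials_def by blast
    have "((\<lambda>z. inverse (f z)) has_derivative (\<lambda>w. - (inverse (f z) * (of_real (Re w) * fx z + of_real (Im w) * fy z) * inverse (f z)))) (at z)"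
      by (rule Deriv.has_derivative_inverse[OF Suc.prems(2) f'])
    then show "((\<lambda>z. inverse (f z)) has_derivative (\<lambda>w. of_real (Re w) * - (fx z * (inverse (f z) * inverse (f z)))
        + of_real (Im w) * - (fy z * (inverse (f z) * inverse (f z))))) (at z)"
      by (simp add: algebra_simps)
  qed
  then show ?case by (rule C_k_SucI) (intro C_k_minus C_k_mult f i)+
qed (simp; intro continuous_intros; simp)

lemma C_k_scale: "C_k n f \<Longrightarrow> C_k n (\<lambda>z. f (of_real c * z))"
proof (induction n arbitrary: f)
  case 0
  then show ?case by (auto intro!: continuous_on_compose2[of UNIV f] continuous_intros)
next
  case (Suc n)
  obtain fx fy where f: "C_k n fx" "C_k n fy" "has_partials f fx fy"
    using Suc.prems unfolding C_k_Suc_iff by blast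
  have "has_partials (\<lambda>z. f (of_real c * z)) (\<lambda>z. of_real c * fx (of_real c * z)) (\<lambda>z. of_real c * fy (of_real c * z))"
    unfolding has_partials_def
  proof
    fix z
    have 1: "((\<lambda>z. complex_of_real c * z) has_derivative (\<lambda>w. complex_of_real c * w)) (at z)"
      by (rule bounded_linear_imp_has_derivative[OF bounded_linear_mult_right])
    have 2: "(f has_derivative (\<lambda>w. of_real (Re w) * fx (of_real c * z) + of_real (Im w) * fy (of_real c * z))) (at (of_real c * z))"
      using f(3) unfolding has_partials_def by blast
    show "((\<lambda>z. f (of_real c * z)) has_derivative (\<lambda>w. of_real (Re w) * (of_real c * fx (of_real c * z))
        + of_real (Im w) * (of_real c * fy (of_real c * z)))) (at z)"
      using has_derivative_compose[OF 1 2] by (simp add: algebra_simps)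
  qed
  then show ?case by (rule C_k_SucI) (intro C_k_mult C_k_const Suc.IH f)+
qed

lemma C_k_of_real_Re: "C_k n (\<lambda>z. of_real (Re z))" and C_k_of_real_Im: "C_k n (\<lambda>z. of_real (Im z))"
proof -
  have "C_k n (\<lambda>z. (1/2) * (z + cnj z))" "C_k n (\<lambda>z. (- \<i> / 2) * (z + - cnj z))"
    by (intro C_k_mult C_k_add C_k_const C_k_ident C_k_cnj C_k_minus)+
  moreover have "(\<lambda>z. (1/2) * (z + cnj z)) = (\<lambda>z. of_real (Re z))" "(\<lambda>z. (- \<i> / 2) * (z + - cnj z)) = (\<lambda>z. of_real (Im z))"
    by (auto simp: complex_eq_iff fun_eq_iff)
  ultimately show "C_k n (\<lambda>z. of_real (Re z))" "C_k n (\<lambda>z. of_real (Im z))" by simp_all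
qed

section \<open>A smooth cutoff\<close>

definition flat :: "nat \<Rightarrow> real \<Rightarrow> real" where
  "flat m x = (if 0 < x then exp (- 1 / x) / x ^ m else 0)"

lemma flat_tendsto_0: "(flat m \<longlongrightarrow> 0) (at_right 0)"
proof -
  have "((\<lambda>y::real. y ^ m / exp y) \<longlongrightarrow> 0) at_top" by (rule tendsto_power_div_exp_0)
  then have "((\<lambda>x::real. inverse x ^ m / exp (inverse x)) \<longlongrightarrow> 0) (at_right 0)"
    by (rule filterlim_compose[OF _ filterlim_inverse_at_top_right])
  moreover have "\<forall>\<^sub>F x in at_right 0. inverse x ^ m / exp (inverse x) = flat m x"
    by (auto simp: eventually_at_right_field flat_def exp_minus divide_simps intro!: exI[of _ 1])
  ultimately show ?thesis by (rule Lim_transform_eventually)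
qed

text \<open>The family is closed under differentiation up to linear combinations, which is why the
  power x^m is part of its definition. At 0 the right difference quotient of \<open>flat m\<close>
  is \<open>flat (m + 1)\<close>, which tends to 0.\<close>

lemma flat_derivative: "(flat m has_real_derivative (flat (m + 2) x - real m * flat (m + 1) x)) (at x)"
proof -
  consider "x < 0" | "x = 0" | "0 < x" by linarith
  then show ?thesis
  proof cases
    case 1
    have "((\<lambda>_. 0) has_real_derivative 0) (at x)" by simp
    then have "(flat m has_real_derivative 0) (at x)"
      by (rule has_field_derivative_transform_within[where d="- x"]) (use 1 in \<open>auto simp: flat_def dist_real_def\<close>)
    then show ?thesis using 1 by (simp add: flat_def)
  next
    case 2
    have "((\<lambda>y. (flat m y - flat m 0) / (y - 0)) \<longlongrightarrow> 0) (at 0)"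
    proof (rule filterlim_split_at)
      show "((\<lambda>y. (flat m y - flat m 0) / (y - 0)) \<longlongrightarrow> 0) (at_left 0)"
        by (rule tendsto_eventually) (auto simp: eventually_at_left_field flat_def intro!: exI[of _ "-1"])
      have "\<forall>\<^sub>F y in at_right 0. flat (m + 1) y = (flat m y - flat m 0) / (y - 0)"
        by (auto simp: eventually_at_right_field flat_def intro!: exI[of _ 1])
      then show "((\<lambda>y. (flat m y - flat m 0) / (y - 0)) \<longlongrightarrow> 0) (at_right 0)"
        by (rule Lim_transform_eventually[OF flat_tendsto_0])
    qed
    then show ?thesis using 2 by (simp add: has_field_derivative_iff flat_def)
  next
    case 3
    have "((\<lambda>x. exp (- 1 / x) / x ^ m) has_real_derivative
        ((exp (- 1 / x) * (1 / x\<^sup>2)) * x ^ m - exp (- 1 / x) * (real m * x ^ (m - 1))) / (x ^ m * x ^ m)) (at x)"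
      using 3 by (auto intro!: derivative_eq_intros simp: power2_eq_square)
    moreover have "((exp (- 1 / x) * (1 / x\<^sup>2)) * x ^ m - exp (- 1 / x) * (real m * x ^ (m - 1))) / (x ^ m * x ^ m)
       = flat (m + 2) x - real m * flat (m + 1) x"
      using 3 by (cases m) (auto simp: flat_def field_simps power2_eq_square)
    ultimately have "((\<lambda>x. exp (- 1 / x) / x ^ m) has_real_derivative (flat (m + 2) x - real m * flat (m + 1) x)) (at x)" by simp
    then show ?thesis
      by (rule has_field_derivative_transform_within[where d=x]) (use 3 in \<open>auto simp: flat_def dist_real_def\<close>)
  qed
qed

text \<open>The induction must run over all \<open>m\<close> at once, since every derivative raises
  the index.\<close>

lemma C_k_flat:
  assumes r: "\<And>z. (r has_derivative (\<lambda>w. Re w * rx z + Im w * ry z)) (at z)"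
    and rx: "\<And>n. C_k n (\<lambda>z. of_real (rx z))" and ry: "\<And>n. C_k n (\<lambda>z. of_real (ry z))"
  shows "C_k n (\<lambda>z. of_real (flat m (r z)))"
proof -
  have pd: "has_partials (\<lambda>z. of_real (flat m (r z)))
      (\<lambda>z. (of_real (flat (m + 2) (r z)) + of_real (- real m) * of_real (flat (m + 1) (r z))) * of_real (rx z))
      (\<lambda>z. (of_real (flat (m + 2) (r z)) + of_real (- real m) * of_real (flat (m + 1) (r z))) * of_real (ry z))" for m
    unfolding has_partials_def
  proof
    fix z
    have "(flat m has_derivative (*) (flat (m + 2) (r z) - real m * flat (m + 1) (r z))) (at (r z))"
      using flat_derivative[of m "r z"] by (simp add: has_field_derivative_def)
    from has_derivative_compose[OF r this]
    have "((\<lambda>z. complex_of_real (flat m (r z))) has_derivative (\<lambda>w. complex_of_real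
        ((flat (m + 2) (r z) - real m * flat (m + 1) (r z)) * (Re w * rx z + Im w * ry z)))) (at z)"
      by (rule has_derivative_of_real)
    then show "((\<lambda>z. complex_of_real (flat m (r z))) has_derivative (\<lambda>w.
        of_real (Re w) * ((of_real (flat (m + 2) (r z)) + of_real (- real m) * of_real (flat (m + 1) (r z))) * of_real (rx z))
      + of_real (Im w) * ((of_real (flat (m + 2) (r z)) + of_real (- real m) * of_real (flat (m + 1) (r z))) * of_real (ry z)))) (at z)"
      by (simp add: algebra_simps)
  qed
  show ?thesis
  proof (induction n arbitrary: m)
    case 0
    show ?case using has_partials_continuous[OF pd] by simp
  next
    case (Suc n)
    show ?case by (rule C_k_SucI[OF pd]) (intro C_k_mult C_k_add C_k_const Suc.IH rx ry)+
  qed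
qed

text \<open>A quotient of the usual kind in s = |z|^2, a polynomial in the coordinates, so nothing
  special happens at the origin. The denominator never vanishes: 4 - s and s - 1 have sum 3, so one
  of them is positive.\<close>

definition cutoff :: "complex \<Rightarrow> complex" where
  "cutoff z = of_real (flat 0 (4 - (cmod z)\<^sup>2))
     * inverse (of_real (flat 0 (4 - (cmod z)\<^sup>2)) + of_real (flat 0 ((cmod z)\<^sup>2 - 1)))"

lemma C_k_cutoff: "C_k n cutoff"
proof -
  have d: "((\<lambda>z. c + e * (cmod z)\<^sup>2) has_derivative (\<lambda>w. Re w * (2 * e * Re z) + Im w * (2 * e * Im z))) (at z)" for c e z
    unfolding cmod_power2 by (auto intro!: derivative_eq_intros simp: algebra_simps)
  have c: "C_k n (\<lambda>z. of_real (2 * e * Re z))" "C_k n (\<lambda>z. of_real (2 * e * Im z))" for n e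
    unfolding of_real_mult by (intro C_k_mult C_k_const C_k_of_real_Re C_k_of_real_Im)+
  have f: "C_k n (\<lambda>z. of_real (flat 0 (c + e * (cmod z)\<^sup>2)))" for c e
    by (rule C_k_flat[OF d c])
  have f1: "C_k n (\<lambda>z. of_real (flat 0 (4 - (cmod z)\<^sup>2)))" using f[of 4 "- 1"] by simp
  have f2: "C_k n (\<lambda>z. of_real (flat 0 ((cmod z)\<^sup>2 - 1)))" using f[of "- 1" 1] by simp
  have "flat 0 (4 - s) + flat 0 (s - 1) \<noteq> 0" for s :: real
  proof -
    have "0 \<le> flat 0 x" for x by (simp add: flat_def)
    moreover have "0 < flat 0 (4 - s) \<or> 0 < flat 0 (s - 1)" by (auto simp: flat_def)
    ultimately show ?thesis by (metis add_nonneg_pos add_pos_nonneg less_irrefl)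
  qed
  then have nz: "complex_of_real (flat 0 (4 - s)) + of_real (flat 0 (s - 1)) \<noteq> 0" for s
    by (metis of_real_add of_real_eq_0_iff)
  show ?thesis
    unfolding cutoff_def[abs_def] by (intro C_k_mult C_k_inverse C_k_add f1 f2 nz)
qed

lemma cutoff_eq_1: "cmod z \<le> 1 \<Longrightarrow> cutoff z = 1"
proof -
  assume "cmod z \<le> 1"
  then have "(cmod z)\<^sup>2 \<le> 1" by (simp add: power_le_one)
  then show ?thesis by (simp add: cutoff_def flat_def)
qed

lemma cutoff_eq_0: "2 \<le> cmod z \<Longrightarrow> cutoff z = 0"
proof -
  assume "2 \<le> cmod z"
  then have "2\<^sup>2 \<le> (cmod z)\<^sup>2" by (intro power_mono) auto
  then show ?thesis by (simp add: cutoff_def flat_def)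
qed

section \<open>Compact support: decay, test functions and their derivatives\<close>

lemma has_partials_eq_0:
  assumes pd: "has_partials f fx fy" and S: "open S" "z \<in> S" "\<And>w. w \<in> S \<Longrightarrow> f w = c"
  shows "fx z = 0" "fy z = 0"
proof -
  have "((\<lambda>_. c) has_derivative (\<lambda>w. of_real (Re w) * fx z + of_real (Im w) * fy z)) (at z)"
    using pd[unfolded has_partials_def, rule_format, of z] S
    by (rule has_derivative_transform_within_open) auto
  then have eq: "(\<lambda>w. of_real (Re w) * fx z + of_real (Im w) * fy z) = (\<lambda>_. 0)"
    by (rule has_derivative_unique) simp
  show "fx z = 0" "fy z = 0" using fun_cong[OF eq, of 1] fun_cong[OF eq, of \<i>] by simp_all
qed

lemma bounded_of_compact_support:
  fixes f :: "complex \<Rightarrow> complex"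
  assumes "continuous_on UNIV f" "\<And>z. R < cmod z \<Longrightarrow> f z = 0"
  shows "\<exists>B\<ge>0. \<forall>z. cmod (f z) \<le> B"
proof -
  have "compact (f ` cball 0 R)"
    using assms(1) by (intro compact_continuous_image) (auto intro: continuous_on_subset)
  then obtain B where "\<forall>y\<in>f ` cball 0 R. cmod y \<le> B"
    using compact_imp_bounded[of "f ` cball 0 R"] by (auto simp: bounded_iff)
  then have B: "\<And>z. cmod z \<le> R \<Longrightarrow> cmod (f z) \<le> B" by simp
  have "cmod (f z) \<le> max B 0" for z
  proof (cases "R < cmod z")
    case True
    then show ?thesis using assms(2)[of z] by simp
  next
    case False
    then show ?thesis using B[of z] by simp
  qed
  then show ?thesis by (intro exI[of _ "max B 0"]) auto
qed

text \<open>All three bounds follow from boundedness of f times \<langle>z\<rangle>^4. The first two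
  are the hypotheses of \<open>cauchy_pompeiu\<close>, the third gives integrability.\<close>

lemma compact_support_decay:
  fixes f :: "complex \<Rightarrow> complex"
  assumes "continuous_on UNIV f" "\<And>z. R < cmod z \<Longrightarrow> f z = 0"
  shows "\<exists>B\<ge>0. \<forall>z. cmod (f z) \<le> B / japanese z \<and> cmod (f z) \<le> B / (japanese z)\<^sup>2 \<and> cmod (f z) \<le> B * japanese z powr (- 4)"
proof -
  have cj: "continuous_on UNIV japanese"
    unfolding japanese_def[abs_def] by (intro continuous_intros)
  obtain B where B: "0 \<le> B" "\<And>z. cmod (f z * of_real (japanese z ^ 4)) \<le> B"
  proof -
    have "continuous_on UNIV (\<lambda>z. f z * of_real (japanese z ^ 4))"
      by (intro continuous_intros assms cj)
    from bounded_of_compact_support[OF this, of R] assms(2) show ?thesis by (metis mult_zero_left that)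
  qed
  have 4: "cmod (f z) \<le> B / japanese z ^ 4" for z
    using B(2)[of z] japanese_pos[of z] by (simp add: norm_mult norm_power le_divide_eq)
  have le: "B / japanese z ^ 4 \<le> B / japanese z ^ m" if "m \<le> 4" for z m
    using B(1) japanese_ge_1[of z] that by (intro divide_left_mono power_increasing) auto
  show ?thesis
    using B(1) order_trans[OF 4 le[of 1]] order_trans[OF 4 le[of 2]] 4
    by (intro exI[of _ B]) (auto simp: powr_minus_divide)
qed

lemma test_fun_partials:
  assumes "test_fun \<psi>"
  obtains px py R where "has_partials \<psi> px py" "continuous_on UNIV px" "continuous_on UNIV py"
    "\<And>z. R < cmod z \<Longrightarrow> \<psi> z = 0" "\<And>z. R < cmod z \<Longrightarrow> px z = 0" "\<And>z. R < cmod z \<Longrightarrow> py z = 0"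
proof -
  have "C_k (Suc 0) \<psi>" using assms by (simp add: test_fun_def)
  then obtain px py where p: "has_partials \<psi> px py" "continuous_on UNIV px" "continuous_on UNIV py"
    unfolding C_k_Suc_iff by auto
  have "bounded {z. \<psi> z \<noteq> 0}"
    using assms unfolding test_fun_def by (meson bounded_subset closure_subset compact_imp_bounded)
  then obtain R where R: "\<And>z. \<psi> z \<noteq> 0 \<Longrightarrow> cmod z \<le> R" by (auto simp: bounded_iff)
  then have 0: "\<And>z. R < cmod z \<Longrightarrow> \<psi> z = 0" by force
  have op: "open {z::complex. R < cmod z}" by (intro open_Collect_less continuous_intros)
  have "px z = 0" "py z = 0" if "R < cmod z" for z
    using has_partials_eq_0[OF p(1) op, of z 0] that 0 by auto
  with p 0 show ?thesis by (rule that)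
qed

lemma test_fun_cnj: "test_fun \<psi> \<Longrightarrow> test_fun (\<lambda>z. cnj (\<psi> z))"
  by (simp add: test_fun_def C_k_cnj)

lemma dz_cnj:
  assumes "test_fun \<psi>"
  shows "dz \<psi> z = cnj (dzbar (\<lambda>z. cnj (\<psi> z)) z)"
proof -
  obtain px py R where p: "has_partials \<psi> px py" by (rule test_fun_partials[OF assms])
  show ?thesis
    unfolding has_partials_dz[OF p] has_partials_dzbar[OF has_partials_cnj[OF p]] by simp
qed

text \<open>The third conclusion makes constants weak solutions of the homogeneous dbar-equation, so
  the 1 in the prescribed form of the solution disappears from the first equation. The fourth is the
  fundamental solution property of the Cauchy kernel.\<close>

lemma test_fun_dzbar:
  assumes "test_fun \<psi>"
  shows "continuous_on UNIV (dzbar \<psi>)" "\<exists>R. \<forall>z. R < cmod z \<longrightarrow> dzbar \<psi> z = 0"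
    "(LINT z|lborel. dzbar \<psi> z) = 0" "(LINT z|lborel. dzbar \<psi> z / (w - z)) = of_real pi * \<psi> w"
proof -
  obtain px py R where p: "has_partials \<psi> px py" "continuous_on UNIV px" "continuous_on UNIV py"
    and 0: "\<And>z. R < cmod z \<Longrightarrow> \<psi> z = 0" "\<And>z. R < cmod z \<Longrightarrow> px z = 0" "\<And>z. R < cmod z \<Longrightarrow> py z = 0"
    by (rule test_fun_partials[OF assms]) blast
  have eq: "dzbar \<psi> = (\<lambda>z. (px z + \<i> * py z) / 2)"
    by (rule ext) (rule has_partials_dzbar[OF p(1)])
  show "continuous_on UNIV (dzbar \<psi>)" unfolding eq by (intro continuous_intros p) simp
  show "\<exists>R. \<forall>z. R < cmod z \<longrightarrow> dzbar \<psi> z = 0"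
    unfolding eq by (rule exI[of _ R]) (simp add: 0)
  obtain B1 where B1: "0 \<le> B1" "\<And>z. cmod (\<psi> z) \<le> B1 / japanese z"
    using compact_support_decay[OF has_partials_continuous[OF p(1)] 0(1)] by blast
  obtain B2 where B2: "0 \<le> B2" "\<And>z. cmod (px z) \<le> B2 / (japanese z)\<^sup>2" "\<And>z. cmod (px z) \<le> B2 * japanese z powr (- 4)"
    using compact_support_decay[OF p(2) 0(2)] by blast
  obtain B3 where B3: "0 \<le> B3" "\<And>z. cmod (py z) \<le> B3 / (japanese z)\<^sup>2" "\<And>z. cmod (py z) \<le> B3 * japanese z powr (- 4)"
    using compact_support_decay[OF p(3) 0(3)] by blast
  have [measurable]: "px \<in> borel_measurable borel" "py \<in> borel_measurable borel"
    using p by (auto intro: borel_measurable_continuous_onI)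
  have i: "integrable lborel px" "integrable lborel py"
    using B2(3) B3(3) by (auto intro!: integrable_japanese_bound[where b=4])
  show "(LINT z|lborel. dzbar \<psi> z) = 0"
    using integral_partials_zero[OF p i B1(2,1)] i by (simp add: eq)
  define C where "C = B1 + B2 + B3"
  have C: "0 \<le> C" "B1 \<le> C" "B2 \<le> C" "B3 \<le> C" using B1(1) B2(1) B3(1) by (auto simp: C_def)
  show "(LINT z|lborel. dzbar \<psi> z / (w - z)) = of_real pi * \<psi> w"
    unfolding eq
  proof (rule cauchy_pompeiu(2)[OF p C(1)])
    show "cmod (\<psi> y) \<le> C / japanese y" for y
      by (rule order_trans[OF B1(2)]) (use C in \<open>auto intro!: divide_right_mono\<close>)
    show "cmod (px y) \<le> C / (japanese y)\<^sup>2" for y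
      by (rule order_trans[OF B2(2)]) (use C in \<open>auto intro!: divide_right_mono\<close>)
    show "cmod (py y) \<le> C / (japanese y)\<^sup>2" for y
      by (rule order_trans[OF B3(2)]) (use C in \<open>auto intro!: divide_right_mono\<close>)
  qed
qed

section \<open>Cauchy transforms as solutions in the sense of distributions\<close>

lemma wnn_pairing_finite:
  assumes [measurable]: "f \<in> borel_measurable borel" and fin: "wnn \<theta> f < \<infinity>"
    and c: "continuous_on UNIV X" "\<And>z. R < cmod z \<Longrightarrow> X z = 0"
  shows "(\<integral>\<^sup>+z. f z * ennreal (cmod (X z)) \<partial>lborel) < \<infinity>"
proof -
  have [measurable]: "X \<in> borel_measurable borel" using c(1) by (rule borel_measurable_continuous_onI)
  have cj: "continuous_on UNIV japanese"
    unfolding japanese_def[abs_def] by (intro continuous_intros)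
  let ?g = "\<lambda>z. X z * of_real (japanese z powr \<theta>)"
  have cg: "continuous_on UNIV ?g" by (intro continuous_intros c cj) auto
  obtain B where B: "0 \<le> B" "\<And>z. cmod (?g z) \<le> B * japanese z powr (- 4)"
    using compact_support_decay[OF cg, of R] c(2) by auto
  have "(\<integral>\<^sup>+z. (ennreal (cmod (?g z)))\<^sup>2 \<partial>lborel) \<le> (\<integral>\<^sup>+z. ennreal (B\<^sup>2) * ennreal (japanese z powr (- 8)) \<partial>lborel)"
  proof (rule nn_integral_mono)
    fix z
    have "(cmod (?g z))\<^sup>2 \<le> (B * japanese z powr (- 4))\<^sup>2" by (intro power_mono B) auto
    also have "\<dots> = B\<^sup>2 * japanese z powr (- 8)"
      by (simp add: power_mult_distrib power2_eq_square powr_add[symmetric])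
    finally show "(ennreal (cmod (?g z)))\<^sup>2 \<le> ennreal (B\<^sup>2) * ennreal (japanese z powr (- 8))"
      unfolding ennreal_power[OF norm_ge_zero] by (subst ennreal_mult[symmetric]) (auto intro: ennreal_leI)
  qed
  also have "\<dots> = ennreal (B\<^sup>2) * (\<integral>\<^sup>+z. ennreal (japanese z powr (- 8)) \<partial>lborel)"
    by (rule nn_integral_cmult) measurable
  also have "\<dots> < \<infinity>" using nn_integral_japanese[of 8] by (simp add: ennreal_mult_less_top)
  finally have g2: "(\<integral>\<^sup>+z. (ennreal (cmod (?g z)))\<^sup>2 \<partial>lborel) < \<infinity>" .
  have "(\<integral>\<^sup>+z. f z * ennreal (cmod (X z)) \<partial>lborel) = (\<integral>\<^sup>+z. (f z * ennreal (japanese z powr (- \<theta>))) * ennreal (cmod (?g z)) \<partial>lborel)"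
  proof (rule nn_integral_cong)
    fix z
    have "japanese z powr (- \<theta>) * cmod (?g z) = cmod (X z) * (japanese z powr (- \<theta>) * japanese z powr \<theta>)"
      by (simp add: norm_mult)
    also have "japanese z powr (- \<theta>) * japanese z powr \<theta> = 1" by (simp add: powr_add[symmetric])
    finally show "f z * ennreal (cmod (X z)) = (f z * ennreal (japanese z powr (- \<theta>))) * ennreal (cmod (?g z))"
      unfolding mult.assoc by (subst ennreal_mult[symmetric]) auto
  qed
  also have "(\<dots>)\<^sup>2 \<le> (\<integral>\<^sup>+z. (f z * ennreal (japanese z powr (- \<theta>)))\<^sup>2 \<partial>lborel) * (\<integral>\<^sup>+z. (ennreal (cmod (?g z)))\<^sup>2 \<partial>lborel)"
    by (rule Cauchy_Schwarz_nn_integral) measurable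
  also have "(\<integral>\<^sup>+z. (f z * ennreal (japanese z powr (- \<theta>)))\<^sup>2 \<partial>lborel) = wnn \<theta> f"
    unfolding wnn_def by (intro nn_integral_cong)
      (simp add: power_mult_distrib power2_eq_square[of "ennreal _"] ennreal_mult[symmetric] powr_add[symmetric])
  also have "wnn \<theta> f * (\<integral>\<^sup>+z. (ennreal (cmod (?g z)))\<^sup>2 \<partial>lborel) < \<infinity>"
    using fin g2 by (simp add: ennreal_mult_less_top)
  finally show ?thesis
    by (simp add: power2_eq_square ennreal_mult_less_top less_top[symmetric] ennreal_mult_eq_top_iff)
qed

text \<open>Fubini lets the inner integral see the test function first, where Cauchy--Pompeiu
  evaluates it at w; the sign comes from z - w against w - z. The hypothesis \<open>fin\<close>
  provides absolute convergence of the double integral.\<close>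

lemma cauchy_transform_dbar:
  assumes [measurable]: "v \<in> borel_measurable borel"
    and fin: "wnn \<theta> (pot (\<lambda>w. ennreal (cmod (v w)))) < \<infinity>" and \<psi>: "test_fun \<psi>"
  shows "(LINT z|lborel. (LINT w|lborel. v w / (z - w)) * dzbar \<psi> z) = - of_real pi * (LINT w|lborel. v w * \<psi> w)"
proof -
  note c = test_fun_dzbar[OF \<psi>]
  have [measurable]: "dzbar \<psi> \<in> borel_measurable borel" by (rule borel_measurable_continuous_onI[OF c(1)])
  obtain R where R: "\<And>z. R < cmod z \<Longrightarrow> dzbar \<psi> z = 0" using c(2) by blast
  let ?f = "\<lambda>z w. v w / (z - w) * dzbar \<psi> z"
  have int: "integrable (lborel \<Otimes>\<^sub>M lborel) (case_prod ?f)"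
  proof (rule integrableI_bounded)
    show "case_prod ?f \<in> borel_measurable (lborel \<Otimes>\<^sub>M lborel)" by measurable
    have "(\<integral>\<^sup>+q. ennreal (cmod (case_prod ?f q)) \<partial>(lborel \<Otimes>\<^sub>M lborel))
        = (\<integral>\<^sup>+z. \<integral>\<^sup>+w. ennreal (cmod (?f z w)) \<partial>lborel \<partial>lborel)"
      by (subst lborel.nn_integral_fst[symmetric]) auto
    also have "\<dots> = (\<integral>\<^sup>+z. pot (\<lambda>w. ennreal (cmod (v w))) z * ennreal (cmod (dzbar \<psi> z)) \<partial>lborel)"
    proof (rule nn_integral_cong)
      fix z
      have "(\<integral>\<^sup>+w. ennreal (cmod (?f z w)) \<partial>lborel) = (\<integral>\<^sup>+w. (ennreal (cmod (v w)) * ennreal (1 / cmod (z - w))) * ennreal (cmod (dzbar \<psi> z)) \<partial>lborel)"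
        by (intro nn_integral_cong) (simp add: norm_mult norm_divide ennreal_mult[symmetric])
      then show "(\<integral>\<^sup>+w. ennreal (cmod (?f z w)) \<partial>lborel) = pot (\<lambda>w. ennreal (cmod (v w))) z * ennreal (cmod (dzbar \<psi> z))"
        unfolding pot_def by (simp add: nn_integral_multc)
    qed
    also have "\<dots> < \<infinity>"
      by (rule wnn_pairing_finite[OF _ fin c(1) R]) measurable
    finally show "(\<integral>\<^sup>+q. ennreal (cmod (case_prod ?f q)) \<partial>(lborel \<Otimes>\<^sub>M lborel)) < \<infinity>" .
  qed
  have "(LINT z|lborel. (LINT w|lborel. v w / (z - w)) * dzbar \<psi> z) = (LINT z|lborel. LINT w|lborel. ?f z w)"
    unfolding integral_mult_left_zero ..
  also have "\<dots> = (LINT w|lborel. LINT z|lborel. ?f z w)"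
    by (rule lborel_pair.Fubini_integral[OF int, symmetric])
  also have "\<dots> = (LINT w|lborel. - of_real pi * (v w * \<psi> w))"
  proof (rule Bochner_Integration.integral_cong[OF refl])
    fix w
    have "(LINT z|lborel. ?f z w) = (LINT z|lborel. - v w * (dzbar \<psi> z / (w - z)))"
    proof (rule Bochner_Integration.integral_cong[OF refl])
      fix z
      show "?f z w = - v w * (dzbar \<psi> z / (w - z))"
        using minus_divide_right[of "v w * dzbar \<psi> z" "w - z"] by simp
    qed
    also have "\<dots> = - v w * (of_real pi * \<psi> w)"
      unfolding integral_mult_right_zero c(4) ..
    finally show "(LINT z|lborel. ?f z w) = - of_real pi * (v w * \<psi> w)" by simp
  qed
  also have "\<dots> = - of_real pi * (LINT w|lborel. v w * \<psi> w)"
    by (rule integral_mult_right_zero)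
  finally show ?thesis .
qed

lemma dist_dzbar_opE:
  assumes v: "v \<in> borel_measurable borel" and h: "0 < h"
    and fin: "wnn \<theta> (pot (\<lambda>w. ennreal (cmod (v w)))) < \<infinity>" and \<psi>: "test_fun \<psi>"
  shows "of_real h * dist_dzbar (opE h v) \<psi> = dist_of v \<psi>"
proof -
  have "dist_of (opE h v) (dzbar \<psi>) = (LINT z|lborel. of_real (1 / (pi * h)) * ((LINT w|lborel. v w / (z - w)) * dzbar \<psi> z))"
    unfolding dist_of_def opE_def by (simp only: mult.assoc)
  also have "\<dots> = of_real (1 / (pi * h)) * (- of_real pi * dist_of v \<psi>)"
    unfolding integral_mult_right_zero cauchy_transform_dbar[OF v fin \<psi>] dist_of_def ..
  finally show ?thesis using h by (simp add: dist_dzbar_def)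
qed

lemma dist_of_cnj: "dist_of (\<lambda>z. cnj (u z)) (\<lambda>z. cnj (\<psi> z)) = cnj (dist_of u \<psi>)"
  unfolding dist_of_def Bochner_Integration.integral_cnj[symmetric] by simp

text \<open>This symmetry transfers every fact about E and dbar to F and the conjugate
  derivative.\<close>

lemma opF_cnj: "opF h v z = cnj (opE h (\<lambda>w. cnj (v w)) z)"
  unfolding opF_def opE_def complex_cnj_mult Bochner_Integration.integral_cnj[symmetric] by simp

lemma dist_dz_cnj:
  assumes \<psi>: "test_fun \<psi>"
  shows "dist_dz u \<psi> = cnj (dist_dzbar (\<lambda>z. cnj (u z)) (\<lambda>z. cnj (\<psi> z)))"
proof -
  have "dz \<psi> = (\<lambda>z. cnj (dzbar (\<lambda>z. cnj (\<psi> z)) z))" by (rule ext) (rule dz_cnj[OF \<psi>])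
  then show ?thesis
    unfolding dist_dz_def dist_dzbar_def using dist_of_cnj[of "\<lambda>z. cnj (u z)" "dzbar (\<lambda>z. cnj (\<psi> z))"] by simp
qed

lemma dist_dz_opF:
  assumes [measurable]: "v \<in> borel_measurable borel" and h: "0 < h"
    and fin: "wnn \<theta> (pot (\<lambda>w. ennreal (cmod (v w)))) < \<infinity>" and \<psi>: "test_fun \<psi>"
  shows "of_real h * dist_dz (opF h v) \<psi> = dist_of v \<psi>"
proof -
  have "of_real h * dist_dzbar (opE h (\<lambda>w. cnj (v w))) (\<lambda>z. cnj (\<psi> z)) = dist_of (\<lambda>w. cnj (v w)) (\<lambda>z. cnj (\<psi> z))"
    by (rule dist_dzbar_opE[OF _ h _ test_fun_cnj[OF \<psi>], where \<theta>=\<theta>]) (use fin in auto)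
  then have "cnj (of_real h * dist_dzbar (opE h (\<lambda>w. cnj (v w))) (\<lambda>z. cnj (\<psi> z))) = dist_of v \<psi>"
    unfolding dist_of_cnj by simp
  then show ?thesis
    unfolding dist_dz_cnj[OF \<psi>] opF_cnj[abs_def] by simp
qed

section \<open>Weighted spaces and a weak Liouville theorem\<close>

abbreviation wn :: "real \<Rightarrow> (complex \<Rightarrow> complex) \<Rightarrow> ennreal" where
  "wn \<theta> v \<equiv> wnn \<theta> (\<lambda>z. ennreal (cmod (v z)))"

lemma wn_eq: "wn \<theta> v = (\<integral>\<^sup>+z. (ennreal (cmod (of_real (japanese z powr (- \<theta>)) * v z)))\<^sup>2 \<partial>lborel)"
  unfolding wnn_def
proof (rule nn_integral_cong)
  fix z
  have "(cmod (of_real (japanese z powr (- \<theta>)) * v z))\<^sup>2 = (cmod (v z))\<^sup>2 * japanese z powr (- 2 * \<theta>)"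
    by (simp add: norm_mult power_mult_distrib power2_eq_square[of "_ powr _"] powr_add[symmetric])
  then show "(ennreal (cmod (v z)))\<^sup>2 * ennreal (japanese z powr (- 2 * \<theta>))
      = (ennreal (cmod (of_real (japanese z powr (- \<theta>)) * v z)))\<^sup>2"
    unfolding ennreal_power[OF norm_ge_zero] by (simp add: ennreal_mult)
qed

lemma wL2_iff: "v \<in> wL2 \<theta> \<longleftrightarrow> v \<in> borel_measurable borel \<and> wn \<theta> v < \<infinity>"
proof
  assume "v \<in> wL2 \<theta>"
  then obtain u where u: "u \<in> L2" and v: "v = (\<lambda>z. of_real (japanese z powr \<theta>) * u z)"
    by (auto simp: wL2_def)
  have [measurable]: "u \<in> borel_measurable borel" using u by (simp add: L2_nn_integral)
  have eq: "of_real (japanese z powr (- \<theta>)) * v z = u z" for z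
    unfolding v mult.assoc[symmetric] of_real_mult[symmetric] by (simp add: powr_add[symmetric])
  have "v \<in> borel_measurable borel" unfolding v by measurable
  moreover have "wn \<theta> v < \<infinity>" using u unfolding wn_eq eq L2_nn_integral by simp
  ultimately show "v \<in> borel_measurable borel \<and> wn \<theta> v < \<infinity>" by simp
next
  assume a: "v \<in> borel_measurable borel \<and> wn \<theta> v < \<infinity>"
  then have [measurable]: "v \<in> borel_measurable borel" by simp
  let ?u = "\<lambda>z. of_real (japanese z powr (- \<theta>)) * v z"
  have "?u \<in> L2" unfolding L2_nn_integral using a by (simp add: wn_eq)
  moreover have "v = (\<lambda>z. of_real (japanese z powr \<theta>) * ?u z)"
    unfolding mult.assoc[symmetric] of_real_mult[symmetric] by (simp add: powr_add[symmetric])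
  ultimately show "v \<in> wL2 \<theta>"
    unfolding wL2_def by (intro CollectI exI[of _ ?u] conjI)
qed

lemma wL2_measurable: "v \<in> wL2 \<theta> \<Longrightarrow> v \<in> borel_measurable borel"
  by (simp add: wL2_iff)

lemma wnorm_power2: "v \<in> wL2 \<theta> \<Longrightarrow> ennreal ((wnorm \<theta> v)\<^sup>2) = wn \<theta> v"
proof -
  assume v: "v \<in> wL2 \<theta>"
  have [measurable]: "v \<in> borel_measurable borel" by (rule wL2_measurable[OF v])
  have "integrable lborel (\<lambda>z. (cmod (of_real (japanese z powr (- \<theta>)) * v z))\<^sup>2)"
    using v unfolding wL2_iff wn_eq by (intro integrableI_bounded) (auto simp: ennreal_power)
  then have "wn \<theta> v = ennreal (LINT z|lborel. (cmod (of_real (japanese z powr (- \<theta>)) * v z))\<^sup>2)"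
    unfolding wn_eq ennreal_power[OF norm_ge_zero] by (rule nn_integral_eq_integral) simp
  then show ?thesis unfolding wnorm_def by simp
qed

lemma wnorm_nonneg: "0 \<le> wnorm \<theta> v"
  by (simp add: wnorm_def)

lemma wnorm_le:
  assumes "u \<in> wL2 \<theta>" "v \<in> wL2 \<theta>" "wn \<theta> u \<le> ennreal (c\<^sup>2) * wn \<theta> v" "0 \<le> c"
  shows "wnorm \<theta> u \<le> c * wnorm \<theta> v"
proof -
  have "ennreal ((wnorm \<theta> u)\<^sup>2) \<le> ennreal ((c * wnorm \<theta> v)\<^sup>2)"
    using assms by (simp add: wnorm_power2 power_mult_distrib ennreal_mult)
  then have "(wnorm \<theta> u)\<^sup>2 \<le> (c * wnorm \<theta> v)\<^sup>2" by (simp add: ennreal_le_iff)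
  then show ?thesis by (rule power2_le_imp_le) (simp add: assms wnorm_nonneg)
qed

lemma wnn_mono_AE:
  "AE z in lborel. u z \<le> v z \<Longrightarrow> wnn \<theta> u \<le> wnn \<theta> v"
  unfolding wnn_def by (intro nn_integral_mono_AE) (auto elim!: eventually_mono intro!: mult_right_mono power_mono)

lemma wnn_cmult:
  assumes [measurable]: "v \<in> borel_measurable borel"
  shows "wnn \<theta> (\<lambda>z. c * v z) = c\<^sup>2 * wnn \<theta> v"
  unfolding wnn_def power_mult_distrib mult.assoc by (rule nn_integral_cmult) measurable

lemma wn_cong: "ae_eq u v \<Longrightarrow> wn \<theta> u = wn \<theta> v"
  unfolding ae_eq_def wnn_def by (intro nn_integral_cong_AE) (auto elim!: eventually_mono)

lemma ennreal_sum_power2_le: "(a + b)\<^sup>2 \<le> 2 * a\<^sup>2 + 2 * (b :: ennreal)\<^sup>2"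
proof (cases a; cases b)
  fix r s assume "a = ennreal r" "0 \<le> r" "b = ennreal s" "0 \<le> s"
  moreover have "(r + s)\<^sup>2 \<le> 2 * r\<^sup>2 + 2 * s\<^sup>2" using sum_squares_bound[of r s] by (simp add: power2_sum)
  ultimately show ?thesis
    by (simp add: ennreal_plus[symmetric] ennreal_power ennreal_mult[symmetric] ennreal_numeral[symmetric]
        del: ennreal_plus ennreal_numeral)
qed auto

text \<open>A substitute for Minkowski's inequality at the level of squared norms. It costs factors
  2, for which the contraction constant 1/16 below leaves room.\<close>

lemma wn_add_le:
  assumes [measurable]: "u \<in> borel_measurable borel" "v \<in> borel_measurable borel"
  shows "wn \<theta> (\<lambda>z. u z + v z) \<le> 2 * wn \<theta> u + 2 * wn \<theta> v"
proof -
  have "wn \<theta> (\<lambda>z. u z + v z) \<le> (\<integral>\<^sup>+z. 2 * ((ennreal (cmod (u z)))\<^sup>2 * ennreal (japanese z powr (- 2 * \<theta>)))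
     + 2 * ((ennreal (cmod (v z)))\<^sup>2 * ennreal (japanese z powr (- 2 * \<theta>))) \<partial>lborel)"
    unfolding wnn_def
  proof (rule nn_integral_mono)
    fix z
    have "(ennreal (cmod (u z + v z)))\<^sup>2 \<le> (ennreal (cmod (u z)) + ennreal (cmod (v z)))\<^sup>2"
      by (intro power_mono) (auto simp: ennreal_plus[symmetric] norm_triangle_ineq intro!: ennreal_leI simp del: ennreal_plus)
    also have "\<dots> \<le> 2 * (ennreal (cmod (u z)))\<^sup>2 + 2 * (ennreal (cmod (v z)))\<^sup>2" by (rule ennreal_sum_power2_le)
    finally have "(ennreal (cmod (u z + v z)))\<^sup>2 * ennreal (japanese z powr (- 2 * \<theta>))
      \<le> (2 * (ennreal (cmod (u z)))\<^sup>2 + 2 * (ennreal (cmod (v z)))\<^sup>2) * ennreal (japanese z powr (- 2 * \<theta>))"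
      by (rule mult_right_mono) simp
    then show "(ennreal (cmod (u z + v z)))\<^sup>2 * ennreal (japanese z powr (- 2 * \<theta>))
      \<le> 2 * ((ennreal (cmod (u z)))\<^sup>2 * ennreal (japanese z powr (- 2 * \<theta>)))
        + 2 * ((ennreal (cmod (v z)))\<^sup>2 * ennreal (japanese z powr (- 2 * \<theta>)))"
      by (simp add: distrib_right mult.assoc)
  qed
  also have "\<dots> = 2 * wn \<theta> u + 2 * wn \<theta> v"
    unfolding wnn_def by (subst nn_integral_add, measurable, subst (1 2) nn_integral_cmult, measurable)
  finally show ?thesis .
qed

lemma wn_scale: "v \<in> borel_measurable borel \<Longrightarrow> wn \<theta> (\<lambda>z. c * v z) = ennreal ((cmod c)\<^sup>2) * wn \<theta> v"
  using wnn_cmult[of "\<lambda>z. ennreal (cmod (v z))" \<theta> "ennreal (cmod c)"]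
  by (simp add: norm_mult ennreal_mult ennreal_power)

lemma wL2_add: "u \<in> wL2 \<theta> \<Longrightarrow> v \<in> wL2 \<theta> \<Longrightarrow> (\<lambda>z. u z + v z) \<in> wL2 \<theta>"
proof -
  assume "u \<in> wL2 \<theta>" "v \<in> wL2 \<theta>"
  then have m: "u \<in> borel_measurable borel" "v \<in> borel_measurable borel" and f: "wn \<theta> u < \<infinity>" "wn \<theta> v < \<infinity>"
    by (auto simp: wL2_iff)
  have "2 * wn \<theta> u + 2 * wn \<theta> v < \<infinity>" using f by (simp add: ennreal_mult_less_top)
  with wn_add_le[OF m, of \<theta>] have "wn \<theta> (\<lambda>z. u z + v z) < \<infinity>" by (rule le_less_trans)
  then show ?thesis using m by (simp add: wL2_iff)
qed

lemma wL2_scale: "v \<in> wL2 \<theta> \<Longrightarrow> (\<lambda>z. c * v z) \<in> wL2 \<theta>"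
  by (auto simp: wL2_iff wn_scale ennreal_mult_less_top)

lemma wL2_diff: "u \<in> wL2 \<theta> \<Longrightarrow> v \<in> wL2 \<theta> \<Longrightarrow> (\<lambda>z. u z - v z) \<in> wL2 \<theta>"
  using wL2_add[of u \<theta> "\<lambda>z. (- 1) * v z"] wL2_scale[of v \<theta> "- 1"] by simp

lemma wL2_cnj: "v \<in> wL2 \<theta> \<Longrightarrow> (\<lambda>z. cnj (v z)) \<in> wL2 \<theta>"
  by (auto simp: wL2_iff)

lemma wL2_zero: "(\<lambda>_. 0) \<in> wL2 \<theta>"
  by (simp add: wL2_iff wnn_def)

lemma wn_diff_le:
  assumes [measurable]: "u \<in> borel_measurable borel" "v \<in> borel_measurable borel"
  shows "wn \<theta> (\<lambda>z. u z - v z) \<le> 2 * wn \<theta> u + 2 * wn \<theta> v"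
  using wn_add_le[of u "\<lambda>z. - v z" \<theta>] by simp

lemma wn_eq_0:
  assumes [measurable]: "v \<in> borel_measurable borel" and 0: "wn \<theta> v = 0"
  shows "AE z in lborel. v z = 0"
proof -
  have "AE z in lborel. (ennreal (cmod (v z)))\<^sup>2 * ennreal (japanese z powr (- 2 * \<theta>)) = 0"
    using 0 unfolding wnn_def by (subst (asm) nn_integral_0_iff_AE) auto
  then show ?thesis
    by eventually_elim (auto simp: ennreal_eq_0_iff[symmetric] ennreal_power)
qed

lemma wnn_antimono: "\<theta> \<le> \<theta>' \<Longrightarrow> wnn \<theta>' v \<le> wnn \<theta> v"
  unfolding wnn_def
proof (intro nn_integral_mono mult_left_mono ennreal_leI)
  fix z :: complex assume "\<theta> \<le> \<theta>'"
  then have "- 2 * \<theta>' \<le> - 2 * \<theta>" by simp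
  then show "japanese z powr (- 2 * \<theta>') \<le> japanese z powr (- 2 * \<theta>)"
    by (rule powr_mono[OF _ japanese_ge_1])
qed simp

lemma wL2_mono: "\<theta> \<le> \<theta>' \<Longrightarrow> v \<in> wL2 \<theta> \<Longrightarrow> v \<in> wL2 \<theta>'"
  unfolding wL2_iff using wnn_antimono le_less_trans by blast

lemma ae_eq_refl: "ae_eq u u" by (simp add: ae_eq_def)

lemma ae_eq_sym: "ae_eq u v \<Longrightarrow> ae_eq v u"
  by (auto simp: ae_eq_def elim: eventually_mono)

lemma ae_eq_trans:
  assumes "ae_eq u v" "ae_eq v w"
  shows "ae_eq u w"
  using assms unfolding ae_eq_def by eventually_elim simp

section \<open>The weak Liouville theorem at the borderline weight\<close>

lemma integrable_wL2_test:
  assumes f: "f \<in> wL2 \<theta>" and c: "continuous_on UNIV X" "\<And>z. R < cmod z \<Longrightarrow> X z = 0"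
  shows "integrable lborel (\<lambda>z. f z * X z)"
proof (rule integrableI_bounded)
  have [measurable]: "f \<in> borel_measurable borel" "X \<in> borel_measurable borel"
    using f c(1) by (auto simp: wL2_iff intro: borel_measurable_continuous_onI)
  show "(\<lambda>z. f z * X z) \<in> borel_measurable lborel" by measurable
  have "(\<integral>\<^sup>+z. ennreal (cmod (f z)) * ennreal (cmod (X z)) \<partial>lborel) < \<infinity>"
    by (rule wnn_pairing_finite[where \<theta>=\<theta>, OF _ _ c]) (use f in \<open>auto simp: wL2_iff\<close>)
  then show "(\<integral>\<^sup>+z. ennreal (cmod (f z * X z)) \<partial>lborel) < \<infinity>"
    by (simp add: norm_mult ennreal_mult)
qed

text \<open>The weight splits as \<langle>z\<rangle>^(-1), which puts \<open>f\<close> in L^2, times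
  \<langle>z\<rangle>^(-3), itself in L^2. The result is the growth condition of
  \<open>AE_eq_limit_of_averages\<close>.\<close>

lemma integrable_wL2_1:
  assumes f: "f \<in> wL2 1"
  shows "integrable lborel (\<lambda>z. cmod (f z) * japanese z powr (- 4))"
proof -
  have [measurable]: "f \<in> borel_measurable borel" using f by (simp add: wL2_iff)
  have 1: "(\<lambda>z. of_real (japanese z powr (- 1)) * f z) \<in> L2"
    using f unfolding wL2_iff wn_eq L2_nn_integral by simp
  have 2: "(\<lambda>z. complex_of_real (japanese z powr (- 3))) \<in> L2"
  proof -
    have "(\<integral>\<^sup>+z. (ennreal (cmod (complex_of_real (japanese z powr (- 3)))))\<^sup>2 \<partial>lborel) = (\<integral>\<^sup>+z. ennreal (japanese z powr (- 6)) \<partial>lborel)"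
      by (intro nn_integral_cong) (simp add: power2_eq_square ennreal_mult[symmetric] powr_add[symmetric])
    then show ?thesis unfolding L2_nn_integral using nn_integral_japanese[of 6] by simp
  qed
  have "cmod (of_real (japanese z powr (- 1)) * f z * complex_of_real (japanese z powr (- 3))) = cmod (f z) * japanese z powr (- 4)" for z
  proof -
    have "japanese z powr (- 1) * japanese z powr (- 3) = japanese z powr (- 4)"
      by (subst powr_add[symmetric]) simp
    then show ?thesis
      unfolding norm_mult norm_of_real abs_of_nonneg[OF powr_ge_zero] by (metis mult.assoc mult.commute)
  qed
  with integrable_norm[OF integrable_L2_mult[OF 1 2]] show ?thesis by simp
qed

lemma C_k_reg_kernel:
  assumes t: "0 < t"
  shows "C_k n (reg_kernel t a)"
proof -
  have D: "complex_of_real ((cmod (a - y))\<^sup>2 + t) = (a + - y) * cnj (a + - y) + of_real t" for y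
    unfolding of_real_add complex_norm_square by simp
  have nz: "(a + - y) * cnj (a + - y) + complex_of_real t \<noteq> 0" for y
    unfolding D[symmetric] of_real_eq_0_iff using t by (simp add: add_nonneg_pos less_imp_neq[symmetric])
  have "reg_kernel t a = (\<lambda>y. cnj (a + - y) * inverse ((a + - y) * cnj (a + - y) + of_real t))"
    unfolding reg_kernel_def[abs_def] D by (simp add: divide_inverse)
  moreover have "C_k n (\<lambda>y. cnj (a + - y) * inverse ((a + - y) * cnj (a + - y) + of_real t))"
    by (intro C_k_mult C_k_cnj C_k_add C_k_inverse C_k_const C_k_minus C_k_ident nz)
  ultimately show ?thesis by (simp only:)
qed

text \<open>Testing against \<open>reg_kernel t a\<close>, cut off at radius \<open>n \<rightarrow> \<infinity>\<close>, shows that the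
  averages of \<open>f\<close> against the kernels \<open>t / (|z - a|^2 + t)^2\<close> vanish.  The borderline weight
  \<open>\<theta> = 1\<close> is just enough to make the cutoff error tend to \<open>0\<close>.\<close>

lemma weak_holomorphic_average_zero:
  assumes f: "f \<in> wL2 1" and weak: "\<And>\<psi>. test_fun \<psi> \<Longrightarrow> dist_of f (dzbar \<psi>) = 0" and t: "0 < t"
  shows "(LINT z|lborel. f z * of_real (t / ((cmod (a - z))\<^sup>2 + t)\<^sup>2)) = 0"
proof -
  have [measurable]: "f \<in> borel_measurable borel" using f by (simp add: wL2_iff)
  obtain cx cy where cut: "C_k 0 cx" "C_k 0 cy" "has_partials cutoff cx cy"
    using C_k_cutoff[of "Suc 0"] unfolding C_k_Suc_iff by blast
  have ccut: "continuous_on UNIV cutoff" "continuous_on UNIV cx" "continuous_on UNIV cy"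
    using cut has_partials_continuous by auto
  have opens: "open {z::complex. 2 < cmod z}" "open {z::complex. cmod z < 1}"
    by (intro open_Collect_less continuous_intros)+
  have c0: "cx z = 0" "cy z = 0" if "2 < cmod z \<or> cmod z < 1" for z
    using has_partials_eq_0[OF cut(3) opens(1), of z 0] has_partials_eq_0[OF cut(3) opens(2), of z 1]
      that cutoff_eq_0 cutoff_eq_1 by auto
  define cb where "cb z = (cx z + \<i> * cy z) / 2" for z
  have ccb: "continuous_on UNIV cb" unfolding cb_def[abs_def] by (intro continuous_intros ccut) simp
  obtain B1 where B1: "0 \<le> B1" "\<And>z. cmod (cutoff z) \<le> B1"
    using bounded_of_compact_support[OF ccut(1), of 2] cutoff_eq_0 by (metis less_imp_le)
  obtain B2 where B2: "0 \<le> B2" "\<And>z. cmod (cb z) \<le> B2"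
    using bounded_of_compact_support[OF ccb, of 2] c0 by (auto simp: cb_def)
  define R where "R n = real (Suc n)" for n
  have R: "1 \<le> R n" "0 < R n" for n by (auto simp: R_def)
  define D where "D y = (cmod (a - y))\<^sup>2 + t" for y
  have D0: "0 < D y" for y using t by (simp add: D_def add_nonneg_pos)
  define kx where "kx y = - 1 / of_real (D y) + 2 * of_real (Re (a - y)) * cnj (a - y) / (of_real (D y))\<^sup>2" for y
  define ky where "ky y = \<i> / of_real (D y) + 2 * of_real (Im (a - y)) * cnj (a - y) / (of_real (D y))\<^sup>2" for y
  have pk: "has_partials (reg_kernel t a) kx ky"
    using has_partials_reg_kernel[OF t, of a] unfolding kx_def[abs_def] ky_def[abs_def] D_def .
  have dbk: "(kx y + \<i> * ky y) / 2 = - of_real (t / (D y)\<^sup>2)" for y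
    unfolding kx_def ky_def D_def by (rule reg_kernel_dbar[OF t])
  have ck: "continuous_on UNIV (reg_kernel t a)" by (rule has_partials_continuous[OF pk])
  \<comment> \<open>A genuine test function that agrees with the regularised kernel on the disc of
    radius \<open>R n\<close>.\<close>
  define \<psi> where "\<psi> n z = reg_kernel t a z * cutoff (of_real (1 / R n) * z)" for n z
  have vanish: "cutoff (of_real (1 / R n) * z) = 0" "cb (of_real (1 / R n) * z) = 0" if "2 * R n < cmod z" for n z
  proof -
    have "2 < cmod (of_real (1 / R n) * z)" using that R(2)[of n] by (simp add: norm_mult norm_divide less_divide_eq)
    then show "cutoff (of_real (1 / R n) * z) = 0" "cb (of_real (1 / R n) * z) = 0"
      using cutoff_eq_0 c0 by (auto simp: cb_def)
  qed
  have test: "test_fun (\<psi> n)" for n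
    unfolding test_fun_def
  proof (intro conjI allI)
    show "C_k m (\<psi> n)" for m
      unfolding \<psi>_def[abs_def] by (intro C_k_mult C_k_reg_kernel C_k_scale C_k_cutoff t)
    have "{z. \<psi> n z \<noteq> 0} \<subseteq> cball 0 (2 * R n)"
      using vanish(1)[of n] by (force simp: \<psi>_def)
    then have "bounded {z. \<psi> n z \<noteq> 0}" by (rule bounded_subset[OF bounded_cball])
    then show "compact (closure {z. \<psi> n z \<noteq> 0})" by (simp add: compact_closure)
  qed
  have pc: "has_partials (\<lambda>z. cutoff (of_real (1 / R n) * z))
      (\<lambda>z. of_real (1 / R n) * cx (of_real (1 / R n) * z)) (\<lambda>z. of_real (1 / R n) * cy (of_real (1 / R n) * z))" for n
    unfolding has_partials_def
  proof
    fix z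
    have 1: "((\<lambda>z. complex_of_real (1 / R n) * z) has_derivative (\<lambda>w. complex_of_real (1 / R n) * w)) (at z)"
      by (rule bounded_linear_imp_has_derivative[OF bounded_linear_mult_right])
    have 2: "(cutoff has_derivative (\<lambda>w. of_real (Re w) * cx (of_real (1 / R n) * z) + of_real (Im w) * cy (of_real (1 / R n) * z))) (at (of_real (1 / R n) * z))"
      using cut(3) unfolding has_partials_def by blast
    show "((\<lambda>z. cutoff (of_real (1 / R n) * z)) has_derivative (\<lambda>w. of_real (Re w) * (of_real (1 / R n) * cx (of_real (1 / R n) * z))
        + of_real (Im w) * (of_real (1 / R n) * cy (of_real (1 / R n) * z)))) (at z)"
      using has_derivative_compose[OF 1 2] by (simp add: add_divide_distrib)
  qed
  have db: "dzbar (\<psi> n) z = - of_real (t / (D z)\<^sup>2) * cutoff (of_real (1 / R n) * z)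
      + reg_kernel t a z * (of_real (1 / R n) * cb (of_real (1 / R n) * z))" for n z
  proof -
    have alg: "((u1 * c + k * c1) + \<i> * (u2 * c + k * c2)) / 2 = ((u1 + \<i> * u2) / 2) * c + k * ((c1 + \<i> * c2) / 2)"
      for u1 u2 c k c1 c2 :: complex by (simp add: field_simps)
    have "dzbar (\<psi> n) z = ((kx z + \<i> * ky z) / 2) * cutoff (of_real (1 / R n) * z) + reg_kernel t a z
        * ((of_real (1 / R n) * cx (of_real (1 / R n) * z) + \<i> * (of_real (1 / R n) * cy (of_real (1 / R n) * z))) / 2)"
      unfolding \<psi>_def[abs_def] has_partials_dzbar[OF has_partials_mult[OF pk pc]] alg ..
    moreover have "(of_real (1 / R n) * cx (of_real (1 / R n) * z) + \<i> * (of_real (1 / R n) * cy (of_real (1 / R n) * z))) / 2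
       = of_real (1 / R n) * cb (of_real (1 / R n) * z)"
      by (simp add: cb_def add_divide_distrib mult.commute)
    ultimately show ?thesis unfolding dbk by simp
  qed
  let ?X1 = "\<lambda>n z. - complex_of_real (t / (D z)\<^sup>2) * cutoff (of_real (1 / R n) * z)"
  let ?X2 = "\<lambda>n z. reg_kernel t a z * (of_real (1 / R n) * cb (of_real (1 / R n) * z))"
  have cD: "continuous_on UNIV (\<lambda>z. complex_of_real (t / (D z)\<^sup>2))"
    using D0 unfolding D_def by (intro continuous_intros) (auto simp: less_imp_neq[symmetric])
  have cs: "continuous_on UNIV (\<lambda>z. g (complex_of_real (1 / R n) * z))" if "continuous_on UNIV g" for g :: "complex \<Rightarrow> complex" and n
    by (rule continuous_on_compose2[OF that continuous_on_mult[OF continuous_on_const continuous_on_id]]) simp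
  have cX: "continuous_on UNIV (?X1 n)" "continuous_on UNIV (?X2 n)" for n
    by (intro continuous_intros cD ck cs ccut ccb; use R(2)[of n] in simp)+
  have i1: "integrable lborel (\<lambda>z. f z * ?X1 n z)" for n
    by (rule integrable_wL2_test[OF f cX(1), of "2 * R n"]) (simp only: vanish mult_zero_right)
  have i2: "integrable lborel (\<lambda>z. f z * ?X2 n z)" for n
    by (rule integrable_wL2_test[OF f cX(2), of "2 * R n"]) (simp only: vanish mult_zero_right)
  have sum0: "(LINT z|lborel. f z * ?X1 n z) = - (LINT z|lborel. f z * ?X2 n z)" for n
  proof -
    have "0 = (LINT z|lborel. f z * ?X1 n z + f z * ?X2 n z)"
      using weak[OF test[of n]] unfolding dist_of_def db by (simp only: distrib_left)
    also have "\<dots> = (LINT z|lborel. f z * ?X1 n z) + (LINT z|lborel. f z * ?X2 n z)"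
      by (rule Bochner_Integration.integral_add[OF i1 i2])
    finally show ?thesis by (simp add: eq_neg_iff_add_eq_0)
  qed
  define G where "G = 2 * (japanese a)\<^sup>2 / t + 2"
  have G: "0 < G" using t by (simp add: G_def add_nonneg_pos)
  have lim1: "(\<lambda>n. LINT z|lborel. f z * ?X1 n z) \<longlonglongrightarrow> (LINT z|lborel. f z * - of_real (t / (D z)\<^sup>2))"
  proof (rule integral_dominated_convergence)
    show "integrable lborel (\<lambda>z. (t * G\<^sup>2 * B1) * (cmod (f z) * japanese z powr (- 4)))"
      by (rule integrable_mult_right[OF integrable_wL2_1[OF f]])
    show "AE z in lborel. (\<lambda>n. f z * ?X1 n z) \<longlonglongrightarrow> f z * - of_real (t / (D z)\<^sup>2)"
    proof (intro AE_I2 tendsto_eventually)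
      fix z :: complex
      obtain N where N: "cmod z < real N" using reals_Archimedean2 by blast
      have "f z * ?X1 n z = f z * - of_real (t / (D z)\<^sup>2)" if "N \<le> n" for n
      proof -
        have "cmod z \<le> R n" using N that by (simp add: R_def)
        then have "cmod (of_real (1 / R n) * z) \<le> 1" using R(2)[of n] by (simp add: norm_mult norm_divide divide_le_eq)
        then show ?thesis by (simp add: cutoff_eq_1 del: of_real_divide)
      qed
      then show "\<forall>\<^sub>F n in sequentially. f z * ?X1 n z = f z * - of_real (t / (D z)\<^sup>2)"
        unfolding eventually_sequentially by blast
    qed
    show "AE z in lborel. cmod (f z * ?X1 n z) \<le> (t * G\<^sup>2 * B1) * (cmod (f z) * japanese z powr (- 4))" for n
    proof (intro AE_I2)
      fix z
      have "(1 / D z)\<^sup>2 \<le> (G / (japanese z)\<^sup>2)\<^sup>2"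
        unfolding D_def G_def using t by (intro power_mono inverse_regularized_le) (auto simp: add_nonneg_nonneg)
      then have "t * (1 / D z)\<^sup>2 \<le> t * (G / (japanese z)\<^sup>2)\<^sup>2" using t by (intro mult_left_mono) auto
      also have "\<dots> = t * G\<^sup>2 * japanese z powr (- 4)"
        by (simp add: power_divide powr_minus_divide power_mult[symmetric])
      finally have "t / (D z)\<^sup>2 \<le> t * G\<^sup>2 * japanese z powr (- 4)" by (simp add: power_divide)
      then have "cmod (?X1 n z) \<le> (t * G\<^sup>2 * japanese z powr (- 4)) * B1"
        unfolding norm_mult norm_minus_cancel norm_of_real
        using B1 t by (intro mult_mono) auto
      from mult_left_mono[OF this norm_ge_zero[of "f z"]]
      show "cmod (f z * ?X1 n z) \<le> (t * G\<^sup>2 * B1) * (cmod (f z) * japanese z powr (- 4))"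
        unfolding norm_mult[of "f z"] by (simp only: mult_ac)
    qed
  qed (use i1 borel_measurable_integrable in \<open>auto simp: D_def\<close>)
  define F where "F z = (cmod (f z))\<^sup>2 * japanese z powr (- 2)" for z
  have iF: "integrable lborel F"
    using f unfolding wL2_iff wnn_def F_def
    by (intro integrableI_bounded) (auto simp: ennreal_power ennreal_mult[symmetric])
  have [measurable]: "F \<in> borel_measurable borel" unfolding F_def by measurable
  \<comment> \<open>The L^2 mass of f/\<langle>z\<rangle> outside the disc of radius
    \<open>R n\<close>. As the tail of a convergent integral it tends to 0, without any
    rate.\<close>
  define E where "E n = (LINT z|lborel. indicator {z. R n \<le> cmod z} z * F z)" for n
  have F0: "0 \<le> F z" for z by (simp add: F_def)
  have iE: "integrable lborel (\<lambda>z. indicator {z. R n \<le> cmod z} z * F z)" for n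
    by (rule Bochner_Integration.integrable_bound[OF iF]) (auto simp: indicator_def)
  have E: "E \<longlonglongrightarrow> 0"
  proof -
    have "E \<longlonglongrightarrow> (LINT z|(lborel :: complex measure). 0)"
      unfolding E_def
    proof (rule integral_dominated_convergence[OF _ _ iF])
      show "AE z in lborel. (\<lambda>n. indicator {z. R n \<le> cmod z} z * F z) \<longlonglongrightarrow> 0"
      proof (intro AE_I2 tendsto_eventually)
        fix z :: complex
        obtain N where N: "cmod z < real N" using reals_Archimedean2 by blast
        then have "\<forall>n\<ge>N. indicator {z. R n \<le> cmod z} z * F z = 0" by (auto simp: R_def)
        then show "\<forall>\<^sub>F n in sequentially. indicator {z. R n \<le> cmod z} z * F z = 0"
          unfolding eventually_sequentially by blast
      qed
      show "AE z in lborel. norm (indicator {z. R n \<le> cmod z} z * F z) \<le> F z" for n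
        by (intro AE_I2) (auto simp: indicator_def F0)
    qed measurable
    then show ?thesis by simp
  qed
  define K where "K = sqrt G * B2"
  have K0: "0 \<le> K" using G B2 by (simp add: K_def)
  have m1: "(\<lambda>z. ennreal (indicator {z. R n \<le> cmod z} z * (cmod (f z) * japanese z powr (- 1)))) \<in> borel_measurable lborel" for n
  proof -
    have [measurable]: "{z::complex. R n \<le> cmod z} \<in> sets borel"
      by (intro borel_closed closed_Collect_le continuous_intros)
    have "(\<lambda>z. cmod (f z) * japanese z powr (- 1)) \<in> borel_measurable lborel" by measurable
    then show ?thesis
      by (intro measurable_compose[OF _ measurable_ennreal] borel_measurable_times borel_measurable_indicator) simp_all
  qed
  have m2: "(\<lambda>z. ennreal (K / R n) * indicator (cball (0::complex) (2 * R n)) z) \<in> borel_measurable lborel" for n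
    by (intro borel_measurable_times_ennreal borel_measurable_indicator) simp_all
  \<comment> \<open>The derivative of the cutoff is O(1/R) and lives on R \<le> |z| \<le> 2R, while
    the kernel is O(1/\<langle>z\<rangle>). Cauchy--Schwarz pairs the tail mass of
    f/\<langle>z\<rangle> with an area of order R^2, which cancels 1/R^2 exactly, so the tail mass
    alone forces convergence.\<close>
  have err: "ennreal ((cmod (LINT z|lborel. f z * ?X2 n z))\<^sup>2) \<le> ennreal (16 * K\<^sup>2 * E n)" for n
  proof -
    have "ennreal (cmod (LINT z|lborel. f z * ?X2 n z)) \<le> (\<integral>\<^sup>+z. ennreal (cmod (f z * ?X2 n z)) \<partial>lborel)"
      by (rule integral_norm_bound_ennreal[OF i2])
    also have "\<dots> \<le> (\<integral>\<^sup>+z. ennreal (indicator {z. R n \<le> cmod z} z * (cmod (f z) * japanese z powr (- 1))) * (ennreal (K / R n) * indicator (cball (0::complex) (2 * R n)) z) \<partial>lborel)"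
    proof (rule nn_integral_mono)
      fix z
      show "ennreal (cmod (f z * ?X2 n z)) \<le> ennreal (indicator {z. R n \<le> cmod z} z * (cmod (f z) * japanese z powr (- 1))) * (ennreal (K / R n) * indicator (cball (0::complex) (2 * R n)) z)"
      proof (cases "R n \<le> cmod z \<and> cmod z \<le> 2 * R n")
        case True
        have "cmod (?X2 n z) \<le> (sqrt G / japanese z) * (1 / R n * B2)"
          unfolding norm_mult norm_of_real using R(2)[of n] B2 G norm_reg_kernel_le[OF t, of a z]
          by (intro mult_mono) (auto simp: G_def)
        also have "\<dots> = japanese z powr (- 1) * (K / R n)"
          by (simp add: K_def powr_neg_one)
        finally have "cmod (f z * ?X2 n z) \<le> cmod (f z) * (japanese z powr (- 1) * (K / R n))"
          unfolding norm_mult[of "f z"] by (rule mult_left_mono) simp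
        then have "ennreal (cmod (f z * ?X2 n z)) \<le> ennreal ((cmod (f z) * japanese z powr (- 1)) * (K / R n))"
          by (intro ennreal_leI) (simp only: mult.assoc)
        also have "\<dots> = ennreal (cmod (f z) * japanese z powr (- 1)) * ennreal (K / R n)"
          using K0 R(2)[of n] by (intro ennreal_mult) auto
        finally show ?thesis using True by simp
      next
        case False
        have "cb (of_real (1 / R n) * z) = 0"
        proof (cases "cmod z < R n")
          case True
          then have "cmod (of_real (1 / R n) * z) < 1" using R(2)[of n] by (simp add: norm_mult norm_divide divide_less_eq)
          then show ?thesis using c0 by (simp add: cb_def)
        next
          case False
          with \<open>\<not> (R n \<le> cmod z \<and> cmod z \<le> 2 * R n)\<close> have "2 * R n < cmod z" by auto
          then show ?thesis by (rule vanish(2))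
        qed
        then show ?thesis by simp
      qed
    qed
    finally have "(ennreal (cmod (LINT z|lborel. f z * ?X2 n z)))\<^sup>2 \<le> (\<integral>\<^sup>+z. ennreal (indicator {z. R n \<le> cmod z} z * (cmod (f z) * japanese z powr (- 1))) * (ennreal (K / R n) * indicator (cball (0::complex) (2 * R n)) z) \<partial>lborel)\<^sup>2"
      by (intro power_mono) auto
    also have "\<dots> \<le> (\<integral>\<^sup>+z. (ennreal (indicator {z. R n \<le> cmod z} z * (cmod (f z) * japanese z powr (- 1))))\<^sup>2 \<partial>lborel) * (\<integral>\<^sup>+z. (ennreal (K / R n) * indicator (cball (0::complex) (2 * R n)) z)\<^sup>2 \<partial>lborel)"
      by (rule Cauchy_Schwarz_nn_integral[OF m1 m2])
    also have "(\<integral>\<^sup>+z. (ennreal (indicator {z. R n \<le> cmod z} z * (cmod (f z) * japanese z powr (- 1))))\<^sup>2 \<partial>lborel) = (\<integral>\<^sup>+z. ennreal (indicator {z. R n \<le> cmod z} z * F z) \<partial>lborel)"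
      by (intro nn_integral_cong) (auto simp: ennreal_power F_def indicator_def power_divide powr_minus_divide)
    also have "\<dots> = ennreal (E n)"
      unfolding E_def by (rule nn_integral_eq_integral[OF iE]) (auto simp: F0)
    also have "(\<integral>\<^sup>+z. (ennreal (K / R n) * indicator (cball (0::complex) (2 * R n)) z)\<^sup>2 \<partial>lborel) \<le> ennreal (16 * K\<^sup>2)"
    proof -
      have "(\<integral>\<^sup>+z. (ennreal (K / R n) * indicator (cball (0::complex) (2 * R n)) z)\<^sup>2 \<partial>lborel) = (\<integral>\<^sup>+z. ennreal ((K / R n)\<^sup>2) * indicator (cball (0::complex) (2 * R n)) z \<partial>lborel)"
        using K0 R(2)[of n] by (intro nn_integral_cong) (auto simp: indicator_def ennreal_power)
      also have "\<dots> = ennreal ((K / R n)\<^sup>2) * emeasure lborel (cball (0::complex) (2 * R n))"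
        by (rule nn_integral_cmult_indicator) simp
      \<comment> \<open>Only the order R^2 of the area matters, so the disc is replaced by its
        circumscribed square of side 4R.\<close>
      also have "emeasure lborel (cball (0::complex) (2 * R n)) \<le> emeasure lborel (cbox (Complex (- 2 * R n) (- 2 * R n)) (Complex (2 * R n) (2 * R n)))"
      proof (rule emeasure_mono)
        show "cball 0 (2 * R n) \<subseteq> cbox (Complex (- 2 * R n) (- 2 * R n)) (Complex (2 * R n) (2 * R n))"
        proof
          fix z :: complex assume "z \<in> cball 0 (2 * R n)"
          then have "\<bar>Re z\<bar> \<le> 2 * R n" "\<bar>Im z\<bar> \<le> 2 * R n"
            using abs_Re_le_cmod[of z] abs_Im_le_cmod[of z] by auto
          then show "z \<in> cbox (Complex (- 2 * R n) (- 2 * R n)) (Complex (2 * R n) (2 * R n))"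
            by (auto simp: in_cbox_complex_iff)
        qed
      qed simp
      also have "\<dots> = ennreal ((4 * R n) * (4 * R n))"
        using R(2)[of n] by (subst emeasure_lborel_cbox) (auto simp: Basis_complex_def inner_complex_def)
      finally have "(\<integral>\<^sup>+z. (ennreal (K / R n) * indicator (cball (0::complex) (2 * R n)) z)\<^sup>2 \<partial>lborel) \<le> ennreal ((K / R n)\<^sup>2) * ennreal ((4 * R n) * (4 * R n))"
        by (simp add: mult_left_mono)
      also have "\<dots> = ennreal ((K / R n)\<^sup>2 * ((4 * R n) * (4 * R n)))"
        using R(2)[of n] by (intro ennreal_mult[symmetric]) auto
      also have "(K / R n)\<^sup>2 * ((4 * R n) * (4 * R n)) = 16 * K\<^sup>2"
        using R(2)[of n] by (simp add: power2_eq_square)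
      finally show ?thesis .
    qed
    finally have "(ennreal (cmod (LINT z|lborel. f z * ?X2 n z)))\<^sup>2 \<le> ennreal (E n) * ennreal (16 * K\<^sup>2)"
      by (simp add: mult_left_mono)
    also have "\<dots> = ennreal (16 * K\<^sup>2 * E n)"
    proof -
      have "0 \<le> E n" unfolding E_def by (intro Bochner_Integration.integral_nonneg) (auto simp: F0)
      then show ?thesis by (subst ennreal_mult[symmetric]) (auto simp: mult_ac)
    qed
    finally show ?thesis by (simp add: ennreal_power)
  qed
  have E0: "0 \<le> E n" for n unfolding E_def by (intro Bochner_Integration.integral_nonneg) (auto simp: F0)
  have err': "(cmod (LINT z|lborel. f z * ?X2 n z))\<^sup>2 \<le> 16 * K\<^sup>2 * E n" for n
    using err[of n] E0[of n] by (simp add: ennreal_le_iff)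
  have "(\<lambda>n. (cmod (LINT z|lborel. f z * ?X2 n z))\<^sup>2) \<longlonglongrightarrow> 0"
  proof (rule tendsto_sandwich[where f="\<lambda>_. 0"])
    show "(\<lambda>n. 16 * K\<^sup>2 * E n) \<longlonglongrightarrow> 0" using tendsto_mult[OF tendsto_const E, of "16 * K\<^sup>2"] by simp
  qed (use err' in auto)
  then have "(\<lambda>n. sqrt ((cmod (LINT z|lborel. f z * ?X2 n z))\<^sup>2)) \<longlonglongrightarrow> sqrt 0" by (rule tendsto_real_sqrt)
  then have "(\<lambda>n. LINT z|lborel. f z * ?X2 n z) \<longlonglongrightarrow> 0" by (simp add: tendsto_norm_zero_iff)
  then have "(\<lambda>n. LINT z|lborel. f z * ?X1 n z) \<longlonglongrightarrow> 0"
    unfolding sum0 using tendsto_minus by fastforce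
  with lim1 have "(LINT z|lborel. f z * - of_real (t / (D z)\<^sup>2)) = 0" by (rule LIMSEQ_unique)
  then show ?thesis by (simp add: D_def)
qed

text \<open>All averages of \<open>f\<close> against one approximate identity vanish, so their limit
  0 is \<open>f\<close> almost everywhere. The kernel is the one produced by dbar of the regularised
  Cauchy kernel, divided by its mass pi.\<close>

theorem weak_liouville:
  assumes f: "f \<in> wL2 1" and weak: "\<And>\<psi>. test_fun \<psi> \<Longrightarrow> dist_of f (dzbar \<psi>) = 0"
  shows "AE z in lborel. f z = 0"
proof -
  define k where "k x = 1 / (pi * (1 + (cmod x)\<^sup>2)\<^sup>2)" for x :: complex
  have k[measurable]: "k \<in> borel_measurable borel" unfolding k_def[abs_def] by measurable
  have k0: "0 \<le> k x" for x by (simp add: k_def)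
  have kC: "k x \<le> 1 * japanese x powr (- 4)" for x
  proof -
    have "k x \<le> 1 / (1 * ((japanese x)\<^sup>2)\<^sup>2)"
      unfolding k_def japanese_squared[symmetric] using pi_gt3
      by (intro divide_left_mono mult_right_mono) auto
    then show ?thesis by (simp add: powr_minus_divide power_mult[symmetric])
  qed
  have k1: "(\<integral>\<^sup>+x. ennreal (k x) \<partial>lborel) = 1"
  proof -
    have "(\<integral>\<^sup>+x. ennreal (k x) \<partial>lborel) = (\<integral>\<^sup>+x. ennreal (1 / pi) * ennreal (1 / (1 + (cmod (x::complex))\<^sup>2)\<^sup>2) \<partial>lborel)"
      by (intro nn_integral_cong) (simp add: k_def ennreal_mult[symmetric])
    also have "\<dots> = ennreal (1 / pi) * ennreal pi"
      by (subst nn_integral_cmult) (auto simp: nn_integral_japanese_4)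
    also have "\<dots> = 1" by (subst ennreal_mult[symmetric]) auto
    finally show ?thesis .
  qed
  define \<tau> :: "nat \<Rightarrow> real" where "\<tau> n = 1 / (real n + 1)" for n
  have \<tau>: "0 < \<tau> n" "\<tau> n \<le> 1" for n by (auto simp: \<tau>_def add_nonneg_pos)
  have \<tau>lim: "\<tau> \<longlonglongrightarrow> 0" unfolding \<tau>_def by real_asymp
  have zero: "(LINT z|lborel. f z * of_real (k ((1 / \<tau> n) *\<^sub>R (a - z)) / (\<tau> n)\<^sup>2)) = 0" for n a
  proof -
    define T where "T = \<tau> n"
    have T: "0 < T" using \<tau> by (simp add: T_def)
    \<comment> \<open>The approximate identity at width T is the regularised kernel with parameter t
      = T^2.\<close>
    have "k ((1 / T) *\<^sub>R (a - z)) / T\<^sup>2 = (1 / pi) * (T\<^sup>2 / ((cmod (a - z))\<^sup>2 + T\<^sup>2)\<^sup>2)" for z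
    proof -
      have p: "0 < (cmod (a - z))\<^sup>2 + T\<^sup>2" using T by (simp add: add_nonneg_pos)
      have "1 + (cmod ((1 / T) *\<^sub>R (a - z)))\<^sup>2 = ((cmod (a - z))\<^sup>2 + T\<^sup>2) / T\<^sup>2"
        unfolding norm_scaleR using T by (simp add: power_divide add_divide_distrib)
      moreover have "1 / (pi * (S / U)\<^sup>2) / U = 1 / pi * (U / S\<^sup>2)" if "0 < S" "0 < U" for S U :: real
        using that by (simp add: power2_eq_square)
      ultimately show ?thesis unfolding k_def using T p by (simp only: zero_less_power)
    qed
    then have "(LINT z|lborel. f z * of_real (k ((1 / \<tau> n) *\<^sub>R (a - z)) / (\<tau> n)\<^sup>2))
       = (LINT z|lborel. of_real (1 / pi) * (f z * of_real (T\<^sup>2 / ((cmod (a - z))\<^sup>2 + T\<^sup>2)\<^sup>2)))"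
      unfolding T_def[symmetric] by (simp only: of_real_mult mult.left_commute)
    also have "\<dots> = 0"
      unfolding integral_mult_right_zero
      using weak_holomorphic_average_zero[OF f weak, of "T\<^sup>2" a] T by simp
    finally show ?thesis .
  qed
  have "AE z in lborel. f z = (\<lambda>_. 0) z"
    by (rule AE_eq_limit_of_averages[OF wL2_measurable[OF f] integrable_wL2_1[OF f] k k0 kC k1 \<tau> \<tau>lim, where B=0])
      (simp_all only: zero norm_zero tendsto_const order_refl)
  then show ?thesis by simp
qed

section \<open>Neumann series up to null sets\<close>

text \<open>Cauchy--Schwarz for series with weights 2^(-i), whose squares sum to 4/3 \<le> 2. It
  bounds the square of an infinite sum by squares, at the price of the growing weights 4^i.\<close>

lemma suminf_power2_le:
  fixes a :: "nat \<Rightarrow> ennreal"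
  shows "(\<Sum>i. a i)\<^sup>2 \<le> 2 * (\<Sum>i. 4 ^ i * (a i)\<^sup>2)"
proof -
  let ?f = "\<lambda>i::nat. ennreal ((1 / 2) ^ i)" and ?g = "\<lambda>i. ennreal (2 ^ i) * a i"
  have fg: "a i = ?f i * ?g i" for i
  proof -
    have "?f i * ennreal (2 ^ i) = ennreal ((1 / 2) ^ i * 2 ^ i)" by (rule ennreal_mult[symmetric]) auto
    also have "(1 / 2) ^ i * 2 ^ i = (1 :: real)" by (simp add: power_mult_distrib[symmetric])
    finally show ?thesis by (simp add: mult.assoc[symmetric])
  qed
  have "(\<Sum>i. a i)\<^sup>2 = (\<integral>\<^sup>+i. ?f i * ?g i \<partial>count_space UNIV)\<^sup>2"
    unfolding fg[symmetric] by (simp add: nn_integral_count_space_nat)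
  also have "\<dots> \<le> (\<integral>\<^sup>+i. (?f i)\<^sup>2 \<partial>count_space UNIV) * (\<integral>\<^sup>+i. (?g i)\<^sup>2 \<partial>count_space UNIV)"
    by (rule Cauchy_Schwarz_nn_integral) auto
  also have "(\<integral>\<^sup>+i. (?f i)\<^sup>2 \<partial>count_space UNIV) = (\<Sum>i. ennreal ((1 / 4) ^ i))"
    unfolding nn_integral_count_space_nat
    by (intro suminf_cong) (simp add: power2_eq_square ennreal_mult[symmetric] power_mult_distrib[symmetric])
  also have "\<dots> = ennreal (\<Sum>i. (1 / 4) ^ i)"
    by (intro suminf_ennreal2) (auto intro: summable_geometric)
  also have "\<dots> \<le> 2"
    by (subst suminf_geometric) (auto simp: ennreal_numeral[symmetric] ennreal_leI simp del: ennreal_numeral)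
  also have "(\<integral>\<^sup>+i. (?g i)\<^sup>2 \<partial>count_space UNIV) = (\<Sum>i. 4 ^ i * (a i)\<^sup>2)"
    unfolding nn_integral_count_space_nat
  proof (intro suminf_cong)
    fix i
    have "(ennreal (2 ^ i))\<^sup>2 = ennreal ((2 ^ i)\<^sup>2)" by (simp add: ennreal_power)
    also have "(2 ^ i)\<^sup>2 = (4 ^ i :: real)" by (simp add: power2_eq_square power_mult_distrib[symmetric])
    also have "ennreal (4 ^ i) = 4 ^ i" by (simp add: ennreal_power[symmetric])
    finally show "(?g i)\<^sup>2 = 4 ^ i * (a i)\<^sup>2" by (simp add: power_mult_distrib)
  qed
  finally show ?thesis by (simp add: mult_right_mono)
qed

lemma ennreal_two_sum:
  assumes "0 \<le> x" "0 \<le> y"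
  shows "2 * ennreal x + 2 * (ennreal (1 / 16) * ennreal y) = ennreal (2 * x + 2 * (1 / 16 * y))"
proof -
  have "2 * ennreal x = ennreal (2 * x)" using assms(1) by (simp add: ennreal_mult)
  moreover have "2 * (ennreal (1 / 16) * ennreal y) = ennreal (2 * (1 / 16 * y))"
    using assms(2) by (simp only: ennreal_mult[of 2 "1 / 16 * y"] ennreal_mult[of "1 / 16" y]
        ennreal_numeral mult_nonneg_nonneg zero_le_divide_1_iff zero_le_numeral)
  ultimately show ?thesis using assms by simp
qed

text \<open>Linearity is assumed only for differences and only up to null sets, which is all that
  Cauchy integrals satisfy. The constant 1/16 for squared norms means a contraction by 1/4 in norm;
  it beats the weights 4^i of \<open>suminf_power2_le\<close> as well as the factors 2 of
  \<open>wn_add_le\<close>.\<close>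

locale ae_contraction =
  fixes \<theta> :: real and S :: "(complex \<Rightarrow> complex) \<Rightarrow> complex \<Rightarrow> complex"
  assumes S_wL2: "u \<in> wL2 \<theta> \<Longrightarrow> S u \<in> wL2 \<theta>"
    and S_contraction: "u \<in> wL2 \<theta> \<Longrightarrow> wn \<theta> (S u) \<le> ennreal (1 / 16) * wn \<theta> u"
    and S_diff: "u \<in> wL2 \<theta> \<Longrightarrow> v \<in> wL2 \<theta> \<Longrightarrow> ae_eq (S (\<lambda>z. u z - v z)) (\<lambda>z. S u z - S v z)"
begin

lemma one_minus_wL2: "u \<in> wL2 \<theta> \<Longrightarrow> one_minus S u \<in> wL2 \<theta>"
  unfolding one_minus_def by (intro wL2_diff S_wL2)

lemma lower_bound:
  assumes u: "u \<in> wL2 \<theta>"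
  shows "wn \<theta> u \<le> ennreal 4 * wn \<theta> (one_minus S u)"
proof -
  note m = wL2_measurable[OF u] wL2_measurable[OF S_wL2[OF u]] wL2_measurable[OF one_minus_wL2[OF u]]
  have fin: "wn \<theta> u < \<infinity>" "wn \<theta> (one_minus S u) < \<infinity>"
    using u one_minus_wL2[OF u] by (auto simp: wL2_iff)
  \<comment> \<open>Finiteness of both norms allows the term a/8 to be absorbed on the left.\<close>
  then obtain a b where a: "wn \<theta> u = ennreal a" "0 \<le> a" and b: "wn \<theta> (one_minus S u) = ennreal b" "0 \<le> b"
    by (cases "wn \<theta> u"; cases "wn \<theta> (one_minus S u)") auto
  have "wn \<theta> u = wn \<theta> (\<lambda>z. one_minus S u z + S u z)" by (simp add: one_minus_def)
  also have "\<dots> \<le> 2 * wn \<theta> (one_minus S u) + 2 * wn \<theta> (S u)" by (rule wn_add_le[OF m(3,2)])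
  also have "\<dots> \<le> 2 * wn \<theta> (one_minus S u) + 2 * (ennreal (1 / 16) * wn \<theta> u)"
    by (intro add_left_mono mult_left_mono S_contraction u) auto
  also have "\<dots> = ennreal (2 * b + 2 * (1 / 16 * a))"
    unfolding a(1) b(1) by (rule ennreal_two_sum[OF b(2) a(2)])
  finally have "a \<le> 2 * b + 2 * (1 / 16 * a)" unfolding a(1) using a(2) b(2) by (subst (asm) ennreal_le_iff) auto
  then have "a \<le> 4 * b" using b(2) by simp
  from ennreal_leI[OF this] show ?thesis unfolding a(1) b(1) using b(2) by (simp add: ennreal_mult)
qed

lemma one_minus_diff:
  assumes "u \<in> wL2 \<theta>" "v \<in> wL2 \<theta>"
  shows "ae_eq (one_minus S (\<lambda>z. u z - v z)) (\<lambda>z. one_minus S u z - one_minus S v z)"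
  using S_diff[OF assms] unfolding ae_eq_def one_minus_def by eventually_elim simp

text \<open>The forward direction is well-definedness on classes: a difference of norm 0 is sent by
  S to a function of norm 0. The backward direction is the lower bound applied to the
  difference.\<close>

lemma one_minus_inj_iff:
  assumes uv: "u \<in> wL2 \<theta>" "v \<in> wL2 \<theta>"
  shows "ae_eq u v \<longleftrightarrow> ae_eq (one_minus S u) (one_minus S v)"
proof -
  note d = wL2_diff[OF uv]
  have m: "(\<lambda>z. u z - v z) \<in> borel_measurable borel" "S (\<lambda>z. u z - v z) \<in> borel_measurable borel"
    using d S_wL2 by (auto simp: wL2_iff)
  show ?thesis
  proof
    assume "ae_eq u v"
    then have "ae_eq (\<lambda>z. u z - v z) (\<lambda>_. 0)" unfolding ae_eq_def by eventually_elim simp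
    then have 0: "wn \<theta> (\<lambda>z. u z - v z) = 0" by (subst wn_cong) (auto simp: wnn_def)
    have "wn \<theta> (S (\<lambda>z. u z - v z)) = 0"
      using S_contraction[OF d] by (simp add: 0)
    from wn_eq_0[OF m(2) this] S_diff[OF uv] \<open>ae_eq u v\<close>
    show "ae_eq (one_minus S u) (one_minus S v)"
      unfolding ae_eq_def one_minus_def by eventually_elim simp
  next
    assume "ae_eq (one_minus S u) (one_minus S v)"
    with one_minus_diff[OF uv] have "ae_eq (one_minus S (\<lambda>z. u z - v z)) (\<lambda>_. 0)"
      unfolding ae_eq_def by eventually_elim simp
    then have 0: "wn \<theta> (one_minus S (\<lambda>z. u z - v z)) = 0" by (subst wn_cong) (auto simp: wnn_def)
    have "wn \<theta> (\<lambda>z. u z - v z) = 0" using lower_bound[OF d] by (simp add: 0)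
    from wn_eq_0[OF m(1) this] show "ae_eq u v"
      unfolding ae_eq_def by eventually_elim simp
  qed
qed

text \<open>Successive approximation with s(n + 1) = v + S s(n). Rather than through completeness of
  the space, the limit is built pointwise: the increments are absolutely summable almost
  everywhere.\<close>

lemma one_minus_surj:
  assumes v: "v \<in> wL2 \<theta>"
  shows "\<exists>u\<in>wL2 \<theta>. ae_eq (one_minus S u) v"
proof -
  define s where "s = rec_nat (\<lambda>_. 0) (\<lambda>_ w z. v z + S w z)"
  have s0: "s 0 = (\<lambda>_. 0)" and sS: "s (Suc n) = (\<lambda>z. v z + S (s n) z)" for n
    by (simp_all add: s_def)
  have s: "s n \<in> wL2 \<theta>" for n
    by (induction n) (auto simp: s0 sS wL2_zero intro!: wL2_add v S_wL2)
  define d where "d n = (\<lambda>z. s (Suc n) z - s n z)" for n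
  have d: "d n \<in> wL2 \<theta>" for n unfolding d_def by (intro wL2_diff s)
  have [measurable]: "d n \<in> borel_measurable borel" "s n \<in> borel_measurable borel" for n
    using d s by (auto simp: wL2_iff)
  obtain W where W: "wn \<theta> (d 0) = ennreal W" "0 \<le> W"
    using d[of 0] by (cases "wn \<theta> (d 0)") (auto simp: wL2_iff)
  have dW: "wn \<theta> (d n) \<le> ennreal ((1 / 16) ^ n * W)" for n
  proof (induction n)
    case (Suc n)
    have "ae_eq (d (Suc n)) (S (d n))"
      using S_diff[OF s[of "Suc n"] s[of n]] unfolding d_def sS[of "Suc n"] ae_eq_def
      by eventually_elim (simp add: sS)
    then have "wn \<theta> (d (Suc n)) = wn \<theta> (S (d n))" by (rule wn_cong)
    also have "\<dots> \<le> ennreal (1 / 16) * wn \<theta> (d n)" by (rule S_contraction[OF d])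
    also have "\<dots> \<le> ennreal (1 / 16) * ennreal ((1 / 16) ^ n * W)" by (intro mult_left_mono Suc) auto
    also have "\<dots> = ennreal ((1 / 16) ^ Suc n * W)" using W(2) by (simp add: ennreal_mult[symmetric])
    finally show ?case .
  qed (simp add: W)
  have tail: "wnn \<theta> (\<lambda>z. \<Sum>i. ennreal (cmod (d (i + n) z))) \<le> ennreal (4 * ((1 / 16) ^ n * W))" for n
  proof -
    have "wnn \<theta> (\<lambda>z. \<Sum>i. ennreal (cmod (d (i + n) z)))
      \<le> (\<integral>\<^sup>+z. (\<Sum>i. 2 * 4 ^ i * ((ennreal (cmod (d (i + n) z)))\<^sup>2 * ennreal (japanese z powr (- 2 * \<theta>)))) \<partial>lborel)"
      unfolding wnn_def
    proof (rule nn_integral_mono)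
      fix z
      have "(\<Sum>i. ennreal (cmod (d (i + n) z)))\<^sup>2 * ennreal (japanese z powr (- 2 * \<theta>))
         \<le> 2 * (\<Sum>i. 4 ^ i * (ennreal (cmod (d (i + n) z)))\<^sup>2) * ennreal (japanese z powr (- 2 * \<theta>))"
        by (intro mult_right_mono suminf_power2_le) auto
      also have "\<dots> = (\<Sum>i. 2 * 4 ^ i * ((ennreal (cmod (d (i + n) z)))\<^sup>2 * ennreal (japanese z powr (- 2 * \<theta>))))"
        by (simp add: ennreal_suminf_cmult[symmetric] ennreal_suminf_multc[symmetric] mult.assoc del: ennreal_suminf_cmult ennreal_suminf_multc)
      finally show "(\<Sum>i. ennreal (cmod (d (i + n) z)))\<^sup>2 * ennreal (japanese z powr (- 2 * \<theta>))
         \<le> (\<Sum>i. 2 * 4 ^ i * ((ennreal (cmod (d (i + n) z)))\<^sup>2 * ennreal (japanese z powr (- 2 * \<theta>))))" .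
    qed
    also have "\<dots> = (\<Sum>i. 2 * 4 ^ i * wn \<theta> (d (i + n)))"
      unfolding wnn_def by (subst nn_integral_suminf) (auto simp: nn_integral_cmult)
    \<comment> \<open>The weights 4^i meet the decay (1/16)^i of the squared increments and leave a
      geometric series of ratio 1/4.\<close>
    also have "\<dots> \<le> (\<Sum>i. ennreal (2 * ((1 / 16) ^ n * W) * (1 / 4) ^ i))"
    proof (intro suminf_le allI summableI)
      fix i
      have p: "2 * 4 ^ i = ennreal (2 * 4 ^ i)" by (simp add: ennreal_mult ennreal_power[symmetric])
      have "ennreal (2 * 4 ^ i) * wn \<theta> (d (i + n)) \<le> ennreal (2 * 4 ^ i) * ennreal ((1 / 16) ^ (i + n) * W)"
        by (intro mult_left_mono dW) auto
      also have "ennreal (2 * 4 ^ i) * ennreal ((1 / 16) ^ (i + n) * W) = ennreal (2 * 4 ^ i * ((1 / 16) ^ (i + n) * W))"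
        using W(2) by (intro ennreal_mult[symmetric]) auto
      also have "2 * 4 ^ i * ((1 / 16) ^ (i + n) * W) = 2 * ((1 / 16) ^ n * W) * (4 ^ i * (1 / 16) ^ i)"
        by (simp only: power_add mult_ac)
      also have "4 ^ i * (1 / 16) ^ i = ((1 / 4) ^ i :: real)" by (simp add: power_mult_distrib[symmetric])
      finally show "2 * 4 ^ i * wn \<theta> (d (i + n)) \<le> ennreal (2 * ((1 / 16) ^ n * W) * (1 / 4) ^ i)"
        unfolding p .
    qed
    also have "\<dots> = ennreal (\<Sum>i. 2 * ((1 / 16) ^ n * W) * (1 / 4) ^ i)"
      using W(2) by (intro suminf_ennreal2) (auto intro!: summable_mult summable_geometric)
    also have "(\<Sum>i. 2 * ((1 / 16) ^ n * W) * (1 / 4) ^ i) = 2 * ((1 / 16) ^ n * W) * (4 / 3)"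
      by (subst suminf_mult) (auto intro: summable_geometric simp: suminf_geometric)
    also have "ennreal (2 * ((1 / 16) ^ n * W) * (4 / 3)) \<le> ennreal (4 * ((1 / 16) ^ n * W))"
      using W(2) by (intro ennreal_leI) (auto intro!: mult_nonneg_nonneg)
    finally show ?thesis .
  qed
  define u where "u z = (\<Sum>i. d i z)" for z
  have [measurable]: "u \<in> borel_measurable borel" unfolding u_def[abs_def] by measurable
  \<comment> \<open>The weighted square of the sum of absolute values has finite integral, so that
    sum is finite almost everywhere.\<close>
  have summ: "AE z in lborel. summable (\<lambda>i. cmod (d i z))"
  proof -
    have m: "(\<lambda>z. (\<Sum>i. ennreal (cmod (d i z)))\<^sup>2 * ennreal (japanese z powr (- 2 * \<theta>))) \<in> borel_measurable lborel"
      by measurable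
    have "wnn \<theta> (\<lambda>z. \<Sum>i. ennreal (cmod (d i z))) \<noteq> \<infinity>"
      using tail[of 0] by (auto simp: top_unique)
    from nn_integral_noteq_infinite[OF m this[unfolded wnn_def]] show ?thesis
    proof eventually_elim
      case (elim z)
      then have "(\<Sum>i. ennreal (cmod (d i z))) \<noteq> top"
        by (auto simp: ennreal_top_mult power2_eq_square)
      then show ?case by (intro summable_suminf_not_top) auto
    qed
  qed
  have split: "AE z in lborel. ennreal (cmod (u z - s n z)) \<le> (\<Sum>i. ennreal (cmod (d (i + n) z)))" for n
    using summ
  proof eventually_elim
    case (elim z)
    have sm: "summable (\<lambda>i. d i z)" by (rule summable_norm_cancel[OF elim])
    have "(\<Sum>i<n. d i z) = s n z" unfolding d_def using sum_lessThan_telescope[of "\<lambda>i. s i z" n] by (simp add: s0)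
    then have "u z - s n z = (\<Sum>i. d (i + n) z)" unfolding u_def using suminf_minus_initial_segment[OF sm, of n] by simp
    moreover have sm': "summable (\<lambda>i. cmod (d (i + n) z))" using elim by (rule summable_ignore_initial_segment)
    ultimately have "cmod (u z - s n z) \<le> (\<Sum>i. cmod (d (i + n) z))" using summable_norm[OF sm'] by simp
    then have "ennreal (cmod (u z - s n z)) \<le> ennreal (\<Sum>i. cmod (d (i + n) z))" by (rule ennreal_leI)
    also have "\<dots> = (\<Sum>i. ennreal (cmod (d (i + n) z)))" by (rule suminf_ennreal2[OF _ sm', symmetric]) auto
    finally show ?case .
  qed
  have r: "wn \<theta> (\<lambda>z. u z - s n z) \<le> ennreal (4 * ((1 / 16) ^ n * W))" for n
    by (rule order_trans[OF wnn_mono_AE[OF split] tail])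
  have u: "u \<in> wL2 \<theta>"
    using r[of 0] by (auto simp: wL2_iff s0 intro: le_less_trans[OF _ ennreal_less_top])
  have Tv: "(\<lambda>z. one_minus S u z - v z) \<in> wL2 \<theta>" by (intro wL2_diff one_minus_wL2 u v)
  have small: "wn \<theta> (\<lambda>z. one_minus S u z - v z) \<le> ennreal (9 * W * (1 / 16) ^ n)" for n
  proof -
    have us: "(\<lambda>z. u z - s n z) \<in> wL2 \<theta>" for n by (intro wL2_diff u s)
    \<comment> \<open>Eliminating v through the recursion expresses the residual by the errors at
      two consecutive steps, so no continuity of S beyond the contraction bound enters.\<close>
    have "ae_eq (\<lambda>z. one_minus S u z - v z) (\<lambda>z. (u z - s (Suc n) z) - S (\<lambda>z. u z - s n z) z)"
      using S_diff[OF u s[of n]] unfolding ae_eq_def one_minus_def sS by eventually_elim simp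
    then have "wn \<theta> (\<lambda>z. one_minus S u z - v z) = wn \<theta> (\<lambda>z. (u z - s (Suc n) z) - S (\<lambda>z. u z - s n z) z)"
      by (rule wn_cong)
    also have "\<dots> \<le> 2 * wn \<theta> (\<lambda>z. u z - s (Suc n) z) + 2 * wn \<theta> (S (\<lambda>z. u z - s n z))"
      by (rule wn_diff_le) (use us S_wL2 in \<open>auto dest: wL2_measurable\<close>)
    also have "\<dots> \<le> 2 * ennreal (4 * ((1 / 16) ^ Suc n * W)) + 2 * (ennreal (1 / 16) * ennreal (4 * ((1 / 16) ^ n * W)))"
      by (intro add_mono mult_left_mono r order_trans[OF S_contraction[OF us]]) auto
    also have "\<dots> = ennreal (2 * (4 * ((1 / 16) ^ Suc n * W)) + 2 * (1 / 16 * (4 * ((1 / 16) ^ n * W))))"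
      using W(2) by (intro ennreal_two_sum) auto
    also have "\<dots> \<le> ennreal (9 * W * (1 / 16) ^ n)"
    proof (rule ennreal_leI)
      have "0 \<le> (1 / 16) ^ n * W" using W(2) by simp
      then show "2 * (4 * ((1 / 16) ^ Suc n * W)) + 2 * (1 / 16 * (4 * ((1 / 16) ^ n * W))) \<le> 9 * W * (1 / 16) ^ n"
        by (simp add: mult_ac)
    qed
    finally show ?thesis .
  qed
  have "wn \<theta> (\<lambda>z. one_minus S u z - v z) = 0"
  proof -
    have "(\<lambda>n. 9 * W * (1 / 16) ^ n) \<longlonglongrightarrow> 9 * W * 0"
      by (intro tendsto_mult tendsto_const LIMSEQ_power_zero) simp
    then have "(\<lambda>n. ennreal (9 * W * (1 / 16) ^ n)) \<longlonglongrightarrow> ennreal 0" by (intro tendsto_ennrealI) simp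
    then have "wn \<theta> (\<lambda>z. one_minus S u z - v z) \<le> ennreal 0"
      by (rule LIMSEQ_le_const) (use small in auto)
    then show ?thesis by simp
  qed
  then have "AE z in lborel. one_minus S u z - v z = 0" by (rule wn_eq_0[OF wL2_measurable[OF Tv]])
  then have "ae_eq (one_minus S u) v" unfolding ae_eq_def by eventually_elim simp
  with u show ?thesis by blast
qed

lemma invertible: "invertible_wL2 \<theta> (one_minus S)"
  unfolding invertible_wL2_def
proof (intro conjI)
  show "\<exists>C. \<forall>u\<in>wL2 \<theta>. wnorm \<theta> u \<le> C * wnorm \<theta> (one_minus S u)"
    using lower_bound by (intro exI[of _ 2] ballI wnorm_le one_minus_wL2) auto
qed (use one_minus_wL2 one_minus_inj_iff one_minus_surj in auto)

lemma inverse_spec: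
  assumes "v \<in> wL2 \<theta>"
  shows "inverse_wL2 \<theta> (one_minus S) v \<in> wL2 \<theta>"
    and "ae_eq (one_minus S (inverse_wL2 \<theta> (one_minus S) v)) v"
proof -
  have "\<exists>u. u \<in> wL2 \<theta> \<and> ae_eq (one_minus S u) v" using one_minus_surj[OF assms] by blast
  from someI_ex[OF this]
  show "inverse_wL2 \<theta> (one_minus S) v \<in> wL2 \<theta>"
    "ae_eq (one_minus S (inverse_wL2 \<theta> (one_minus S) v)) v"
    by (simp_all add: inverse_wL2_def)
qed

lemma inverse_unique:
  assumes "v \<in> wL2 \<theta>" "u \<in> wL2 \<theta>" "ae_eq (one_minus S u) v"
  shows "ae_eq u (inverse_wL2 \<theta> (one_minus S) v)"
  using one_minus_inj_iff[OF assms(2) inverse_spec(1)[OF assms(1)]]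
    ae_eq_trans[OF assms(3) ae_eq_sym[OF inverse_spec(2)[OF assms(1)]]] by blast

lemma solution_norm:
  assumes "v \<in> wL2 \<theta>" "u \<in> wL2 \<theta>" "ae_eq (one_minus S u) v"
  shows "wnorm \<theta> u \<le> 2 * wnorm \<theta> v"
  using lower_bound[OF assms(2)] wn_cong[OF assms(3), of \<theta>] assms(1,2) by (intro wnorm_le) auto

end

section \<open>The operators A and B\<close>

text \<open>The difference has vanishing weak dbar-derivative and lies in \<langle>.\<rangle> L^2,
  so Liouville applies. This is what converts differential equations into integral
  equations.\<close>

lemma dzbar_eq_iff:
  assumes u: "u \<in> wL2 1" and v: "v \<in> wL2 1"
  shows "(\<forall>\<psi>. test_fun \<psi> \<longrightarrow> dist_dzbar u \<psi> = dist_dzbar v \<psi>) \<longleftrightarrow> ae_eq u v"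
proof
  assume eq: "\<forall>\<psi>. test_fun \<psi> \<longrightarrow> dist_dzbar u \<psi> = dist_dzbar v \<psi>"
  have "AE z in lborel. u z - v z = 0"
  proof (rule weak_liouville)
    show "(\<lambda>z. u z - v z) \<in> wL2 1" by (rule wL2_diff[OF u v])
    fix \<psi> assume \<psi>: "test_fun \<psi>"
    obtain R where R: "\<And>z. R < cmod z \<Longrightarrow> dzbar \<psi> z = 0" using test_fun_dzbar(2)[OF \<psi>] by blast
    note c = test_fun_dzbar(1)[OF \<psi>]
    have "dist_of (\<lambda>z. u z - v z) (dzbar \<psi>) = dist_of u (dzbar \<psi>) - dist_of v (dzbar \<psi>)"
      unfolding dist_of_def left_diff_distrib
      by (rule Bochner_Integration.integral_diff[OF integrable_wL2_test[OF u c R] integrable_wL2_test[OF v c R]])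
    then show "dist_of (\<lambda>z. u z - v z) (dzbar \<psi>) = 0" using eq \<psi> by (simp add: dist_dzbar_def)
  qed
  then show "ae_eq u v" unfolding ae_eq_def by eventually_elim simp
next
  assume ae: "ae_eq u v"
  show "\<forall>\<psi>. test_fun \<psi> \<longrightarrow> dist_dzbar u \<psi> = dist_dzbar v \<psi>"
  proof (intro allI impI)
    fix \<psi> assume \<psi>: "test_fun \<psi>"
    have [measurable]: "dzbar \<psi> \<in> borel_measurable borel" "u \<in> borel_measurable borel" "v \<in> borel_measurable borel"
      using test_fun_dzbar(1)[OF \<psi>] u v by (auto intro: borel_measurable_continuous_onI wL2_measurable)
    have "dist_of u (dzbar \<psi>) = dist_of v (dzbar \<psi>)"
      unfolding dist_of_def
      by (rule integral_cong_AE) (use ae in \<open>auto simp: ae_eq_def elim!: eventually_mono\<close>)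
    then show "dist_dzbar u \<psi> = dist_dzbar v \<psi>" by (simp add: dist_dzbar_def)
  qed
qed

lemma dz_eq_iff:
  assumes u: "u \<in> wL2 1" and v: "v \<in> wL2 1"
  shows "(\<forall>\<psi>. test_fun \<psi> \<longrightarrow> dist_dz u \<psi> = dist_dz v \<psi>) \<longleftrightarrow> ae_eq u v"
proof -
  have "(\<forall>\<psi>. test_fun \<psi> \<longrightarrow> dist_dz u \<psi> = dist_dz v \<psi>)
     \<longleftrightarrow> (\<forall>\<psi>. test_fun \<psi> \<longrightarrow> dist_dzbar (\<lambda>z. cnj (u z)) \<psi> = dist_dzbar (\<lambda>z. cnj (v z)) \<psi>)"
  proof (intro iffI allI impI)
    fix \<psi> assume "\<forall>\<psi>. test_fun \<psi> \<longrightarrow> dist_dz u \<psi> = dist_dz v \<psi>" and \<psi>: "test_fun \<psi>"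
    then have "dist_dz u (\<lambda>z. cnj (\<psi> z)) = dist_dz v (\<lambda>z. cnj (\<psi> z))" using test_fun_cnj by blast
    then show "dist_dzbar (\<lambda>z. cnj (u z)) \<psi> = dist_dzbar (\<lambda>z. cnj (v z)) \<psi>"
      unfolding dist_dz_cnj[OF test_fun_cnj[OF \<psi>]] by simp
  next
    fix \<psi> assume "\<forall>\<psi>. test_fun \<psi> \<longrightarrow> dist_dzbar (\<lambda>z. cnj (u z)) \<psi> = dist_dzbar (\<lambda>z. cnj (v z)) \<psi>" and \<psi>: "test_fun \<psi>"
    then show "dist_dz u \<psi> = dist_dz v \<psi>"
      unfolding dist_dz_cnj[OF \<psi>] using test_fun_cnj[OF \<psi>] by simp
  qed
  also have "\<dots> \<longleftrightarrow> ae_eq (\<lambda>z. cnj (u z)) (\<lambda>z. cnj (v z))"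
    by (rule dzbar_eq_iff[OF wL2_cnj[OF u] wL2_cnj[OF v]])
  also have "\<dots> \<longleftrightarrow> ae_eq u v" by (simp add: ae_eq_def)
  finally show ?thesis .
qed

lemma wnn_AE_finite:
  assumes [measurable]: "f \<in> borel_measurable borel" and fin: "wnn \<theta> f < \<infinity>"
  shows "AE z in lborel. f z < \<infinity>"
proof -
  have "AE z in lborel. (f z)\<^sup>2 * ennreal (japanese z powr (- 2 * \<theta>)) \<noteq> \<infinity>"
    by (rule nn_integral_noteq_infinite) (use fin in \<open>auto simp: wnn_def\<close>)
  then show ?thesis
  proof eventually_elim
    case (elim z)
    show ?case
    proof (rule ccontr)
      assume "\<not> f z < \<infinity>"
      then have "f z = top" by (simp add: less_top[symmetric])
      with elim show False by (simp add: power2_eq_square ennreal_top_mult)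
    qed
  qed
qed

section \<open>Removing h: A and B expressed through one Cauchy transform\<close>

definition freq :: "complex \<Rightarrow> complex" where
  "freq k = 2 * \<i> * cnj k"

text \<open>\<open>freq k\<close> is \<open>omega k\<close> divided by h, so the quotient by h
  inside the phase disappears; its modulus is 2/h.\<close>

lemma tau_eq:
  assumes k: "k \<noteq> 0"
  shows "tau (hpar k) (omega k) u z = ephase (freq k) z * u z"
    and "tau (hpar k) (- omega k) u z = ephase (- freq k) z * u z"
proof -
  have "\<i> / of_real (hpar k) * of_real (Re (z * cnj (omega k))) = \<i> * of_real (Re (z * cnj (freq k)))"
  proof -
    have "omega k = freq k * of_real (hpar k)"
      by (simp add: omega_def freq_def hpar_def)
    then have "Re (z * cnj (omega k)) = Re (z * cnj (freq k)) * hpar k"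
      by (simp add: algebra_simps)
    then show ?thesis using k by (simp add: hpar_def)
  qed
  then show "tau (hpar k) (omega k) u z = ephase (freq k) z * u z"
    "tau (hpar k) (- omega k) u z = ephase (- freq k) z * u z"
    by (simp_all add: tau_def ephase_def del: times_complex.sel)
qed

text \<open>The common form of both operators: A is this transform, and B is \<sigma> times its
  conjugate by complex conjugation.\<close>

definition ctrans :: "(complex \<Rightarrow> complex) \<Rightarrow> complex \<Rightarrow> (complex \<Rightarrow> complex) \<Rightarrow> complex \<Rightarrow> complex" where
  "ctrans q k u z = of_real (1 / (2 * pi)) * (LINT w|lborel. ephase (- freq k) w * q w * u w / (z - w))"

text \<open>The factor \<open>h\<close> in front of \<open>q\<close> cancels the \<open>1 / h\<close> in \<^const>\<open>opE\<close>.\<close>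

lemma opA_eq_ctrans:
  assumes k: "k \<noteq> 0"
  shows "opA q k = ctrans q k"
proof (intro ext)
  fix u z
  have h: "hpar k \<noteq> 0" using k by (simp add: hpar_def)
  have "opA q k u z = (LINT w|lborel. of_real (1 / (pi * hpar k)) * (ephase (- freq k) w * (of_real (hpar k) * q w / 2 * u w) / (z - w)))"
    unfolding opA_def opE_def tau_eq[OF k] by (rule integral_mult_right_zero[symmetric])
  also have "\<dots> = (LINT w|lborel. of_real (1 / (2 * pi)) * (ephase (- freq k) w * q w * u w / (z - w)))"
  proof (intro Bochner_Integration.integral_cong refl)
    fix w
    have alg: "of_real (1 / (pi * hpar k)) * (e * (of_real (hpar k) * a / 2 * b) / d) = of_real (1 / (2 * pi)) * (e * a * b / d)"
      for e a b d :: complex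
      using h by (cases "d = 0") (simp_all add: field_simps)
    show "of_real (1 / (pi * hpar k)) * (ephase (- freq k) w * (of_real (hpar k) * q w / 2 * u w) / (z - w))
      = of_real (1 / (2 * pi)) * (ephase (- freq k) w * q w * u w / (z - w))"
      by (rule alg)
  qed
  also have "\<dots> = ctrans q k u z"
    unfolding ctrans_def by (rule integral_mult_right_zero)
  finally show "opA q k u z = ctrans q k u z" .
qed

lemma opB_eq_ctrans:
  assumes k: "k \<noteq> 0"
  shows "opB \<sigma> q k u = (\<lambda>z. \<sigma> * cnj (ctrans q k (\<lambda>w. cnj (u w)) z))"
proof
  fix z
  have "(\<lambda>w. cnj (tau (hpar k) (omega k) (\<lambda>w. of_real (hpar k) * cnj (q w) / 2 * u w) w))
     = tau (hpar k) (- omega k) (\<lambda>w. of_real (hpar k) * q w / 2 * cnj (u w))"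
    unfolding tau_eq[OF k, abs_def] by (rule ext) (simp add: cnj_ephase)
  then have "opB \<sigma> q k u z = \<sigma> * cnj (opA q k (\<lambda>w. cnj (u w)) z)"
    unfolding opB_def opF_cnj opA_def by simp
  then show "opB \<sigma> q k u z = \<sigma> * cnj (ctrans q k (\<lambda>w. cnj (u w)) z)"
    unfolding opA_eq_ctrans[OF k] .
qed

lemma sigma_F_eq_opB: "sigma_F_tau_hq2 \<sigma> q k = opB \<sigma> q k (\<lambda>_. 1)"
  by (simp add: sigma_F_tau_hq2_def opB_def)

lemma sigma_F_eq_F: "sigma_F_tau_hq2 \<sigma> q k = (\<lambda>z. \<sigma> / 2 * F_tau_hq q k z)"
proof
  fix z
  let ?t = "tau (hpar k) (omega k) (\<lambda>w. of_real (hpar k) * cnj (q w))"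
  have "tau (hpar k) (omega k) (\<lambda>w. of_real (hpar k) * cnj (q w) / 2) w / (cnj z - cnj w) = 1 / 2 * (?t w / (cnj z - cnj w))" for w
    by (simp add: tau_def)
  then have "opF (hpar k) (tau (hpar k) (omega k) (\<lambda>w. of_real (hpar k) * cnj (q w) / 2)) z = 1 / 2 * opF (hpar k) ?t z"
    unfolding opF_def by (simp only: integral_mult_right_zero mult.left_commute)
  then show "sigma_F_tau_hq2 \<sigma> q k z = \<sigma> / 2 * F_tau_hq q k z"
    by (simp add: sigma_F_tau_hq2_def F_tau_hq_def)
qed

lemma ctrans_scale: "ctrans q k (\<lambda>w. c * u w) = (\<lambda>z. c * ctrans q k u z)"
proof
  fix z
  have "ephase (- freq k) w * q w * (c * u w) / (z - w) = c * (ephase (- freq k) w * q w * u w / (z - w))" for w by simp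
  then show "ctrans q k (\<lambda>w. c * u w) z = c * ctrans q k u z"
    unfolding ctrans_def by (simp only: integral_mult_right_zero mult.left_commute)
qed

lemma wnorm_scale: "wnorm \<theta> (\<lambda>z. c * v z) = cmod c * wnorm \<theta> v"
proof -
  have "(cmod (of_real (japanese z powr (- \<theta>)) * (c * v z)))\<^sup>2 = (cmod c)\<^sup>2 * (cmod (of_real (japanese z powr (- \<theta>)) * v z))\<^sup>2" for z
    by (simp add: norm_mult power_mult_distrib)
  then show ?thesis
    unfolding wnorm_def by (simp add: real_sqrt_mult)
qed

text \<open>The part of AB that does not involve \<sigma>. Conjugating it by complex conjugation
  gives BA up to \<sigma>, so a single estimate controls both products.\<close>

definition Sop :: "(complex \<Rightarrow> complex) \<Rightarrow> complex \<Rightarrow> (complex \<Rightarrow> complex) \<Rightarrow> complex \<Rightarrow> complex" where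
  "Sop q k u = ctrans q k (\<lambda>w. cnj (ctrans q k (\<lambda>x. cnj (u x)) w))"

lemma AB_eq: "k \<noteq> 0 \<Longrightarrow> opA q k \<circ> opB \<sigma> q k = (\<lambda>u z. \<sigma> * Sop q k u z)"
  by (rule ext) (simp add: opA_eq_ctrans opB_eq_ctrans ctrans_scale Sop_def)

lemma BA_eq: "k \<noteq> 0 \<Longrightarrow> opB \<sigma> q k \<circ> opA q k = (\<lambda>u z. \<sigma> * cnj (Sop q k (\<lambda>x. cnj (u x)) z))"
  by (rule ext) (simp add: opA_eq_ctrans opB_eq_ctrans Sop_def)

text \<open>Collects what the later argument retains of the regularity of q: weighted square
  integrability, pointwise decay and the oscillatory bound. The constants are fixed before k
  appears, which makes all estimates uniform in k.\<close>

locale cgo_setup =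
  fixes q :: "complex \<Rightarrow> complex" and s \<epsilon> Cs Q Co :: real
  assumes s: "1 < s" "s \<le> 2" and \<epsilon>: "0 < \<epsilon>" "\<epsilon> \<le> 1"
    and q[measurable]: "q \<in> borel_measurable borel" and q_L2: "wn (- 2) q < \<infinity>"
    and Q: "0 \<le> Q" "AE y in lborel. cmod (q y) \<le> Q * japanese y powr (- 2)"
    and Cs: "0 \<le> Cs" "\<And>v. v \<in> borel_measurable borel \<Longrightarrow> wnn \<epsilon> (pot v) \<le> ennreal Cs * wnn (\<epsilon> - 2) v"
    and Co: "0 \<le> Co" "\<And>h \<eta> z x. 0 < h \<Longrightarrow> h \<le> 1 \<Longrightarrow> cmod \<eta> = 2 / h \<Longrightarrow> x \<noteq> z \<Longrightarrow>
      cmod (LINT y|lborel. ephase (- \<eta>) y * q y / ((z - y) * (cnj y - cnj x))) \<le> Co * h powr (s - 1) / cmod (z - x)"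
begin

text \<open>The natural domain of the transform: all u for which q u lies in the space on which the
  potential is bounded. Unlike \<langle>.\<rangle>^\<epsilon> L^2 it contains the constant 1, to
  which B must be applied.\<close>

definition adm :: "(complex \<Rightarrow> complex) \<Rightarrow> bool" where
  "adm u \<longleftrightarrow> u \<in> borel_measurable borel \<and> wn (\<epsilon> - 2) (\<lambda>w. q w * u w) < \<infinity>"

lemma adm_iff: "adm u \<longleftrightarrow> u \<in> borel_measurable borel \<and> (\<lambda>w. q w * u w) \<in> wL2 (\<epsilon> - 2)"
  by (auto simp: adm_def wL2_iff)

text \<open>The decay of q gains exactly the two powers of the weight that the potential loses, so
  multiplication by q followed by the potential maps \<langle>.\<rangle>^\<epsilon> L^2 to
  itself.\<close>

lemma wnn_q_le:
  "wnn (\<epsilon> - 2) (\<lambda>w. ennreal (cmod (q w)) * p w) \<le> ennreal (Q\<^sup>2) * wnn \<epsilon> p"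
  if [measurable]: "p \<in> borel_measurable borel"
proof -
  have "wnn (\<epsilon> - 2) (\<lambda>w. ennreal (cmod (q w)) * p w)
     \<le> (\<integral>\<^sup>+z. ennreal (Q\<^sup>2) * ((p z)\<^sup>2 * ennreal (japanese z powr (- 2 * \<epsilon>))) \<partial>lborel)"
    unfolding wnn_def
  proof (rule nn_integral_mono_AE)
    show "AE z in lborel. (ennreal (cmod (q z)) * p z)\<^sup>2 * ennreal (japanese z powr (- 2 * (\<epsilon> - 2)))
      \<le> ennreal (Q\<^sup>2) * ((p z)\<^sup>2 * ennreal (japanese z powr (- 2 * \<epsilon>)))"
      using Q(2)
    proof eventually_elim
      case (elim z)
      have "(cmod (q z))\<^sup>2 * japanese z powr (- 2 * (\<epsilon> - 2)) \<le> (Q * japanese z powr (- 2))\<^sup>2 * japanese z powr (- 2 * (\<epsilon> - 2))"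
        by (intro mult_right_mono power_mono elim) auto
      also have "\<dots> = Q\<^sup>2 * (japanese z powr (- 2) * japanese z powr (- 2) * japanese z powr (- 2 * (\<epsilon> - 2)))"
        by (simp only: power_mult_distrib power2_eq_square mult_ac)
      also have "japanese z powr (- 2) * japanese z powr (- 2) * japanese z powr (- 2 * (\<epsilon> - 2)) = japanese z powr (- 2 * \<epsilon>)"
        unfolding powr_add[symmetric] by (rule arg_cong[where f="\<lambda>t. japanese z powr t"]) simp
      finally have "ennreal ((cmod (q z))\<^sup>2 * japanese z powr (- 2 * (\<epsilon> - 2))) \<le> ennreal (Q\<^sup>2 * japanese z powr (- 2 * \<epsilon>))"
        by (rule ennreal_leI)
      then have "(ennreal (cmod (q z)))\<^sup>2 * ennreal (japanese z powr (- 2 * (\<epsilon> - 2))) \<le> ennreal (Q\<^sup>2) * ennreal (japanese z powr (- 2 * \<epsilon>))"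
        by (simp add: ennreal_mult ennreal_power)
      from mult_left_mono[OF this, of "(p z)\<^sup>2"] show ?case
        by (simp add: power_mult_distrib mult_ac)
    qed
  qed
  also have "\<dots> = ennreal (Q\<^sup>2) * wnn \<epsilon> p"
    unfolding wnn_def by (rule nn_integral_cmult) measurable
  finally show ?thesis .
qed

lemma wL2_adm:
  assumes u: "u \<in> wL2 \<epsilon>"
  shows "adm u" "wn (\<epsilon> - 2) (\<lambda>w. q w * u w) \<le> ennreal (Q\<^sup>2) * wn \<epsilon> u"
proof -
  have m[measurable]: "u \<in> borel_measurable borel" by (rule wL2_measurable[OF u])
  have "(\<lambda>w. ennreal (cmod (q w * u w))) = (\<lambda>w. ennreal (cmod (q w)) * ennreal (cmod (u w)))"
    by (simp add: norm_mult ennreal_mult)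
  then show le: "wn (\<epsilon> - 2) (\<lambda>w. q w * u w) \<le> ennreal (Q\<^sup>2) * wn \<epsilon> u"
    using wnn_q_le[of "\<lambda>w. ennreal (cmod (u w))"] by simp
  have "ennreal (Q\<^sup>2) * wn \<epsilon> u < \<infinity>" using u by (simp add: wL2_iff ennreal_mult_less_top)
  with le show "adm u" unfolding adm_def using m le_less_trans by blast
qed

text \<open>Rests on \<langle>z\<rangle>^2 q being in L^2. The pointwise decay of q would leave
  \<langle>z\<rangle>^(-\<epsilon>), which is not square integrable for \<epsilon> \<le> 1.\<close>

lemma adm_one: "adm (\<lambda>_. 1)"
proof -
  have "wn (\<epsilon> - 2) q \<le> wn (- 2) q" using \<epsilon> by (intro wnn_antimono) simp
  then show ?thesis unfolding adm_def using q_L2 le_less_trans by fastforce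
qed

lemma adm_add: "adm u \<Longrightarrow> adm v \<Longrightarrow> adm (\<lambda>z. u z + v z)"
  using wL2_add[of "\<lambda>w. q w * u w" "\<epsilon> - 2" "\<lambda>w. q w * v w"] by (auto simp: adm_iff distrib_left)

lemma adm_cnj: "adm u \<Longrightarrow> adm (\<lambda>z. cnj (u z))"
  by (auto simp: adm_def norm_mult)

section \<open>Mapping properties of the transform and the pointwise bound for its square\<close>

lemma norm_ctrans_le: "ennreal (cmod (ctrans q k u z)) \<le> pot (\<lambda>w. ennreal (cmod (q w * u w))) z"
proof -
  have "cmod (ctrans q k u z) \<le> 1 * cmod (LINT w|lborel. ephase (- freq k) w * q w * u w / (z - w))"
    unfolding ctrans_def norm_mult using pi_gt3 by (intro mult_right_mono) (auto simp: norm_divide)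
  then have "ennreal (cmod (ctrans q k u z)) \<le> ennreal (cmod (LINT w|lborel. ephase (- freq k) w * q w * u w / (z - w)))"
    by (intro ennreal_leI) simp
  also have "\<dots> \<le> (\<integral>\<^sup>+w. ennreal (cmod (ephase (- freq k) w * q w * u w / (z - w))) \<partial>lborel)"
    by (rule norm_integral_le_nn)
  also have "\<dots> = pot (\<lambda>w. ennreal (cmod (q w * u w))) z"
    unfolding pot_def by (intro nn_integral_cong) (simp add: norm_mult norm_divide ennreal_mult[symmetric])
  finally show ?thesis .
qed

lemma measurable_ctrans: "u \<in> borel_measurable borel \<Longrightarrow> ctrans q k u \<in> borel_measurable borel"
proof -
  assume [measurable]: "u \<in> borel_measurable borel"
  show "ctrans q k u \<in> borel_measurable borel" unfolding ctrans_def[abs_def] by measurable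
qed

lemma pot_adm:
  assumes u: "adm u"
  shows "wnn \<epsilon> (pot (\<lambda>w. ennreal (cmod (q w * u w)))) \<le> ennreal Cs * wn (\<epsilon> - 2) (\<lambda>w. q w * u w)"
    and "wnn \<epsilon> (pot (\<lambda>w. ennreal (cmod (q w * u w)))) < \<infinity>"
    and "AE z in lborel. pot (\<lambda>w. ennreal (cmod (q w * u w))) z < \<infinity>"
proof -
  have [measurable]: "u \<in> borel_measurable borel" using u by (simp add: adm_def)
  show le: "wnn \<epsilon> (pot (\<lambda>w. ennreal (cmod (q w * u w)))) \<le> ennreal Cs * wn (\<epsilon> - 2) (\<lambda>w. q w * u w)"
    by (rule Cs(2)) measurable
  also have "\<dots> < \<infinity>" using u by (simp add: adm_def ennreal_mult_less_top)
  finally show fin: "wnn \<epsilon> (pot (\<lambda>w. ennreal (cmod (q w * u w)))) < \<infinity>" .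
  show "AE z in lborel. pot (\<lambda>w. ennreal (cmod (q w * u w))) z < \<infinity>"
    by (rule wnn_AE_finite[OF _ fin]) measurable
qed

lemma ctrans_wL2:
  assumes u: "adm u"
  shows "ctrans q k u \<in> wL2 \<epsilon>" "wn \<epsilon> (ctrans q k u) \<le> ennreal Cs * wn (\<epsilon> - 2) (\<lambda>w. q w * u w)"
proof -
  have le: "wn \<epsilon> (ctrans q k u) \<le> wnn \<epsilon> (pot (\<lambda>w. ennreal (cmod (q w * u w))))"
    by (intro wnn_mono_AE AE_I2 norm_ctrans_le)
  show "wn \<epsilon> (ctrans q k u) \<le> ennreal Cs * wn (\<epsilon> - 2) (\<lambda>w. q w * u w)"
    by (rule order_trans[OF le pot_adm(1)[OF u]])
  show "ctrans q k u \<in> wL2 \<epsilon>"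
    using u le_less_trans[OF le pot_adm(2)[OF u]] by (simp add: wL2_iff measurable_ctrans adm_def)
qed

lemma ctrans_integrable:
  assumes [measurable]: "u \<in> borel_measurable borel" and fin: "pot (\<lambda>w. ennreal (cmod (q w * u w))) z < \<infinity>"
  shows "integrable lborel (\<lambda>w. ephase (- freq k) w * q w * u w / (z - w))"
proof (rule integrableI_bounded)
  show "(\<lambda>w. ephase (- freq k) w * q w * u w / (z - w)) \<in> borel_measurable lborel" by measurable
  have "(\<integral>\<^sup>+w. ennreal (cmod (ephase (- freq k) w * q w * u w / (z - w))) \<partial>lborel) = pot (\<lambda>w. ennreal (cmod (q w * u w))) z"
    unfolding pot_def by (intro nn_integral_cong) (simp add: norm_mult norm_divide ennreal_mult[symmetric])
  with fin show "(\<integral>\<^sup>+w. ennreal (cmod (ephase (- freq k) w * q w * u w / (z - w))) \<partial>lborel) < \<infinity>" by simp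
qed

text \<open>Both integrals converge absolutely where the two potentials are finite, hence almost
  everywhere; at the remaining points the default value 0 of a divergent integral can break
  additivity.\<close>

lemma ctrans_add:
  assumes u: "adm u" and v: "adm v"
  shows "ae_eq (ctrans q k (\<lambda>z. u z + v z)) (\<lambda>z. ctrans q k u z + ctrans q k v z)"
  unfolding ae_eq_def using pot_adm(3)[OF u] pot_adm(3)[OF v]
proof eventually_elim
  case (elim z)
  have m: "u \<in> borel_measurable borel" "v \<in> borel_measurable borel" using u v by (auto simp: adm_def)
  have "ephase (- freq k) w * q w * (u w + v w) / (z - w)
     = ephase (- freq k) w * q w * u w / (z - w) + ephase (- freq k) w * q w * v w / (z - w)" for w
    by (simp add: distrib_left add_divide_distrib)
  then have "(LINT w|lborel. ephase (- freq k) w * q w * (u w + v w) / (z - w))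
     = (LINT w|lborel. ephase (- freq k) w * q w * u w / (z - w)) + (LINT w|lborel. ephase (- freq k) w * q w * v w / (z - w))"
    using Bochner_Integration.integral_add[OF ctrans_integrable[OF m(1) elim(1)] ctrans_integrable[OF m(2) elim(2)]] by simp
  then show ?case by (simp add: ctrans_def distrib_left)
qed

lemma ctrans_diff:
  assumes u: "adm u" and v: "adm v"
  shows "ae_eq (ctrans q k (\<lambda>z. u z - v z)) (\<lambda>z. ctrans q k u z - ctrans q k v z)"
proof -
  have "adm (\<lambda>z. (- 1) * v z)" using v by (simp add: adm_def norm_mult)
  from ctrans_add[OF u this] show ?thesis unfolding ctrans_scale by simp
qed

text \<open>In contrast to additivity this holds at every point, since each value depends only on
  the class of the integrand. It lets almost everywhere identities be substituted under an outer
  transform.\<close>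

lemma ctrans_cong:
  assumes [measurable]: "u \<in> borel_measurable borel" "v \<in> borel_measurable borel" and "ae_eq u v"
  shows "ctrans q k u = ctrans q k v"
proof
  fix z
  have "(LINT w|lborel. ephase (- freq k) w * q w * u w / (z - w)) = (LINT w|lborel. ephase (- freq k) w * q w * v w / (z - w))"
  proof (rule integral_cong_AE)
    show "AE w in lborel. ephase (- freq k) w * q w * u w / (z - w) = ephase (- freq k) w * q w * v w / (z - w)"
      using assms(3) unfolding ae_eq_def by eventually_elim simp
  qed measurable
  then show "ctrans q k u z = ctrans q k v z" by (simp add: ctrans_def)
qed

lemma freq_hpar: "k \<noteq> 0 \<Longrightarrow> cmod (freq k) = 2 / hpar k" "k \<noteq> 0 \<Longrightarrow> 0 < hpar k"
  by (simp_all add: freq_def hpar_def norm_mult)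

text \<open>Exchanging the two integrations puts the oscillating factor in the inner integral, where
  \<open>Co\<close> applies for fixed endpoints z and x. What remains is the plain potential of |q
  u| times the small factor, so Schur's test is used with positive kernels only.\<close>

lemma Sop_pointwise:
  assumes k: "k \<noteq> 0" and h: "hpar k \<le> 1" and u: "adm u"
  shows "AE z in lborel. ennreal (cmod (Sop q k u z))
     \<le> ennreal (Co * hpar k powr (s - 1)) * pot (\<lambda>w. ennreal (cmod (q w * u w))) z"
proof -
  have [measurable]: "u \<in> borel_measurable borel" using u by (simp add: adm_def)
  let ?P = "pot (\<lambda>w. ennreal (cmod (q w * u w)))"
  define a where "a = (\<lambda>w. ephase (- freq k) w * q w)"
  have [measurable]: "a \<in> borel_measurable borel" unfolding a_def by measurable
  have na: "cmod (a w) = cmod (q w)" for w by (simp add: a_def norm_mult)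
  \<comment> \<open>Two rounds of the Schur bound show that the iterated potential is finite almost
    everywhere; at such z the double integral converges absolutely.\<close>
  have "wnn (\<epsilon> - 2) (\<lambda>w. ennreal (cmod (q w)) * ?P w) \<le> ennreal (Q\<^sup>2) * wnn \<epsilon> ?P"
    by (rule wnn_q_le) measurable
  also have "\<dots> < \<infinity>" using pot_adm(2)[OF u] by (simp add: ennreal_mult_less_top)
  finally have f1: "wnn (\<epsilon> - 2) (\<lambda>w. ennreal (cmod (q w)) * ?P w) < \<infinity>" .
  have "wnn \<epsilon> (pot (\<lambda>w. ennreal (cmod (q w)) * ?P w)) \<le> ennreal Cs * wnn (\<epsilon> - 2) (\<lambda>w. ennreal (cmod (q w)) * ?P w)"
    by (rule Cs(2)) measurable
  also have "\<dots> < \<infinity>" using f1 by (simp add: ennreal_mult_less_top)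
  finally have f2: "wnn \<epsilon> (pot (\<lambda>w. ennreal (cmod (q w)) * ?P w)) < \<infinity>" .
  have "AE z in lborel. pot (\<lambda>w. ennreal (cmod (q w)) * ?P w) z < \<infinity>"
    by (rule wnn_AE_finite[OF _ f2]) measurable
  then show ?thesis
  proof eventually_elim
    case (elim z)
    note fin = elim
    let ?f = "\<lambda>y x. a y * (cnj (a x) * u x / (cnj y - cnj x)) / (z - y)"
    define c where "c = complex_of_real (1 / (2 * pi))"
    have c1: "cmod c \<le> 1" using pi_gt3 by (simp add: c_def norm_divide)
    have int: "integrable (lborel \<Otimes>\<^sub>M lborel) (case_prod ?f)"
    proof (rule integrableI_bounded)
      show "case_prod ?f \<in> borel_measurable (lborel \<Otimes>\<^sub>M lborel)" by measurable
      have "(\<integral>\<^sup>+p. ennreal (cmod (case_prod ?f p)) \<partial>(lborel \<Otimes>\<^sub>M lborel)) = (\<integral>\<^sup>+y. \<integral>\<^sup>+x. ennreal (cmod (?f y x)) \<partial>lborel \<partial>lborel)"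
        by (subst lborel.nn_integral_fst[symmetric]) auto
      also have "\<dots> = pot (\<lambda>w. ennreal (cmod (q w)) * ?P w) z"
        unfolding pot_def[of _ z]
      proof (rule nn_integral_cong)
        fix y
        have "(\<integral>\<^sup>+x. ennreal (cmod (?f y x)) \<partial>lborel) = (\<integral>\<^sup>+x. (ennreal (cmod (q y)) * ennreal (1 / cmod (z - y))) * (ennreal (cmod (q x * u x)) * ennreal (1 / cmod (y - x))) \<partial>lborel)"
        proof (rule nn_integral_cong)
          fix x
          have "cmod (cnj y - cnj x) = cmod (y - x)" by (metis complex_cnj_diff complex_mod_cnj)
          then show "ennreal (cmod (?f y x)) = (ennreal (cmod (q y)) * ennreal (1 / cmod (z - y))) * (ennreal (cmod (q x * u x)) * ennreal (1 / cmod (y - x)))"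
            by (simp add: norm_mult norm_divide na ennreal_mult[symmetric])
        qed
        also have "\<dots> = (ennreal (cmod (q y)) * ennreal (1 / cmod (z - y))) * ?P y"
          unfolding pot_def by (rule nn_integral_cmult) measurable
        finally show "(\<integral>\<^sup>+x. ennreal (cmod (?f y x)) \<partial>lborel) = ennreal (cmod (q y)) * ?P y * ennreal (1 / cmod (z - y))"
          by (simp only: mult_ac)
      qed
      finally show "(\<integral>\<^sup>+p. ennreal (cmod (case_prod ?f p)) \<partial>(lborel \<Otimes>\<^sub>M lborel)) < \<infinity>" using fin by simp
    qed
    have inner: "cnj (ctrans q k (\<lambda>x. cnj (u x)) y) = c * (LINT x|lborel. cnj (a x) * u x / (cnj y - cnj x))" for y
    proof -
      have "cnj (LINT x|lborel. ephase (- freq k) x * q x * cnj (u x) / (y - x)) = (LINT x|lborel. cnj (ephase (- freq k) x * q x * cnj (u x) / (y - x)))"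
        by (rule Bochner_Integration.integral_cnj[symmetric])
      then show ?thesis unfolding ctrans_def c_def by (simp add: a_def)
    qed
    have "Sop q k u z = c * (LINT y|lborel. a y * (c * (LINT x|lborel. cnj (a x) * u x / (cnj y - cnj x))) / (z - y))"
      unfolding Sop_def inner by (simp add: ctrans_def c_def a_def)
    also have "\<dots> = c * (LINT y|lborel. c * (LINT x|lborel. ?f y x))"
    proof -
      have "a y * (c * (LINT x|lborel. cnj (a x) * u x / (cnj y - cnj x))) / (z - y) = c * (LINT x|lborel. ?f y x)" for y
      proof -
        have "(LINT x|lborel. ?f y x) = (LINT x|lborel. (a y / (z - y)) * (cnj (a x) * u x / (cnj y - cnj x)))"
          by (simp only: times_divide_eq_left)
        then show ?thesis unfolding integral_mult_right_zero by simp
      qed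
      then show ?thesis by simp
    qed
    also have "\<dots> = c * (c * (LINT x|lborel. LINT y|lborel. ?f y x))"
      unfolding integral_mult_right_zero lborel_pair.Fubini_integral[OF int] ..
    \<comment> \<open>Only the factors in y stay inside: the phase, q(y) and both Cauchy kernels.
      This is the integral estimated in \<open>Co\<close>.\<close>
    also have "(LINT x|lborel. LINT y|lborel. ?f y x) = (LINT x|lborel. (cnj (a x) * u x) * (LINT y|lborel. ephase (- freq k) y * q y / ((z - y) * (cnj y - cnj x))))"
    proof (rule Bochner_Integration.integral_cong[OF refl])
      fix x
      have "?f y x = (cnj (a x) * u x) * (ephase (- freq k) y * q y / ((z - y) * (cnj y - cnj x)))" for y
        by (simp add: a_def mult_ac)
      then show "(LINT y|lborel. ?f y x) = (cnj (a x) * u x) * (LINT y|lborel. ephase (- freq k) y * q y / ((z - y) * (cnj y - cnj x)))"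
        by (simp only: integral_mult_right_zero)
    qed
    finally have S: "Sop q k u z = c * (c * (LINT x|lborel. (cnj (a x) * u x) * (LINT y|lborel. ephase (- freq k) y * q y / ((z - y) * (cnj y - cnj x)))))" .
    let ?M = "\<lambda>x. LINT y|lborel. ephase (- freq k) y * q y / ((z - y) * (cnj y - cnj x))"
    have "cmod (Sop q k u z) \<le> 1 * (1 * cmod (LINT x|lborel. (cnj (a x) * u x) * ?M x))"
      unfolding S norm_mult[of c] using c1 by (intro mult_mono) auto
    then have "ennreal (cmod (Sop q k u z)) \<le> ennreal (cmod (LINT x|lborel. (cnj (a x) * u x) * ?M x))"
      by (intro ennreal_leI) simp
    also have "\<dots> \<le> (\<integral>\<^sup>+x. ennreal (cmod ((cnj (a x) * u x) * ?M x)) \<partial>lborel)"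
      by (rule norm_integral_le_nn)
    also have "\<dots> \<le> (\<integral>\<^sup>+x. ennreal (Co * hpar k powr (s - 1)) * (ennreal (cmod (q x * u x)) * ennreal (1 / cmod (z - x))) \<partial>lborel)"
    proof (rule nn_integral_mono_AE)
      show "AE x in lborel. ennreal (cmod ((cnj (a x) * u x) * ?M x))
         \<le> ennreal (Co * hpar k powr (s - 1)) * (ennreal (cmod (q x * u x)) * ennreal (1 / cmod (z - x)))"
        using AE_lborel_singleton[of z]
      proof eventually_elim
        case (elim x)
        have "cmod ((cnj (a x) * u x) * ?M x) = cmod (q x * u x) * cmod (?M x)" by (simp add: norm_mult na)
        also have "\<dots> \<le> cmod (q x * u x) * (Co * hpar k powr (s - 1) / cmod (z - x))"
          by (intro mult_left_mono Co(2) freq_hpar k h elim) auto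
        also have "\<dots> = (Co * hpar k powr (s - 1)) * (cmod (q x * u x) * (1 / cmod (z - x)))" by simp
        finally have "ennreal (cmod ((cnj (a x) * u x) * ?M x)) \<le> ennreal ((Co * hpar k powr (s - 1)) * (cmod (q x * u x) * (1 / cmod (z - x))))"
          by (rule ennreal_leI)
        also have "\<dots> = ennreal (Co * hpar k powr (s - 1)) * (ennreal (cmod (q x * u x)) * ennreal (1 / cmod (z - x)))"
          using Co(1) by (subst ennreal_mult, simp, simp, subst ennreal_mult) auto
        finally show ?case .
      qed
    qed
    also have "\<dots> = ennreal (Co * hpar k powr (s - 1)) * ?P z"
      unfolding pot_def by (rule nn_integral_cmult) measurable
    finally show ?case .
  qed
qed

end

section \<open>Contraction estimates for the two products\<close>

context cgo_setup
begin

text \<open>Formulated on \<open>adm\<close> so that it also applies to the constant 1, which gives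
  the size of the leading term of the first correction.\<close>

lemma Sop_adm:
  assumes k: "k \<noteq> 0" and h: "hpar k \<le> 1" and u: "adm u"
  shows "Sop q k u \<in> wL2 \<epsilon>"
    and "wn \<epsilon> (Sop q k u) \<le> ennreal ((Co * sqrt Cs * hpar k powr (s - 1))\<^sup>2) * wn (\<epsilon> - 2) (\<lambda>w. q w * u w)"
proof -
  have m[measurable]: "u \<in> borel_measurable borel" using u by (simp add: adm_def)
  let ?c = "Co * hpar k powr (s - 1)"
  have c0: "0 \<le> ?c" using Co(1) by simp
  have "wn \<epsilon> (Sop q k u) \<le> wnn \<epsilon> (\<lambda>z. ennreal ?c * pot (\<lambda>w. ennreal (cmod (q w * u w))) z)"
    by (rule wnn_mono_AE[OF Sop_pointwise[OF k h u]])
  also have "\<dots> = (ennreal ?c)\<^sup>2 * wnn \<epsilon> (pot (\<lambda>w. ennreal (cmod (q w * u w))))"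
    by (rule wnn_cmult) measurable
  also have "\<dots> \<le> (ennreal ?c)\<^sup>2 * (ennreal Cs * wn (\<epsilon> - 2) (\<lambda>w. q w * u w))"
    by (intro mult_left_mono pot_adm(1) u) simp
  also have "\<dots> = ennreal ((Co * sqrt Cs * hpar k powr (s - 1))\<^sup>2) * wn (\<epsilon> - 2) (\<lambda>w. q w * u w)"
  proof -
    have "(Co * sqrt Cs * hpar k powr (s - 1))\<^sup>2 = ?c\<^sup>2 * Cs"
      using Cs(1) by (simp add: power_mult_distrib)
    then show ?thesis using c0 Cs(1) by (simp add: ennreal_power ennreal_mult mult.assoc)
  qed
  finally show le: "wn \<epsilon> (Sop q k u) \<le> ennreal ((Co * sqrt Cs * hpar k powr (s - 1))\<^sup>2) * wn (\<epsilon> - 2) (\<lambda>w. q w * u w)" .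
  also have "\<dots> < \<infinity>" using u by (simp add: adm_def ennreal_mult_less_top)
  finally have fin: "wn \<epsilon> (Sop q k u) < \<infinity>" .
  have "Sop q k u \<in> borel_measurable borel"
    unfolding Sop_def using m by (intro measurable_ctrans measurable_cnj)
  with fin show "Sop q k u \<in> wL2 \<epsilon>" by (simp add: wL2_iff)
qed

lemma Sop_bounded:
  assumes k: "k \<noteq> 0" and h: "hpar k \<le> 1" and u: "u \<in> wL2 \<epsilon>"
  shows "wn \<epsilon> (Sop q k u) \<le> ennreal ((Co * sqrt Cs * Q * hpar k powr (s - 1))\<^sup>2) * wn \<epsilon> u"
proof -
  have "wn \<epsilon> (Sop q k u) \<le> ennreal ((Co * sqrt Cs * hpar k powr (s - 1))\<^sup>2) * (ennreal (Q\<^sup>2) * wn \<epsilon> u)"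
    by (rule order_trans[OF Sop_adm(2)[OF k h wL2_adm(1)[OF u]]]) (intro mult_left_mono wL2_adm(2) u, simp)
  also have "\<dots> = ennreal ((Co * sqrt Cs * Q * hpar k powr (s - 1))\<^sup>2) * wn \<epsilon> u"
    unfolding mult.assoc[symmetric] by (subst ennreal_mult[symmetric]) (auto simp: power_mult_distrib mult_ac)
  finally show ?thesis .
qed

lemma Sop_diff:
  assumes u: "u \<in> wL2 \<epsilon>" and v: "v \<in> wL2 \<epsilon>"
  shows "ae_eq (Sop q k (\<lambda>z. u z - v z)) (\<lambda>z. Sop q k u z - Sop q k v z)"
proof -
  note au = adm_cnj[OF wL2_adm(1)[OF u]] and av = adm_cnj[OF wL2_adm(1)[OF v]]
  note wu = wL2_cnj[OF ctrans_wL2(1)[OF au, of k]] and wv = wL2_cnj[OF ctrans_wL2(1)[OF av, of k]]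
  have m: "(\<lambda>x. cnj (u x - v x)) \<in> borel_measurable borel"
    using wL2_measurable[OF wL2_cnj[OF wL2_diff[OF u v]]] .
  have "ctrans q k (\<lambda>w. cnj (ctrans q k (\<lambda>x. cnj (u x - v x)) w))
      = ctrans q k (\<lambda>w. cnj (ctrans q k (\<lambda>x. cnj (u x)) w) - cnj (ctrans q k (\<lambda>x. cnj (v x)) w))"
  proof (rule ctrans_cong)
    show "ae_eq (\<lambda>w. cnj (ctrans q k (\<lambda>x. cnj (u x - v x)) w)) (\<lambda>w. cnj (ctrans q k (\<lambda>x. cnj (u x)) w) - cnj (ctrans q k (\<lambda>x. cnj (v x)) w))"
      using ctrans_diff[OF au av, of k] unfolding ae_eq_def by eventually_elim simp
    show "(\<lambda>w. cnj (ctrans q k (\<lambda>x. cnj (u x - v x)) w)) \<in> borel_measurable borel"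
      by (intro measurable_cnj measurable_ctrans m)
    show "(\<lambda>w. cnj (ctrans q k (\<lambda>x. cnj (u x)) w) - cnj (ctrans q k (\<lambda>x. cnj (v x)) w)) \<in> borel_measurable borel"
      by (rule wL2_measurable[OF wL2_diff[OF wu wv]])
  qed
  then show ?thesis
    unfolding Sop_def using ctrans_diff[OF wL2_adm(1)[OF wu] wL2_adm(1)[OF wv], of k] by simp
qed

lemma AB_bound:
  assumes k: "k \<noteq> 0" and h: "hpar k \<le> 1" and \<sigma>: "cmod \<sigma> = 1" and u: "u \<in> wL2 \<epsilon>"
  shows "(opA q k \<circ> opB \<sigma> q k) u \<in> wL2 \<epsilon>"
    and "wn \<epsilon> ((opA q k \<circ> opB \<sigma> q k) u) \<le> ennreal ((Co * sqrt Cs * Q * hpar k powr (s - 1))\<^sup>2) * wn \<epsilon> u"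
proof -
  note S = Sop_adm(1)[OF k h wL2_adm(1)[OF u]]
  show "(opA q k \<circ> opB \<sigma> q k) u \<in> wL2 \<epsilon>"
    unfolding AB_eq[OF k] by (rule wL2_scale[OF S])
  show "wn \<epsilon> ((opA q k \<circ> opB \<sigma> q k) u) \<le> ennreal ((Co * sqrt Cs * Q * hpar k powr (s - 1))\<^sup>2) * wn \<epsilon> u"
    unfolding AB_eq[OF k] using Sop_bounded[OF k h u] wL2_measurable[OF S] \<sigma> by (simp add: wn_scale norm_mult)
qed

lemma BA_bound:
  assumes k: "k \<noteq> 0" and h: "hpar k \<le> 1" and \<sigma>: "cmod \<sigma> = 1" and u: "u \<in> wL2 \<epsilon>"
  shows "(opB \<sigma> q k \<circ> opA q k) u \<in> wL2 \<epsilon>"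
    and "wn \<epsilon> ((opB \<sigma> q k \<circ> opA q k) u) \<le> ennreal ((Co * sqrt Cs * Q * hpar k powr (s - 1))\<^sup>2) * wn \<epsilon> u"
proof -
  note u' = wL2_cnj[OF u]
  note S = Sop_adm(1)[OF k h wL2_adm(1)[OF u']]
  show "(opB \<sigma> q k \<circ> opA q k) u \<in> wL2 \<epsilon>"
    unfolding BA_eq[OF k] by (rule wL2_scale[OF wL2_cnj[OF S]])
  show "wn \<epsilon> ((opB \<sigma> q k \<circ> opA q k) u) \<le> ennreal ((Co * sqrt Cs * Q * hpar k powr (s - 1))\<^sup>2) * wn \<epsilon> u"
    unfolding BA_eq[OF k] using Sop_bounded[OF k h u'] wL2_measurable[OF S] \<sigma> by (simp add: norm_mult)
qed

lemma contraction_constant: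
  assumes "Co * sqrt Cs * Q * hpar k powr (s - 1) \<le> 1 / 4"
  shows "ennreal ((Co * sqrt Cs * Q * hpar k powr (s - 1))\<^sup>2) \<le> ennreal (1 / 16)"
proof (rule ennreal_leI)
  have "(Co * sqrt Cs * Q * hpar k powr (s - 1))\<^sup>2 \<le> (1 / 4)\<^sup>2"
    using assms Co(1) Cs(1) Q(1) by (intro power_mono) auto
  then show "(Co * sqrt Cs * Q * hpar k powr (s - 1))\<^sup>2 \<le> 1 / 16" by (simp add: power2_eq_square)
qed

lemma AB_contraction:
  assumes k: "k \<noteq> 0" and h: "hpar k \<le> 1" and \<sigma>: "cmod \<sigma> = 1"
    and small: "Co * sqrt Cs * Q * hpar k powr (s - 1) \<le> 1 / 4"
  shows "ae_contraction \<epsilon> (opA q k \<circ> opB \<sigma> q k)"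
proof
  fix u v assume u: "u \<in> wL2 \<epsilon>"
  show "(opA q k \<circ> opB \<sigma> q k) u \<in> wL2 \<epsilon>" by (rule AB_bound(1)[OF k h \<sigma> u])
  show "wn \<epsilon> ((opA q k \<circ> opB \<sigma> q k) u) \<le> ennreal (1 / 16) * wn \<epsilon> u"
    by (rule order_trans[OF AB_bound(2)[OF k h \<sigma> u] mult_right_mono[OF contraction_constant[OF small]]]) simp
  assume v: "v \<in> wL2 \<epsilon>"
  show "ae_eq ((opA q k \<circ> opB \<sigma> q k) (\<lambda>z. u z - v z)) (\<lambda>z. (opA q k \<circ> opB \<sigma> q k) u z - (opA q k \<circ> opB \<sigma> q k) v z)"
    using Sop_diff[OF u v, of k] unfolding AB_eq[OF k] ae_eq_def
    by eventually_elim (simp add: right_diff_distrib)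
qed

lemma BA_contraction:
  assumes k: "k \<noteq> 0" and h: "hpar k \<le> 1" and \<sigma>: "cmod \<sigma> = 1"
    and small: "Co * sqrt Cs * Q * hpar k powr (s - 1) \<le> 1 / 4"
  shows "ae_contraction \<epsilon> (opB \<sigma> q k \<circ> opA q k)"
proof
  fix u v assume u: "u \<in> wL2 \<epsilon>"
  show "(opB \<sigma> q k \<circ> opA q k) u \<in> wL2 \<epsilon>" by (rule BA_bound(1)[OF k h \<sigma> u])
  show "wn \<epsilon> ((opB \<sigma> q k \<circ> opA q k) u) \<le> ennreal (1 / 16) * wn \<epsilon> u"
    by (rule order_trans[OF BA_bound(2)[OF k h \<sigma> u] mult_right_mono[OF contraction_constant[OF small]]]) simp
  assume v: "v \<in> wL2 \<epsilon>"
  show "ae_eq ((opB \<sigma> q k \<circ> opA q k) (\<lambda>z. u z - v z)) (\<lambda>z. (opB \<sigma> q k \<circ> opA q k) u z - (opB \<sigma> q k \<circ> opA q k) v z)"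
    using Sop_diff[OF wL2_cnj[OF u] wL2_cnj[OF v], of k] unfolding BA_eq[OF k] ae_eq_def
    by eventually_elim (simp add: right_diff_distrib)
qed

lemma opA_adm:
  assumes "k \<noteq> 0" "adm u"
  shows "opA q k u \<in> wL2 \<epsilon>"
  unfolding opA_eq_ctrans[OF assms(1)] by (rule ctrans_wL2(1)[OF assms(2)])

lemma opB_adm:
  assumes "k \<noteq> 0" "adm u"
  shows "opB \<sigma> q k u \<in> wL2 \<epsilon>"
  unfolding opB_eq_ctrans[OF assms(1)] by (intro wL2_scale wL2_cnj ctrans_wL2(1) adm_cnj assms)

lemma opA_add:
  assumes "k \<noteq> 0" "adm u" "adm v"
  shows "ae_eq (opA q k (\<lambda>z. u z + v z)) (\<lambda>z. opA q k u z + opA q k v z)"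
  unfolding opA_eq_ctrans[OF assms(1)] by (rule ctrans_add[OF assms(2,3)])

lemma opB_add:
  assumes "k \<noteq> 0" "adm u" "adm v"
  shows "ae_eq (opB \<sigma> q k (\<lambda>z. u z + v z)) (\<lambda>z. opB \<sigma> q k u z + opB \<sigma> q k v z)"
  using ctrans_add[OF adm_cnj[OF assms(2)] adm_cnj[OF assms(3)], of k]
  unfolding opB_eq_ctrans[OF assms(1)] ae_eq_def by eventually_elim (simp add: distrib_left)

lemma opA_cong:
  assumes "k \<noteq> 0" "u \<in> borel_measurable borel" "v \<in> borel_measurable borel" "ae_eq u v"
  shows "opA q k u = opA q k v"
  unfolding opA_eq_ctrans[OF assms(1)] by (rule ctrans_cong[OF assms(2-4)])

lemma opB_cong:
  assumes "k \<noteq> 0" "u \<in> borel_measurable borel" "v \<in> borel_measurable borel" "ae_eq u v"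
  shows "opB \<sigma> q k u = opB \<sigma> q k v"
proof -
  have "ctrans q k (\<lambda>w. cnj (u w)) = ctrans q k (\<lambda>w. cnj (v w))"
    using assms by (intro ctrans_cong) (auto simp: ae_eq_def)
  then show ?thesis unfolding opB_eq_ctrans[OF assms(1)] by simp
qed

section \<open>Equivalence of the differential system with the integral equations\<close>

lemma pot_tau_finite:
  assumes k: "k \<noteq> 0" and u: "adm u" and v: "\<And>w. cmod (v w) = hpar k / 2 * cmod (q w * u w)"
  shows "wnn \<epsilon> (pot (\<lambda>w. ennreal (cmod (v w)))) < \<infinity>"
proof -
  have [measurable]: "u \<in> borel_measurable borel" using u by (simp add: adm_def)
  have h: "0 \<le> hpar k / 2" by (simp add: hpar_def)
  have "pot (\<lambda>w. ennreal (cmod (v w))) = (\<lambda>z. ennreal (hpar k / 2) * pot (\<lambda>w. ennreal (cmod (q w * u w))) z)"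
  proof
    fix z
    have "pot (\<lambda>w. ennreal (cmod (v w))) z = (\<integral>\<^sup>+w. ennreal (hpar k / 2) * (ennreal (cmod (q w * u w)) * ennreal (1 / cmod (z - w))) \<partial>lborel)"
      unfolding pot_def v using h by (intro nn_integral_cong) (simp only: ennreal_mult norm_ge_zero mult.assoc)
    also have "\<dots> = ennreal (hpar k / 2) * pot (\<lambda>w. ennreal (cmod (q w * u w))) z"
      unfolding pot_def by (rule nn_integral_cmult) measurable
    finally show "pot (\<lambda>w. ennreal (cmod (v w))) z = ennreal (hpar k / 2) * pot (\<lambda>w. ennreal (cmod (q w * u w))) z" .
  qed
  then have "wnn \<epsilon> (pot (\<lambda>w. ennreal (cmod (v w)))) = (ennreal (hpar k / 2))\<^sup>2 * wnn \<epsilon> (pot (\<lambda>w. ennreal (cmod (q w * u w))))"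
    by (simp add: wnn_cmult)
  then show ?thesis
    using pot_adm(2)[OF u] unfolding ennreal_power[OF h] by (simp add: ennreal_mult_less_top)
qed

lemma opA_solves:
  assumes k: "k \<noteq> 0" and u: "adm u" and \<psi>: "test_fun \<psi>"
  shows "of_real (hpar k) * dist_dzbar (opA q k u) \<psi>
     = dist_of (tau (hpar k) (- omega k) (\<lambda>z. of_real (hpar k) * q z / 2 * u z)) \<psi>"
  unfolding opA_def
proof (rule dist_dzbar_opE[OF _ _ _ \<psi>, where \<theta>=\<epsilon>])
  have [measurable]: "u \<in> borel_measurable borel" using u by (simp add: adm_def)
  show h: "0 < hpar k" by (rule freq_hpar(2)[OF k])
  show "tau (hpar k) (- omega k) (\<lambda>w. of_real (hpar k) * q w / 2 * u w) \<in> borel_measurable borel"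
    unfolding tau_eq[OF k, abs_def] by measurable
  show "wnn \<epsilon> (pot (\<lambda>w. ennreal (cmod (tau (hpar k) (- omega k) (\<lambda>w. of_real (hpar k) * q w / 2 * u w) w)))) < \<infinity>"
    by (rule pot_tau_finite[OF k u]) (use h in \<open>simp add: tau_eq[OF k] norm_mult norm_divide\<close>)
qed

lemma opB_solves:
  assumes k: "k \<noteq> 0" and u: "adm u" and \<psi>: "test_fun \<psi>"
  shows "of_real (hpar k) * dist_dz (opB \<sigma> q k u) \<psi>
     = dist_of (\<lambda>z. \<sigma> * tau (hpar k) (omega k) (\<lambda>w. of_real (hpar k) * cnj (q w) / 2 * u w) z) \<psi>"
proof -
  let ?t = "tau (hpar k) (omega k) (\<lambda>w. of_real (hpar k) * cnj (q w) / 2 * u w)"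
  have h: "0 < hpar k" by (rule freq_hpar(2)[OF k])
  have sol: "of_real (hpar k) * dist_dz (opF (hpar k) ?t) \<psi> = dist_of ?t \<psi>"
  proof (rule dist_dz_opF[OF _ h _ \<psi>, where \<theta>=\<epsilon>])
    have [measurable]: "u \<in> borel_measurable borel" using u by (simp add: adm_def)
    show "?t \<in> borel_measurable borel" unfolding tau_eq[OF k, abs_def] by measurable
    show "wnn \<epsilon> (pot (\<lambda>w. ennreal (cmod (?t w)))) < \<infinity>"
      by (rule pot_tau_finite[OF k u]) (use h in \<open>simp add: tau_eq[OF k] norm_mult norm_divide\<close>)
  qed
  have "dist_of (\<lambda>z. \<sigma> * w z) f = \<sigma> * dist_of w f" for w f
    unfolding dist_of_def mult.assoc by (rule integral_mult_right_zero)
  note lin = this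
  have "of_real (hpar k) * dist_dz (opB \<sigma> q k u) \<psi> = \<sigma> * (of_real (hpar k) * dist_dz (opF (hpar k) ?t) \<psi>)"
    unfolding opB_def dist_dz_def lin by (simp only: mult_minus_right mult.left_commute)
  with sol show ?thesis unfolding lin by (simp only:)
qed

text \<open>A v2 and B(1 + v1) are particular solutions of the two equations and lie in
  \<langle>.\<rangle> L^2. By the Liouville theorem each equation therefore means equality with its
  particular solution almost everywhere.\<close>

lemma cgo_solution_iff:
  assumes k: "k \<noteq> 0"
  shows "cgo_solution \<epsilon> \<sigma> q k v1 v2 \<longleftrightarrow> v1 \<in> wL2 \<epsilon> \<and> v2 \<in> wL2 \<epsilon> \<and>
    ae_eq v1 (opA q k v2) \<and> ae_eq v2 (opB \<sigma> q k (\<lambda>z. 1 + v1 z))"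
proof (cases "v1 \<in> wL2 \<epsilon> \<and> v2 \<in> wL2 \<epsilon>")
  case True
  then have v1: "v1 \<in> wL2 \<epsilon>" and v2: "v2 \<in> wL2 \<epsilon>" by auto
  note a2 = wL2_adm(1)[OF v2] and a1 = adm_add[OF adm_one wL2_adm(1)[OF v1]]
  have h: "complex_of_real (hpar k) \<noteq> 0" using freq_hpar(2)[OF k] by simp
  note L1 = wL2_mono[OF \<epsilon>(2)]
  \<comment> \<open>The constant 1 has zero dbar-derivative, so it drops out of the first equation
    and survives only as an inhomogeneity in the second.\<close>
  have one: "dist_dzbar (\<lambda>z. 1 + v1 z) \<psi> = dist_dzbar v1 \<psi>" if \<psi>: "test_fun \<psi>" for \<psi>
  proof -
    obtain R where R: "\<And>z. R < cmod z \<Longrightarrow> dzbar \<psi> z = 0" using test_fun_dzbar(2)[OF \<psi>] by blast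
    note c = test_fun_dzbar(1)[OF \<psi>]
    have i: "integrable lborel (dzbar \<psi>)"
    proof -
      obtain B where "0 \<le> B" "\<And>z. cmod (dzbar \<psi> z) \<le> B * japanese z powr (- 4)"
        using compact_support_decay[OF c, of R] R by blast
      then show ?thesis using borel_measurable_continuous_onI[OF c]
        by (intro integrable_japanese_bound[where b=4]) auto
    qed
    have "dist_of (\<lambda>z. 1 + v1 z) (dzbar \<psi>) = (LINT z|lborel. dzbar \<psi> z + v1 z * dzbar \<psi> z)"
      unfolding dist_of_def by (simp add: distrib_right)
    also have "\<dots> = (LINT z|lborel. dzbar \<psi> z) + (LINT z|lborel. v1 z * dzbar \<psi> z)"
      by (rule Bochner_Integration.integral_add[OF i integrable_wL2_test[OF v1 c R]])
    also have "\<dots> = dist_of v1 (dzbar \<psi>)" using test_fun_dzbar(3)[OF \<psi>] by (simp add: dist_of_def)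
    finally show ?thesis by (simp add: dist_dzbar_def)
  qed
  have "dbar_system \<sigma> q k (\<lambda>z. 1 + v1 z) v2 \<longleftrightarrow>
     (\<forall>\<psi>. test_fun \<psi> \<longrightarrow> dist_dzbar v1 \<psi> = dist_dzbar (opA q k v2) \<psi>) \<and>
     (\<forall>\<psi>. test_fun \<psi> \<longrightarrow> dist_dz v2 \<psi> = dist_dz (opB \<sigma> q k (\<lambda>z. 1 + v1 z)) \<psi>)"
  proof -
    have "of_real (hpar k) * dist_dzbar (\<lambda>z. 1 + v1 z) \<psi> = dist_of (tau (hpar k) (- omega k) (\<lambda>z. of_real (hpar k) * q z / 2 * v2 z)) \<psi>
        \<longleftrightarrow> dist_dzbar v1 \<psi> = dist_dzbar (opA q k v2) \<psi>" if "test_fun \<psi>" for \<psi>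
      unfolding one[OF that] opA_solves[OF k a2 that, symmetric] using h by simp
    moreover have "of_real (hpar k) * dist_dz v2 \<psi> = dist_of (\<lambda>z. \<sigma> * tau (hpar k) (omega k) (\<lambda>w. of_real (hpar k) * cnj (q w) / 2 * (1 + v1 w)) z) \<psi>
        \<longleftrightarrow> dist_dz v2 \<psi> = dist_dz (opB \<sigma> q k (\<lambda>z. 1 + v1 z)) \<psi>" if "test_fun \<psi>" for \<psi>
      unfolding opB_solves[OF k a1 that, symmetric] using h by simp
    ultimately show ?thesis unfolding dbar_system_def by blast
  qed
  also have "\<dots> \<longleftrightarrow> ae_eq v1 (opA q k v2) \<and> ae_eq v2 (opB \<sigma> q k (\<lambda>z. 1 + v1 z))"
    by (intro arg_cong2[where f="(\<and>)"] dzbar_eq_iff dz_eq_iff L1 v1 v2 opA_adm opB_adm k a1 a2)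
  finally show ?thesis using True by (simp add: cgo_solution_def)
qed (auto simp: cgo_solution_def)

text \<open>Inserting the second integral equation into the first gives (1 - AB) u1 = A b with b = B
  1. The remainder u1 - A b is AB u1, and |u1| \<le> 2 |A b| in norm, so each estimate is one
  application of the contraction bound; u2 is treated in the same way with BA.\<close>

lemma main_estimates:
  "\<exists>h0>0. \<exists>C. \<forall>\<sigma>\<in>{1, -1}. \<forall>k. k \<noteq> 0 \<and> hpar k \<le> h0 \<longrightarrow>
      invertible_wL2 \<epsilon> (one_minus (opA q k \<circ> opB \<sigma> q k)) \<and>
      invertible_wL2 \<epsilon> (one_minus (opB \<sigma> q k \<circ> opA q k)) \<and>
      (\<exists>u1 u2. unique_cgo_solution \<epsilon> \<sigma> q k u1 u2 \<and>
        ae_eq u1 (inverse_wL2 \<epsilon> (one_minus (opA q k \<circ> opB \<sigma> q k))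
                   (opA q k (sigma_F_tau_hq2 \<sigma> q k))) \<and>
        bounded_wL2 \<epsilon> (\<lambda>z. u1 z - opA q k (sigma_F_tau_hq2 \<sigma> q k) z)
          (C * (hpar k powr (s - 1) * wnorm \<epsilon> (opA q k (F_tau_hq q k)))) \<and>
        ae_eq u2 (inverse_wL2 \<epsilon> (one_minus (opB \<sigma> q k \<circ> opA q k))
                   (sigma_F_tau_hq2 \<sigma> q k)) \<and>
        bounded_wL2 \<epsilon> (\<lambda>z. u2 z - sigma_F_tau_hq2 \<sigma> q k z)
          (C * (hpar k powr (s - 1) * wnorm \<epsilon> (F_tau_hq q k))) \<and>
        bounded_wL2 \<epsilon> (\<lambda>z. u1 z - opA q k (sigma_F_tau_hq2 \<sigma> q k) z)
          (C * hpar k powr (2 * (s - 1))) \<and>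
        bounded_wL2 \<epsilon> u1 (C * hpar k powr (s - 1)))"
proof -
  define D where "D = Co * sqrt Cs * Q"
  define D1 where "D1 = Co * sqrt Cs"
  have D0: "0 \<le> D" "0 \<le> D1" using Co(1) Cs(1) Q(1) by (auto simp: D_def D1_def)
  obtain N where N: "wn (\<epsilon> - 2) (\<lambda>w. q w * 1) = ennreal N" "0 \<le> N"
    using adm_one unfolding adm_def by (cases "wn (\<epsilon> - 2) (\<lambda>w. q w * 1)") auto
  define N1 where "N1 = D1 * sqrt N"
  have N1: "0 \<le> N1" using D0 N by (simp add: N1_def)
  \<comment> \<open>Chosen so that h0 powr (s - 1) = 1/(4D + 4). This gives D h powr (s - 1) \<le>
    1/4; the added 4 covers D = 0 and ensures h0 \<le> 1.\<close>
  define h0 where "h0 = (1 / (4 * D + 4)) powr (1 / (s - 1))"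
  have h0: "0 < h0" using D0 by (simp add: h0_def)
  have h0_1: "h0 \<le> 1" unfolding h0_def using D0 s by (intro powr_le1) (auto simp: divide_le_eq)
  \<comment> \<open>One summand for each use: D for the two relative errors, 2 D N1 for the
    quadratic error, 2 N1 for the size of u1.\<close>
  define C where "C = D + 2 * D * N1 + 2 * N1"
  have C: "D \<le> C" "2 * D * N1 \<le> C" "2 * N1 \<le> C" using D0 N1 by (auto simp: C_def)
  have main: "invertible_wL2 \<epsilon> (one_minus (opA q k \<circ> opB \<sigma> q k)) \<and>
      invertible_wL2 \<epsilon> (one_minus (opB \<sigma> q k \<circ> opA q k)) \<and>
      (\<exists>u1 u2. unique_cgo_solution \<epsilon> \<sigma> q k u1 u2 \<and>
        ae_eq u1 (inverse_wL2 \<epsilon> (one_minus (opA q k \<circ> opB \<sigma> q k))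
                   (opA q k (sigma_F_tau_hq2 \<sigma> q k))) \<and>
        bounded_wL2 \<epsilon> (\<lambda>z. u1 z - opA q k (sigma_F_tau_hq2 \<sigma> q k) z)
          (C * (hpar k powr (s - 1) * wnorm \<epsilon> (opA q k (F_tau_hq q k)))) \<and>
        ae_eq u2 (inverse_wL2 \<epsilon> (one_minus (opB \<sigma> q k \<circ> opA q k))
                   (sigma_F_tau_hq2 \<sigma> q k)) \<and>
        bounded_wL2 \<epsilon> (\<lambda>z. u2 z - sigma_F_tau_hq2 \<sigma> q k z)
          (C * (hpar k powr (s - 1) * wnorm \<epsilon> (F_tau_hq q k))) \<and>
        bounded_wL2 \<epsilon> (\<lambda>z. u1 z - opA q k (sigma_F_tau_hq2 \<sigma> q k) z)
          (C * hpar k powr (2 * (s - 1))) \<and>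
        bounded_wL2 \<epsilon> u1 (C * hpar k powr (s - 1)))"
    if \<sigma>': "\<sigma> \<in> {1, -1}" and k: "k \<noteq> 0" and hk: "hpar k \<le> h0" for \<sigma> k
  proof -
    define h where "h = hpar k powr (s - 1)"
    have hp: "0 < hpar k" by (rule freq_hpar(2)[OF k])
    have h: "0 \<le> h" by (simp add: h_def)
    have h1: "hpar k \<le> 1" using hk h0_1 by simp
    have \<sigma>: "cmod \<sigma> = 1" using \<sigma>' by auto
    have small: "Co * sqrt Cs * Q * hpar k powr (s - 1) \<le> 1 / 4"
    proof -
      have "hpar k powr (s - 1) \<le> h0 powr (s - 1)" using hk hp s by (intro powr_mono2) auto
      also have "\<dots> = 1 / (4 * D + 4)" unfolding h0_def using s D0 by (simp add: powr_powr)
      finally have "D * hpar k powr (s - 1) \<le> D * (1 / (4 * D + 4))" using D0 by (intro mult_left_mono)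
      also have "\<dots> \<le> 1 / 4" using D0 by (simp add: divide_simps)
      finally show ?thesis by (simp add: D_def)
    qed
    let ?AB = "opA q k \<circ> opB \<sigma> q k" and ?BA = "opB \<sigma> q k \<circ> opA q k"
    interpret AB: ae_contraction \<epsilon> ?AB by (rule AB_contraction[OF k h1 \<sigma> small])
    interpret BA: ae_contraction \<epsilon> ?BA by (rule BA_contraction[OF k h1 \<sigma> small])
    define b where "b = sigma_F_tau_hq2 \<sigma> q k"
    have b1: "b = opB \<sigma> q k (\<lambda>_. 1)" unfolding b_def by (rule sigma_F_eq_opB)
    have b: "b \<in> wL2 \<epsilon>" unfolding b1 by (rule opB_adm[OF k adm_one])
    note ab = wL2_adm(1)[OF b]
    have Ab: "opA q k b \<in> wL2 \<epsilon>" by (rule opA_adm[OF k ab])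
    define u1 where "u1 = inverse_wL2 \<epsilon> (one_minus ?AB) (opA q k b)"
    have u1: "u1 \<in> wL2 \<epsilon>" and u1_eq: "ae_eq (one_minus ?AB u1) (opA q k b)"
      unfolding u1_def using AB.inverse_spec[OF Ab] by auto
    note au1 = wL2_adm(1)[OF u1]
    have Bu1: "opB \<sigma> q k u1 \<in> wL2 \<epsilon>" by (rule opB_adm[OF k au1])
    \<comment> \<open>u2 is read off from the second integral equation; its description by the
      inverse of 1 - BA is derived afterwards.\<close>
    define u2 where "u2 z = b z + opB \<sigma> q k u1 z" for z
    have u2: "u2 \<in> wL2 \<epsilon>" unfolding u2_def by (rule wL2_add[OF b Bu1])
    note m = wL2_measurable[OF u1] wL2_measurable[OF u2]
    have A2: "opA q k u2 \<in> wL2 \<epsilon>" by (rule opA_adm[OF k wL2_adm(1)[OF u2]])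
    have uA: "ae_eq u1 (opA q k u2)"
      using u1_eq opA_add[OF k ab wL2_adm(1)[OF Bu1]] unfolding ae_eq_def one_minus_def u2_def[abs_def]
      by eventually_elim (simp add: algebra_simps)
    have uB: "ae_eq u2 (opB \<sigma> q k (\<lambda>z. 1 + u1 z))"
      using opB_add[OF k adm_one au1, of \<sigma>] unfolding ae_eq_def u2_def b1 by eventually_elim simp
    have sol: "cgo_solution \<epsilon> \<sigma> q k u1 u2"
      unfolding cgo_solution_iff[OF k] using u1 u2 uA uB by blast
    have uniq: "ae_eq v1 u1 \<and> ae_eq v2 u2" if "cgo_solution \<epsilon> \<sigma> q k v1 v2" for v1 v2
    proof -
      have v: "v1 \<in> wL2 \<epsilon>" "v2 \<in> wL2 \<epsilon>" and vA: "ae_eq v1 (opA q k v2)" and vB: "ae_eq v2 (opB \<sigma> q k (\<lambda>z. 1 + v1 z))"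
        using that unfolding cgo_solution_iff[OF k] by auto
      note av1 = wL2_adm(1)[OF v(1)]
      have Bv1: "opB \<sigma> q k v1 \<in> wL2 \<epsilon>" by (rule opB_adm[OF k av1])
      have v2: "ae_eq v2 (\<lambda>z. b z + opB \<sigma> q k v1 z)"
        using vB opB_add[OF k adm_one av1, of \<sigma>] unfolding ae_eq_def b1 by eventually_elim simp
      have "opA q k v2 = opA q k (\<lambda>z. b z + opB \<sigma> q k v1 z)"
        by (rule opA_cong[OF k wL2_measurable[OF v(2)] wL2_measurable[OF wL2_add[OF b Bv1]] v2])
      with vA have "ae_eq v1 (opA q k (\<lambda>z. b z + opB \<sigma> q k v1 z))" by (simp only:)
      then have "ae_eq (one_minus ?AB v1) (opA q k b)"
        using opA_add[OF k ab wL2_adm(1)[OF Bv1]] unfolding ae_eq_def one_minus_def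
        by eventually_elim (simp add: algebra_simps)
      then have e1: "ae_eq v1 u1" unfolding u1_def by (rule AB.inverse_unique[OF Ab v(1)])
      have eqB: "opB \<sigma> q k v1 = opB \<sigma> q k u1"
        by (rule opB_cong[OF k wL2_measurable[OF v(1)] m(1) e1])
      have "ae_eq v2 u2" using v2 unfolding u2_def[abs_def] eqB .
      with e1 show ?thesis by blast
    qed
    \<comment> \<open>Applying B to u1 = A u2 gives B u1 = BA u2, and B u1 is u2 - b by
      definition.\<close>
    have u2_BA: "ae_eq (one_minus ?BA u2) b"
    proof -
      have "opB \<sigma> q k (opA q k u2) = opB \<sigma> q k u1"
        by (rule opB_cong[OF k wL2_measurable[OF A2] m(1) ae_eq_sym[OF uA]])
      then show ?thesis unfolding ae_eq_def one_minus_def by (simp add: u2_def)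
    qed
    note n1 = AB.solution_norm[OF Ab u1 u1_eq] and n2 = BA.solution_norm[OF b u2 u2_BA]
    have e1: "ae_eq (\<lambda>z. u1 z - opA q k b z) (?AB u1)"
      using u1_eq unfolding ae_eq_def one_minus_def by eventually_elim (auto simp: algebra_simps)
    have e2: "ae_eq (\<lambda>z. u2 z - b z) (?BA u2)"
      using u2_BA unfolding ae_eq_def one_minus_def by eventually_elim (auto simp: algebra_simps)
    have d1: "(\<lambda>z. u1 z - opA q k b z) \<in> wL2 \<epsilon>" by (rule wL2_diff[OF u1 Ab])
    have d2: "(\<lambda>z. u2 z - b z) \<in> wL2 \<epsilon>" by (rule wL2_diff[OF u2 b])
    have r1: "wnorm \<epsilon> (\<lambda>z. u1 z - opA q k b z) \<le> D * h * wnorm \<epsilon> u1"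
      using AB_bound(2)[OF k h1 \<sigma> u1] wn_cong[OF e1, of \<epsilon>] D0(1) h
      by (intro wnorm_le[OF d1 u1]) (simp_all add: D_def h_def)
    have r2: "wnorm \<epsilon> (\<lambda>z. u2 z - b z) \<le> D * h * wnorm \<epsilon> u2"
      using BA_bound(2)[OF k h1 \<sigma> u2] wn_cong[OF e2, of \<epsilon>] D0(1) h
      by (intro wnorm_le[OF d2 u2]) (simp_all add: D_def h_def)
    \<comment> \<open>The factor 1/2 in front of q compensates the 2 in |u2| \<le> 2 |b|, so the
      relative errors have constant D.\<close>
    have bF: "wnorm \<epsilon> b = 1 / 2 * wnorm \<epsilon> (F_tau_hq q k)"
      unfolding b_def sigma_F_eq_F wnorm_scale using \<sigma> by (simp add: norm_divide)
    have AbF: "wnorm \<epsilon> (opA q k b) = 1 / 2 * wnorm \<epsilon> (opA q k (F_tau_hq q k))"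
      unfolding b_def sigma_F_eq_F opA_eq_ctrans[OF k] ctrans_scale wnorm_scale using \<sigma> by (simp add: norm_divide)
    \<comment> \<open>A b is \<sigma> times the composed operator applied to 1, so the oscillatory
      gain is already present in the leading term.\<close>
    have AbN: "wnorm \<epsilon> (opA q k b) \<le> N1 * h"
    proof -
      have eq: "opA q k b = (\<lambda>z. \<sigma> * Sop q k (\<lambda>_. 1) z)"
        using fun_cong[OF AB_eq[OF k, of q \<sigma>], of "\<lambda>_. 1"] unfolding b1 by simp
      have S: "Sop q k (\<lambda>_. 1) \<in> wL2 \<epsilon>" by (rule Sop_adm(1)[OF k h1 adm_one])
      have "ennreal ((wnorm \<epsilon> (Sop q k (\<lambda>_. 1)))\<^sup>2) \<le> ennreal ((D1 * h)\<^sup>2) * ennreal N"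
        using Sop_adm(2)[OF k h1 adm_one] unfolding wnorm_power2[OF S] N(1) D1_def h_def .
      also have "\<dots> = ennreal ((N1 * h)\<^sup>2)"
        using N(2) by (subst ennreal_mult[symmetric]) (auto simp: N1_def power_mult_distrib)
      finally have "(wnorm \<epsilon> (Sop q k (\<lambda>_. 1)))\<^sup>2 \<le> (N1 * h)\<^sup>2" by (simp add: ennreal_le_iff)
      then have "wnorm \<epsilon> (Sop q k (\<lambda>_. 1)) \<le> N1 * h"
        by (rule power2_le_imp_le) (use N1 h in simp)
      then show ?thesis unfolding eq wnorm_scale using \<sigma> by simp
    qed
    have Dh: "0 \<le> D * h" using D0 h by simp
    have hh: "h * h = hpar k powr (2 * (s - 1))"
      unfolding h_def powr_add[symmetric] by (rule arg_cong[where f="\<lambda>t. hpar k powr t"]) simp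
    have B1: "wnorm \<epsilon> (\<lambda>z. u1 z - opA q k b z) \<le> C * (h * wnorm \<epsilon> (opA q k (F_tau_hq q k)))"
    proof -
      have "wnorm \<epsilon> (\<lambda>z. u1 z - opA q k b z) \<le> D * h * (2 * wnorm \<epsilon> (opA q k b))"
        using r1 mult_left_mono[OF n1 Dh] by linarith
      also have "\<dots> = D * (h * wnorm \<epsilon> (opA q k (F_tau_hq q k)))" unfolding AbF by simp
      also have "\<dots> \<le> C * (h * wnorm \<epsilon> (opA q k (F_tau_hq q k)))"
        using C h by (intro mult_right_mono) (auto simp: wnorm_nonneg)
      finally show ?thesis .
    qed
    have B2: "wnorm \<epsilon> (\<lambda>z. u2 z - b z) \<le> C * (h * wnorm \<epsilon> (F_tau_hq q k))"
    proof -
      have "wnorm \<epsilon> (\<lambda>z. u2 z - b z) \<le> D * h * (2 * wnorm \<epsilon> b)"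
        using r2 mult_left_mono[OF n2 Dh] by linarith
      also have "\<dots> = D * (h * wnorm \<epsilon> (F_tau_hq q k))" unfolding bF by simp
      also have "\<dots> \<le> C * (h * wnorm \<epsilon> (F_tau_hq q k))"
        using C h by (intro mult_right_mono) (auto simp: wnorm_nonneg)
      finally show ?thesis .
    qed
    have B3: "wnorm \<epsilon> (\<lambda>z. u1 z - opA q k b z) \<le> C * hpar k powr (2 * (s - 1))"
    proof -
      have "wnorm \<epsilon> (\<lambda>z. u1 z - opA q k b z) \<le> D * h * (2 * wnorm \<epsilon> (opA q k b))"
        using r1 mult_left_mono[OF n1 Dh] by linarith
      also have "\<dots> \<le> D * h * (2 * (N1 * h))" using Dh AbN by (intro mult_left_mono) auto
      also have "\<dots> = (2 * D * N1) * (h * h)" by (simp add: mult_ac)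
      also have "\<dots> \<le> C * (h * h)" using C h by (intro mult_right_mono) auto
      finally show ?thesis unfolding hh .
    qed
    have B4: "wnorm \<epsilon> u1 \<le> C * h"
    proof -
      have "wnorm \<epsilon> u1 \<le> (2 * N1) * h" using n1 AbN by linarith
      also have "\<dots> \<le> C * h" using C h by (intro mult_right_mono) auto
      finally show ?thesis .
    qed
    show ?thesis
    proof (rule conjI[OF AB.invertible conjI[OF BA.invertible]], rule exI[of _ u1], rule exI[of _ u2], intro conjI)
      show "unique_cgo_solution \<epsilon> \<sigma> q k u1 u2"
        unfolding unique_cgo_solution_def using sol uniq by blast
      show "ae_eq u1 (inverse_wL2 \<epsilon> (one_minus ?AB) (opA q k (sigma_F_tau_hq2 \<sigma> q k)))"
        unfolding u1_def b_def by (rule ae_eq_refl)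
      show "ae_eq u2 (inverse_wL2 \<epsilon> (one_minus ?BA) (sigma_F_tau_hq2 \<sigma> q k))"
        unfolding b_def[symmetric] by (rule BA.inverse_unique[OF b u2 u2_BA])
    qed (use B1 B2 B3 B4 d1 d2 u1 in \<open>simp_all add: bounded_wL2_def b_def h_def\<close>)
  qed
  show ?thesis
    using h0 main by (intro exI[of _ h0] conjI exI[of _ C]) auto
qed

end

section \<open>The main result\<close>

text \<open>The regularity of \<open>q\<close> enters only through the Fourier representation of
  \<open>\<langle>z\<rangle>\<^sup>2 q\<close>, whose density is integrable because \<open>s > 1\<close>.\<close>

lemma sobolev_cgo_setup:
  assumes s: "1 < s" "s \<le> 2" and q: "(\<lambda>z. of_real ((japanese z)\<^sup>2) * q z) \<in> sobolev s"
    and \<epsilon>: "\<epsilon> \<in> {0<..1}"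
  shows "\<exists>Cs Q Co. cgo_setup q s \<epsilon> Cs Q Co"
proof -
  let ?w = "\<lambda>z. of_real ((japanese z)\<^sup>2) * q z"
  obtain g where pl: "has_plancherel ?w g" and gs: "(\<lambda>\<xi>. of_real (japanese \<xi> powr s) * g \<xi>) \<in> L2"
    using q unfolding sobolev_def by blast
  have w: "?w \<in> L2" and gm[measurable]: "g \<in> borel_measurable borel"
    using pl by (auto simp: has_plancherel_def L2_def)
  \<comment> \<open>Absorbs the constant (2 pi)^(-2) of the inversion formula.\<close>
  define G where "G \<xi> = g \<xi> / of_real ((2 * pi)\<^sup>2)" for \<xi>
  have Gm[measurable]: "G \<in> borel_measurable borel" unfolding G_def by measurable
  have GL2: "(\<lambda>\<xi>. of_real (japanese \<xi> powr s) * G \<xi>) \<in> L2"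
  proof -
    have "(cmod (of_real (japanese \<xi> powr s) * G \<xi>))\<^sup>2 = (1 / (2 * pi) ^ 4) * (cmod (of_real (japanese \<xi> powr s) * g \<xi>))\<^sup>2" for \<xi>
      by (simp add: G_def norm_mult norm_divide norm_power power_mult_distrib power_divide power_mult[symmetric])
    moreover have "(\<lambda>\<xi>. of_real (japanese \<xi> powr s) * G \<xi>) \<in> borel_measurable borel" by measurable
    ultimately show ?thesis using gs by (simp add: L2_def)
  qed
  note gi = sobolev_weight_tail(1)[OF s(1) gm gs] and Gi = sobolev_weight_tail(1)[OF s(1) Gm GL2]
  have jw: "jweight z * of_real ((japanese z)\<^sup>2) = 1" for z by (simp add: jweight_def)
  have q_eq: "q = (\<lambda>z. jweight z * ?w z)"
    by (rule ext) (simp only: mult.assoc[symmetric] jw mult_1)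
  have qm[measurable]: "q \<in> borel_measurable borel"
    by (subst q_eq) (use w in \<open>auto simp: L2_def intro!: borel_measurable_times\<close>)
  have rep: "AE y in lborel. q y = jweight y * (LINT \<xi>|lborel. G \<xi> * ephase \<xi> y)"
    using fourier_inversion[OF pl gi]
  proof eventually_elim
    case (elim y)
    show ?case by (subst q_eq) (simp only: elim G_def)
  qed
  obtain Cs where Cs: "0 \<le> Cs" "\<And>v. v \<in> borel_measurable borel \<Longrightarrow> wnn \<epsilon> (pot v) \<le> ennreal Cs * wnn (\<epsilon> - 2) v"
    using schur_bound[of \<epsilon>] \<epsilon> by auto
  obtain Co where Co: "0 \<le> Co" "\<And>h \<eta> z x. 0 < h \<Longrightarrow> h \<le> 1 \<Longrightarrow> cmod \<eta> = 2 / h \<Longrightarrow> x \<noteq> z \<Longrightarrow>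
     cmod (LINT y|lborel. ephase (- \<eta>) y * (jweight y * (LINT \<xi>|lborel. G \<xi> * ephase \<xi> y)) / ((z - y) * (cnj y - cnj x)))
     \<le> Co * h powr (s - 1) / cmod (z - x)"
    using oscillatory_kernel_bound[OF s Gm GL2] by blast
  \<comment> \<open>The Fourier integral is bounded by the L^1 norm of its density; this is how the
    Sobolev hypothesis yields pointwise decay of q.\<close>
  define Q where "Q = (LINT \<xi>|lborel. cmod (G \<xi>))"
  have "cgo_setup q s \<epsilon> Cs Q Co"
  proof
    show "1 < s" "s \<le> 2" "0 < \<epsilon>" "\<epsilon> \<le> 1" using s \<epsilon> by auto
    show "q \<in> borel_measurable borel" by (rule qm)
    show "0 \<le> Cs" "0 \<le> Co" by (rule Cs Co)+
    show "wnn \<epsilon> (pot v) \<le> ennreal Cs * wnn (\<epsilon> - 2) v" if "v \<in> borel_measurable borel" for v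
      by (rule Cs(2)[OF that])
    show "wn (- 2) q < \<infinity>"
      using w unfolding wn_eq L2_nn_integral by simp
    show "0 \<le> Q" unfolding Q_def by (intro Bochner_Integration.integral_nonneg) auto
    show "AE y in lborel. cmod (q y) \<le> Q * japanese y powr (- 2)"
      using rep
    proof eventually_elim
      case (elim y)
      have "cmod (LINT \<xi>|lborel. G \<xi> * ephase \<xi> y) \<le> (LINT \<xi>|lborel. cmod (G \<xi> * ephase \<xi> y))"
        by (rule integral_norm_bound)
      also have "\<dots> = Q" unfolding Q_def by (simp add: norm_mult)
      finally have "cmod (jweight y) * cmod (LINT \<xi>|lborel. G \<xi> * ephase \<xi> y) \<le> cmod (jweight y) * Q"
        by (intro mult_left_mono) auto
      then show ?case unfolding elim norm_mult norm_jweight(1) by (simp only: mult.commute)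
    qed
    show "cmod (LINT y|lborel. ephase (- \<eta>) y * q y / ((z - y) * (cnj y - cnj x))) \<le> Co * h powr (s - 1) / cmod (z - x)"
      if "0 < h" "h \<le> 1" "cmod \<eta> = 2 / h" "x \<noteq> z" for h \<eta> z x
    proof -
      have "(LINT y|lborel. ephase (- \<eta>) y * q y / ((z - y) * (cnj y - cnj x)))
        = (LINT y|lborel. ephase (- \<eta>) y * (jweight y * (LINT \<xi>|lborel. G \<xi> * ephase \<xi> y)) / ((z - y) * (cnj y - cnj x)))"
      proof (rule integral_cong_AE)
        show "AE y in lborel. ephase (- \<eta>) y * q y / ((z - y) * (cnj y - cnj x))
          = ephase (- \<eta>) y * (jweight y * (LINT \<xi>|lborel. G \<xi> * ephase \<xi> y)) / ((z - y) * (cnj y - cnj x))"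
          using rep by eventually_elim simp
      qed measurable
      then show ?thesis using Co(2)[OF that] by simp
    qed
  qed
  then show ?thesis by blast
qed

text \<open>The spaces increase with \<epsilon>, so the solution for the smaller exponent is one of
  the solutions for the larger, where uniqueness leaves no other class.\<close>

lemma unique_cgo_solution_mono:
  assumes "\<epsilon> \<le> \<epsilon>'" and u: "unique_cgo_solution \<epsilon> \<sigma> q k u1 u2" and w: "unique_cgo_solution \<epsilon>' \<sigma> q k w1 w2"
  shows "unique_cgo_solution \<epsilon>' \<sigma> q k u1 u2"
proof -
  have sol: "cgo_solution \<epsilon>' \<sigma> q k u1 u2"
    using u wL2_mono[OF assms(1)] by (auto simp: unique_cgo_solution_def cgo_solution_def)
  then have uw: "ae_eq w1 u1" "ae_eq w2 u2"
    using w ae_eq_sym unfolding unique_cgo_solution_def by blast+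
  have "ae_eq v1 u1 \<and> ae_eq v2 u2" if "cgo_solution \<epsilon>' \<sigma> q k v1 v2" for v1 v2
    using w that uw ae_eq_trans unfolding unique_cgo_solution_def by blast
  with sol show ?thesis unfolding unique_cgo_solution_def by blast
qed

theorem proposition3p2:
  fixes q :: "complex \<Rightarrow> complex" and s :: real
  assumes "1 < s" and "s \<le> 2"
    and "(\<lambda>z. of_real ((japanese z)\<^sup>2) * q z) \<in> sobolev s"
  shows "(\<forall>\<epsilon>\<in>{0<..1}. \<exists>h0>0. \<exists>C. \<forall>\<sigma>\<in>{1, -1}. \<forall>k. k \<noteq> 0 \<and> hpar k \<le> h0 \<longrightarrow>
      invertible_wL2 \<epsilon> (one_minus (opA q k \<circ> opB \<sigma> q k)) \<and>
      invertible_wL2 \<epsilon> (one_minus (opB \<sigma> q k \<circ> opA q k)) \<and>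
      (\<exists>u1 u2. unique_cgo_solution \<epsilon> \<sigma> q k u1 u2 \<and>
        ae_eq u1 (inverse_wL2 \<epsilon> (one_minus (opA q k \<circ> opB \<sigma> q k))
                   (opA q k (sigma_F_tau_hq2 \<sigma> q k))) \<and>
        bounded_wL2 \<epsilon> (\<lambda>z. u1 z - opA q k (sigma_F_tau_hq2 \<sigma> q k) z)
          (C * (hpar k powr (s - 1) * wnorm \<epsilon> (opA q k (F_tau_hq q k)))) \<and>
        ae_eq u2 (inverse_wL2 \<epsilon> (one_minus (opB \<sigma> q k \<circ> opA q k))
                   (sigma_F_tau_hq2 \<sigma> q k)) \<and>
        bounded_wL2 \<epsilon> (\<lambda>z. u2 z - sigma_F_tau_hq2 \<sigma> q k z)
          (C * (hpar k powr (s - 1) * wnorm \<epsilon> (F_tau_hq q k))) \<and>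
        bounded_wL2 \<epsilon> (\<lambda>z. u1 z - opA q k (sigma_F_tau_hq2 \<sigma> q k) z)
          (C * hpar k powr (2 * (s - 1))) \<and>
        bounded_wL2 \<epsilon> u1 (C * hpar k powr (s - 1)))) \<and>
    (\<forall>\<epsilon>\<in>{0<..1}. \<forall>\<epsilon>'\<in>{0<..1}. \<exists>h0>0. \<forall>\<sigma>\<in>{1, -1}. \<forall>k. k \<noteq> 0 \<and> hpar k \<le> h0 \<longrightarrow>
      (\<exists>u1 u2. unique_cgo_solution \<epsilon> \<sigma> q k u1 u2 \<and> unique_cgo_solution \<epsilon>' \<sigma> q k u1 u2))"
    (is "(\<forall>\<epsilon>\<in>_. \<exists>h0>0. \<exists>C. \<forall>\<sigma>\<in>_. \<forall>k. _ k h0 \<longrightarrow> ?R \<epsilon> C \<sigma> k) \<and> (\<forall>\<epsilon>\<in>_. \<forall>\<epsilon>'\<in>_. ?Q \<epsilon> \<epsilon>')")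
proof -
  have P: "\<exists>h0>0. \<exists>C. \<forall>\<sigma>\<in>{1, -1}. \<forall>k. k \<noteq> 0 \<and> hpar k \<le> h0 \<longrightarrow> ?R \<epsilon> C \<sigma> k" if \<epsilon>: "\<epsilon> \<in> {0<..1}" for \<epsilon>
  proof -
    obtain Cs Q Co where "cgo_setup q s \<epsilon> Cs Q Co"
      using sobolev_cgo_setup[OF assms \<epsilon>] by blast
    then interpret cgo_setup q s \<epsilon> Cs Q Co .
    show ?thesis by (rule main_estimates)
  qed
  have ex: "\<exists>h0>0. \<forall>\<sigma>\<in>{1, -1}. \<forall>k. k \<noteq> 0 \<and> hpar k \<le> h0 \<longrightarrow> (\<exists>u1 u2. unique_cgo_solution \<epsilon> \<sigma> q k u1 u2)"
    if e: "\<epsilon> \<in> {0<..1}" for \<epsilon>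
  proof -
    obtain h0 C where h0: "0 < h0" and H: "\<forall>\<sigma>\<in>{1, -1}. \<forall>k. k \<noteq> 0 \<and> hpar k \<le> h0 \<longrightarrow> ?R \<epsilon> C \<sigma> k"
      using P[OF e] by (elim exE conjE) (rule that)
    show ?thesis
    proof (intro exI[of _ h0] conjI h0 ballI allI impI)
      fix \<sigma> k :: complex assume "\<sigma> \<in> {1, -1}" "k \<noteq> 0 \<and> hpar k \<le> h0"
      from H[rule_format, OF this] show "\<exists>u1 u2. unique_cgo_solution \<epsilon> \<sigma> q k u1 u2"
        by (elim conjE exE) (intro exI)
    qed
  qed
  have Q: "?Q \<epsilon> \<epsilon>'" if e: "\<epsilon> \<in> {0<..1}" "\<epsilon>' \<in> {0<..1}" for \<epsilon> \<epsilon>'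
  proof -
    obtain h1 where h1: "0 < h1" "\<And>\<sigma> k. \<sigma> \<in> {1, -1} \<Longrightarrow> k \<noteq> 0 \<Longrightarrow> hpar k \<le> h1 \<Longrightarrow> \<exists>u1 u2. unique_cgo_solution \<epsilon> \<sigma> q k u1 u2"
      using ex[OF e(1)] by blast
    obtain h2 where h2: "0 < h2" "\<And>\<sigma> k. \<sigma> \<in> {1, -1} \<Longrightarrow> k \<noteq> 0 \<Longrightarrow> hpar k \<le> h2 \<Longrightarrow> \<exists>u1 u2. unique_cgo_solution \<epsilon>' \<sigma> q k u1 u2"
      using ex[OF e(2)] by blast
    have "\<exists>u1 u2. unique_cgo_solution \<epsilon> \<sigma> q k u1 u2 \<and> unique_cgo_solution \<epsilon>' \<sigma> q k u1 u2"
      if k: "\<sigma> \<in> {1, -1}" "k \<noteq> 0" "hpar k \<le> min h1 h2" for \<sigma> k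
    proof -
      obtain u1 u2 where u: "unique_cgo_solution \<epsilon> \<sigma> q k u1 u2" using h1(2)[of \<sigma> k] k by auto
      obtain w1 w2 where w: "unique_cgo_solution \<epsilon>' \<sigma> q k w1 w2" using h2(2)[of \<sigma> k] k by auto
      show ?thesis
      proof (cases "\<epsilon> \<le> \<epsilon>'")
        case True
        then show ?thesis using unique_cgo_solution_mono[OF True u w] u by blast
      next
        case False
        then have "\<epsilon>' \<le> \<epsilon>" by simp
        from unique_cgo_solution_mono[OF this w u] w show ?thesis by blast
      qed
    qed
    then show ?thesis using h1(1) h2(1) by (intro exI[of _ "min h1 h2"]) auto
  qed
  show ?thesis by (intro conjI ballI P Q)
qed

end
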